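(* Let $(R,\mathfrak m)$ be a local Noetherian ring of dimension $d>0$ with infinite residue field and let $J$ be a minimal reduction of $\mathfrak m$. Then the Sally module $S_J(\mathfrak m)$ of $\mathfrak m$ with respect to $J$ has dimension $d$ if and only if $e_1(\mathfrak m)-e_0(\mathfrak m)-e_1(J)+1>0$. In this event, the multiplicity of $S_J(\mathfrak m)$ is exactly $e_1(\mathfrak m)-e_0(\mathfrak m)-e_1(J)+1$.
   Context: Let $(R,\mathfrak m)$ be a local Noetherian ring of dimension $d>0$ with infinite residue field, and let $\lambda(\cdot)$ denote length. For an $\mathfrak m$-primary ideal $I$, the Hilbert coefficients $e_0(I),\dots,e_d(I)$ are the integers such that, for $n\gg 0$, $\lambda(R/I^n)=e_0(I)\binom{n+d-1}{d}-e_1(I)\binom{n+d-2}{d-1}+\cdots+(-1)^d e_d(I)$. A minimal reduction $J$ of $I$ is an ideal $J\subseteq I$ generated by $d$ elements such that $I^{r+1}=JI^r$ for some integer $r\ge 0$ (so $J$ is itself $\mathfrak m$-primary and $e_i(J)$ is defined). The Rees algebra of $I$ is $\mathcal R(I)=\bigoplus_{n\ge 0}I^nt^n$. The Sally module of $I$ with respect to a minimal reduction $J$ is the finitely generated graded $\mathcal R(J)$-module $S_J(I)=I\mathcal R(I)/I\mathcal R(J)=\bigoplus_{n\ge 2}I^n/IJ^{n-1}$, where $I^n/IJ^{n-1}$ is the component of degree $n-1$. Its dimension is its Krull dimension as an $\mathcal R(J)$-module. When this dimension is $d$, the function $n\mapsto\lambda(I^n/IJ^{n-1})$ agrees for $n\gg0$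 with a polynomial of degree $d-1$, and the multiplicity of $S_J(I)$ is $(d-1)!$ times the leading coefficient of that polynomial. *)

theory Defs
  imports
    "HOL-Algebra.UnivPoly"
    "HOL-Algebra.Ring_Divisibility"
    "HOL-Algebra.Ideal_Product"
    "HOL-Computational_Algebra.Polynomial"
    "HOL-Library.Extended_Real"
begin

hide_const (open) Polynomial.smult Polynomial.monom

locale local_noetherian_ring = cring R + noetherian_ring R
  for R (structure) +
  fixes \<mm> :: "'a set"
  assumes maximal: "maximalideal \<mm> R"
    and maximal_unique: "maximalideal \<nn> R \<Longrightarrow> \<nn> = \<mm>"

(* The value lives in ereal so that the zero ring (no primes at all) has dimension Sup {} = -\<infinity>. *)
definition krull_dim :: "('a, 'b) ring_scheme \<Rightarrow> ereal" where
  "krull_dim R = Sup {ereal (real n) | n. \<exists>P :: nat \<Rightarrow> 'a set.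
     (\<forall>i\<le>n. primeideal (P i) R) \<and> (\<forall>i<n. P i \<subset> P (Suc i))}"

definition module_annihilator ::
    "('a, 'c) ring_scheme \<Rightarrow> ('a, 'b, 'd) module_scheme \<Rightarrow> 'a set" where
  "module_annihilator A M =
     {a \<in> carrier A. \<forall>x \<in> carrier M. a \<odot>\<^bsub>M\<^esub> x = \<zero>\<^bsub>M\<^esub>}"

definition module_dim ::
    "('a, 'c) ring_scheme \<Rightarrow> ('a, 'b, 'd) module_scheme \<Rightarrow> ereal" where
  "module_dim A M = krull_dim (A Quot module_annihilator A M)"

definition module_length ::
    "('a, 'c) ring_scheme \<Rightarrow> ('a, 'b, 'd) module_scheme \<Rightarrow> enat" where
  "module_length A M = Sup {enat n | n. \<exists>N :: nat \<Rightarrow> 'b set.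
     (\<forall>i\<le>n. submodule (N i) A M) \<and> (\<forall>i<n. N i \<subset> N (Suc i))}"

(* Module records extend ring records; the fields mult and one play no role in the module axioms
   and are left undefined. *)
definition quot_module ::
    "('a, 'b, 'd) module_scheme \<Rightarrow> 'b set \<Rightarrow> ('a, 'b set) module" where
  "quot_module M N =
     \<lparr>carrier = a_rcosets\<^bsub>M\<^esub> N, mult = undefined, one = undefined,
      zero = N, add = set_add M,
      smult = (\<lambda>a X. \<Union>x\<in>X. N +>\<^bsub>M\<^esub> (a \<odot>\<^bsub>M\<^esub> x))\<rparr>"

(* A subset I of the ring B (an ideal, or all of B), with B acting by multiplication. Any subring
   of B for which I is stable acts by the same operation. *)
definition ideal_module :: "('a, 'c) ring_scheme \<Rightarrow> 'a set \<Rightarrow> ('a, 'a) module" where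
  "ideal_module B I =
     \<lparr>carrier = I, mult = mult B, one = one B, zero = zero B, add = add B, smult = mult B\<rparr>"

(* I^n, with I^0 = carrier R. *)
abbreviation ideal_power :: "('a, 'c) ring_scheme \<Rightarrow> 'a set \<Rightarrow> nat \<Rightarrow> 'a set" where
  "ideal_power R I n \<equiv> I [^]\<^bsub>ideals_set R\<^esub> n"

(* In the definitions below, d stands for the dimension of R. *)

definition is_hilbert_coeffs ::
    "('a, 'c) ring_scheme \<Rightarrow> nat \<Rightarrow> 'a set \<Rightarrow> (nat \<Rightarrow> int) \<Rightarrow> bool" where
  "is_hilbert_coeffs R d I e \<longleftrightarrow>
     (\<forall>i>d. e i = 0) \<and>
     (\<forall>\<^sub>F n in sequentially. \<exists>l.
        module_length R (quot_module (ideal_module R (carrier R)) (ideal_power R I n)) = enat l \<and>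
        int l = (\<Sum>i\<le>d. (- 1) ^ i * e i * int ((n + d - 1 - i) choose (d - i))))"

definition hilbert_coeff :: "('a, 'c) ring_scheme \<Rightarrow> nat \<Rightarrow> 'a set \<Rightarrow> nat \<Rightarrow> int" where
  "hilbert_coeff R d I = (THE e. is_hilbert_coeffs R d I e)"

definition minimal_reduction :: "('a, 'c) ring_scheme \<Rightarrow> nat \<Rightarrow> 'a set \<Rightarrow> 'a set \<Rightarrow> bool" where
  "minimal_reduction R d I J \<longleftrightarrow>
     J \<subseteq> I \<and>
     (\<exists>x :: nat \<Rightarrow> 'a. x ` {..<d} \<subseteq> carrier R \<and> J = genideal R (x ` {..<d})) \<and>
     (\<exists>r. ideal_power R I (Suc r) = J \<cdot>\<^bsub>R\<^esub> ideal_power R I r)"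

(* The Rees algebra as the subring of R[t] of polynomials whose n-th coefficient is in I^n. *)
definition rees_algebra :: "('a, 'c) ring_scheme \<Rightarrow> 'a set \<Rightarrow> (nat \<Rightarrow> 'a) ring" where
  "rees_algebra R I =
     \<lparr>carrier = {p \<in> carrier (UP R). \<forall>n. p n \<in> ideal_power R I n},
      mult = mult (UP R), one = one (UP R), zero = zero (UP R), add = add (UP R)\<rparr>"

(* The extension I R(K) of the ideal I of R to the Rees algebra R(K). *)
definition rees_extension :: "('a, 'c) ring_scheme \<Rightarrow> 'a set \<Rightarrow> 'a set \<Rightarrow> (nat \<Rightarrow> 'a) set" where
  "rees_extension R I K = genideal (rees_algebra R K) ((\<lambda>a. monom (UP R) a 0) ` I)"

(* I R(I) / I R(J), to be regarded as a module over rees_algebra R J. *)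
definition sally_module ::
    "('a, 'c) ring_scheme \<Rightarrow> 'a set \<Rightarrow> 'a set \<Rightarrow> (nat \<Rightarrow> 'a, (nat \<Rightarrow> 'a) set) module" where
  "sally_module R J I =
     quot_module (ideal_module (rees_algebra R I) (rees_extension R I I)) (rees_extension R I J)"

(* The R-module I^n / I J^(n-1), which is the component of degree n - 1 of the Sally module.
   Only n > 0 is meaningful. *)
definition sally_component ::
    "('a, 'c) ring_scheme \<Rightarrow> 'a set \<Rightarrow> 'a set \<Rightarrow> nat \<Rightarrow> ('a, 'a set) module" where
  "sally_component R J I n =
     quot_module (ideal_module R (ideal_power R I n)) (I \<cdot>\<^bsub>R\<^esub> ideal_power R J (n - 1))"

definition sally_hilbert_poly :: "('a, 'c) ring_scheme \<Rightarrow> 'a set \<Rightarrow> 'a set \<Rightarrow> rat poly" where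
  "sally_hilbert_poly R J I =
     (THE p. \<forall>\<^sub>F n in sequentially. \<exists>l.
        module_length R (sally_component R J I n) = enat l \<and> of_nat l = poly p (of_nat n))"

(* The multiplicity of a Sally module of dimension d; its Hilbert polynomial then has degree
   d - 1. Not meaningful when the dimension is smaller. *)
definition sally_multiplicity ::
    "('a, 'c) ring_scheme \<Rightarrow> nat \<Rightarrow> 'a set \<Rightarrow> 'a set \<Rightarrow> rat" where
  "sally_multiplicity R d J I = fact (d - 1) * lead_coeff (sally_hilbert_poly R J I)"

end

theory Submission
  imports Defs
begin

text \<open>All lengths are lengths of chains in the modular lattice of ideals. From
  \<open>\<lambda>(\<mm>\<^sup>n/\<mm>J\<^sup>n\<^sup>-\<^sup>1) = \<lambda>(R/J\<^sup>n\<^sup>-\<^sup>1) + \<lambda>(J\<^sup>n\<^sup>-\<^sup>1/\<mm>J\<^sup>n\<^sup>-\<^sup>1) - \<lambda>(R/\<mm>\<^sup>n)\<close>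
  and \<open>e\<^sub>0(J) = e\<^sub>0(\<mm>)\<close> one reads off that the component of degree \<open>n - 1\<close> of the Sally module has
  a length which is a polynomial in \<open>n\<close> of degree at most \<open>d - 1\<close>, and that its coefficient of
  \<open>n\<^sup>d\<^sup>-\<^sup>1/(d - 1)!\<close> is \<open>e\<^sub>1(\<mm>) - e\<^sub>0(\<mm>) - e\<^sub>1(J) + 1\<close>. Here the summand \<open>1\<close> comes from the fibre
  ring \<open>\<R>(J)/\<mm>\<R>(J)\<close>: it is generated by \<open>d\<close> elements, and since \<open>R\<close> has dimension \<open>d\<close>, its Hilbert
  function grows too fast for it to be a proper quotient of the polynomial ring.

  In particular \<open>\<mm>\<R>(J)\<close> is prime, and the chains of primes above it have length at most \<open>d\<close>, with
  equality for the primes generated by \<open>\<mm>\<close> and an initial segment of the variables. A power of \<open>\<mm>\<close>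
  multiplies \<open>\<mm>\<R>(\<mm>)\<close> into \<open>\<mm>\<R>(J)\<close>, so every prime above the annihilator of the Sally module
  contains \<open>\<mm>\<R>(J)\<close>, and the dimension is \<open>d\<close> iff the annihilator lies in \<open>\<mm>\<R>(J)\<close>. If an element
  outside \<open>\<mm>\<R>(J)\<close> annihilates the Sally module, the lengths of the components grow like those of a module over a
  proper quotient of the polynomial ring, so the coefficient vanishes. If no such element exists,
  some homogeneous element of the Sally module is annihilated only by elements of \<open>\<mm>\<R>(J)\<close>, and the
  lengths grow at least like the Hilbert function of the fibre ring, so the coefficient is positive.\<close>

section \<open>Lengths of chains in modular lattices\<close>

text \<open>Krull dimension is handled through growth alone. An element of a prime
  \<open>P (i + 1)\<close> outside \<open>P i\<close> acts injectively modulo \<open>P i\<close>; if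
  it shifts a filtration by a bounded amount, lengths along a chain of primes obey Pascal's
  recursion up to that shift, and a chain of \<open>s + 1\<close> primes forces growth like
  \<open>n choose s\<close> (\<open>chain_growth\<close>). This is used twice: for the powers of
  \<open>J\<close> in \<open>R\<close>, where Artin-Rees bounds the shift and the fibre ring is
  bounded from below, and for polynomials of bounded degree in the Rees algebra, where it excludes
  long chains of primes, homogeneous or not. The obstacle is that many of the sequences to be
  compared are known only through upper bounds, not as polynomials. Growth is therefore measured by
  \<open>small\<close>, a bound on partial sums that survives sums, shifts and the passage from
  \<open>s\<close> to \<open>s + 1\<close> generators; it meets Hilbert polynomials only through
  their top coefficients. Graded modules are pairs of families of ideals, so that most comparisons
  of lengths are statements about ideals of \<open>R\<close>, and genuine quotient modules appear
  only where the definitions demand them.\<close>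

definition chain_length :: "'b set set \<Rightarrow> 'b set \<Rightarrow> 'b set \<Rightarrow> enat" where
  "chain_length L A B = Sup {enat n | n. \<exists>N :: nat \<Rightarrow> 'b set.
     (\<forall>i\<le>n. N i \<in> L \<and> A \<subseteq> N i \<and> N i \<subseteq> B) \<and> (\<forall>i<n. N i \<subset> N (Suc i))}"

lemma chain_length_upper:
  assumes "\<And>i. i \<le> n \<Longrightarrow> N i \<in> L \<and> A \<subseteq> N i \<and> N i \<subseteq> B"
    and "\<And>i. i < n \<Longrightarrow> N i \<subset> N (Suc i)"
  shows "enat n \<le> chain_length L A B"
  unfolding chain_length_def using assms by (intro Sup_upper) auto

lemma chain_length_least:
  assumes "\<And>n N. \<lbrakk>\<And>i. i \<le> n \<Longrightarrow> N i \<in> L \<and> A \<subseteq> N i \<and> N i \<subseteq> B;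
                   \<And>i. i < n \<Longrightarrow> N i \<subset> N (Suc i)\<rbrakk> \<Longrightarrow> enat n \<le> u"
  shows "chain_length L A B \<le> u"
  unfolding chain_length_def using assms by (intro Sup_least) blast

text \<open>Strictness on comparable pairs is all that a map of intervals needs to carry chains to
  chains; it may fail to be injective or to respect joins. Preimages, images and unions of cosets
  are all compared through it. The endpoints of an interval need not belong to \<open>L\<close>,
  which is why mere sets may serve as lower bounds later.\<close>

lemma chain_length_transport:
  assumes "\<And>N. \<lbrakk>N \<in> L; A \<subseteq> N; N \<subseteq> B\<rbrakk> \<Longrightarrow> g N \<in> L' \<and> A' \<subseteq> g N \<and> g N \<subseteq> B'"
    and "\<And>N N'. \<lbrakk>N \<in> L; N' \<in> L; A \<subseteq> N; N \<subset> N'; N' \<subseteq> B\<rbrakk> \<Longrightarrow> g N \<subset> g N'"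
  shows "chain_length L A B \<le> chain_length L' A' B'"
proof (rule chain_length_least)
  fix n and N :: "nat \<Rightarrow> 'a set"
  assume N: "\<And>i. i \<le> n \<Longrightarrow> N i \<in> L \<and> A \<subseteq> N i \<and> N i \<subseteq> B"
    and st: "\<And>i. i < n \<Longrightarrow> N i \<subset> N (Suc i)"
  show "enat n \<le> chain_length L' A' B'"
  proof (rule chain_length_upper[where N = "g \<circ> N"])
    fix i assume "i \<le> n" with N[of i] assms(1)[of "N i"]
    show "(g \<circ> N) i \<in> L' \<and> A' \<subseteq> (g \<circ> N) i \<and> (g \<circ> N) i \<subseteq> B'" by simp
  next
    fix i assume "i < n" with N[of i] N[of "Suc i"] st[of i] assms(2)[of "N i" "N (Suc i)"]
    show "(g \<circ> N) i \<subset> (g \<circ> N) (Suc i)" by simp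
  qed
qed

lemma chain_length_mono:
  assumes "A' \<subseteq> A" "B \<subseteq> B'"
  shows "chain_length L A B \<le> chain_length L A' B'"
  using assms by (intro chain_length_transport[where g = id]) auto

lemma chain_length_extend:
  assumes "X \<subset> Y" "Y \<in> L" "A \<subseteq> X" "X \<in> L"
  shows "chain_length L A X + 1 \<le> chain_length L A Y"
proof -
  have *: "enat n \<le> chain_length L A Y - 1"
    if N: "\<And>i. i \<le> n \<Longrightarrow> N i \<in> L \<and> A \<subseteq> N i \<and> N i \<subseteq> X"
    and st: "\<And>i. i < n \<Longrightarrow> N i \<subset> N (Suc i)" for n and N :: "nat \<Rightarrow> 'a set"
  proof -
    have "enat (Suc n) \<le> chain_length L A Y"
    proof (rule chain_length_upper[where N = "\<lambda>i. if i \<le> n then N i else Y"])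
      fix i assume "i \<le> Suc n"
      then show "(if i \<le> n then N i else Y) \<in> L \<and> A \<subseteq> (if i \<le> n then N i else Y)
          \<and> (if i \<le> n then N i else Y) \<subseteq> Y"
        using N[of i] assms by auto
    next
      fix i assume "i < Suc n"
      then show "(if i \<le> n then N i else Y) \<subset> (if Suc i \<le> n then N (Suc i) else Y)"
        using st[of i] N[of i] assms(1) by (cases "i = n") auto
    qed
    then show ?thesis by (cases "chain_length L A Y") (auto simp: one_enat_def)
  qed
  have "chain_length L A X \<le> chain_length L A Y - 1"
    by (rule chain_length_least) (rule *)
  \<comment> \<open>Subtraction on \<open>enat\<close> is truncated, so the bound by
    \<open>chain_length L A Y - 1\<close> gives a strict increase only once the longer interval has
    positive length; the chain from \<open>X\<close> to \<open>Y\<close> provides this.\<close>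
  moreover have "enat 1 \<le> chain_length L A Y"
    by (rule chain_length_upper[where N = "\<lambda>i. if i = 0 then X else Y"]) (use assms in auto)
  ultimately show ?thesis
    by (cases "chain_length L A Y"; cases "chain_length L A X") (auto simp: one_enat_def)
qed

lemma chain_length_self [simp]: "chain_length L A A = 0"
proof -
  have "chain_length L A A \<le> 0"
  proof (rule chain_length_least)
    fix n and N :: "nat \<Rightarrow> 'a set"
    assume N: "\<And>i. i \<le> n \<Longrightarrow> N i \<in> L \<and> A \<subseteq> N i \<and> N i \<subseteq> A"
      and st: "\<And>i. i < n \<Longrightarrow> N i \<subset> N (Suc i)"
    show "enat n \<le> 0"
      using N[of 0] N[of 1] st[of 0] by (cases n) (auto simp: zero_enat_def)
  qed
  then show ?thesis by simp
qed

lemma chain_length_pos: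
  assumes "A \<subset> B" "A \<in> L" "B \<in> L"
  shows "1 \<le> chain_length L A B"
  using chain_length_extend[OF assms(1,3) subset_refl assms(2)] by simp

lemma enat_step:
  fixes a b :: enat
  assumes "a + 1 \<le> a'" "b \<le> b'"
  shows "a + b + 1 \<le> a' + b'" "b + a + 1 \<le> b' + a'"
  using add_mono[OF assms] add_mono[OF assms(2,1)] by (simp_all add: ac_simps)

text \<open>Only inclusions are required: \<open>join\<close> is a least upper bound within
  \<open>L\<close>, and of the modular law just the half that does not hold in every lattice. This
  isolates what additivity of length needs, so that it applies both to ideals and to submodules over
  a smaller set of scalars.\<close>

locale modular_family =
  fixes L :: "'b set set" and join :: "'b set \<Rightarrow> 'b set \<Rightarrow> 'b set"
  assumes Int_closed: "\<lbrakk>A \<in> L; B \<in> L\<rbrakk> \<Longrightarrow> A \<inter> B \<in> L"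
    and join_closed: "\<lbrakk>A \<in> L; B \<in> L\<rbrakk> \<Longrightarrow> join A B \<in> L"
    and join_upper: "\<lbrakk>A \<in> L; B \<in> L\<rbrakk> \<Longrightarrow> A \<subseteq> join A B \<and> B \<subseteq> join A B"
    and join_least: "\<lbrakk>A \<in> L; B \<in> L; C \<in> L; A \<subseteq> C; B \<subseteq> C\<rbrakk> \<Longrightarrow> join A B \<subseteq> C"
    and modular: "\<lbrakk>A \<in> L; B \<in> L; C \<in> L; A \<subseteq> C\<rbrakk> \<Longrightarrow> join A B \<inter> C \<subseteq> join A (B \<inter> C)"
begin

text \<open>Additivity of length, proved without composition series so that infinite lengths are
  covered. A chain in the long interval is projected to the two short ones by meeting and joining
  with \<open>B\<close>; each of its steps remains strict in at least one projection. For the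
  converse a chain above \<open>B\<close> is placed on top of chains below \<open>B\<close>.\<close>

lemma chain_length_add:
  assumes L: "A \<in> L" "B \<in> L" "C \<in> L" and "A \<subseteq> B" "B \<subseteq> C"
  shows "chain_length L A C = chain_length L A B + chain_length L B C"
proof (rule antisym)
  show "chain_length L A C \<le> chain_length L A B + chain_length L B C"
  proof (rule chain_length_least)
    fix n N
    assume N: "\<And>i. i \<le> n \<Longrightarrow> N i \<in> L \<and> A \<subseteq> N i \<and> N i \<subseteq> C"
      and st: "\<And>i. i < n \<Longrightarrow> N i \<subset> N (Suc i)"
    have "enat k \<le> chain_length L A (N k \<inter> B) + chain_length L B (join (N k) B)" if "k \<le> n" for k
      using that
    proof (induction k)
      case 0 then show ?case by (simp add: zero_enat_def[symmetric])
    next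
      case (Suc k)
      let ?X = "N k" and ?Y = "N (Suc k)"
      have XY: "?X \<in> L" "?Y \<in> L" "?X \<subset> ?Y" "A \<subseteq> ?X" using N[of k] N[of "Suc k"] st[of k] Suc.prems by auto
      have i: "?X \<inter> B \<in> L" "?Y \<inter> B \<in> L" "join ?X B \<in> L" "join ?Y B \<in> L"
        using XY L Int_closed join_closed by auto
      have jm: "join ?X B \<subseteq> join ?Y B"
        using join_least[OF XY(1) L(2) i(4)] join_upper[OF XY(2) L(2)] XY(3) by blast
      have bx: "B \<subseteq> join ?X B" using join_upper XY L by auto
      \<comment> \<open>If both projections of a step were equal, every element of \<open>?Y\<close>
        would lie in \<open>join ?X B \<inter> ?Y\<close>, and the modular law would push it into
        \<open>?X\<close>.\<close>
      have "?X \<inter> B \<subset> ?Y \<inter> B \<or> join ?X B \<subset> join ?Y B"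
      proof (rule ccontr)
        assume "\<not> ?thesis"
        then have e: "?X \<inter> B = ?Y \<inter> B" "join ?X B = join ?Y B" using XY(3) jm by auto
        have "?Y \<subseteq> join ?X B \<inter> ?Y" using e join_upper[OF XY(2) L(2)] by auto
        also have "\<dots> \<subseteq> join ?X (B \<inter> ?Y)" using modular XY L by auto
        also have "\<dots> \<subseteq> ?X" using e XY i by (intro join_least) (auto simp: Int_commute)
        finally show False using XY(3) by blast
      qed
      then have "chain_length L A (?X \<inter> B) + chain_length L B (join ?X B) + 1
             \<le> chain_length L A (?Y \<inter> B) + chain_length L B (join ?Y B)"
      proof
        assume "?X \<inter> B \<subset> ?Y \<inter> B"
        then have "chain_length L A (?X \<inter> B) + 1 \<le> chain_length L A (?Y \<inter> B)"
          using i XY assms by (intro chain_length_extend) auto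
        moreover have "chain_length L B (join ?X B) \<le> chain_length L B (join ?Y B)"
          using jm by (intro chain_length_mono) auto
        ultimately show ?thesis by (rule enat_step)
      next
        assume "join ?X B \<subset> join ?Y B"
        then have "chain_length L B (join ?X B) + 1 \<le> chain_length L B (join ?Y B)"
          using i XY assms bx by (intro chain_length_extend) auto
        moreover have "chain_length L A (?X \<inter> B) \<le> chain_length L A (?Y \<inter> B)"
          using XY by (intro chain_length_mono) auto
        ultimately show ?thesis by (rule enat_step)
      qed
      moreover have "enat k \<le> chain_length L A (?X \<inter> B) + chain_length L B (join ?X B)" using Suc by simp
      then have "enat (Suc k) \<le> chain_length L A (?X \<inter> B) + chain_length L B (join ?X B) + 1"
        using add_right_mono[of "enat k" _ 1] by (simp add: one_enat_def)
      ultimately show ?case by (rule order_trans[rotated])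
    qed
    from this[of n] have "enat n \<le> chain_length L A (N n \<inter> B) + chain_length L B (join (N n) B)" by simp
    also have "\<dots> \<le> chain_length L A B + chain_length L B C"
      using N[of n] join_least[of "N n" B C] L assms by (intro add_mono chain_length_mono) auto
    finally show "enat n \<le> chain_length L A B + chain_length L B C" .
  qed
  have *: "chain_length L A B + enat n \<le> chain_length L A C"
    if N: "\<And>i. i \<le> n \<Longrightarrow> N i \<in> L \<and> B \<subseteq> N i \<and> N i \<subseteq> C"
      and st: "\<And>i. i < n \<Longrightarrow> N i \<subset> N (Suc i)" for n N
  proof -
    have "chain_length L A B + enat k \<le> chain_length L A (N k)" if "k \<le> n" for k
      using that
    proof (induction k)
      case 0 then show ?case using N[of 0] by (auto simp: zero_enat_def[symmetric] intro: chain_length_mono)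
    next
      case (Suc k)
      have "chain_length L A (N k) + 1 \<le> chain_length L A (N (Suc k))"
        using N[of k] N[of "Suc k"] st[of k] Suc.prems assms by (intro chain_length_extend) auto
      moreover have "chain_length L A B + enat k \<le> chain_length L A (N k)" using Suc by simp
      then have "chain_length L A B + enat (Suc k) \<le> chain_length L A (N k) + 1"
        using add_right_mono[of "chain_length L A B + enat k" _ 1] by (simp add: one_enat_def add.assoc)
      ultimately show ?case by (rule order_trans[rotated])
    qed
    from this[of n] have "chain_length L A B + enat n \<le> chain_length L A (N n)" by simp
    also have "\<dots> \<le> chain_length L A C" using N[of n] by (intro chain_length_mono) auto
    finally show ?thesis .
  qed
  \<comment> \<open>With an infinite total nothing is to be shown. Otherwise the lower length is a
    finite \<open>a\<close>, and every chain above \<open>B\<close> has length at most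
    \<open>c - a\<close>.\<close>
  show "chain_length L A B + chain_length L B C \<le> chain_length L A C"
  proof (cases "chain_length L A C")
    case (enat c)
    have "chain_length L A B + enat 0 \<le> chain_length L A C"
      by (rule *[where N = "\<lambda>_. B"]) (use assms in auto)
    then obtain a where a: "chain_length L A B = enat a" "a \<le> c"
      using enat by (cases "chain_length L A B") auto
    have "chain_length L B C \<le> enat (c - a)"
    proof (rule chain_length_least)
      fix n N
      assume "\<And>i. i \<le> n \<Longrightarrow> N i \<in> L \<and> B \<subseteq> N i \<and> N i \<subseteq> C"
        "\<And>i. i < n \<Longrightarrow> N i \<subset> N (Suc i)"
      then have "chain_length L A B + enat n \<le> chain_length L A C" by (rule *)
      then show "enat n \<le> enat (c - a)" using a enat by simp
    qed
    then show ?thesis using a enat by (cases "chain_length L B C") auto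
  qed auto
qed

end

section \<open>Subgroups stable under multiplication\<close>

text \<open>The scalars \<open>C\<close> are a parameter because two lattices are needed: with
  \<open>C\<close> the whole carrier these are the ideals, and with \<open>C\<close> the constants
  of the Rees algebra they include the polynomials of bounded degree, which need not form an
  ideal.\<close>

definition submods :: "('a, 'b) ring_scheme \<Rightarrow> 'a set \<Rightarrow> 'a set set" where
  "submods S C = {N. additive_subgroup N S \<and> (\<forall>c\<in>C. \<forall>x\<in>N. c \<otimes>\<^bsub>S\<^esub> x \<in> N)}"

definition mult_set :: "('a, 'b) ring_scheme \<Rightarrow> 'a \<Rightarrow> 'a set \<Rightarrow> 'a set" where
  "mult_set S x A = (\<lambda>a. x \<otimes>\<^bsub>S\<^esub> a) ` A"

abbreviation (in ring) set_plus :: "'a set \<Rightarrow> 'a set \<Rightarrow> 'a set" (infixl "\<boxplus>" 65) where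
  "A \<boxplus> B \<equiv> set_add R A B"

context cring
begin

lemma mem_set_add: "z \<in> A \<boxplus> B \<longleftrightarrow> (\<exists>a\<in>A. \<exists>b\<in>B. z = a \<oplus> b)"
  by (auto simp: set_add_def')

lemma additive_subgroup_iff:
  "additive_subgroup N R \<longleftrightarrow> N \<subseteq> carrier R \<and> \<zero> \<in> N \<and> (\<forall>x\<in>N. \<forall>y\<in>N. x \<oplus> y \<in> N) \<and> (\<forall>x\<in>N. \<ominus> x \<in> N)"
proof
  assume "additive_subgroup N R" then interpret additive_subgroup N R .
  show "N \<subseteq> carrier R \<and> \<zero> \<in> N \<and> (\<forall>x\<in>N. \<forall>y\<in>N. x \<oplus> y \<in> N) \<and> (\<forall>x\<in>N. \<ominus> x \<in> N)"
    using a_subset by auto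
next
  assume "N \<subseteq> carrier R \<and> \<zero> \<in> N \<and> (\<forall>x\<in>N. \<forall>y\<in>N. x \<oplus> y \<in> N) \<and> (\<forall>x\<in>N. \<ominus> x \<in> N)"
  then show "additive_subgroup N R"
    by (intro additive_subgroupI subgroup.intro) (auto simp: a_inv_def)
qed

lemma submodsI:
  assumes "N \<subseteq> carrier R" "\<zero> \<in> N" "\<And>x y. x \<in> N \<Longrightarrow> y \<in> N \<Longrightarrow> x \<oplus> y \<in> N" "\<And>x. x \<in> N \<Longrightarrow> \<ominus> x \<in> N"
    "\<And>c x. c \<in> C \<Longrightarrow> x \<in> N \<Longrightarrow> c \<otimes> x \<in> N"
  shows "N \<in> submods R C"
  using assms by (auto simp: submods_def additive_subgroup_iff)

lemma submodsD:
  assumes "N \<in> submods R C"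
  shows "N \<subseteq> carrier R" "\<zero> \<in> N" "x \<in> N \<Longrightarrow> y \<in> N \<Longrightarrow> x \<oplus> y \<in> N" "x \<in> N \<Longrightarrow> \<ominus> x \<in> N"
    "x \<in> N \<Longrightarrow> y \<in> N \<Longrightarrow> x \<ominus> y \<in> N" "c \<in> C \<Longrightarrow> x \<in> N \<Longrightarrow> c \<otimes> x \<in> N" "x \<in> N \<Longrightarrow> x \<in> carrier R"
  using assms by (auto simp: submods_def additive_subgroup_iff a_minus_def)

lemma add_cancel_left: "\<lbrakk>a \<in> carrier R; b \<in> carrier R\<rbrakk> \<Longrightarrow> (a \<oplus> b) \<ominus> a = b"
  by (simp add: a_minus_def a_comm a_assoc r_neg) (metis a_comm a_inv_closed a_lcomm r_neg r_zero)

lemma add_cancel_right: "\<lbrakk>a \<in> carrier R; b \<in> carrier R\<rbrakk> \<Longrightarrow> (a \<oplus> b) \<ominus> b = a"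
  by (simp add: a_minus_def a_assoc r_neg)

lemma submods_Int: "\<lbrakk>A \<in> submods R C; B \<in> submods R C\<rbrakk> \<Longrightarrow> A \<inter> B \<in> submods R C"
  by (rule submodsI) (auto dest: submodsD)

lemma submods_add:
  assumes C: "C \<subseteq> carrier R" and A: "A \<in> submods R C" and B: "B \<in> submods R C"
  shows "A \<boxplus> B \<in> submods R C"
proof (rule submodsI)
  show "A \<boxplus> B \<subseteq> carrier R" using submodsD(7)[OF A] submodsD(7)[OF B] by (auto simp: mem_set_add)
  show "\<zero> \<in> A \<boxplus> B" using submodsD(2)[OF A] submodsD(2)[OF B] unfolding mem_set_add
    by (metis r_zero zero_closed)
  fix x y assume "x \<in> A \<boxplus> B" "y \<in> A \<boxplus> B"
  then obtain a b c d where e: "a \<in> A" "b \<in> B" "c \<in> A" "d \<in> B" "x = a \<oplus> b" "y = c \<oplus> d"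
    by (auto simp: mem_set_add)
  then have "x \<oplus> y = (a \<oplus> c) \<oplus> (b \<oplus> d)" using submodsD(7)[OF A] submodsD(7)[OF B]
    by (simp add: a_ac)
  then show "x \<oplus> y \<in> A \<boxplus> B" using e submodsD(3)[OF A] submodsD(3)[OF B] unfolding mem_set_add by blast
next
  fix x assume "x \<in> A \<boxplus> B"
  then obtain a b where e: "a \<in> A" "b \<in> B" "x = a \<oplus> b" by (auto simp: mem_set_add)
  then have "\<ominus> x = (\<ominus> a) \<oplus> (\<ominus> b)" using submodsD(7)[OF A] submodsD(7)[OF B] by (simp add: minus_add)
  then show "\<ominus> x \<in> A \<boxplus> B" using e submodsD(4)[OF A] submodsD(4)[OF B] unfolding mem_set_add by blast
  fix c assume c: "c \<in> C"
  have "c \<otimes> x = c \<otimes> a \<oplus> c \<otimes> b"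
    using e c C submodsD(7)[OF A e(1)] submodsD(7)[OF B e(2)] by (auto simp: r_distr)
  then show "c \<otimes> x \<in> A \<boxplus> B" using e c submodsD(6)[OF A] submodsD(6)[OF B] unfolding mem_set_add by blast
qed

lemma submods_add_upper:
  assumes A: "A \<in> submods R C" and B: "B \<in> submods R C"
  shows "A \<subseteq> A \<boxplus> B" "B \<subseteq> A \<boxplus> B"
proof -
  show "A \<subseteq> A \<boxplus> B"
  proof
    fix x assume "x \<in> A" then have "x = x \<oplus> \<zero>" using submodsD(7)[OF A] by simp
    then show "x \<in> A \<boxplus> B" using \<open>x \<in> A\<close> submodsD(2)[OF B] unfolding mem_set_add by blast
  qed
  show "B \<subseteq> A \<boxplus> B"
  proof
    fix x assume "x \<in> B" then have "x = \<zero> \<oplus> x" using submodsD(7)[OF B] by simp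
    then show "x \<in> A \<boxplus> B" using \<open>x \<in> B\<close> submodsD(2)[OF A] unfolding mem_set_add by blast
  qed
qed

lemma submods_add_least:
  assumes "K \<in> submods R C" "A \<subseteq> K" "B \<subseteq> K" shows "A \<boxplus> B \<subseteq> K"
  using assms(2,3) submodsD(3)[OF assms(1)] unfolding mem_set_add subset_iff by blast

lemma submods_modular:
  assumes "A \<in> submods R C" "B \<in> submods R C" "K \<in> submods R C" "A \<subseteq> K"
  shows "(A \<boxplus> B) \<inter> K \<subseteq> A \<boxplus> (B \<inter> K)"
proof
  fix z assume "z \<in> (A \<boxplus> B) \<inter> K"
  then obtain a b where e: "a \<in> A" "b \<in> B" "z = a \<oplus> b" "z \<in> K" by (auto simp: mem_set_add)
  have "a \<in> carrier R" "b \<in> carrier R" using e submodsD(7)[OF assms(1)] submodsD(7)[OF assms(2)] by auto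
  then have "b = z \<ominus> a" using e add_cancel_left by simp
  then have "b \<in> K" using e assms(4) submodsD(5)[OF assms(3), of z a] by auto
  then show "z \<in> A \<boxplus> (B \<inter> K)" using e unfolding mem_set_add by blast
qed

lemma modular_submods:
  assumes "C \<subseteq> carrier R" shows "modular_family (submods R C) (set_add R)"
proof
  fix A B K assume L: "A \<in> submods R C" "B \<in> submods R C"
  show "A \<inter> B \<in> submods R C" "A \<boxplus> B \<in> submods R C" "A \<subseteq> A \<boxplus> B \<and> B \<subseteq> A \<boxplus> B"
    using submods_Int[OF L] submods_add[OF assms L] submods_add_upper[OF L] by auto
  assume K: "K \<in> submods R C" "A \<subseteq> K"
  show "(A \<boxplus> B) \<inter> K \<subseteq> A \<boxplus> (B \<inter> K)" by (rule submods_modular[OF L K])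
  assume "B \<subseteq> K"
  then show "A \<boxplus> B \<subseteq> K" using submods_add_least K by blast
qed

lemma mult_set_submods:
  assumes C: "C \<subseteq> carrier R" and A: "A \<in> submods R C" and x: "x \<in> carrier R"
  shows "mult_set R x A \<in> submods R C"
proof (rule submodsI)
  note a = submodsD[OF A]
  show "mult_set R x A \<subseteq> carrier R" using x a by (auto simp: mult_set_def)
  show "\<zero> \<in> mult_set R x A" using x a(2) unfolding mult_set_def by (metis image_eqI r_null)
  fix y z assume "y \<in> mult_set R x A" "z \<in> mult_set R x A"
  then obtain b c where e: "b \<in> A" "c \<in> A" "y = x \<otimes> b" "z = x \<otimes> c" by (auto simp: mult_set_def)
  then have "y \<oplus> z = x \<otimes> (b \<oplus> c)" using x a(7) by (simp add: r_distr)
  then show "y \<oplus> z \<in> mult_set R x A" using e a(3) by (auto simp: mult_set_def)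
next
  note a = submodsD[OF A]
  fix y assume "y \<in> mult_set R x A"
  then obtain b where e: "b \<in> A" "y = x \<otimes> b" by (auto simp: mult_set_def)
  then have "\<ominus> y = x \<otimes> (\<ominus> b)" using x a(7) by (simp add: r_minus)
  then show "\<ominus> y \<in> mult_set R x A" using e a(4) by (auto simp: mult_set_def)
  fix c assume c: "c \<in> C"
  have "c \<otimes> y = x \<otimes> (c \<otimes> b)" using e c C x a(7) m_lcomm by auto
  then show "c \<otimes> y \<in> mult_set R x A" using e c a(6) by (auto simp: mult_set_def)
qed

lemma colon_submods:
  assumes C: "C \<subseteq> carrier R" and A: "A \<in> submods R C" and B: "B \<in> submods R C" and x: "x \<in> carrier R"
  shows "{a \<in> A. x \<otimes> a \<in> B} \<in> submods R C"
proof (rule submodsI)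
  note a = submodsD[OF A] and b = submodsD[OF B]
  show "{a \<in> A. x \<otimes> a \<in> B} \<subseteq> carrier R" using a by auto
  show "\<zero> \<in> {a \<in> A. x \<otimes> a \<in> B}" using a b x by auto
  fix y z assume "y \<in> {a \<in> A. x \<otimes> a \<in> B}" "z \<in> {a \<in> A. x \<otimes> a \<in> B}"
  then show "y \<oplus> z \<in> {a \<in> A. x \<otimes> a \<in> B}" using a b x by (auto simp: r_distr)
next
  note a = submodsD[OF A] and b = submodsD[OF B]
  fix y assume "y \<in> {a \<in> A. x \<otimes> a \<in> B}"
  then show "\<ominus> y \<in> {a \<in> A. x \<otimes> a \<in> B}" using a b x by (auto simp: r_minus)
  fix c assume "c \<in> C"
  then show "c \<otimes> y \<in> {a \<in> A. x \<otimes> a \<in> B}" using \<open>y \<in> _\<close> a b x C m_lcomm[of x c y] by auto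
qed

text \<open>Multiplication by \<open>x\<close> maps \<open>A/D\<close> onto
  \<open>(xA + B)/B\<close>, so lengths cannot increase; taking preimages makes this a strictly
  monotone map of lattices. With \<open>x = \<one>\<close> it is the comparison of the second
  isomorphism theorem.\<close>

lemma chain_length_mult_le:
  assumes C: "C \<subseteq> carrier R" and A: "A \<in> submods R C" and B: "B \<in> submods R C" and x: "x \<in> carrier R"
    and D: "D \<subseteq> A" "\<And>d. d \<in> D \<Longrightarrow> x \<otimes> d \<in> B"
  shows "chain_length (submods R C) B (mult_set R x A \<boxplus> B) \<le> chain_length (submods R C) D A"
proof (rule chain_length_transport[where g = "\<lambda>N. {a \<in> A. x \<otimes> a \<in> N}"])
  fix N assume N: "N \<in> submods R C" "B \<subseteq> N" "N \<subseteq> mult_set R x A \<boxplus> B"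
  then show "{a \<in> A. x \<otimes> a \<in> N} \<in> submods R C \<and> D \<subseteq> {a \<in> A. x \<otimes> a \<in> N} \<and> {a \<in> A. x \<otimes> a \<in> N} \<subseteq> A"
    using colon_submods[OF C A N(1) x] D by auto
next
  fix N N' assume N: "N \<in> submods R C" "N' \<in> submods R C" "B \<subseteq> N" "N \<subset> N'" "N' \<subseteq> mult_set R x A \<boxplus> B"
  then obtain z where z: "z \<in> N'" "z \<notin> N" by blast
  then have "z \<in> mult_set R x A \<boxplus> B" using N(5) by blast
  then obtain a b where ab: "a \<in> A" "b \<in> B" "z = x \<otimes> a \<oplus> b" by (auto simp: mem_set_add mult_set_def)
  then have c: "x \<otimes> a \<in> carrier R" "b \<in> carrier R" using submodsD(7)[OF A] submodsD(7)[OF B] x by auto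
  have e: "x \<otimes> a = z \<ominus> b" unfolding ab(3) using c add_cancel_right by simp
  have b: "b \<in> N" "b \<in> N'" using ab(2) N(3,4) by auto
  have "x \<otimes> a \<in> N'" unfolding e by (rule submodsD(5)[OF N(2) z(1) b(2)])
  moreover have "x \<otimes> a \<notin> N" using z(2) submodsD(3)[OF N(1) _ b(1)] unfolding ab(3) by auto
  ultimately have "a \<in> {a \<in> A. x \<otimes> a \<in> N'} - {a \<in> A. x \<otimes> a \<in> N}" using ab(1) by simp
  moreover have "{a \<in> A. x \<otimes> a \<in> N} \<subseteq> {a \<in> A. x \<otimes> a \<in> N'}" using N(4) by auto
  ultimately show "{a \<in> A. x \<otimes> a \<in> N} \<subset> {a \<in> A. x \<otimes> a \<in> N'}" by blast
qed

text \<open>The counterpart for injections: if only elements of \<open>D\<close> are sent into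
  \<open>B\<close>, then \<open>A/D\<close> embeds into \<open>(xA + B)/B\<close>, and sending
  \<open>N\<close> to \<open>xN + B\<close> is strictly monotone on submodules containing
  \<open>D\<close>.\<close>

lemma chain_length_mult_ge:
  assumes C: "C \<subseteq> carrier R" and A: "A \<in> submods R C" and B: "B \<in> submods R C" and x: "x \<in> carrier R"
    and D: "\<And>d. d \<in> A \<Longrightarrow> x \<otimes> d \<in> B \<Longrightarrow> d \<in> D"
  shows "chain_length (submods R C) D A \<le> chain_length (submods R C) B (mult_set R x A \<boxplus> B)"
proof (rule chain_length_transport[where g = "\<lambda>N. mult_set R x N \<boxplus> B"])
  fix N assume N: "N \<in> submods R C" "D \<subseteq> N" "N \<subseteq> A"
  have "mult_set R x N \<boxplus> B \<subseteq> mult_set R x A \<boxplus> B" using N unfolding mult_set_def set_add_def' by blast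
  moreover have "mult_set R x N \<in> submods R C" by (rule mult_set_submods[OF C N(1) x])
  ultimately show "mult_set R x N \<boxplus> B \<in> submods R C \<and> B \<subseteq> mult_set R x N \<boxplus> B \<and> mult_set R x N \<boxplus> B \<subseteq> mult_set R x A \<boxplus> B"
    using submods_add_upper(2) submods_add[OF C] B by simp
next
  fix N N' assume N: "N \<in> submods R C" "N' \<in> submods R C" "D \<subseteq> N" "N \<subset> N'" "N' \<subseteq> A"
  then obtain z where z: "z \<in> N'" "z \<notin> N" by blast
  have zc: "z \<in> carrier R" using z submodsD(7)[OF N(2)] by blast
  have mB: "mult_set R x N' \<in> submods R C" using mult_set_submods[OF C N(2) x] .
  have "x \<otimes> z \<in> mult_set R x N' \<boxplus> B"
    using submods_add_upper(1)[OF mB B] z by (auto simp: mult_set_def)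
  moreover have "x \<otimes> z \<notin> mult_set R x N \<boxplus> B"
  proof
    assume "x \<otimes> z \<in> mult_set R x N \<boxplus> B"
    then obtain n b where nb: "n \<in> N" "b \<in> B" "x \<otimes> z = x \<otimes> n \<oplus> b" by (auto simp: mem_set_add mult_set_def)
    have nc: "n \<in> carrier R" "b \<in> carrier R" using nb submodsD(7)[OF N(1)] submodsD(7)[OF B] by auto
    have "x \<otimes> (z \<ominus> n) = x \<otimes> z \<ominus> x \<otimes> n" using x zc nc by (simp add: a_minus_def r_distr r_minus)
    also have "\<dots> = b" using nb(3) add_cancel_left nc x by simp
    finally have "x \<otimes> (z \<ominus> n) = b" .
    moreover have "z \<ominus> n \<in> A" using z nb N submodsD(5)[OF A] by blast
    ultimately have "z \<ominus> n \<in> N" using D nb N(3) by blast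
    then have "(z \<ominus> n) \<oplus> n \<in> N" using nb submodsD(3)[OF N(1)] by blast
    then have "z \<in> N" using zc nc by (simp add: a_minus_def a_assoc l_neg)
    then show False using z by blast
  qed
  moreover have "mult_set R x N \<boxplus> B \<subseteq> mult_set R x N' \<boxplus> B" using N unfolding mult_set_def set_add_def' by blast
  ultimately show "mult_set R x N \<boxplus> B \<subset> mult_set R x N' \<boxplus> B" by blast
qed

lemma ideal_iff_submods: "ideal I R \<longleftrightarrow> I \<in> submods R (carrier R)"
proof
  assume "ideal I R" then show "I \<in> submods R (carrier R)"
    by (simp add: ideal.axioms(1) ideal.I_l_closed submods_def)
next
  assume I: "I \<in> submods R (carrier R)"
  show "ideal I R"
  proof (rule idealI[OF ring_axioms])
    show "subgroup I (add_monoid R)" using I by (simp add: submods_def additive_subgroup_def)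
    fix a x assume a: "a \<in> I" "x \<in> carrier R"
    show "x \<otimes> a \<in> I" using submodsD(6)[OF I a(2,1)] .
    then show "a \<otimes> x \<in> I" using m_comm[OF submodsD(7)[OF I a(1)] a(2)] by simp
  qed
qed

end

section \<open>Ideals and graded families\<close>

text \<open>With \<open>E\<close> in degree \<open>n\<close> and \<open>F\<close> in degree
  \<open>n + 1\<close>, this is the part of degree \<open>n + 1\<close> reached from degree
  \<open>n\<close> by the variables \<open>x 0\<close>, ..., \<open>x (s - 1)\<close>, together with
  \<open>F\<close>. The recursion peels off the last variable, as the inductions on \<open>s\<close>
  do.\<close>

fun lin_span :: "('a, 'b) ring_scheme \<Rightarrow> (nat \<Rightarrow> 'a) \<Rightarrow> nat \<Rightarrow> 'a set \<Rightarrow> 'a set \<Rightarrow> 'a set" where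
  "lin_span S x 0 E F = F"
| "lin_span S x (Suc s) E F = set_add S (mult_set S (x s) E) (lin_span S x s E F)"

context cring
begin

abbreviation len :: "'a set \<Rightarrow> 'a set \<Rightarrow> enat" where
  "len \<equiv> chain_length (submods R (carrier R))"

lemma idealD:
  assumes "ideal I R"
  shows "I \<subseteq> carrier R" "\<zero> \<in> I" "x \<in> I \<Longrightarrow> y \<in> I \<Longrightarrow> x \<oplus> y \<in> I" "x \<in> I \<Longrightarrow> \<ominus> x \<in> I"
    "x \<in> I \<Longrightarrow> y \<in> I \<Longrightarrow> x \<ominus> y \<in> I" "r \<in> carrier R \<Longrightarrow> x \<in> I \<Longrightarrow> r \<otimes> x \<in> I"
    "r \<in> carrier R \<Longrightarrow> x \<in> I \<Longrightarrow> x \<otimes> r \<in> I" "x \<in> I \<Longrightarrow> x \<in> carrier R"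
  using submodsD[OF assms[unfolded ideal_iff_submods]] ideal.I_r_closed[OF assms] by auto

lemma mult_set_ideal: "\<lbrakk>ideal A R; x \<in> carrier R\<rbrakk> \<Longrightarrow> ideal (mult_set R x A) R"
  unfolding ideal_iff_submods by (rule mult_set_submods) auto

lemma colon_ideal: "\<lbrakk>ideal A R; ideal B R; x \<in> carrier R\<rbrakk> \<Longrightarrow> ideal {a \<in> A. x \<otimes> a \<in> B} R"
  unfolding ideal_iff_submods by (rule colon_submods) auto

lemma Int_ideal: "\<lbrakk>ideal A R; ideal B R\<rbrakk> \<Longrightarrow> ideal (A \<inter> B) R"
  unfolding ideal_iff_submods by (rule submods_Int)

lemma mult_set_subset: "mult_set R x A \<subseteq> B \<longleftrightarrow> (\<forall>a\<in>A. x \<otimes> a \<in> B)"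
  by (auto simp: mult_set_def)

lemma plus_upper1: "\<lbrakk>ideal A R; ideal B R\<rbrakk> \<Longrightarrow> A \<subseteq> A \<boxplus> B"
  unfolding ideal_iff_submods by (rule submods_add_upper)

lemma plus_upper2: "\<lbrakk>ideal A R; ideal B R\<rbrakk> \<Longrightarrow> B \<subseteq> A \<boxplus> B"
  unfolding ideal_iff_submods by (rule submods_add_upper)

lemma plus_least: "\<lbrakk>ideal K R; A \<subseteq> K; B \<subseteq> K\<rbrakk> \<Longrightarrow> A \<boxplus> B \<subseteq> K"
  unfolding ideal_iff_submods by (rule submods_add_least)

lemma plus_mono: "\<lbrakk>A \<subseteq> A'; B \<subseteq> B'\<rbrakk> \<Longrightarrow> A \<boxplus> B \<subseteq> A' \<boxplus> B'"
  unfolding set_add_def' by blast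

lemma plus_absorb: "\<lbrakk>ideal A R; ideal B R; A \<subseteq> B\<rbrakk> \<Longrightarrow> A \<boxplus> B = B"
  using plus_least[of B A B] plus_upper2[of A B] by blast

lemma plus_ideal_commute: "\<lbrakk>ideal A R; ideal B R\<rbrakk> \<Longrightarrow> A \<boxplus> B = B \<boxplus> A"
  by (metis ideal_def set_add_comm idealD(1))

lemma prodI: "\<lbrakk>i \<in> I; j \<in> J\<rbrakk> \<Longrightarrow> i \<otimes> j \<in> I \<cdot> J"
  by (rule ideal_prod.prod)

lemma prod_least:
  assumes "ideal K R" "\<And>i j. \<lbrakk>i \<in> I; j \<in> J\<rbrakk> \<Longrightarrow> i \<otimes> j \<in> K"
  shows "I \<cdot> J \<subseteq> K"
proof
  fix z assume "z \<in> I \<cdot> J"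
  then show "z \<in> K" by induction (use assms idealD(3)[OF assms(1)] in auto)
qed

lemma prod_mono: assumes "I \<subseteq> I'" "J \<subseteq> J'" shows "I \<cdot> J \<subseteq> I' \<cdot> J'"
proof
  fix z assume "z \<in> I \<cdot> J"
  then show "z \<in> I' \<cdot> J'" by induction (use assms in \<open>auto intro: ideal_prod.intros\<close>)
qed

lemma prod_subset1: "\<lbrakk>ideal I R; ideal J R\<rbrakk> \<Longrightarrow> I \<cdot> J \<subseteq> I"
  using ideal_prod_inter by blast

lemma prod_subset2: "\<lbrakk>ideal I R; ideal J R\<rbrakk> \<Longrightarrow> I \<cdot> J \<subseteq> J"
  using ideal_prod_inter by blast

lemma prod_one: "ideal I R \<Longrightarrow> carrier R \<cdot> I = I"
  using ideal_prod_one ideal_prod_commute oneideal by metis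

lemma ideals_set_simps [simp]: "mult (ideals_set R) = ideal_prod R" "one (ideals_set R) = carrier R"
  by (simp_all add: ideals_set_def)

lemma ideal_power_0: "ideal_power R I 0 = carrier R"
  by (simp add: nat_pow_def ideals_set_def)

lemma ideal_power_Suc: "ideal_power R I (Suc n) = ideal_power R I n \<cdot> I"
  by (simp add: nat_pow_def ideals_set_def)

lemma ideal_power_ideal: "ideal I R \<Longrightarrow> ideal (ideal_power R I n) R"
  by (induction n) (auto simp: ideal_power_0 ideal_power_Suc oneideal ideal_prod_is_ideal)

lemma ideal_power_1: "ideal I R \<Longrightarrow> ideal_power R I (Suc 0) = I"
  by (simp add: ideal_power_0 ideal_power_Suc prod_one)

lemma ideal_power_add:
  assumes "ideal I R" shows "ideal_power R I (m + n) = ideal_power R I m \<cdot> ideal_power R I n"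
  by (induction n) (use assms in \<open>auto simp: ideal_power_0 ideal_power_Suc ideal_power_ideal
        ideal_prod_one ideal_prod_assoc\<close>)

lemma ideal_power_Suc2: "ideal I R \<Longrightarrow> ideal_power R I (Suc n) = I \<cdot> ideal_power R I n"
  using ideal_power_add[of I 1 n] ideal_power_1[of I] by simp

lemma ideal_power_antimono:
  assumes "ideal I R" "m \<le> n" shows "ideal_power R I n \<subseteq> ideal_power R I m"
  using ideal_power_add[OF assms(1), of m "n - m"] prod_subset1 ideal_power_ideal assms by auto

lemma ideal_power_mono: "I \<subseteq> J \<Longrightarrow> ideal_power R I n \<subseteq> ideal_power R J n"
proof (induction n)
  case (Suc n)
  then show ?case unfolding ideal_power_Suc by (intro prod_mono) auto
qed (simp add: ideal_power_0)

lemma ideal_power_multI: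
  "\<lbrakk>ideal I R; x \<in> ideal_power R I m; y \<in> ideal_power R I n\<rbrakk> \<Longrightarrow> x \<otimes> y \<in> ideal_power R I (m + n)"
  by (simp add: ideal_power_add prodI)

lemma len_add:
  "\<lbrakk>ideal A R; ideal B R; ideal K R; A \<subseteq> B; B \<subseteq> K\<rbrakk> \<Longrightarrow> len A K = len A B + len B K"
  unfolding ideal_iff_submods
  by (rule modular_family.chain_length_add[OF modular_submods]) auto

lemma len_mult_le:
  "\<lbrakk>ideal A R; ideal B R; x \<in> carrier R; D \<subseteq> A; \<And>d. d \<in> D \<Longrightarrow> x \<otimes> d \<in> B\<rbrakk>
   \<Longrightarrow> len B (mult_set R x A \<boxplus> B) \<le> len D A"
  unfolding ideal_iff_submods by (rule chain_length_mult_le) auto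

lemma len_mult_ge:
  "\<lbrakk>ideal A R; ideal B R; x \<in> carrier R; \<And>d. d \<in> A \<Longrightarrow> x \<otimes> d \<in> B \<Longrightarrow> d \<in> D\<rbrakk>
   \<Longrightarrow> len D A \<le> len B (mult_set R x A \<boxplus> B)"
  unfolding ideal_iff_submods by (rule chain_length_mult_ge) auto

lemma len_mult_eq:
  assumes "ideal A R" "ideal B R" "x \<in> carrier R"
  shows "len {a \<in> A. x \<otimes> a \<in> B} A = len B (mult_set R x A \<boxplus> B)"
  by (intro antisym len_mult_le len_mult_ge) (use assms in auto)

lemma mult_set_one: "A \<subseteq> carrier R \<Longrightarrow> mult_set R \<one> A = A"
  by (force simp: mult_set_def)

lemma len_plus_le:
  assumes "ideal A R" "ideal B R" "D \<subseteq> A" "D \<subseteq> B"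
  shows "len B (A \<boxplus> B) \<le> len D A"
proof -
  have "\<one> \<otimes> d \<in> B" if "d \<in> D" for d using that assms(4) idealD(8)[OF assms(2), of d] by auto
  then show ?thesis
    using len_mult_le[OF assms(1,2) one_closed assms(3)] idealD(1)[OF assms(1)] by (simp add: mult_set_one)
qed

text \<open>A pair stands for the graded module with components \<open>A n / B n\<close> over the
  polynomial ring in \<open>s\<close> variables, the i-th variable acting by multiplication with
  \<open>x i\<close> into the next degree. Neither the quotient nor the polynomial ring is formed:
  the variables are elements of \<open>R\<close>, and the degree is remembered by the index.\<close>

definition graded_pair :: "nat \<Rightarrow> (nat \<Rightarrow> 'a) \<Rightarrow> (nat \<Rightarrow> 'a set) \<Rightarrow> (nat \<Rightarrow> 'a set) \<Rightarrow> bool" where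
  "graded_pair s x A B \<longleftrightarrow> (\<forall>n. ideal (A n) R \<and> ideal (B n) R \<and> B n \<subseteq> A n) \<and>
     (\<forall>n. \<forall>i<s. (\<forall>a\<in>A n. x i \<otimes> a \<in> A (Suc n)) \<and> (\<forall>b\<in>B n. x i \<otimes> b \<in> B (Suc n)))"

text \<open>Generation in bounded degree. When \<open>R\<close> is noetherian all components are
  finitely generated, so this amounts to finite generation over the polynomial ring.\<close>

definition graded_fg :: "nat \<Rightarrow> (nat \<Rightarrow> 'a) \<Rightarrow> (nat \<Rightarrow> 'a set) \<Rightarrow> (nat \<Rightarrow> 'a set) \<Rightarrow> bool" where
  "graded_fg s x A B \<longleftrightarrow> (\<exists>N. \<forall>n\<ge>N. A (Suc n) \<subseteq> lin_span R x s (A n) (B (Suc n)))"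

lemma graded_pairD:
  assumes "graded_pair s x A B"
  shows "ideal (A n) R" "ideal (B n) R" "B n \<subseteq> A n"
    "i < s \<Longrightarrow> a \<in> A n \<Longrightarrow> x i \<otimes> a \<in> A (Suc n)" "i < s \<Longrightarrow> b \<in> B n \<Longrightarrow> x i \<otimes> b \<in> B (Suc n)"
  using assms unfolding graded_pair_def by auto

lemma lin_span_ideal:
  "\<lbrakk>ideal E R; ideal F R; \<And>i. i < s \<Longrightarrow> x i \<in> carrier R\<rbrakk> \<Longrightarrow> ideal (lin_span R x s E F) R"
  by (induction s) (auto simp: add_ideals mult_set_ideal)

lemma lin_span_least:
  assumes "ideal K R" "F \<subseteq> K" "\<And>i e. i < s \<Longrightarrow> e \<in> E \<Longrightarrow> x i \<otimes> e \<in> K"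
  shows "lin_span R x s E F \<subseteq> K"
  using assms(3)
proof (induction s)
  case (Suc s)
  have "mult_set R (x s) E \<subseteq> K" using Suc.prems[of s] by (simp add: mult_set_subset)
  moreover have "lin_span R x s E F \<subseteq> K" using Suc by simp
  ultimately show ?case using plus_least[OF assms(1)] by simp
qed (simp add: assms(2))

lemma lin_span_base:
  assumes "ideal E R" "ideal F R" "\<And>i. i < s \<Longrightarrow> x i \<in> carrier R"
  shows "F \<subseteq> lin_span R x s E F"
  using assms(3)
proof (induction s)
  case (Suc s)
  then have "F \<subseteq> lin_span R x s E F" by simp
  also have "\<dots> \<subseteq> lin_span R x (Suc s) E F"
    unfolding lin_span.simps using Suc.prems assms by (intro plus_upper2 mult_set_ideal lin_span_ideal) auto
  finally show ?case .
qed simp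

lemma lin_span_gen:
  assumes "ideal E R" "ideal F R" "\<And>i. i < s \<Longrightarrow> x i \<in> carrier R" "i < s" "e \<in> E"
  shows "x i \<otimes> e \<in> lin_span R x s E F"
  using assms(3,4)
proof (induction s)
  case (Suc s)
  have id: "ideal (mult_set R (x s) E) R" "ideal (lin_span R x s E F) R"
    using Suc.prems assms by (auto intro!: mult_set_ideal lin_span_ideal)
  show ?case
  proof (cases "i = s")
    case True
    then have "x i \<otimes> e \<in> mult_set R (x s) E" using assms(5) by (auto simp: mult_set_def)
    then show ?thesis using plus_upper1[OF id] by auto
  next
    case False
    then have "x i \<otimes> e \<in> lin_span R x s E F" using Suc by simp
    then show ?thesis using plus_upper2[OF id] by auto
  qed
qed simp

lemma lin_span_split:
  assumes "ideal E R" "ideal F R" "\<And>i. i < s \<Longrightarrow> x i \<in> carrier R" "c \<in> lin_span R x s E F"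
  obtains g f where "g \<in> lin_span R x s E {\<zero>}" "f \<in> F" "c = g \<oplus> f"
proof -
  let ?G = "lin_span R x s E {\<zero>}"
  have G: "ideal ?G R" using assms zeroideal by (intro lin_span_ideal) auto
  have "lin_span R x s E F \<subseteq> ?G \<boxplus> F"
  proof (rule lin_span_least)
    show "ideal (?G \<boxplus> F) R" using G assms(2) by (rule add_ideals)
    show "F \<subseteq> ?G \<boxplus> F" using G assms(2) by (rule plus_upper2)
    fix i e assume "i < s" "e \<in> E"
    then have "x i \<otimes> e \<in> ?G" using assms zeroideal by (intro lin_span_gen) auto
    then show "x i \<otimes> e \<in> ?G \<boxplus> F" using plus_upper1[OF G assms(2)] by auto
  qed
  then show ?thesis using assms(4) that unfolding subset_iff mem_set_add by blast
qed

text \<open>The submodule generated by \<open>B\<close> and the multiples of \<open>y\<close>: the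
  quotient of \<open>A\<close> by it is the cokernel of multiplication by the last variable. In
  degree 0 no multiple occurs.\<close>

definition shifted :: "'a \<Rightarrow> (nat \<Rightarrow> 'a set) \<Rightarrow> (nat \<Rightarrow> 'a set) \<Rightarrow> nat \<Rightarrow> 'a set" where
  "shifted y A B n = (case n of 0 \<Rightarrow> B 0 | Suc k \<Rightarrow> mult_set R y (A k) \<boxplus> B (Suc k))"

lemma shifted_simps: "shifted y A B 0 = B 0" "shifted y A B (Suc k) = mult_set R y (A k) \<boxplus> B (Suc k)"
  by (simp_all add: shifted_def)

lemma shifted_pair:
  assumes gp: "graded_pair (Suc s) x A B" and x: "\<And>i. i \<le> s \<Longrightarrow> x i \<in> carrier R"
  shows "graded_pair s x A (shifted (x s) A B)"
  unfolding graded_pair_def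
proof (intro conjI allI impI ballI)
  note g = graded_pairD[OF gp]
  fix n
  show idA: "ideal (A n) R" by (rule g)
  show "ideal (shifted (x s) A B n) R"
    by (cases n) (simp_all add: shifted_simps g x add_ideals mult_set_ideal)
  show "shifted (x s) A B n \<subseteq> A n"
  proof (cases n)
    case (Suc k)
    have "mult_set R (x s) (A k) \<subseteq> A n" using g(4)[of s _ k] Suc by (simp add: mult_set_subset)
    then show ?thesis using plus_least[OF g(1)] g(3)[of n] Suc by (simp add: shifted_simps)
  qed (simp add: shifted_simps g)
  fix i assume i: "i < s"
  show "a \<in> A n \<Longrightarrow> x i \<otimes> a \<in> A (Suc n)" for a using g(4)[of i a n] i by simp
  fix b assume b: "b \<in> shifted (x s) A B n"
  show "x i \<otimes> b \<in> shifted (x s) A B (Suc n)"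
  proof (cases n)
    case 0
    then have "x i \<otimes> b \<in> B (Suc n)" using b g(5)[of i b 0] i by (simp add: shifted_simps)
    then show ?thesis using plus_upper2[OF mult_set_ideal[OF g(1) x, of s n] g(2)[of "Suc n"]] by (auto simp: shifted_simps)
  next
    case (Suc k)
    then obtain a c where ac: "a \<in> A k" "c \<in> B n" "b = x s \<otimes> a \<oplus> c"
      using b by (auto simp: shifted_simps mem_set_add mult_set_def)
    have "x i \<otimes> b = x s \<otimes> (x i \<otimes> a) \<oplus> x i \<otimes> c"
      using ac x[of i] x[of s] i idealD(8)[OF g(1), of a k] idealD(8)[OF g(2), of c n]
      by (simp add: r_distr m_lcomm)
    moreover have "x i \<otimes> a \<in> A n" "x i \<otimes> c \<in> B (Suc n)" using ac g(4)[of i a k] g(5)[of i c n] i Suc by auto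
    ultimately show ?thesis unfolding shifted_simps mem_set_add mult_set_def by blast
  qed
qed

text \<open>The last variable acts as zero on the cokernel, so its multiples are absorbed by the
  denominators and one variable fewer suffices for generation.\<close>

lemma shifted_fg:
  assumes gp: "graded_pair (Suc s) x A B" and x: "\<And>i. i \<le> s \<Longrightarrow> x i \<in> carrier R"
    and fg: "graded_fg (Suc s) x A B"
  shows "graded_fg s x A (shifted (x s) A B)"
proof -
  note g = graded_pairD[OF gp] and h = graded_pairD[OF shifted_pair[OF gp x]]
  obtain N where N: "\<And>n. n \<ge> N \<Longrightarrow> A (Suc n) \<subseteq> lin_span R x (Suc s) (A n) (B (Suc n))"
    using fg unfolding graded_fg_def by blast
  have "lin_span R x (Suc s) (A n) (B (Suc n)) \<subseteq> lin_span R x s (A n) (shifted (x s) A B (Suc n))"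
    (is "_ \<subseteq> ?K") for n
  proof (rule lin_span_least)
    have xs: "\<And>i. i < s \<Longrightarrow> x i \<in> carrier R" using x by simp
    show K: "ideal ?K R" using g h xs by (intro lin_span_ideal) auto
    have F: "shifted (x s) A B (Suc n) \<subseteq> ?K" using g h xs by (intro lin_span_base) auto
    have id: "ideal (mult_set R (x s) (A n)) R" "ideal (B (Suc n)) R" using g x by (auto intro: mult_set_ideal)
    show "B (Suc n) \<subseteq> ?K" using F plus_upper2[OF id] by (simp add: shifted_simps)
    fix i e assume ie: "i < Suc s" "e \<in> A n"
    show "x i \<otimes> e \<in> ?K"
    proof (cases "i = s")
      case True
      then have "x i \<otimes> e \<in> mult_set R (x s) (A n)" using ie by (auto simp: mult_set_def)
      then show ?thesis using F plus_upper1[OF id] by (auto simp: shifted_simps)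
    next
      case False
      then show ?thesis using ie g h xs by (intro lin_span_gen) auto
    qed
  qed
  then show ?thesis using N unfolding graded_fg_def by blast
qed

end

section \<open>Hilbert's basis theorem for graded families\<close>

context cring
begin

lemma shifted_decomp:
  assumes "f \<in> shifted y A B m"
  obtains b where "m = 0" "b \<in> B m" "f = b"
  | k a b where "m = Suc k" "a \<in> A k" "b \<in> B m" "f = y \<otimes> a \<oplus> b"
  using assms by (cases m) (auto simp: shifted_simps mem_set_add mult_set_def)

text \<open>The family of initial forms of \<open>C\<close> along the powers of \<open>y\<close>: a graded version of the
  leading coefficient ideals in Hilbert's basis theorem.\<close>

definition initial_family :: "'a \<Rightarrow> (nat \<Rightarrow> 'a set) \<Rightarrow> (nat \<Rightarrow> 'a set) \<Rightarrow> nat \<Rightarrow> nat \<Rightarrow> 'a set" where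
  "initial_family y A C j m = {a \<in> A m. (y [^] j) \<otimes> a \<in> C (m + j)}"

text \<open>Graded submodules of a finitely generated graded module are finitely generated.
  \<open>D j m\<close> collects the coefficients of \<open>y [^] j\<close> in \<open>C\<close>; they
  increase with \<open>j\<close>, and modulo \<open>yA\<close> they are finitely generated over the
  remaining variables by induction. As \<open>A\<close> is not free over the powers of
  \<open>y\<close>, such coefficients are only meaningful modulo \<open>X\<close>, and elements of
  \<open>X\<close> are handled by trading one degree for one power of \<open>y\<close>.\<close>

theorem graded_noetherian:
  assumes noeth: "noetherian_ring R"
  shows "\<lbrakk>\<And>i. i < s \<Longrightarrow> x i \<in> carrier R; graded_pair s x A B; graded_fg s x A B;
          graded_pair s x C B; \<And>n. C n \<subseteq> A n\<rbrakk> \<Longrightarrow> graded_fg s x C B"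
proof (induction s arbitrary: A B C)
  case 0
  then obtain N where N: "\<And>n. n \<ge> N \<Longrightarrow> A (Suc n) \<subseteq> B (Suc n)" unfolding graded_fg_def by auto
  then have "C (Suc n) \<subseteq> B (Suc n)" if "n \<ge> N" for n using "0.prems"(5)[of "Suc n"] that by blast
  then show ?case unfolding graded_fg_def by auto
next
  case (Suc s)
  define y where "y = x s"
  note a = graded_pairD[OF Suc.prems(2)] and c = graded_pairD[OF Suc.prems(4)]
  have y: "y \<in> carrier R" using Suc.prems(1) by (simp add: y_def)
  have xs: "\<And>i. i < s \<Longrightarrow> x i \<in> carrier R" and xs': "\<And>i. i \<le> s \<Longrightarrow> x i \<in> carrier R" using Suc.prems(1) by auto
  have yp: "y [^] (j::nat) \<in> carrier R" for j using y by simp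
  define X where "X = shifted y A B"
  have X: "graded_pair s x A X" unfolding X_def y_def by (rule shifted_pair[OF Suc.prems(2) xs'])
  have Xfg: "graded_fg s x A X" unfolding X_def y_def by (rule shifted_fg[OF Suc.prems(2) xs' Suc.prems(3)])
  note xd = graded_pairD[OF X]
  define D where "D = initial_family y A C"
  have D: "d \<in> D j m \<longleftrightarrow> d \<in> A m \<and> (y [^] j) \<otimes> d \<in> C (m + j)" for d j m
    by (auto simp: D_def initial_family_def)
  have Did: "ideal (D j m) R" for j m
    unfolding D_def initial_family_def using a c yp by (intro colon_ideal) auto
  have yC: "y \<otimes> d \<in> C (Suc n)" if "d \<in> C n" for d n using c(4)[of s d n] that by (simp add: y_def)
  have yB: "(y [^] j) \<otimes> b \<in> B (m + j)" if "b \<in> B m" for b j m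
  proof (induction j)
    case 0 then show ?case using that idealD(8)[OF a(2)] by simp
  next
    case (Suc j)
    have bc: "b \<in> carrier R" using that idealD(8)[OF a(2)] by blast
    have "(y [^] Suc j) \<otimes> b = y \<otimes> ((y [^] j) \<otimes> b)" using y yp bc by (simp add: m_ac)
    then show ?case using a(5)[of s _ "m + j"] Suc by (simp add: y_def)
  qed
  have BD: "B m \<subseteq> D j m" for j m using yB a(3) c(3) unfolding D subset_iff by blast
  have Dmono1: "D j m \<subseteq> D (Suc j) m" for j m
  proof
    fix d assume d: "d \<in> D j m"
    have dc: "d \<in> carrier R" using d idealD(8)[OF Did] by blast
    have "(y [^] Suc j) \<otimes> d = y \<otimes> ((y [^] j) \<otimes> d)" using y yp dc by (simp add: m_ac)
    then show "d \<in> D (Suc j) m" using d yC[of "(y [^] j) \<otimes> d" "m + j"] by (auto simp: D)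
  qed
  have Dmono: "D j m \<subseteq> D j' m" if "j \<le> j'" for j j' m
    using that by (induction rule: dec_induct) (use Dmono1 in blast)+
  have Dx: "x i \<otimes> d \<in> D j (Suc m)" if "i < s" "d \<in> D j m" for i d j m
  proof -
    have dc: "d \<in> carrier R" using that idealD(8)[OF Did] by blast
    have "(y [^] j) \<otimes> (x i \<otimes> d) = x i \<otimes> ((y [^] j) \<otimes> d)" using xs that y yp dc by (simp add: m_lcomm)
    then show ?thesis using a(4)[of i d m] c(4)[of i "(y [^] j) \<otimes> d" "m + j"] that by (auto simp: D)
  qed
  \<comment> \<open>Modulo \<open>X\<close> the variable \<open>y\<close> acts as zero, so the
    induction hypothesis applies to each \<open>L j\<close> and to their union
    \<open>M\<close>.\<close>
  define L where "L = (\<lambda>j m. D j m \<boxplus> X m)"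
  have Lid: "ideal (L j m) R" for j m unfolding L_def using Did xd by (intro add_ideals) auto
  have DA: "D j m \<subseteq> A m" for j m by (auto simp: D)
  have DL: "D j m \<subseteq> L j m" and XL: "X m \<subseteq> L j m" for j m
    unfolding L_def using plus_upper1[OF Did xd(2)] plus_upper2[OF Did xd(2)] by auto
  have LA: "L j m \<subseteq> A m" for j m unfolding L_def by (rule plus_least[OF a(1) DA xd(3)])
  have Lmono: "L j m \<subseteq> L j' m" if "j \<le> j'" for j j' m
    unfolding L_def using Dmono[OF that] by (intro plus_mono) auto
  have Lx: "x i \<otimes> d \<in> L j (Suc m)" if i: "i < s" and d: "d \<in> L j m" for i d j m
  proof -
    obtain u v where uv: "u \<in> D j m" "v \<in> X m" "d = u \<oplus> v" using d by (auto simp: L_def mem_set_add)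
    have "x i \<otimes> d = x i \<otimes> u \<oplus> x i \<otimes> v"
      using uv idealD(8)[OF Did, of u] idealD(8)[OF xd(2), of v] xs[OF i] by (simp add: r_distr)
    then show ?thesis unfolding L_def mem_set_add using Dx[OF i uv(1)] xd(5)[OF i uv(2)] by blast
  qed
  have Lgp: "graded_pair s x (L j) X" for j
    unfolding graded_pair_def using Lid xd XL Lx by auto
  have Lfg: "graded_fg s x (L j) X" for j
    by (rule Suc.IH[OF xs X Xfg Lgp LA])
  define M where "M = (\<lambda>m. \<Union>j. L j m)"
  have Mstab: "\<exists>j. M m = L j m" for m
  proof -
    have "\<Union> (range (\<lambda>j. L j m)) \<in> range (\<lambda>j. L j m)"
    proof (rule noetherian_ring.ideal_chain_is_trivial[OF noeth])
      show "subset.chain {I. ideal I R} (range (\<lambda>j. L j m))"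
        unfolding pred_on.chain_def using Lid Lmono by (auto simp: subset_iff) (meson nat_le_linear)+
    qed auto
    then show ?thesis by (auto simp: M_def)
  qed
  have LM: "L j m \<subseteq> M m" for j m by (auto simp: M_def)
  have Mgp: "graded_pair s x M X"
    unfolding graded_pair_def
  proof (intro conjI allI impI ballI)
    fix n
    show "ideal (M n) R" using Mstab[of n] Lid by auto
    show "ideal (X n) R" by (rule xd)
    show "X n \<subseteq> M n" using XL LM by blast
    fix i assume i: "i < s"
    show "b \<in> X n \<Longrightarrow> x i \<otimes> b \<in> X (Suc n)" for b using xd(5)[OF i] .
    fix d assume "d \<in> M n"
    then obtain j where "d \<in> L j n" by (auto simp: M_def)
    then show "x i \<otimes> d \<in> M (Suc n)" using Lx[OF i] LM by blast
  qed
  have MA: "M m \<subseteq> A m" for m using LA by (auto simp: M_def)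
  have "graded_fg s x M X" by (rule Suc.IH[OF xs X Xfg Mgp MA])
  then obtain N where N: "\<And>n. n \<ge> N \<Longrightarrow> M (Suc n) \<subseteq> lin_span R x s (M n) (X (Suc n))"
    unfolding graded_fg_def by blast
  obtain \<phi> where \<phi>: "\<And>m. M m = L (\<phi> m) m" using Mstab by metis
  \<comment> \<open>Each degree up to \<open>N\<close> becomes stationary at some index, and beyond
    \<open>N\<close> every degree of \<open>M\<close> is generated by the preceding one; a single
    \<open>j0\<close> therefore serves all degrees.\<close>
  define j0 where "j0 = Max (\<phi> ` {..N})"
  have \<phi>j: "\<phi> m \<le> j0" if "m \<le> N" for m using that unfolding j0_def by (intro Max_ge) auto
  have stab: "L j m = M m" if "j \<ge> j0" for j m
  proof (cases "m \<le> N")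
    case True
    have "L (\<phi> m) m \<subseteq> L j m" by (rule Lmono[OF order_trans[OF \<phi>j[OF True] that]])
    then show ?thesis using \<phi>[of m] LM[of j m] by (intro equalityI) simp_all
  next
    case False
    have "L j m = M m" if "m \<ge> N" for m using that
    proof (induction m rule: dec_induct)
      case base
      have "L (\<phi> N) N \<subseteq> L j N" by (rule Lmono[OF order_trans[OF \<phi>j \<open>j \<ge> j0\<close>]]) simp
      then show ?case using \<phi>[of N] LM[of j N] by (intro equalityI) simp_all
    next
      case (step m)
      have "M (Suc m) \<subseteq> lin_span R x s (L j m) (X (Suc m))" using N[of m] step by simp
      also have "\<dots> \<subseteq> L j (Suc m)" by (rule lin_span_least[OF Lid XL]) (use Lx in auto)
      finally show ?case using LM[of j "Suc m"] by auto
    qed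
    then show ?thesis using False by simp
  qed
  have "\<exists>N. \<forall>n\<ge>N. L j (Suc n) \<subseteq> lin_span R x s (L j n) (X (Suc n))" for j
    using Lfg unfolding graded_fg_def by blast
  then obtain \<psi> where \<psi>: "\<And>j n. n \<ge> \<psi> j \<Longrightarrow> L j (Suc n) \<subseteq> lin_span R x s (L j n) (X (Suc n))" by metis
  define N1 where "N1 = Max (\<psi> ` {..j0})"
  have \<psi>N: "\<psi> j \<le> N1" if "j \<le> j0" for j using that unfolding N1_def by (intro Max_ge) auto
  \<comment> \<open>The bound \<open>N1 + j0\<close> on the total degree forces one of two cases:
    either \<open>j\<close> exceeds \<open>j0\<close>, and a factor \<open>y\<close> can be split
    off because \<open>L j\<close> equals \<open>L (j - 1)\<close>, or \<open>m\<close> exceeds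
    \<open>N1\<close>, and the remaining variables generate. Both succeed up to an element of
    \<open>X m\<close>; such an element is \<open>y \<otimes> u\<close> modulo \<open>B\<close> with
    \<open>u\<close> in degree \<open>m - 1\<close>, where the induction on \<open>m\<close>
    applies.\<close>
  have key: "(y [^] j) \<otimes> d \<in> lin_span R x (Suc s) (C k) (B (Suc k))"
    if "d \<in> D j m" "m + j = Suc k" "Suc k > N1 + j0" for d j m k
    using that
  proof (induction m arbitrary: j d rule: less_induct)
    case (less m)
    let ?G = "lin_span R x (Suc s) (C k) (B (Suc k))"
    have Gid: "ideal ?G R" by (rule lin_span_ideal) (use c Suc.prems(1) in auto)
    have BG: "B (Suc k) \<subseteq> ?G" by (rule lin_span_base) (use c Suc.prems(1) in auto)
    have genG: "x i \<otimes> e \<in> ?G" if "i \<le> s" "e \<in> C k" for i e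
      by (rule lin_span_gen) (use c Suc.prems(1) that in auto)
    have dc: "d \<in> carrier R" using less.prems idealD(8)[OF Did] by blast
    have "\<exists>h f. h \<in> D j m \<and> (y [^] j) \<otimes> h \<in> ?G \<and> f \<in> X m \<and> d = h \<oplus> f"
    proof (cases "j \<le> j0")
      case True
      then obtain m' where m': "m = Suc m'" "m' \<ge> N1" using less.prems by (cases m) auto
      have sub: "lin_span R x s (L j m') (X m) \<subseteq> lin_span R x s (D j m') (X m)"
      proof (rule lin_span_least)
        show "ideal (lin_span R x s (D j m') (X m)) R" by (rule lin_span_ideal[OF Did xd(2) xs])
        show b: "X m \<subseteq> lin_span R x s (D j m') (X m)" by (rule lin_span_base[OF Did xd(2) xs])
        fix i e assume i: "i < s" and e: "e \<in> L j m'"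
        obtain u v where uv: "u \<in> D j m'" "v \<in> X m'" "e = u \<oplus> v" using e by (auto simp: L_def mem_set_add)
        have "x i \<otimes> e = x i \<otimes> u \<oplus> x i \<otimes> v"
          using uv idealD(8)[OF Did, of u] idealD(8)[OF xd(2), of v] xs[OF i] by (simp add: r_distr)
        moreover have "x i \<otimes> u \<in> lin_span R x s (D j m') (X m)"
          by (rule lin_span_gen[OF Did xd(2) xs i uv(1)])
        moreover have "x i \<otimes> v \<in> lin_span R x s (D j m') (X m)" using b xd(5)[OF i uv(2)] m' by blast
        ultimately show "x i \<otimes> e \<in> lin_span R x s (D j m') (X m)"
          using idealD(3)[OF \<open>ideal (lin_span R x s (D j m') (X m)) R\<close>] by simp
      qed
      have "d \<in> L j m" using less.prems DL by blast
      then have d2: "d \<in> lin_span R x s (D j m') (X m)" using \<psi>[of j m'] \<psi>N[OF True] m' sub by auto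
      obtain g f where gf: "g \<in> lin_span R x s (D j m') {\<zero>}" "f \<in> X m" "d = g \<oplus> f"
        by (rule lin_span_split[OF Did xd(2) xs d2])
      have "lin_span R x s (D j m') {\<zero>} \<subseteq> D j m"
        by (rule lin_span_least[OF Did]) (use idealD(2)[OF Did] Dx m' in auto)
      moreover have "lin_span R x s (D j m') {\<zero>} \<subseteq> {u \<in> carrier R. (y [^] j) \<otimes> u \<in> ?G}"
      proof (rule lin_span_least)
        show "ideal {u \<in> carrier R. (y [^] j) \<otimes> u \<in> ?G} R" by (rule colon_ideal[OF oneideal Gid yp])
        show "{\<zero>} \<subseteq> {u \<in> carrier R. (y [^] j) \<otimes> u \<in> ?G}" using idealD(2)[OF Gid] y by simp
        fix i e assume i: "i < s" and e: "e \<in> D j m'"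
        have ec: "e \<in> carrier R" using e idealD(8)[OF Did] by blast
        have "(y [^] j) \<otimes> (x i \<otimes> e) = x i \<otimes> ((y [^] j) \<otimes> e)" using xs[OF i] y ec by (simp add: m_lcomm)
        moreover have "(y [^] j) \<otimes> e \<in> C k" using e m' less.prems(2) by (simp add: D)
        ultimately show "x i \<otimes> e \<in> {u \<in> carrier R. (y [^] j) \<otimes> u \<in> ?G}"
          using genG[of i] i xs[OF i] ec by simp
      qed
      ultimately show ?thesis using gf by blast
    next
      case False
      then obtain i where i: "j = Suc i" "i \<ge> j0" by (cases j) auto
      have "L j m = L i m" using stab[of i m] stab[of j m] i by simp
      then have "d \<in> L i m" using less.prems(1) DL[of j m] by blast
      then obtain h f where hf: "h \<in> D i m" "f \<in> X m" "d = h \<oplus> f" by (auto simp: L_def mem_set_add)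
      have hc: "h \<in> carrier R" using hf idealD(8)[OF Did] by blast
      have "(y [^] j) \<otimes> h = x s \<otimes> ((y [^] i) \<otimes> h)" using y hc i by (simp add: m_ac y_def)
      moreover have "(y [^] i) \<otimes> h \<in> C k" using hf(1) less.prems(2) i by (simp add: D)
      ultimately have "(y [^] j) \<otimes> h \<in> ?G" using genG[of s] by simp
      then show ?thesis using hf Dmono1[of i m] i by blast
    qed
    then obtain h f where h: "h \<in> D j m" "(y [^] j) \<otimes> h \<in> ?G" and f: "f \<in> X m" and d: "d = h \<oplus> f" by blast
    have hc: "h \<in> carrier R" "f \<in> carrier R" using h f idealD(8)[OF Did] idealD(8)[OF xd(2)] by auto
    have "f = d \<ominus> h" unfolding d using hc add_cancel_left by simp
    then have fD: "f \<in> D j m" using idealD(5)[OF Did less.prems(1) h(1)] by simp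
    have "(y [^] j) \<otimes> f \<in> ?G"
      using f unfolding X_def
    proof (cases rule: shifted_decomp)
      case (1 b)
      then have "(y [^] j) \<otimes> f \<in> B (m + j)" using yB[of b m j] by simp
      then show ?thesis using less.prems(2) BG by auto
    next
      case (2 m' u b)
      have uc: "u \<in> carrier R" "b \<in> carrier R" using 2 idealD(8)[OF a(1)] idealD(8)[OF a(2)] by auto
      have "y \<otimes> u = f \<ominus> b" unfolding 2(4) using uc y add_cancel_right by simp
      then have "y \<otimes> u \<in> D j m" using idealD(5)[OF Did fD, of b] BD 2(3) by auto
      moreover have e: "(y [^] j) \<otimes> (y \<otimes> u) = (y [^] Suc j) \<otimes> u" using y uc by (simp add: m_ac)
      ultimately have "u \<in> D (Suc j) m'" using 2(1,2) by (simp add: D)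
      then have "(y [^] Suc j) \<otimes> u \<in> ?G" using 2(1) less.prems by (intro less.IH[of m']) auto
      moreover have "(y [^] j) \<otimes> b \<in> ?G" using yB[OF 2(3), of j] less.prems(2) BG by auto
      moreover have "(y [^] j) \<otimes> f = (y [^] Suc j) \<otimes> u \<oplus> (y [^] j) \<otimes> b"
        unfolding 2(4) e[symmetric] using y uc by (simp add: r_distr)
      ultimately show ?thesis using idealD(3)[OF Gid] by simp
    qed
    then have "(y [^] j) \<otimes> h \<oplus> (y [^] j) \<otimes> f \<in> ?G" using h(2) idealD(3)[OF Gid] by blast
    then show ?case unfolding d using hc y by (simp add: r_distr)
  qed
  have "C (Suc n) \<subseteq> lin_span R x (Suc s) (C n) (B (Suc n))" if n: "n \<ge> N1 + j0" for n
  proof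
    fix d assume d: "d \<in> C (Suc n)"
    then have dc: "d \<in> carrier R" using idealD(8)[OF c(1)] by blast
    have "d \<in> D 0 (Suc n)" using d dc Suc.prems(5)[of "Suc n"] by (auto simp: D)
    then have "(y [^] (0::nat)) \<otimes> d \<in> lin_span R x (Suc s) (C n) (B (Suc n))"
      using n by (intro key) auto
    then show "d \<in> lin_span R x (Suc s) (C n) (B (Suc n))" using dc by simp
  qed
  then show ?case unfolding graded_fg_def by blast
qed

end

section \<open>Numerical polynomials\<close>

text \<open>Numerical polynomials are expanded in the basis \<open>(n + k - 1 choose k)\<close>, the one in
  which Hilbert coefficients are defined.\<close>

definition has_num_poly :: "nat \<Rightarrow> (nat \<Rightarrow> int) \<Rightarrow> (nat \<Rightarrow> int) \<Rightarrow> bool" where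
  "has_num_poly s c f \<longleftrightarrow> (\<forall>k\<ge>s. c k = 0) \<and>
     (\<forall>\<^sub>F n in sequentially. f n = (\<Sum>k<s. c k * int ((n + k - 1) choose k)))"

lemma has_num_poly_mono:
  assumes "has_num_poly s c f" "s \<le> t" shows "has_num_poly t c f"
proof -
  have "(\<Sum>k<s. c k * int ((n + k - 1) choose k)) = (\<Sum>k<t. c k * int ((n + k - 1) choose k))" for n
    using assms by (intro sum.mono_neutral_left) (auto simp: has_num_poly_def)
  then show ?thesis using assms by (auto simp: has_num_poly_def)
qed

lemma has_num_poly_drop:
  assumes "has_num_poly (Suc s) c f" "c s = 0" shows "has_num_poly s c f"
proof -
  have "\<forall>k\<ge>s. c k = 0" using assms by (metis has_num_poly_def le_antisym not_less_eq_eq)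
  then show ?thesis using assms by (simp add: has_num_poly_def)
qed

lemma has_num_poly_cong:
  assumes "has_num_poly s c f" "\<forall>\<^sub>F n in sequentially. f n = g n" shows "has_num_poly s c g"
  using assms unfolding has_num_poly_def by (auto elim: eventually_elim2)

lemma has_num_poly_add:
  assumes "has_num_poly s c f" "has_num_poly s d g"
  shows "has_num_poly s (\<lambda>k. c k + d k) (\<lambda>n. f n + g n)"
  using assms unfolding has_num_poly_def
  by (auto elim: eventually_elim2 simp: sum.distrib algebra_simps)

lemma has_num_poly_uminus:
  assumes "has_num_poly s c f" shows "has_num_poly s (\<lambda>k. - c k) (\<lambda>n. - f n)"
  using assms unfolding has_num_poly_def by (auto elim: eventually_mono simp: sum_negf)

lemma has_num_poly_diff:
  assumes "has_num_poly s c f" "has_num_poly s d g"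
  shows "has_num_poly s (\<lambda>k. c k - d k) (\<lambda>n. f n - g n)"
  using has_num_poly_add[OF assms(1) has_num_poly_uminus[OF assms(2)]] by simp

lemma num_basis_step:
  assumes "n \<ge> 2"
  shows "(n + Suc k - 1) choose Suc k = ((n - 1 + Suc k - 1) choose Suc k) + ((n + k - 1) choose k)"
proof -
  obtain m where "n = Suc (Suc m)" using assms by (metis Suc_le_D numeral_2_eq_2 le_Suc_ex plus_nat.simps)
  then show ?thesis by simp
qed

text \<open>In this basis the backward difference of a basis function is the one with the preceding
  index, so replacing \<open>n\<close> by \<open>n - 1\<close> subtracts from each coefficient its
  successor. The top coefficient is unchanged.\<close>

lemma has_num_poly_shift:
  assumes "has_num_poly s c f"
  shows "has_num_poly s (\<lambda>k. c k - c (Suc k)) (\<lambda>n. f (n - 1))"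
  unfolding has_num_poly_def
proof (intro conjI allI impI)
  fix k assume "s \<le> k" then show "c k - c (Suc k) = 0" using assms by (simp add: has_num_poly_def)
next
  have z: "c k = 0" if "s \<le> k" for k using assms that by (simp add: has_num_poly_def)
  obtain N where N: "\<And>n. n \<ge> N \<Longrightarrow> f n = (\<Sum>k<s. c k * int ((n + k - 1) choose k))"
    using assms unfolding has_num_poly_def eventually_sequentially by blast
  have "f (n - 1) = (\<Sum>k<s. (c k - c (Suc k)) * int ((n + k - 1) choose k))" if n: "n \<ge> N + 2" for n
  proof -
    define p where "p = (\<lambda>m k. int ((m + k - 1) choose k))"
    have step: "p n (Suc k) = p (n - 1) (Suc k) + p n k" for k
      using num_basis_step[of n k] n by (simp add: p_def)
    \<comment> \<open>Summation by parts, stated for every initial segment with its boundary term;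
      at \<open>t = s\<close> the boundary coefficient \<open>c s\<close> vanishes.\<close>
    have "(\<Sum>k<t. c k * p (n - 1) k) = (\<Sum>k<t. (c k - c (Suc k)) * p n k) + c t * p n (t - 1)" if "t > 0" for t
      using that
    proof (induction t rule: nat_induct_non_zero)
      case 1 then show ?case by (simp add: p_def)
    next
      case (Suc t)
      then obtain u where u: "t = Suc u" by (cases t) auto
      show ?case using Suc step[of u] by (simp add: u algebra_simps)
    qed
    then have "(\<Sum>k<s. c k * p (n - 1) k) = (\<Sum>k<s. (c k - c (Suc k)) * p n k)"
      using z[of s] by (cases "s = 0") auto
    then show ?thesis using N[of "n - 1"] n by (simp add: p_def)
  qed
  then show "\<forall>\<^sub>F n in sequentially. f (n - 1) = (\<Sum>k<s. (c k - c (Suc k)) * int ((n + k - 1) choose k))"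
    unfolding eventually_sequentially by blast
qed

text \<open>Summation raises the index of every basis function by one, so the coefficients move up
  unchanged and only a constant of summation is new, namely the eventual value of
  \<open>h\<close>.\<close>

lemma has_num_poly_sum_coeff:
  assumes "has_num_poly s c g" "\<forall>\<^sub>F n in sequentially. f (Suc n) - f n = g (Suc n)"
  shows "\<exists>c'. has_num_poly (Suc s) c' f \<and> (\<forall>k. c' (Suc k) = c k)"
proof -
  have z: "c k = 0" if "s \<le> k" for k using assms that by (simp add: has_num_poly_def)
  obtain N where N: "\<And>n. n \<ge> N \<Longrightarrow> g n = (\<Sum>k<s. c k * int ((n + k - 1) choose k))"
    using assms unfolding has_num_poly_def eventually_sequentially by blast
  obtain M where M: "\<And>n. n \<ge> M \<Longrightarrow> f (Suc n) - f n = g (Suc n)"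
    using assms unfolding eventually_sequentially by blast
  define h where "h = (\<lambda>n. f n - (\<Sum>k<s. c k * int ((n + Suc k - 1) choose Suc k)))"
  define K where "K = N + M + 2"
  have h: "h (Suc n) = h n" if "n \<ge> K" for n
  proof -
    have "int ((Suc n + Suc k - 1) choose Suc k) = int ((n + Suc k - 1) choose Suc k) + int ((Suc n + k - 1) choose k)" for k
      using num_basis_step[of "Suc n" k] that by (simp add: K_def)
    then have "(\<Sum>k<s. c k * int ((Suc n + Suc k - 1) choose Suc k))
        = (\<Sum>k<s. c k * int ((n + Suc k - 1) choose Suc k)) + g (Suc n)"
      using N[of "Suc n"] that by (simp add: K_def sum.distrib[symmetric] algebra_simps)
    then show ?thesis using M[of n] that by (simp add: h_def K_def)
  qed
  have hc: "h n = h K" if "n \<ge> K" for n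
    using that by (induction n rule: dec_induct) (simp_all add: h)
  define c' where "c' = (\<lambda>k. case k of 0 \<Rightarrow> h K | Suc j \<Rightarrow> c j)"
  have "f n = (\<Sum>k<Suc s. c' k * int ((n + k - 1) choose k))" if "n \<ge> K" for n
    using hc[OF that] by (simp only: sum.lessThan_Suc_shift) (simp add: c'_def h_def)
  moreover have "\<forall>k\<ge>Suc s. c' k = 0" using z by (auto simp: c'_def split: nat.split)
  ultimately have "has_num_poly (Suc s) c' f" unfolding has_num_poly_def eventually_sequentially by blast
  then show ?thesis by (intro exI[of _ c']) (simp add: c'_def)
qed

lemma has_num_poly_sum:
  assumes "has_num_poly s c g" "\<forall>\<^sub>F n in sequentially. f (Suc n) - f n = g (Suc n)"
  shows "\<exists>c'. has_num_poly (Suc s) c' f"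
  using has_num_poly_sum_coeff[OF assms] by blast

text \<open>The rising factorial divided by \<open>k!\<close>, over an arbitrary field of
  characteristic 0: the reals serve for the behaviour at infinity, the rationals for the Hilbert
  polynomial of the Sally module.\<close>

definition basis_poly :: "nat \<Rightarrow> 'a::field_char_0 poly" where
  "basis_poly k = Polynomial.smult (inverse (fact k)) (\<Prod>j<k. [:of_nat j, 1:])"

lemma poly_basis_poly:
  assumes "n \<ge> 1" shows "poly (basis_poly k) (of_nat n) = of_nat ((n + k - 1) choose k)"
proof -
  have "poly (\<Prod>j<k. [:of_nat j, 1:]) (of_nat n) = (pochhammer (of_nat n) k :: 'a)"
    by (simp add: poly_prod pochhammer_prod add.commute atLeast0LessThan)
  moreover have "of_nat ((n + k - 1) choose k) = (pochhammer (of_nat n) k / fact k :: 'a)"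
    using assms by (simp add: binomial_gbinomial gbinomial_pochhammer' of_nat_diff)
  ultimately show ?thesis by (simp add: basis_poly_def field_simps)
qed

lemma degree_basis_poly: "degree (basis_poly k :: 'a::field_char_0 poly) = k"
  by (simp add: basis_poly_def degree_prod_eq_sum_degree)

lemma lead_coeff_basis_poly: "lead_coeff (basis_poly k :: 'a::field_char_0 poly) = inverse (fact k)"
  by (simp only: basis_poly_def lead_coeff_smult lead_coeff_prod) simp

definition num_poly :: "nat \<Rightarrow> (nat \<Rightarrow> int) \<Rightarrow> 'a::field_char_0 poly" where
  "num_poly s c = (\<Sum>k<s. Polynomial.smult (of_int (c k)) (basis_poly k))"

lemma poly_num_poly:
  "n \<ge> 1 \<Longrightarrow> poly (num_poly s c) (of_nat n) = of_int (\<Sum>k<s. c k * int ((n + k - 1) choose k))"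
  by (simp add: num_poly_def poly_sum poly_basis_poly)

lemma degree_num_poly_less: "0 < s \<Longrightarrow> degree (num_poly s c :: 'a::field_char_0 poly) < s"
  unfolding num_poly_def
  by (rule degree_sum_less) (auto simp: degree_basis_poly intro: le_less_trans[OF degree_smult_le])

lemma coeff_num_poly_top:
  "Polynomial.coeff (num_poly (Suc s) c :: 'a::field_char_0 poly) s = of_int (c s) / fact s"
proof -
  have "Polynomial.coeff (num_poly s c :: 'a poly) s = 0"
    using coeff_eq_0[OF degree_num_poly_less[of s c]] by (cases "s = 0") (auto simp: num_poly_def)
  then show ?thesis
    using lead_coeff_basis_poly[where 'a='a, of s]
    by (simp add: num_poly_def degree_basis_poly divide_inverse)
qed

lemma poly_eq_if_eventually:
  fixes p q :: "'a::field_char_0 poly"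
  assumes "\<forall>\<^sub>F n in sequentially. poly p (of_nat n) = poly q (of_nat n)"
  shows "p = q"
proof (rule ccontr)
  assume "p \<noteq> q"
  then have fin: "finite {x. poly (p - q) x = 0}" by (intro poly_roots_finite) auto
  obtain N where N: "\<And>n. n \<ge> N \<Longrightarrow> poly p (of_nat n) = poly q (of_nat n)"
    using assms unfolding eventually_sequentially by blast
  have "(of_nat :: nat \<Rightarrow> 'a) ` {N..} \<subseteq> {x. poly (p - q) x = 0}" using N by auto
  then have "finite ((of_nat :: nat \<Rightarrow> 'a) ` {N..})" using fin by (rule finite_subset)
  then have "finite {N..}" by (rule finite_imageD) (auto intro: inj_onI)
  then show False using infinite_Ici by blast
qed

lemma has_num_poly_poly:
  assumes "has_num_poly s c f"
  shows "\<forall>\<^sub>F n in sequentially. of_int (f n) = poly (num_poly s c :: 'a::field_char_0 poly) (of_nat n)"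
proof -
  have "\<forall>\<^sub>F n in sequentially. f n = (\<Sum>k<s. c k * int ((n + k - 1) choose k))"
    using assms by (simp add: has_num_poly_def)
  then show ?thesis using eventually_ge_at_top[of "1::nat"]
    by eventually_elim (simp only: poly_num_poly)
qed

lemma has_num_poly_zero:
  assumes "has_num_poly s c (\<lambda>_. 0)" shows "c = (\<lambda>_. 0)"
  using assms
proof (induction s)
  case 0 then show ?case by (auto simp: has_num_poly_def)
next
  case (Suc s)
  have "(num_poly (Suc s) c :: rat poly) = 0"
    using has_num_poly_poly[OF Suc.prems, where 'a=rat] by (intro poly_eq_if_eventually) (auto elim!: eventually_mono)
  then have "c s = 0" using coeff_num_poly_top[where 'a=rat, of s c] by simp
  then show ?case using Suc has_num_poly_drop by blast
qed

lemma has_num_poly_unique: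
  assumes "has_num_poly s c f" "has_num_poly s d f" shows "c = d"
  using has_num_poly_zero[of s "\<lambda>k. c k - d k"] has_num_poly_diff[OF assms]
  by (auto simp: fun_eq_iff)

text \<open>A negative coefficient at \<open>s\<close> would be the leading one and would drive the
  polynomial to minus infinity. Applied to differences of length functions, this compares top
  coefficients; \<open>s\<close> only bounds the degree, so the conclusion cannot be strict.\<close>

lemma has_num_poly_lead_nonneg:
  assumes "has_num_poly (Suc s) c f" "\<forall>\<^sub>F n in sequentially. f n \<ge> 0" shows "c s \<ge> 0"
proof (rule ccontr)
  assume neg: "\<not> c s \<ge> 0"
  let ?p = "num_poly (Suc s) c :: real poly"
  have co: "Polynomial.coeff ?p s < 0" using coeff_num_poly_top[where 'a=real, of s c] neg by (simp add: divide_neg_pos)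
  then have dg: "degree ?p = s" using degree_num_poly_less[where 'a=real, of "Suc s" c] le_degree[of ?p s] by auto
  have "lead_coeff (- ?p) > 0" using co dg by simp
  then obtain r where r: "\<And>x. x \<ge> r \<Longrightarrow> poly (- ?p) x \<ge> lead_coeff (- ?p)" using poly_pinfty_gt_lc by blast
  have "\<forall>\<^sub>F n in sequentially. real n \<ge> r" by (rule eventually_sequentiallyI[of "nat \<lceil>r\<rceil>"]) linarith
  then have "\<forall>\<^sub>F n in sequentially. False"
    using has_num_poly_poly[OF assms(1), where 'a=real] assms(2)
  proof eventually_elim
    case (elim n)
    then show ?case using r[of "real n"] \<open>lead_coeff (- ?p) > 0\<close> by simp
  qed
  then show False by simp
qed

lemma has_num_poly_bound:
  assumes "has_num_poly (Suc s) c f" shows "\<exists>C\<ge>0. \<forall>n. f n \<le> C * (int n + 1) ^ s"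
proof -
  obtain N where N: "\<And>n. n \<ge> N \<Longrightarrow> f n = (\<Sum>k<Suc s. c k * int ((n + k - 1) choose k))"
    using assms unfolding has_num_poly_def eventually_sequentially by blast
  have b: "int ((n + k - 1) choose k) \<le> (int (s+1)) ^ s * (int n + 1) ^ s" if "k \<le> s" "n \<ge> 1" for n k
  proof -
    have "(n + k - 1) choose k \<le> (n + k - 1) ^ k" by (cases "k \<le> n + k - 1") (simp_all add: binomial_le_pow binomial_eq_0)
    also have "\<dots> \<le> ((s + 1) * (n + 1)) ^ k" using that by (intro power_mono) (auto simp: algebra_simps)
    also have "\<dots> \<le> ((s + 1) * (n + 1)) ^ s" using that by (intro power_increasing) auto
    finally have "int ((n + k - 1) choose k) \<le> int (((s + 1) * (n + 1)) ^ s)" by linarith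
    moreover have "int (((s + 1) * (n + 1)) ^ s) = (int (s+1)) ^ s * (int n + 1) ^ s"
      by (simp only: of_nat_power of_nat_mult power_mult_distrib of_nat_add of_nat_1)
    ultimately show ?thesis by simp
  qed
  \<comment> \<open>The second sum covers the finitely many arguments at which \<open>f\<close> need
    not agree with its polynomial.\<close>
  define C where "C = (\<Sum>k<Suc s. \<bar>c k\<bar> * (int (s+1)) ^ s) + (\<Sum>n\<le>N. \<bar>f n\<bar>)"
  have C: "C \<ge> 0" unfolding C_def by (intro add_nonneg_nonneg sum_nonneg) auto
  have "f n \<le> C * (int n + 1) ^ s" for n
  proof (cases "n \<le> N \<or> n = 0")
    case True
    then have "f n \<le> (\<Sum>n\<le>N. \<bar>f n\<bar>)" using member_le_sum[of n "{..N}" "\<lambda>n. \<bar>f n\<bar>"] by auto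
    also have "\<dots> \<le> C" unfolding C_def by (simp add: sum_nonneg)
    also have "\<dots> \<le> C * (int n + 1) ^ s" using C by (simp add: mult_le_cancel_left1 one_le_power)
    finally show ?thesis .
  next
    case False
    then have "f n \<le> (\<Sum>k<Suc s. \<bar>c k * int ((n + k - 1) choose k)\<bar>)" using N[of n] sum_mono[of "{..<Suc s}" "\<lambda>k. c k * int ((n + k - 1) choose k)" "\<lambda>k. \<bar>c k * int ((n + k - 1) choose k)\<bar>"] by simp
    also have "\<dots> \<le> (\<Sum>k<Suc s. \<bar>c k\<bar> * ((int (s+1)) ^ s * (int n + 1) ^ s))"
      using b False by (intro sum_mono) (auto simp: abs_mult intro!: mult_left_mono)
    also have "\<dots> = (\<Sum>k<Suc s. \<bar>c k\<bar> * (int (s+1)) ^ s) * (int n + 1) ^ s"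
      by (simp only: sum_distrib_right mult.assoc)
    also have "\<dots> \<le> C * (int n + 1) ^ s" unfolding C_def by (intro mult_right_mono) (auto intro: sum_nonneg)
    finally show ?thesis .
  qed
  then show ?thesis using C by blast
qed

section \<open>The Hilbert-Serre theorem and length bounds by numbers of generators\<close>

context cring
begin

abbreviation fin_len :: "'a set \<Rightarrow> 'a set \<Rightarrow> nat" where
  "fin_len A B \<equiv> the_enat (len A B)"

text \<open>Multiplication by the last variable has kernel \<open>K/B\<close> and cokernel
  \<open>A/X\<close>, both killed by that variable and hence modules over one variable fewer.
  Additivity of length expresses the first difference of the length function by the two smaller
  ones, and summation costs one more coefficient. Finite generation of the kernel is where
  \<open>graded_noetherian\<close> is needed.\<close>

theorem hilbert_serre:
  assumes noeth: "noetherian_ring R"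
  shows "\<lbrakk>\<And>i. i < s \<Longrightarrow> x i \<in> carrier R; graded_pair s x A B; graded_fg s x A B;
          \<And>n. len (B n) (A n) \<noteq> \<infinity>\<rbrakk> \<Longrightarrow> \<exists>c. has_num_poly s c (\<lambda>n. int (fin_len (B n) (A n)))"
proof (induction s arbitrary: A B)
  case 0
  note a = graded_pairD[OF "0.prems"(2)]
  obtain N where N: "\<And>n. n \<ge> N \<Longrightarrow> A (Suc n) \<subseteq> B (Suc n)" using "0.prems"(3) unfolding graded_fg_def by auto
  have "fin_len (B n) (A n) = 0" if n: "n \<ge> Suc N" for n
  proof -
    obtain k where k: "n = Suc k" "k \<ge> N" using n by (cases n) auto
    then have "A n = B n" using N[of k] a(3)[of n] by auto
    then show ?thesis by (simp add: zero_enat_def[symmetric]) (metis enat_0 the_enat.simps)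
  qed
  then have "has_num_poly 0 (\<lambda>_. 0) (\<lambda>n. int (fin_len (B n) (A n)))"
    unfolding has_num_poly_def eventually_sequentially by auto
  then show ?case by blast
next
  case (Suc s)
  define y where "y = x s"
  note a = graded_pairD[OF Suc.prems(2)]
  have y: "y \<in> carrier R" using Suc.prems(1) by (simp add: y_def)
  have xs: "\<And>i. i < s \<Longrightarrow> x i \<in> carrier R" and xs': "\<And>i. i \<le> s \<Longrightarrow> x i \<in> carrier R" using Suc.prems(1) by auto
  define X where "X = shifted y A B"
  have X: "graded_pair s x A X" unfolding X_def y_def by (rule shifted_pair[OF Suc.prems(2) xs'])
  have Xfg: "graded_fg s x A X" unfolding X_def y_def by (rule shifted_fg[OF Suc.prems(2) xs' Suc.prems(3)])
  note xd = graded_pairD[OF X]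
  have BX: "B n \<subseteq> X n" for n
  proof (cases n)
    case (Suc k)
    show ?thesis unfolding X_def shifted_simps Suc
      by (rule plus_upper2[OF mult_set_ideal[OF a(1)[of k] y] a(2)[of "Suc k"]])
  qed (simp add: X_def shifted_simps)
  define K where "K = (\<lambda>n. {u \<in> A n. y \<otimes> u \<in> B (Suc n)})"
  have Kid: "ideal (K n) R" for n unfolding K_def using a y by (intro colon_ideal) auto
  have KA: "K n \<subseteq> A n" for n by (auto simp: K_def)
  have BK: "B n \<subseteq> K n" for n using a(3)[of n] a(5)[of s _ n] by (auto simp: K_def y_def)
  have Kgp: "graded_pair (Suc s) x K B"
    unfolding graded_pair_def
  proof (intro conjI allI impI ballI)
    fix n show "ideal (K n) R" "ideal (B n) R" "B n \<subseteq> K n" using Kid a BK by auto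
    fix i assume i: "i < Suc s"
    show "b \<in> B n \<Longrightarrow> x i \<otimes> b \<in> B (Suc n)" for b using a(5)[OF i] .
    fix u assume u: "u \<in> K n"
    have uc: "u \<in> carrier R" using u idealD(8)[OF Kid] by blast
    have "y \<otimes> (x i \<otimes> u) = x i \<otimes> (y \<otimes> u)" using uc y Suc.prems(1)[OF i] by (simp add: m_lcomm)
    then show "x i \<otimes> u \<in> K (Suc n)" using u a(4)[OF i, of u n] a(5)[OF i, of "y \<otimes> u" "Suc n"] by (auto simp: K_def)
  qed
  then have Kgp': "graded_pair s x K B" unfolding graded_pair_def by auto
  obtain N where N: "\<And>n. n \<ge> N \<Longrightarrow> K (Suc n) \<subseteq> lin_span R x (Suc s) (K n) (B (Suc n))"
    using graded_noetherian[OF noeth Suc.prems(1-3) Kgp KA] unfolding graded_fg_def by blast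
  have "lin_span R x (Suc s) (K n) (B (Suc n)) \<subseteq> lin_span R x s (K n) (B (Suc n))" (is "_ \<subseteq> ?G") for n
  proof (rule lin_span_least)
    show "ideal ?G R" by (rule lin_span_ideal[OF Kid a(2) xs])
    show BG: "B (Suc n) \<subseteq> ?G" by (rule lin_span_base[OF Kid a(2) xs])
    fix i e assume i: "i < Suc s" and e: "e \<in> K n"
    show "x i \<otimes> e \<in> ?G"
    proof (cases "i = s")
      case True
      then have "x i \<otimes> e \<in> B (Suc n)" using e by (simp add: K_def y_def)
      then show ?thesis using BG by blast
    next
      case False
      then have lt: "i < s" using i by simp
      show ?thesis by (rule lin_span_gen[OF Kid a(2) xs lt e])
    qed
  qed
  then have Kfg: "graded_fg s x K B" using N unfolding graded_fg_def by blast
  have fK: "len (B n) (K n) \<noteq> \<infinity>" for n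
    using chain_length_mono[of "B n" "B n" "K n" "A n"] KA[of n] Suc.prems(4)[of n] by (metis enat_ord_simps(5) order_refl)
  have fX: "len (X n) (A n) \<noteq> \<infinity>" for n
    using chain_length_mono[of "B n" "X n" "A n" "A n"] BX[of n] Suc.prems(4)[of n] by (metis enat_ord_simps(5) order_refl)
  obtain c1 where c1: "has_num_poly s c1 (\<lambda>n. int (fin_len (B n) (K n)))"
    using Suc.IH[OF xs Kgp' Kfg fK] by blast
  obtain c2 where c2: "has_num_poly s c2 (\<lambda>n. int (fin_len (X n) (A n)))"
    using Suc.IH[OF xs X Xfg fX] by blast
  \<comment> \<open>The kernel enters in the source degree \<open>n - 1\<close>, the cokernel in the
    target degree \<open>n\<close>.\<close>
  define g where "g = (\<lambda>n. int (fin_len (X n) (A n)) - int (fin_len (B (n - 1)) (K (n - 1))))"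
  have g: "has_num_poly s (\<lambda>k. c2 k - (c1 k - c1 (Suc k))) g"
    unfolding g_def using has_num_poly_diff[OF c2 has_num_poly_shift[OF c1]] .
  have "int (fin_len (B (Suc n)) (A (Suc n))) - int (fin_len (B n) (A n)) = g (Suc n)" for n
  proof -
    have 1: "len (B (Suc n)) (A (Suc n)) = len (B (Suc n)) (X (Suc n)) + len (X (Suc n)) (A (Suc n))"
      using a xd BX by (intro len_add) auto
    have 2: "len (B n) (A n) = len (B n) (K n) + len (K n) (A n)"
      using a Kid BK KA by (intro len_add) auto
    have 3: "len (K n) (A n) = len (B (Suc n)) (X (Suc n))"
      unfolding K_def X_def shifted_simps using len_mult_eq[OF a(1) a(2) y, of n "Suc n"] .
    obtain p q u v where "len (B n) (K n) = enat p" "len (X (Suc n)) (A (Suc n)) = enat q"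
      "len (B n) (A n) = enat u" "len (B (Suc n)) (A (Suc n)) = enat v"
      using fK[of n] fX[of "Suc n"] Suc.prems(4)[of n] Suc.prems(4)[of "Suc n"] by auto
    moreover obtain w where "len (K n) (A n) = enat w"
      using 2 Suc.prems(4)[of n] by (cases "len (K n) (A n)") auto
    ultimately show ?thesis using 1 2 3 by (auto simp: g_def)
  qed
  then show ?case using has_num_poly_sum[OF g] by auto
qed

text \<open>Each variable contributes a quotient of \<open>A/B\<close>, because it carries
  \<open>B\<close> into \<open>T\<close>.\<close>

lemma len_lin_span_le:
  assumes "\<And>i. i < s \<Longrightarrow> x i \<in> carrier R" "ideal A R" "ideal B R" "ideal T R" "B \<subseteq> A"
    and "\<And>i b. i < s \<Longrightarrow> b \<in> B \<Longrightarrow> x i \<otimes> b \<in> T"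
  shows "len T (lin_span R x s A T) \<le> enat s * len B A"
  using assms(1,6)
proof (induction s)
  case (Suc s)
  let ?L = "lin_span R x s A T"
  have L: "ideal ?L R" "T \<subseteq> ?L" using Suc.prems assms by (auto intro!: lin_span_ideal subsetD[OF lin_span_base])
  have x: "x s \<in> carrier R" using Suc.prems by simp
  have "len T (lin_span R x (Suc s) A T) = len T ?L + len ?L (lin_span R x (Suc s) A T)"
    using L assms x Suc.prems plus_upper2[OF mult_set_ideal[OF assms(2) x] L(1)]
    by (intro len_add) (auto intro!: add_ideals mult_set_ideal)
  also have "len ?L (lin_span R x (Suc s) A T) \<le> len B A"
    unfolding lin_span.simps using assms L x Suc.prems by (intro len_mult_le) auto
  also have "len T ?L \<le> enat s * len B A" using Suc by simp
  also have "enat s * len B A + len B A = enat (Suc s) * len B A"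
    by (metis add.commute distrib_right eSuc_enat mult_1 plus_1_eSuc(1))
  finally show ?case by (simp add: add_right_mono)
qed simp

lemma prod_lin_span:
  assumes "\<And>i. i < s \<Longrightarrow> x i \<in> carrier R" "ideal A R" "ideal T R"
  shows "(Idl (x ` {..<s})) \<cdot> A \<subseteq> lin_span R x s A T"
proof (rule prod_least)
  let ?L = "lin_span R x s A T"
  show L: "ideal ?L R" using assms by (intro lin_span_ideal) auto
  fix v a assume v: "v \<in> Idl (x ` {..<s})" and a: "a \<in> A"
  have ac: "a \<in> carrier R" using a idealD(8)[OF assms(2)] by blast
  have gL: "x i \<otimes> a \<in> ?L" if "i < s" for i
    using assms a that by (intro lin_span_gen) auto
  have "Idl (x ` {..<s}) \<subseteq> {v \<in> carrier R. a \<otimes> v \<in> ?L}"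
  proof (rule genideal_minimal)
    show "ideal {v \<in> carrier R. a \<otimes> v \<in> ?L} R" by (rule colon_ideal[OF oneideal L ac])
    show "x ` {..<s} \<subseteq> {v \<in> carrier R. a \<otimes> v \<in> ?L}" using gL assms(1) ac by (auto simp: m_comm)
  qed
  then show "v \<otimes> a \<in> ?L" using v ac by (auto simp: m_comm)
qed

lemma len_prod_le:
  assumes "\<And>i. i < s \<Longrightarrow> x i \<in> carrier R" "ideal A R" "ideal B R" "ideal T R" "B \<subseteq> A"
    "(Idl (x ` {..<s})) \<cdot> B \<subseteq> T"
  shows "len T (T \<boxplus> (Idl (x ` {..<s})) \<cdot> A) \<le> enat s * len B A"
proof -
  have xV: "x i \<in> Idl (x ` {..<s})" if "i < s" for i
    using genideal_self[of "x ` {..<s}"] assms(1) that by auto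
  have "T \<boxplus> (Idl (x ` {..<s})) \<cdot> A \<subseteq> lin_span R x s A T"
    using assms by (intro plus_least prod_lin_span lin_span_base lin_span_ideal) auto
  then have "len T (T \<boxplus> (Idl (x ` {..<s})) \<cdot> A) \<le> len T (lin_span R x s A T)"
    by (intro chain_length_mono) auto
  also have "\<dots> \<le> enat s * len B A"
    using assms(6) prodI[OF xV] by (intro len_lin_span_le[OF assms(1-5)]) auto
  finally show ?thesis .
qed

text \<open>The factor \<open>s\<close> is a number of generators of \<open>V\<close> and does not
  depend on \<open>A\<close>, \<open>B\<close> and \<open>T\<close>. This uniformity allows a whole
  graded family to be bounded with a single constant.\<close>

lemma noetherian_len_prod_le:
  assumes "noetherian_ring R" "ideal V R"
  shows "\<exists>s::nat. \<forall>A B T. ideal A R \<and> ideal B R \<and> ideal T R \<and> B \<subseteq> A \<and> V \<cdot> B \<subseteq> T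
     \<longrightarrow> len T (T \<boxplus> V \<cdot> A) \<le> enat s * len B A"
proof -
  obtain S where S: "S \<subseteq> carrier R" "finite S" "V = Idl S"
    using noetherian_ring.finetely_gen[OF assms] by blast
  obtain x where x: "bij_betw x {0..<card S} S" using ex_bij_betw_nat_finite[OF S(2)] by blast
  then have xS: "x ` {..<card S} = S" by (simp add: bij_betw_def atLeast0LessThan)
  have xc: "x i \<in> carrier R" if "i < card S" for i using xS S(1) that by auto
  show ?thesis
  proof (intro exI allI impI)
    fix A B T assume "ideal A R \<and> ideal B R \<and> ideal T R \<and> B \<subseteq> A \<and> V \<cdot> B \<subseteq> T"
    then show "len T (T \<boxplus> V \<cdot> A) \<le> enat (card S) * len B A"
      using len_prod_le[of "card S" x A B T] xc unfolding xS S(3)[symmetric] by blast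
  qed
qed

end

section \<open>Growth of sequences\<close>

text \<open>For \<open>s > 0\<close> this says that the partial sums are \<open>O(n\<^sup>s\<^sup>-\<^sup>1)\<close>; the extra factor makes it
  meaningful for \<open>s = 0\<close>, where it says that the sequence vanishes.\<close>

definition small :: "nat \<Rightarrow> (nat \<Rightarrow> enat) \<Rightarrow> bool" where
  "small s F \<longleftrightarrow> (\<exists>f C. (\<forall>n. F n \<le> enat (f n)) \<and> (\<forall>n. (n + 1) * (\<Sum>i\<le>n. f i) \<le> C * (n + 1) ^ s))"

lemma smallE:
  assumes "small s F"
  obtains f C where "\<And>n. F n \<le> enat (f n)" "\<And>n. (n + 1) * (\<Sum>i\<le>n. f i) \<le> C * (n + 1) ^ s"
  using assms unfolding small_def by blast

lemma smallI:
  assumes "\<And>n. F n \<le> enat (f n)" "\<And>n. (n + 1) * (\<Sum>i\<le>n. f i) \<le> C * (n + 1) ^ s"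
  shows "small s F"
  using assms unfolding small_def by blast

lemma small_mono: "\<lbrakk>small s G; \<And>n. F n \<le> G n\<rbrakk> \<Longrightarrow> small s F"
  unfolding small_def by (meson order_trans)

lemma small_add:
  assumes "small s F" "small s G" shows "small s (\<lambda>n. F n + G n)"
proof -
  obtain f C where f: "\<And>n. F n \<le> enat (f n)" "\<And>n. (n + 1) * (\<Sum>i\<le>n. f i) \<le> C * (n + 1) ^ s" using smallE[OF assms(1)] by metis
  obtain g D where g: "\<And>n. G n \<le> enat (g n)" "\<And>n. (n + 1) * (\<Sum>i\<le>n. g i) \<le> D * (n + 1) ^ s" using smallE[OF assms(2)] by metis
  show ?thesis
  proof (rule smallI[where f = "\<lambda>n. f n + g n" and C = "C + D"])
    show "F n + G n \<le> enat (f n + g n)" for n using add_mono[OF f(1) g(1)] by simp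
    show "(n + 1) * (\<Sum>i\<le>n. f i + g i) \<le> (C + D) * (n + 1) ^ s" for n
      using add_mono[OF f(2)[of n] g(2)[of n]] by (simp only: sum.distrib distrib_left distrib_right)
  qed
qed

lemma small_zero: "small s (\<lambda>n. 0)"
  by (rule smallI[where f = "\<lambda>_. 0" and C = 0]) simp_all

lemma small_sum: "(\<And>i. i < (k::nat) \<Longrightarrow> small s (F i)) \<Longrightarrow> small s (\<lambda>n. \<Sum>i<k. F i n)"
  by (induction k) (auto simp: small_zero intro: small_add)

lemma small_cmult:
  fixes k :: nat
  assumes "small s F" shows "small s (\<lambda>n. enat k * F n)"
proof -
  obtain f C where f: "\<And>n. F n \<le> enat (f n)" "\<And>n. (n + 1) * (\<Sum>i\<le>n. f i) \<le> C * (n + 1) ^ s" using smallE[OF assms] by metis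
  show ?thesis
  proof (rule smallI[where f = "\<lambda>n. k * f n" and C = "k * C"])
    fix n
    show "enat k * F n \<le> enat (k * f n)" using mult_left_mono[OF f(1)[of n], of "enat k"] by simp
    have "(n + 1) * (\<Sum>i\<le>n. k * f i) = k * ((n + 1) * (\<Sum>i\<le>n. f i))"
      by (simp only: sum_distrib_left[symmetric] mult.left_commute)
    also have "\<dots> \<le> k * (C * (n + 1) ^ s)" using f(2) by (rule mult_left_mono) simp
    finally show "(n + 1) * (\<Sum>i\<le>n. k * f i) \<le> k * C * (n + 1) ^ s" by (simp only: mult.assoc)
  qed
qed

lemma sum_enat: "(\<Sum>i\<in>A. enat (f i)) = enat (\<Sum>i\<in>A. f i)"
  by (induction A rule: infinite_finite_induct) (auto simp: zero_enat_def)

text \<open>Passing to partial sums is what one more generator does to a Hilbert function, and it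
  costs one power of \<open>n\<close>: each of the \<open>n + 1\<close> partial sums is at most the
  last one.\<close>

lemma small_conv:
  assumes "small s F" shows "small (Suc s) (\<lambda>n. \<Sum>i\<le>n. F i)"
proof -
  obtain f C where f: "\<And>n. F n \<le> enat (f n)" "\<And>n. (n + 1) * (\<Sum>i\<le>n. f i) \<le> C * (n + 1) ^ s" using smallE[OF assms] by metis
  show ?thesis
  proof (rule smallI[where f = "\<lambda>n. \<Sum>i\<le>n. f i" and C = C])
    fix n
    show "(\<Sum>i\<le>n. F i) \<le> enat (\<Sum>i\<le>n. f i)" using f(1) by (simp add: sum_enat[symmetric] sum_mono)
    have "(\<Sum>k\<le>n. \<Sum>i\<le>k. f i) \<le> (\<Sum>k\<le>n. \<Sum>i\<le>n. f i)" by (intro sum_mono sum_mono2) auto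
    also have "\<dots> = (n + 1) * (\<Sum>i\<le>n. f i)" by simp
    also have "\<dots> \<le> C * (n + 1) ^ s" by (rule f(2))
    finally have "(n + 1) * (\<Sum>k\<le>n. \<Sum>i\<le>k. f i) \<le> (n + 1) * (C * (n + 1) ^ s)" by (rule mult_left_mono) simp
    then show "(n + 1) * (\<Sum>k\<le>n. \<Sum>i\<le>k. f i) \<le> C * (n + 1) ^ Suc s" by (simp add: algebra_simps)
  qed
qed

lemma small_unshift:
  assumes "small s F" shows "small s (\<lambda>n. if k \<le> n then F (n - k) else 0)"
proof -
  obtain f C where f: "\<And>n. F n \<le> enat (f n)" "\<And>n. (n + 1) * (\<Sum>i\<le>n. f i) \<le> C * (n + 1) ^ s" using smallE[OF assms] by metis
  show ?thesis
  proof (rule smallI[where f = "\<lambda>n. if k \<le> n then f (n - k) else 0" and C = C])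
    fix n
    show "(if k \<le> n then F (n - k) else 0) \<le> enat (if k \<le> n then f (n - k) else 0)" using f(1) by auto
    have "(\<Sum>i\<le>n. if k \<le> i then f (i - k) else 0) = (\<Sum>i\<in>{i. i \<le> n \<and> k \<le> i}. f (i - k))"
      by (simp add: sum.inter_filter[symmetric])
    also have "\<dots> = (\<Sum>j\<in>(\<lambda>i. i - k) ` {i. i \<le> n \<and> k \<le> i}. f j)"
      by (subst sum.reindex) (auto intro!: inj_onI)
    also have "\<dots> \<le> (\<Sum>j\<le>n. f j)" by (intro sum_mono2) auto
    finally have "(n + 1) * (\<Sum>i\<le>n. if k \<le> i then f (i - k) else 0) \<le> (n + 1) * (\<Sum>j\<le>n. f j)"
      by (rule mult_left_mono) simp
    also have "\<dots> \<le> C * (n + 1) ^ s" by (rule f(2))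
    finally show "(n + 1) * (\<Sum>i\<le>n. if k \<le> i then f (i - k) else 0) \<le> C * (n + 1) ^ s" .
  qed
qed

lemma small_shift:
  assumes "small s F" shows "small s (\<lambda>n. F (n + k))"
proof -
  obtain f C where f: "\<And>n. F n \<le> enat (f n)" "\<And>n. (n + 1) * (\<Sum>i\<le>n. f i) \<le> C * (n + 1) ^ s" using smallE[OF assms] by metis
  show ?thesis
  proof (rule smallI[where f = "\<lambda>n. f (n + k)" and C = "C * (k + 1) ^ s"])
    fix n
    show "F (n + k) \<le> enat (f (n + k))" by (rule f)
    have "(\<Sum>i\<le>n. f (i + k)) = (\<Sum>j\<in>(\<lambda>i. i + k) ` {..n}. f j)" by (subst sum.reindex) auto
    also have "\<dots> \<le> (\<Sum>j\<le>n + k. f j)" by (intro sum_mono2) auto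
    finally have "(n + 1) * (\<Sum>i\<le>n. f (i + k)) \<le> (n + k + 1) * (\<Sum>j\<le>n + k. f j)" by (rule mult_mono[rotated]) auto
    also have "\<dots> \<le> C * (n + k + 1) ^ s" using f(2)[of "n + k"] by simp
    also have "\<dots> \<le> C * ((k + 1) * (n + 1)) ^ s" by (intro mult_left_mono power_mono) auto
    also have "\<dots> = C * (k + 1) ^ s * (n + 1) ^ s" by (simp only: power_mult_distrib mult.assoc)
    finally show "(n + 1) * (\<Sum>i\<le>n. f (i + k)) \<le> C * (k + 1) ^ s * (n + 1) ^ s" .
  qed
qed

text \<open>Finitely many values change the partial sums by a constant \<open>b\<close>, which is
  harmless only if \<open>s > 0\<close>: for \<open>s = 0\<close> a single nonzero value violates
  smallness.\<close>

lemma small_unshift_iff: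
  assumes "small s (\<lambda>n. F (n + k))" "s > 0" "\<And>n. F n \<noteq> \<infinity>" shows "small s F"
proof -
  define G where "G = (\<lambda>n. if n < k then F n else 0)"
  define b where "b = (\<Sum>i<k. the_enat (F i))"
  have "small s G"
  proof (rule smallI[where f = "\<lambda>n. if n < k then the_enat (F n) else 0" and C = b])
    fix n
    show "G n \<le> enat (if n < k then the_enat (F n) else 0)" using assms(3)[of n] by (auto simp: G_def)
    have "(\<Sum>i\<le>n. if i < k then the_enat (F i) else 0) = (\<Sum>i\<in>{i. i \<le> n \<and> i < k}. the_enat (F i))"
      by (simp add: sum.inter_filter[symmetric])
    also have "\<dots> \<le> b" unfolding b_def by (intro sum_mono2) auto
    finally have "(n + 1) * (\<Sum>i\<le>n. if i < k then the_enat (F i) else 0) \<le> (n + 1) * b" by (rule mult_left_mono) simp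
    also have "\<dots> = b * (n + 1)" by simp
    also have "\<dots> \<le> b * (n + 1) ^ s" using assms(2) self_le_power[of "n + 1" s] by (intro mult_left_mono) auto
    finally show "(n + 1) * (\<Sum>i\<le>n. if i < k then the_enat (F i) else 0) \<le> b * (n + 1) ^ s" .
  qed
  from small_add[OF this small_unshift[OF assms(1), of k]] show ?thesis
    by (rule small_mono) (auto simp: G_def)
qed

section \<open>Filtering the powers of an ideal by the powers of its last generator\<close>

context cring
begin

definition mixed_power :: "'a set \<Rightarrow> 'a set \<Rightarrow> nat \<Rightarrow> nat \<Rightarrow> 'a set" where
  "mixed_power K L u j = ideal_power R K u \<cdot> ideal_power R L j"

text \<open>With \<open>L\<close> generated by \<open>y\<close> and \<open>K\<close>, a product of
  \<open>u\<close> factors from \<open>K\<close> and \<open>j\<close> factors from \<open>L\<close>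
  is sorted by the number of factors \<open>y\<close>; this is the part in which fewer than
  \<open>j\<close> of them occur. For \<open>j = 0\<close> nothing is left.\<close>

definition lower_part :: "'a set \<Rightarrow> 'a set \<Rightarrow> nat \<Rightarrow> nat \<Rightarrow> 'a set" where
  "lower_part K L u j = (case j of 0 \<Rightarrow> {\<zero>} | Suc i \<Rightarrow> mixed_power K L (Suc u) i)"

text \<open>The assumption \<open>span\<close> says that \<open>L\<close> is generated by
  \<open>K\<close> and \<open>y\<close>, in the form in which it is applied to products with an
  ideal.\<close>

context
  fixes K L :: "'a set" and y :: 'a
  assumes K: "ideal K R" and L: "ideal L R" and KL: "K \<subseteq> L" and y: "y \<in> L"
    and span: "\<And>A. ideal A R \<Longrightarrow> L \<cdot> A \<subseteq> mult_set R y A \<boxplus> K \<cdot> A"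
begin

lemma yc: "y \<in> carrier R" using y L idealD(8) by blast

lemma mixed_ideal: "ideal (mixed_power K L u j) R"
  unfolding mixed_power_def using K L by (intro ideal_prod_is_ideal ideal_power_ideal)

lemma lower_ideal: "ideal (lower_part K L u j) R"
  by (cases j) (simp_all add: lower_part_def zeroideal mixed_ideal)

lemma mixed_power_L: "L \<cdot> mixed_power K L u j = mixed_power K L u (Suc j)"
proof -
  have i: "ideal (ideal_power R K u) R" "ideal (ideal_power R L j) R" using K L by (auto intro: ideal_power_ideal)
  have "L \<cdot> (ideal_power R K u \<cdot> ideal_power R L j) = (L \<cdot> ideal_power R K u) \<cdot> ideal_power R L j"
    using i L by (simp add: ideal_prod_assoc)
  also have "\<dots> = (ideal_power R K u \<cdot> L) \<cdot> ideal_power R L j" using i L by (simp add: ideal_prod_commute)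
  also have "\<dots> = ideal_power R K u \<cdot> (L \<cdot> ideal_power R L j)" using i L by (simp add: ideal_prod_assoc)
  finally show ?thesis by (simp only: mixed_power_def ideal_power_Suc2[OF L])
qed

lemma mixed_power_K: "K \<cdot> mixed_power K L u j = mixed_power K L (Suc u) j"
  by (simp only: mixed_power_def ideal_power_Suc2[OF K]
      ideal_prod_assoc[OF K ideal_power_ideal[OF K] ideal_power_ideal[OF L]])

lemma mixed_mult_y: "v \<in> mixed_power K L u j \<Longrightarrow> y \<otimes> v \<in> mixed_power K L u (Suc j)"
  using prodI[OF y] mixed_power_L by blast

lemma mixed_mult_K:
  assumes "k \<in> ideal_power R K w" "v \<in> mixed_power K L u j"
  shows "k \<otimes> v \<in> mixed_power K L (u + w) j"
proof -
  have i: "ideal (ideal_power R K u) R" "ideal (ideal_power R K w) R" "ideal (ideal_power R L j) R"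
    using K L by (auto intro: ideal_power_ideal)
  have "k \<otimes> v \<in> ideal_power R K w \<cdot> mixed_power K L u j" by (rule prodI[OF assms])
  also have "\<dots> = mixed_power K L (u + w) j"
    using i K by (simp add: mixed_power_def ideal_prod_assoc[symmetric] add.commute[of u] ideal_power_add)
  finally show ?thesis .
qed

text \<open>Up to terms with fewer factors \<open>y\<close>, only \<open>y [^] j\<close> times the
  power of \<open>K\<close> remains: the induction multiplies by \<open>y\<close> and sends the
  contribution of \<open>K\<close> to the lower part.\<close>

lemma mixed_power_decomp:
  "mixed_power K L u j \<subseteq> mult_set R (y [^] j) (ideal_power R K u) \<boxplus> lower_part K L u j"
proof (induction j)
  case 0
  have i: "ideal (ideal_power R K u) R" using K by (rule ideal_power_ideal)
  have "mixed_power K L u 0 = ideal_power R K u"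
    using i by (simp add: mixed_power_def ideal_prod_one)
  then show ?case using plus_upper1[OF i zeroideal] idealD(1)[OF i] by (simp add: mult_set_one lower_part_def)
next
  case (Suc j)
  have i: "ideal (ideal_power R K u) R" using K by (rule ideal_power_ideal)
  have id: "ideal (mult_set R (y [^] Suc j) (ideal_power R K u)) R"
    using i yc by (intro mult_set_ideal) auto
  let ?S = "mult_set R (y [^] Suc j) (ideal_power R K u) \<boxplus> mixed_power K L (Suc u) j"
  have S: "ideal ?S R" using id mixed_ideal by (rule add_ideals)
  have up: "mult_set R (y [^] Suc j) (ideal_power R K u) \<subseteq> ?S" "mixed_power K L (Suc u) j \<subseteq> ?S"
    by (rule plus_upper1[OF id mixed_ideal] plus_upper2[OF id mixed_ideal])+
  have "mult_set R y (mixed_power K L u j) \<subseteq> ?S"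
    unfolding mult_set_subset
  proof
    fix v assume "v \<in> mixed_power K L u j"
    then obtain k l where kl: "k \<in> ideal_power R K u" "l \<in> lower_part K L u j" "v = (y [^] j) \<otimes> k \<oplus> l"
      using Suc.IH unfolding subset_iff mem_set_add mult_set_def by blast
    have c: "k \<in> carrier R" "l \<in> carrier R" using kl idealD(8)[OF i] idealD(8)[OF lower_ideal] by auto
    have e: "y \<otimes> v = (y [^] Suc j) \<otimes> k \<oplus> y \<otimes> l" unfolding kl(3) using c yc by (simp add: r_distr m_ac)
    have "(y [^] Suc j) \<otimes> k \<in> ?S" using kl(1) up(1) unfolding mult_set_def by blast
    moreover have "y \<otimes> l \<in> mixed_power K L (Suc u) j"
    proof (cases j)
      case 0
      then have "y \<otimes> l = \<zero>" using kl(2) yc by (simp add: lower_part_def)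
      then show ?thesis using idealD(2)[OF mixed_ideal] by simp
    next
      case (Suc i)
      then show ?thesis using kl(2) mixed_mult_y by (simp add: lower_part_def)
    qed
    ultimately show "y \<otimes> v \<in> ?S" unfolding e using up(2) by (intro idealD(3)[OF S]) auto
  qed
  then have "mult_set R y (mixed_power K L u j) \<boxplus> mixed_power K L (Suc u) j \<subseteq> ?S"
    using up(2) by (intro plus_least[OF S])
  then show ?case using span[OF mixed_ideal[of u j]] unfolding mixed_power_L mixed_power_K by (simp add: lower_part_def)
qed

lemma lower_mult_K:
  assumes "k \<in> ideal_power R K w" "v \<in> lower_part K L u j" shows "k \<otimes> v \<in> lower_part K L (u + w) j"
proof (cases j)
  case 0
  have "k \<in> carrier R" using assms idealD(8)[OF ideal_power_ideal[OF K]] by blast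
  then show ?thesis using 0 assms by (simp add: lower_part_def)
next
  case (Suc i)
  then show ?thesis using mixed_mult_K[OF assms(1), of v "Suc u" i] assms(2) by (simp add: lower_part_def)
qed

lemma lower_mult_y:
  assumes "v \<in> lower_part K L u j" shows "y [^] i \<otimes> v \<in> lower_part K L u (j + i)"
proof (induction i)
  case 0 then show ?case using assms idealD(8)[OF lower_ideal] by simp
next
  case (Suc i)
  have vc: "v \<in> carrier R" using assms idealD(8)[OF lower_ideal] by blast
  have e: "y [^] Suc i \<otimes> v = y \<otimes> (y [^] i \<otimes> v)" using yc vc by (simp add: m_ac)
  show ?case
  proof (cases "j + i")
    case 0
    then have "y [^] i \<otimes> v = \<zero>" using Suc.IH by (simp add: lower_part_def)
    then show ?thesis unfolding e using yc idealD(2)[OF lower_ideal] by simp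
  next
    case (Suc k)
    then show ?thesis unfolding e using Suc.IH mixed_mult_y by (simp add: lower_part_def)
  qed
qed

lemma power_y: "y [^] i \<in> ideal_power R L i"
proof (induction i)
  case (Suc i)
  then show ?case using prodI[OF Suc.IH y] by simp
qed (simp add: ideal_power_0)

text \<open>The products of \<open>n - i\<close> factors from \<open>K\<close> and \<open>i\<close>
  from \<open>L\<close> climb from the n-th power of \<open>K\<close> to that of \<open>L\<close>.
  By \<open>mixed_power_decomp\<close> the i-th step is an image of the power of \<open>K\<close>
  with exponent \<open>n - i\<close> under \<open>y [^] i\<close>; \<open>D i\<close> may be any set
  known to be sent into \<open>E\<close> and the earlier steps.\<close>

lemma len_filter_le:
  assumes E: "ideal E R" and EL: "E \<subseteq> ideal_power R L n"
    and D: "\<And>i. i \<le> n \<Longrightarrow> D i \<subseteq> ideal_power R K (n - i)"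
      "\<And>i e. i \<le> n \<Longrightarrow> e \<in> D i \<Longrightarrow> y [^] i \<otimes> e \<in> E \<boxplus> lower_part K L (n - i) i"
  shows "len E (ideal_power R L n) \<le> (\<Sum>i\<le>n. len (D i) (ideal_power R K (n - i)))"
proof -
  have "len E (E \<boxplus> mixed_power K L (n - i) i) \<le> (\<Sum>k\<le>i. len (D k) (ideal_power R K (n - k)))"
    if "i \<le> n" for i using that
  proof (induction i)
    case 0
    have "len E (E \<boxplus> mixed_power K L n 0) \<le> len (D 0) (ideal_power R K n)"
    proof -
      have i: "ideal (ideal_power R K n) R" using K by (rule ideal_power_ideal)
      have "E \<boxplus> lower_part K L n 0 = E" using E by (simp add: lower_part_def plus_ideal_commute[OF E zeroideal])
          (rule plus_absorb[OF zeroideal E], use idealD(2)[OF E] in auto)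
      then have d: "e \<in> E" if "e \<in> D 0" for e
        using D(2)[of 0 e] D(1)[of 0] that idealD(8)[OF i, of e] by auto
      have m: "mixed_power K L n 0 = ideal_power R K n"
        using i by (simp add: mixed_power_def ideal_prod_one)
      show ?thesis unfolding m plus_ideal_commute[OF E i]
        using D(1)[of 0] d by (intro len_plus_le[OF i E]) auto
    qed
    then show ?case by simp
  next
    case (Suc i)
    let ?u = "n - Suc i"
    let ?T = "E \<boxplus> mixed_power K L (n - i) i"
    have u: "Suc ?u = n - i" using Suc.prems by simp
    have T: "ideal ?T R" using E mixed_ideal by (rule add_ideals)
    have ET: "E \<subseteq> ?T" by (rule plus_upper1[OF E mixed_ideal])
    have lp: "lower_part K L ?u (Suc i) = mixed_power K L (n - i) i" by (simp add: lower_part_def u)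
    have ip: "ideal (ideal_power R K ?u) R" using K by (rule ideal_power_ideal)
    let ?Y = "mult_set R (y [^] Suc i) (ideal_power R K ?u)"
    have Y: "ideal ?Y R" using ip yc by (intro mult_set_ideal) auto
    have YT: "ideal (?Y \<boxplus> ?T) R" using Y T by (rule add_ideals)
    have "mixed_power K L ?u (Suc i) \<subseteq> ?Y \<boxplus> mixed_power K L (n - i) i"
      using mixed_power_decomp[of ?u "Suc i"] unfolding lp .
    also have "\<dots> \<subseteq> ?Y \<boxplus> ?T" using plus_upper2[OF E mixed_ideal] by (rule plus_mono[OF order_refl])
    finally have "E \<boxplus> mixed_power K L ?u (Suc i) \<subseteq> ?Y \<boxplus> ?T"
      using ET plus_upper2[OF Y T] by (intro plus_least[OF YT]) auto
    then have "len E (E \<boxplus> mixed_power K L ?u (Suc i)) \<le> len E (?Y \<boxplus> ?T)" by (rule chain_length_mono[OF order_refl])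
    also have "\<dots> = len E ?T + len ?T (?Y \<boxplus> ?T)"
      by (rule len_add[OF E T YT ET plus_upper2[OF Y T]])
    also have "len E ?T \<le> (\<Sum>k\<le>i. len (D k) (ideal_power R K (n - k)))" using Suc by simp
    also have "len ?T (?Y \<boxplus> ?T) \<le> len (D (Suc i)) (ideal_power R K ?u)"
      using D[OF Suc.prems] yc unfolding lp by (intro len_mult_le[OF ip T]) auto
    finally show ?case by (simp add: add_left_mono add_right_mono)
  qed
  from this[of n] have "len E (E \<boxplus> mixed_power K L 0 n) \<le> (\<Sum>k\<le>n. len (D k) (ideal_power R K (n - k)))" by simp
  moreover have "mixed_power K L 0 n = ideal_power R L n"
    using L by (simp add: mixed_power_def prod_one ideal_power_ideal)
  moreover have "E \<boxplus> ideal_power R L n = ideal_power R L n" by (rule plus_absorb[OF E ideal_power_ideal[OF L] EL])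
  ultimately show ?thesis by simp
qed

end

end

section \<open>The fibre ring\<close>

context local_noetherian_ring
begin

lemma m_ideal: "ideal \<mm> R"
  using maximal by (rule maximalideal.axioms)

lemma m_proper: "\<mm> \<noteq> carrier R"
  using maximalideal.I_notcarr[OF maximal] by simp

lemma len_residue: "len \<mm> (carrier R) = 1"
proof (rule antisym)
  show "len \<mm> (carrier R) \<le> 1"
  proof (rule chain_length_least)
    fix n and N :: "nat \<Rightarrow> 'a set"
    assume N: "\<And>i. i \<le> n \<Longrightarrow> N i \<in> submods R (carrier R) \<and> \<mm> \<subseteq> N i \<and> N i \<subseteq> carrier R"
      and st: "\<And>i. i < n \<Longrightarrow> N i \<subset> N (Suc i)"
    have "N i = \<mm> \<or> N i = carrier R" if "i \<le> n" for i
      using maximalideal.I_maximal[OF maximal, of "N i"] N[OF that] by (auto simp: ideal_iff_submods)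
    then have "\<not> n \<ge> 2" using st[of 0] st[of 1] N[of 0] N[of 1] N[of 2]
      by (metis One_nat_def Suc_1 Suc_leD Suc_le_lessD le_0_eq not_less_eq_eq psubsetE psubset_trans zero_le)
    then show "enat n \<le> 1" by (simp add: one_enat_def)
  qed
  have "\<mm> \<subset> carrier R" using m_proper idealD(1)[OF m_ideal] by blast
  then show "1 \<le> len \<mm> (carrier R)"
    using m_ideal oneideal by (intro chain_length_pos) (auto simp: ideal_iff_submods)
qed

lemma noetherian: "noetherian_ring R"
  by (rule noetherian_ring_axioms)

text \<open>Each quotient of successive powers is finitely generated and killed by
  \<open>\<mm>\<close>, so its length is at most the number of generators.\<close>

lemma len_m_power: "len (ideal_power R \<mm> n) (carrier R) \<noteq> \<infinity>"
proof (induction n)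
  case 0 then show ?case by (simp add: ideal_power_0)
next
  case (Suc n)
  have i: "ideal (ideal_power R \<mm> k) R" for k by (rule ideal_power_ideal[OF m_ideal])
  obtain s :: nat where s: "\<forall>A B T. ideal A R \<and> ideal B R \<and> ideal T R \<and> B \<subseteq> A \<and> ideal_power R \<mm> n \<cdot> B \<subseteq> T
     \<longrightarrow> len T (T \<boxplus> ideal_power R \<mm> n \<cdot> A) \<le> enat s * len B A"
    using noetherian_len_prod_le[OF noetherian i[of n]] by blast
  have sub: "ideal_power R \<mm> (Suc n) \<subseteq> ideal_power R \<mm> n" by (rule ideal_power_antimono[OF m_ideal]) simp
  have "len (ideal_power R \<mm> (Suc n)) (ideal_power R \<mm> (Suc n) \<boxplus> ideal_power R \<mm> n \<cdot> carrier R) \<le> enat s * len \<mm> (carrier R)"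
    using idealD(1)[OF m_ideal] oneideal m_ideal i by (intro s[rule_format]) (simp add: ideal_power_Suc ideal_prod_is_ideal)
  then have "len (ideal_power R \<mm> (Suc n)) (ideal_power R \<mm> n) \<le> enat s"
    using plus_absorb[OF i i sub] ideal_prod_one[OF i] len_residue by simp
  then obtain a where "len (ideal_power R \<mm> (Suc n)) (ideal_power R \<mm> n) = enat a" by (metis enat_ile)
  moreover obtain b where "len (ideal_power R \<mm> n) (carrier R) = enat b" using Suc by auto
  moreover have "len (ideal_power R \<mm> (Suc n)) (carrier R)
     = len (ideal_power R \<mm> (Suc n)) (ideal_power R \<mm> n) + len (ideal_power R \<mm> n) (carrier R)"
    using sub idealD(1)[OF i] by (intro len_add i oneideal) auto
  ultimately show ?case by simp
qed

lemma len_finite: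
  assumes "ideal_power R \<mm> n \<subseteq> I" "A \<subseteq> carrier R" shows "len I A \<noteq> \<infinity>"
proof -
  have "len I A \<le> len (ideal_power R \<mm> n) (carrier R)" using assms by (intro chain_length_mono)
  then show ?thesis using len_m_power[of n] by (cases "len I A") auto
qed

lemma gen_ideal: "(\<And>i. i < s \<Longrightarrow> x i \<in> carrier R) \<Longrightarrow> ideal (Idl (x ` {..<s})) R"
  by (intro genideal_ideal) auto

lemma gen_mem: "(\<And>i. i < s \<Longrightarrow> x i \<in> carrier R) \<Longrightarrow> i < s \<Longrightarrow> x i \<in> Idl (x ` {..<s})"
  using genideal_self[of "x ` {..<s}"] by auto

lemma gen_mono:
  fixes s t :: nat
  assumes "\<And>i. i < t \<Longrightarrow> x i \<in> carrier R" "s \<le> t"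
  shows "Idl (x ` {..<s}) \<subseteq> Idl (x ` {..<t})"
proof (rule genideal_minimal[OF gen_ideal])
  show "x ` {..<s} \<subseteq> Idl (x ` {..<t})"
  proof
    fix z assume "z \<in> x ` {..<s}"
    then obtain i where i: "i < s" "z = x i" by auto
    then have "i < t" using assms(2) by simp
    then show "z \<in> Idl (x ` {..<t})" using gen_mem[of t x i] assms(1) i(2) by simp
  qed
qed (rule assms(1))

lemma gen_span:
  assumes "\<And>i. i < Suc s \<Longrightarrow> x i \<in> carrier R" "ideal A R"
  shows "(Idl (x ` {..<Suc s})) \<cdot> A \<subseteq> mult_set R (x s) A \<boxplus> (Idl (x ` {..<s})) \<cdot> A"
proof -
  have "lin_span R x s A {\<zero>} \<subseteq> (Idl (x ` {..<s})) \<cdot> A"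
  proof (rule lin_span_least)
    show i: "ideal ((Idl (x ` {..<s})) \<cdot> A) R" using assms by (intro ideal_prod_is_ideal gen_ideal) auto
    show "{\<zero>} \<subseteq> (Idl (x ` {..<s})) \<cdot> A" using idealD(2)[OF i] by simp
    show "x i \<otimes> e \<in> (Idl (x ` {..<s})) \<cdot> A" if "i < s" "e \<in> A" for i e
      using assms that by (intro prodI gen_mem) auto
  qed
  then have "lin_span R x (Suc s) A {\<zero>} \<subseteq> mult_set R (x s) A \<boxplus> (Idl (x ` {..<s})) \<cdot> A"
    unfolding lin_span.simps by (rule plus_mono[OF order_refl])
  with prod_lin_span[OF assms zeroideal] show ?thesis by (rule order_trans)
qed

text \<open>The degree \<open>n\<close> part of the ideal generated by \<open>\<mm>\<close> and the
  form \<open>f\<close> of degree \<open>a\<close> in the Rees algebra of \<open>K\<close>. Below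
  degree \<open>a\<close> the form contributes nothing, so the truncated difference
  \<open>n - a\<close> never misleads.\<close>

definition form_part :: "'a \<Rightarrow> nat \<Rightarrow> 'a set \<Rightarrow> nat \<Rightarrow> 'a set" where
  "form_part f a K n = (if a \<le> n then mult_set R f (ideal_power R K (n - a)) else {\<zero>})
      \<boxplus> \<mm> \<cdot> ideal_power R K n"

lemma form_part_ideal:
  assumes "ideal K R" "f \<in> carrier R" shows "ideal (form_part f a K n) R"
  unfolding form_part_def using assms m_ideal
  by (auto intro!: add_ideals mult_set_ideal ideal_prod_is_ideal ideal_power_ideal zeroideal)

lemma form_part_cases:
  assumes "e \<in> form_part f a K n"
  obtains k w where "a \<le> n" "k \<in> ideal_power R K (n - a)" "w \<in> \<mm> \<cdot> ideal_power R K n" "e = f \<otimes> k \<oplus> w"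
  | w where "w \<in> \<mm> \<cdot> ideal_power R K n" "e = \<zero> \<oplus> w"
  using assms by (auto simp: form_part_def mem_set_add mult_set_def split: if_splits)

lemma form_part_upper:
  assumes K: "ideal K R" and f: "f \<in> carrier R"
  shows "\<mm> \<cdot> ideal_power R K n \<subseteq> form_part f a K n"
    "a \<le> n \<Longrightarrow> k \<in> ideal_power R K (n - a) \<Longrightarrow> f \<otimes> k \<in> form_part f a K n"
proof -
  have i: "ideal (ideal_power R K j) R" for j using K by (rule ideal_power_ideal)
  have m: "ideal (\<mm> \<cdot> ideal_power R K n) R" using m_ideal i by (rule ideal_prod_is_ideal)
  have t: "ideal (if a \<le> n then mult_set R f (ideal_power R K (n - a)) else {\<zero>}) R"
    using mult_set_ideal[OF i f] zeroideal by simp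
  show "\<mm> \<cdot> ideal_power R K n \<subseteq> form_part f a K n" unfolding form_part_def by (rule plus_upper2[OF t m])
  show "a \<le> n \<Longrightarrow> k \<in> ideal_power R K (n - a) \<Longrightarrow> f \<otimes> k \<in> form_part f a K n"
    using plus_upper1[OF t m] unfolding form_part_def mult_set_def by auto
qed

lemma form_part_subset:
  assumes K: "ideal K R" and f: "f \<in> ideal_power R K a"
  shows "form_part f a K n \<subseteq> ideal_power R K n"
proof -
  have i: "ideal (ideal_power R K j) R" for j using K by (rule ideal_power_ideal)
  have "f \<otimes> k \<in> ideal_power R K n" if "a \<le> n" "k \<in> ideal_power R K (n - a)" for k
    using ideal_power_multI[OF K f that(2)] that(1) by simp
  then show ?thesis unfolding form_part_def using idealD(2)[OF i] prod_subset2[OF m_ideal i]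
    by (intro plus_least[OF i]) (auto simp: mult_set_subset)
qed

lemma zero_ideal_power: "n > 0 \<Longrightarrow> ideal_power R {\<zero>} n = {\<zero>}"
  using ideal_prod_zero[OF ideal_power_ideal[OF zeroideal]] by (cases n) simp_all

lemma gen_zero: "Idl (x ` {..<0::nat}) = {\<zero>}"
  using genideal_minimal[OF zeroideal, of "{}"] idealD(2)[OF genideal_ideal[of "{}"]] by auto

text \<open>In \<open>len_filter_le\<close> the multiples of \<open>\<mm>\<close> may be discarded
  at every step, so one more generator replaces the Hilbert function of the fibre ring by at most
  its partial sums.\<close>

lemma len_fibre_le:
  assumes x: "\<And>i. i < Suc s \<Longrightarrow> x i \<in> carrier R"
  defines "K \<equiv> Idl (x ` {..<s})" and "L \<equiv> Idl (x ` {..<Suc s})"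
  shows "len (\<mm> \<cdot> ideal_power R L n) (ideal_power R L n)
     \<le> (\<Sum>i\<le>n. len (\<mm> \<cdot> ideal_power R K (n - i)) (ideal_power R K (n - i)))"
proof -
  have K: "ideal K R" and L: "ideal L R" unfolding K_def L_def using x by (auto intro!: gen_ideal)
  have KL: "K \<subseteq> L" unfolding K_def L_def by (rule gen_mono[OF x]) auto
  have y: "x s \<in> L" unfolding L_def by (rule gen_mem[OF x]) auto
  have yc: "x s \<in> carrier R" using x by simp
  have span: "L \<cdot> A \<subseteq> mult_set R (x s) A \<boxplus> K \<cdot> A" if "ideal A R" for A
    unfolding K_def L_def by (rule gen_span[OF x that])
  have i: "ideal (ideal_power R K j) R" "ideal (ideal_power R L j) R" for j using K L by (auto intro: ideal_power_ideal)
  have E: "ideal (\<mm> \<cdot> ideal_power R L n) R" using m_ideal i by (intro ideal_prod_is_ideal)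
  show ?thesis
  proof (rule len_filter_le[OF K L KL y span E])
    show "\<mm> \<cdot> ideal_power R L n \<subseteq> ideal_power R L n" by (rule prod_subset2[OF m_ideal i(2)])
    fix k assume k: "k \<le> n"
    show "\<mm> \<cdot> ideal_power R K (n - k) \<subseteq> ideal_power R K (n - k)" by (rule prod_subset2[OF m_ideal i(1)])
    have "\<mm> \<cdot> ideal_power R K (n - k) \<subseteq> {a \<in> carrier R. x s [^] k \<otimes> a \<in> \<mm> \<cdot> ideal_power R L n}"
    proof (rule prod_least)
      show "ideal {a \<in> carrier R. x s [^] k \<otimes> a \<in> \<mm> \<cdot> ideal_power R L n} R"
        using yc by (intro colon_ideal[OF oneideal E]) auto
      fix u v assume uv: "u \<in> \<mm>" "v \<in> ideal_power R K (n - k)"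
      have c: "u \<in> carrier R" "v \<in> carrier R" using uv idealD(8)[OF m_ideal] idealD(8)[OF i(1)] by auto
      have "x s [^] k \<in> ideal_power R L k" by (rule power_y[OF K L KL y span])
      moreover have "v \<in> ideal_power R L (n - k)" using uv(2) ideal_power_mono[OF KL] by blast
      ultimately have "x s [^] k \<otimes> v \<in> ideal_power R L n" using ideal_power_multI[OF L, of "x s [^] k" k v "n - k"] k by simp
      then have "u \<otimes> (x s [^] k \<otimes> v) \<in> \<mm> \<cdot> ideal_power R L n" using uv(1) by (intro prodI)
      moreover have "u \<otimes> (x s [^] k \<otimes> v) = x s [^] k \<otimes> (u \<otimes> v)" using c yc by (simp add: m_lcomm)
      ultimately show "u \<otimes> v \<in> {a \<in> carrier R. x s [^] k \<otimes> a \<in> \<mm> \<cdot> ideal_power R L n}" using c by simp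
    qed
    then show "x s [^] k \<otimes> e \<in> \<mm> \<cdot> ideal_power R L n \<boxplus> lower_part K L (n - k) k"
      if "e \<in> \<mm> \<cdot> ideal_power R K (n - k)" for e
      using that plus_upper1[OF E lower_ideal[OF K L KL y span]] by blast
  qed
qed

text \<open>The right side is the Hilbert function of the polynomial ring in \<open>s\<close>
  variables over the residue field. Written with \<open>choose n\<close> it is also correct for
  \<open>s = 0\<close>, where truncated subtraction makes it 1 at \<open>n = 0\<close> and 0
  afterwards.\<close>

lemma len_fibre_binomial:
  assumes "\<And>i. i < s \<Longrightarrow> x i \<in> carrier R"
  shows "len (\<mm> \<cdot> ideal_power R (Idl (x ` {..<s})) n) (ideal_power R (Idl (x ` {..<s})) n)
     \<le> enat ((n + s - 1) choose n)"
  using assms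
proof (induction s arbitrary: n)
  case 0
  show ?case
  proof (cases n)
    case 0 then show ?thesis
      using len_residue ideal_prod_one[OF m_ideal] by (simp add: ideal_power_0 one_enat_def)
  next
    case (Suc k)
    then have "ideal_power R {\<zero>} n = {\<zero>}" by (intro zero_ideal_power) simp
    then show ?thesis unfolding gen_zero using ideal_prod_zero[OF m_ideal] by simp
  qed
next
  case (Suc s)
  have "len (\<mm> \<cdot> ideal_power R (Idl (x ` {..<Suc s})) n) (ideal_power R (Idl (x ` {..<Suc s})) n)
     \<le> (\<Sum>i\<le>n. len (\<mm> \<cdot> ideal_power R (Idl (x ` {..<s})) (n - i)) (ideal_power R (Idl (x ` {..<s})) (n - i)))"
    by (rule len_fibre_le[OF Suc.prems])
  also have "\<dots> \<le> (\<Sum>i\<le>n. enat ((n - i + s - 1) choose (n - i)))" by (intro sum_mono Suc.IH) (use Suc.prems in auto)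
  also have "\<dots> = enat (\<Sum>i\<le>n. (n - i + s - 1) choose (n - i))" by (rule sum_enat)
  also have "(\<Sum>i\<le>n. (n - i + s - 1) choose (n - i)) = (\<Sum>i\<le>n. (i + s - 1) choose i)"
    by (rule sum.reindex_bij_witness[where i = "\<lambda>i. n - i" and j = "\<lambda>i. n - i"]) auto
  also have "\<dots> = (n + Suc s - 1) choose n"
  proof (cases s)
    case 0
    have "(\<Sum>i\<le>n. (i + 0 - 1) choose i) = (\<Sum>i\<in>{0}. (i + 0 - 1) choose i)"
      by (rule sum.mono_neutral_right) auto
    then show ?thesis using 0 by simp
  next
    case (Suc t)
    then show ?thesis using sum_choose_lower[of t n] by (simp add: add.commute)
  qed
  finally show ?case .
qed

lemma len_fibre_small:
  assumes "\<And>i. i < s \<Longrightarrow> x i \<in> carrier R"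
  shows "small (Suc s) (\<lambda>n. len (\<mm> \<cdot> ideal_power R (Idl (x ` {..<s})) n) (ideal_power R (Idl (x ` {..<s})) n))"
  using assms
proof (induction s)
  case 0
  show ?case
  proof (rule smallI[where f = "\<lambda>n. if n = 0 then 1 else 0" and C = 1])
    show "len (\<mm> \<cdot> ideal_power R (Idl (x ` {..<0})) n) (ideal_power R (Idl (x ` {..<0})) n) \<le> enat (if n = 0 then 1 else 0)" for n
      using len_fibre_binomial[of 0 x n] by (cases n) (simp_all only: binomial_n_0 add_0_right if_True if_False nat.simps diff_Suc_1 n_not_Suc_n binomial_eq_0[OF lessI], simp_all)
  qed simp
next
  case (Suc s)
  let ?h = "\<lambda>n. len (\<mm> \<cdot> ideal_power R (Idl (x ` {..<s})) n) (ideal_power R (Idl (x ` {..<s})) n)"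
  have "small (Suc (Suc s)) (\<lambda>n. \<Sum>i\<le>n. ?h i)" by (intro small_conv Suc.IH) (use Suc.prems in auto)
  moreover have "(\<Sum>i\<le>n. ?h (n - i)) = (\<Sum>i\<le>n. ?h i)" for n
    by (rule sum.reindex_bij_witness[where i = "\<lambda>i. n - i" and j = "\<lambda>i. n - i"]) auto
  ultimately have "small (Suc (Suc s)) (\<lambda>n. \<Sum>i\<le>n. ?h (n - i))" by simp
  then show ?case by (rule small_mono) (rule len_fibre_le[OF Suc.prems])
qed

end

section \<open>Growth of the fibre ring modulo a nonzero form\<close>

context local_noetherian_ring
begin

lemma m_power_mult:
  assumes L: "ideal L R" and z: "z \<in> ideal_power R L i" and e: "e \<in> \<mm> \<cdot> ideal_power R L n"
  shows "z \<otimes> e \<in> \<mm> \<cdot> ideal_power R L (i + n)"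
proof -
  have p: "ideal (ideal_power R L k) R" for k using L by (rule ideal_power_ideal)
  have E: "ideal (\<mm> \<cdot> ideal_power R L (i + n)) R" using m_ideal p by (rule ideal_prod_is_ideal)
  have zc: "z \<in> carrier R" using z idealD(8)[OF p] by blast
  have "\<mm> \<cdot> ideal_power R L n \<subseteq> {a \<in> carrier R. z \<otimes> a \<in> \<mm> \<cdot> ideal_power R L (i + n)}"
  proof (rule prod_least[OF colon_ideal[OF oneideal E zc]])
    fix u v assume uv: "u \<in> \<mm>" "v \<in> ideal_power R L n"
    have c: "u \<in> carrier R" "v \<in> carrier R" using uv idealD(8)[OF m_ideal] idealD(8)[OF p] by auto
    have "z \<otimes> (u \<otimes> v) = u \<otimes> (z \<otimes> v)" using c zc by (simp add: m_lcomm)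
    moreover have "u \<otimes> (z \<otimes> v) \<in> \<mm> \<cdot> ideal_power R L (i + n)"
      by (rule prodI[OF uv(1) ideal_power_multI[OF L z uv(2)]])
    ultimately show "u \<otimes> v \<in> {a \<in> carrier R. z \<otimes> a \<in> \<mm> \<cdot> ideal_power R L (i + n)}" using c by simp
  qed
  then show ?thesis using e by blast
qed

text \<open>In the fibre ring of \<open>x\<^sub>0, \<dots>, x\<^sub>s\<^sub>-\<^sub>1\<close> every nonzero form generates an ideal of
  smaller dimension than the polynomial ring. The induction singles out the coefficient of the
  smallest power of the last variable needed to write \<open>f\<close>.\<close>

theorem form_small:
  assumes "\<And>i. i < s \<Longrightarrow> x i \<in> carrier R"
    and "f \<in> ideal_power R (Idl (x ` {..<s})) a" "f \<notin> \<mm> \<cdot> ideal_power R (Idl (x ` {..<s})) a"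
  shows "small s (\<lambda>n. len (form_part f a (Idl (x ` {..<s})) n) (ideal_power R (Idl (x ` {..<s})) n))"
  using assms
proof (induction s arbitrary: f a)
  case 0
  let ?K = "{\<zero>}"
  note prems = "0.prems"(2,3)[unfolded gen_zero]
  have Ki: "ideal (ideal_power R ?K k) R" for k by (rule ideal_power_ideal[OF zeroideal])
  have a: "a = 0"
  proof (rule ccontr)
    assume "a \<noteq> 0"
    then have "f = \<zero>" using prems(1) zero_ideal_power[of a] by simp
    then show False using prems(2) idealD(2)[OF ideal_prod_is_ideal[OF m_ideal Ki]] by simp
  qed
  have f: "f \<in> carrier R" "f \<notin> \<mm>" using prems a ideal_prod_one[OF m_ideal] by (auto simp: ideal_power_0)
  have "ideal_power R ?K n \<subseteq> form_part f a ?K n" for n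
  proof (cases "n = 0")
    case True
    have i: "ideal (form_part f a ?K 0) R" by (rule form_part_ideal[OF zeroideal f(1)])
    have "\<mm> \<subseteq> form_part f a ?K 0"
      using form_part_upper(1)[OF zeroideal f(1), of 0 a] ideal_prod_one[OF m_ideal] by (simp add: ideal_power_0)
    moreover have "f \<in> form_part f a ?K 0"
      using form_part_upper(2)[OF zeroideal f(1), of a 0 \<one>] a f(1) by (simp add: ideal_power_0)
    ultimately show ?thesis
      using maximalideal.I_maximal[OF maximal i] f(2) idealD(1)[OF i] True by (auto simp: ideal_power_0)
  next
    case False
    then show ?thesis using zero_ideal_power[of n] idealD(2)[OF form_part_ideal[OF zeroideal f(1)]] by simp
  qed
  then have "form_part f a ?K n = ideal_power R ?K n" for n
    using form_part_subset[OF zeroideal prems(1), of n] by blast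
  then show ?case unfolding gen_zero by (simp add: small_zero)
next
  case (Suc s)
  define K L y where "K = Idl (x ` {..<s})" and "L = Idl (x ` {..<Suc s})" and "y = x s"
  have xs: "\<And>i. i < s \<Longrightarrow> x i \<in> carrier R" using Suc.prems(1) by simp
  have K: "ideal K R" and L: "ideal L R" unfolding K_def L_def using Suc.prems(1) by (auto intro!: gen_ideal)
  have KL: "K \<subseteq> L" unfolding K_def L_def by (rule gen_mono[OF Suc.prems(1)]) auto
  have y: "y \<in> L" unfolding L_def y_def by (rule gen_mem[OF Suc.prems(1)]) auto
  have yc: "y \<in> carrier R" using Suc.prems(1) by (simp add: y_def)
  have span: "L \<cdot> A \<subseteq> mult_set R y A \<boxplus> K \<cdot> A" if "ideal A R" for A
    unfolding K_def L_def y_def by (rule gen_span[OF Suc.prems(1) that])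
  note ctx = K L KL y span
  have Kp: "ideal (ideal_power R K k) R" and Lp: "ideal (ideal_power R L k) R" for k
    using K L by (auto intro: ideal_power_ideal)
  have KLp: "ideal_power R K k \<subseteq> ideal_power R L k" for k by (rule ideal_power_mono[OF KL])
  have mL: "ideal (\<mm> \<cdot> ideal_power R L k) R" for k by (rule ideal_prod_is_ideal[OF m_ideal Lp])
  have mKL: "\<mm> \<cdot> ideal_power R K k \<subseteq> \<mm> \<cdot> ideal_power R L k" for k by (rule prod_mono[OF order_refl KLp])
  have f: "f \<in> ideal_power R L a" "f \<notin> \<mm> \<cdot> ideal_power R L a" using Suc.prems unfolding L_def by auto
  have fc: "f \<in> carrier R" using f(1) idealD(8)[OF Lp] by blast
  note yp = power_y[OF ctx]
  \<comment> \<open>Modulo multiples of \<open>\<mm>\<close>, the form \<open>f\<close> can be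
    written with at most \<open>j\<close> factors \<open>y\<close>. The exponent
    \<open>j = a\<close> is always possible, and the least one is taken.\<close>
  define P where "P = (\<lambda>j. j \<le> a \<and> f \<in> mixed_power K L (a - j) j \<boxplus> \<mm> \<cdot> ideal_power R L a)"
  have "P a"
    using plus_upper1[OF Lp mL] f(1) by (auto simp: P_def mixed_power_def ideal_power_0 prod_one Lp)
  define j where "j = (LEAST j. P j)"
  have Pj: "P j" unfolding j_def by (rule LeastI[of P, OF \<open>P a\<close>])
  have Pless: "\<not> P i" if "i < j" for i using not_less_Least that unfolding j_def by blast
  define b where "b = a - j"
  have ja: "a = j + b" using Pj by (simp add: P_def b_def)
  obtain v' w where v': "v' \<in> mixed_power K L b j" and w: "w \<in> \<mm> \<cdot> ideal_power R L a" and fe: "f = v' \<oplus> w"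
    using Pj unfolding P_def b_def mem_set_add by blast
  obtain g v where g: "g \<in> ideal_power R K b" and v: "v \<in> lower_part K L b j" and ve: "v' = (y [^] j) \<otimes> g \<oplus> v"
    using mixed_power_decomp[OF ctx, of b j] v' unfolding subset_iff mem_set_add mult_set_def by blast
  have c: "g \<in> carrier R" "v \<in> carrier R" "w \<in> carrier R" "y [^] j \<in> carrier R"
    using g v w yc idealD(8)[OF Kp] idealD(8)[OF lower_ideal[OF ctx]] idealD(8)[OF mL] by auto
  \<comment> \<open>Otherwise the leading term would be absorbed by the multiples of
    \<open>\<mm>\<close>; what remains of \<open>f\<close> would need fewer factors
    \<open>y\<close>, or for \<open>j = 0\<close> would itself be such a multiple.\<close>
  have gm: "g \<notin> \<mm> \<cdot> ideal_power R K b"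
  proof
    assume "g \<in> \<mm> \<cdot> ideal_power R K b"
    then have "(y [^] j) \<otimes> g \<in> \<mm> \<cdot> ideal_power R L a"
      using m_power_mult[OF L yp[of j], of g b] mKL ja by auto
    then have w2: "(y [^] j) \<otimes> g \<oplus> w \<in> \<mm> \<cdot> ideal_power R L a" using w idealD(3)[OF mL] by blast
    have e: "f = v \<oplus> ((y [^] j) \<otimes> g \<oplus> w)" unfolding fe ve using c by (simp add: a_ac)
    show False
    proof (cases j)
      case 0
      then have "v = \<zero>" using v by (simp add: lower_part_def)
      then show False using e w2 f(2) c by simp
    next
      case (Suc i)
      have "v \<in> mixed_power K L (a - i) i" using v Suc ja by (simp add: lower_part_def)
      then have "P i" unfolding P_def mem_set_add using e w2 Suc ja by auto
      then show False using Pless[of i] Suc by simp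
    qed
  qed
  define h where "h = (\<lambda>n. len (\<mm> \<cdot> ideal_power R K n) (ideal_power R K n))"
  define e where "e = (\<lambda>n. len (form_part g b K n) (ideal_power R K n))"
  have small_e: "small s e" unfolding e_def K_def
    by (rule Suc.IH[OF xs]) (use g gm in \<open>auto simp: K_def\<close>)
  have small_h: "small (Suc s) h" unfolding h_def K_def by (rule len_fibre_small[OF xs])
  have bound: "len (form_part f a L n) (ideal_power R L n) \<le> (\<Sum>i\<le>n. if i < j then h (n - i) else e (n - i))" for n
  proof -
    \<comment> \<open>With fewer than \<open>j\<close> factors \<open>y\<close> there is no room for
      the leading term of \<open>f\<close>, so only multiples of \<open>\<mm>\<close> are discarded
      in these finitely many steps; from \<open>i = j\<close> on, multiples of \<open>g\<close> are
      discarded as well.\<close>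
    define D where "D = (\<lambda>i. if i < j then \<mm> \<cdot> ideal_power R K (n - i) else form_part g b K (n - i))"
    have E: "ideal (form_part f a L n) R" by (rule form_part_ideal[OF L fc])
    have mE: "\<mm> \<cdot> ideal_power R L n \<subseteq> form_part f a L n" by (rule form_part_upper(1)[OF L fc])
    have "len (form_part f a L n) (ideal_power R L n) \<le> (\<Sum>i\<le>n. len (D i) (ideal_power R K (n - i)))"
    proof (rule len_filter_le[OF ctx E])
      show "form_part f a L n \<subseteq> ideal_power R L n" by (rule form_part_subset[OF L f(1)])
      fix i assume i: "i \<le> n"
      show "D i \<subseteq> ideal_power R K (n - i)"
        using form_part_subset[OF K g] prod_subset2[OF m_ideal Kp] by (auto simp: D_def)
      fix u assume u: "u \<in> D i"
      let ?S = "form_part f a L n \<boxplus> lower_part K L (n - i) i"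
      have S: "ideal ?S R" by (rule add_ideals[OF E lower_ideal[OF ctx]])
      have ES: "form_part f a L n \<subseteq> ?S" and lS: "lower_part K L (n - i) i \<subseteq> ?S"
        using plus_upper1[OF E lower_ideal[OF ctx]] plus_upper2[OF E lower_ideal[OF ctx]] by - assumption+
      have yi: "y [^] i \<in> carrier R" using yc by simp
      have mS: "y [^] i \<otimes> z \<in> ?S" if "z \<in> \<mm> \<cdot> ideal_power R K (n - i)" for z
        using m_power_mult[OF L yp[of i], of z "n - i"] that mKL mE ES i by auto
      show "y [^] i \<otimes> u \<in> ?S"
      proof (cases "i < j")
        case True then show ?thesis using mS u by (simp add: D_def)
      next
        case False
        then have "u \<in> form_part g b K (n - i)" using u by (simp add: D_def)
        then show ?thesis
        proof (cases rule: form_part_cases)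
          case (1 k z)
          have kz: "k \<in> carrier R" "z \<in> carrier R"
            using 1 idealD(8)[OF Kp] idealD(8)[OF ideal_prod_is_ideal[OF m_ideal Kp]] by auto
          define q where "q = y [^] (i - j) \<otimes> k"
          have qc: "q \<in> carrier R" using kz yc by (simp add: q_def)
          have kL: "k \<in> ideal_power R L (n - i - b)" using 1(2) KLp by blast
          have na: "(i - j) + (n - i - b) = n - a" "a \<le> n" using ja False 1(1) i by auto
          have qL: "q \<in> ideal_power R L (n - a)"
            unfolding q_def na(1)[symmetric] by (rule ideal_power_multI[OF L yp kL])
          have yij: "y [^] i = y [^] (i - j) \<otimes> y [^] j" using False yc by (simp add: nat_pow_mult)
          \<comment> \<open>The leading term is \<open>f\<close> minus the lower part
            \<open>v\<close> and the error \<open>w\<close>. Multiplied by \<open>q\<close>, these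
            three lie in the ideal of \<open>f\<close>, in an earlier step of the filtration and in
            the multiples of \<open>\<mm>\<close>, respectively.\<close>
          have "y [^] i \<otimes> (g \<otimes> k) = q \<otimes> ((y [^] j) \<otimes> g)"
            unfolding yij q_def using c kz yc by (simp add: m_ac)
          also have "(y [^] j) \<otimes> g = f \<ominus> w \<ominus> v"
            unfolding fe ve using c by (simp add: add_cancel_right)
          also have "q \<otimes> (f \<ominus> w \<ominus> v) = q \<otimes> f \<ominus> q \<otimes> w \<ominus> q \<otimes> v"
            using qc c fc by (simp add: a_minus_def r_distr r_minus)
          finally have eq: "y [^] i \<otimes> (g \<otimes> k) = q \<otimes> f \<ominus> q \<otimes> w \<ominus> q \<otimes> v" .
          have "f \<otimes> q \<in> ?S" using form_part_upper(2)[OF L fc na(2) qL] ES by blast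
          then have s1: "q \<otimes> f \<in> ?S" using qc fc by (simp add: m_comm)
          have "q \<otimes> w \<in> \<mm> \<cdot> ideal_power R L (n - a + a)" by (rule m_power_mult[OF L qL w])
          then have s2: "q \<otimes> w \<in> ?S" using na(2) mE ES by auto
          have "k \<otimes> (y [^] (i - j) \<otimes> v) \<in> lower_part K L (b + (n - i - b)) (j + (i - j))"
            by (rule lower_mult_K[OF ctx 1(2) lower_mult_y[OF ctx v]])
          moreover have "k \<otimes> (y [^] (i - j) \<otimes> v) = q \<otimes> v" using kz c yc by (simp add: q_def m_ac)
          moreover have "b + (n - i - b) = n - i" "j + (i - j) = i" using 1(1) False by auto
          ultimately have s3: "q \<otimes> v \<in> ?S" using lS by auto
          have "y [^] i \<otimes> (g \<otimes> k) \<in> ?S" unfolding eq by (intro idealD(5)[OF S] s1 s2 s3)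
          then have "y [^] i \<otimes> (g \<otimes> k) \<oplus> y [^] i \<otimes> z \<in> ?S" using mS[OF 1(3)] by (rule idealD(3)[OF S])
          then show ?thesis unfolding 1(4) using yi c kz by (simp add: r_distr)
        next
          case (2 z)
          have "z \<in> carrier R" using 2 idealD(8)[OF ideal_prod_is_ideal[OF m_ideal Kp]] by auto
          then show ?thesis unfolding 2(2) using mS[OF 2(1)] by simp
        qed
      qed
    qed
    also have "\<dots> = (\<Sum>i\<le>n. if i < j then h (n - i) else e (n - i))"
      by (intro sum.cong) (auto simp: D_def h_def e_def)
    finally show ?thesis .
  qed
  \<comment> \<open>The first \<open>j\<close> steps contribute finitely many shifted copies of
    \<open>h\<close>, which has the growth of \<open>s\<close> generators; the others form partial
    sums of \<open>e\<close>, which is smaller by one power.\<close>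
  have "small (Suc s) (\<lambda>n. (\<Sum>i<j. if i \<le> n then h (n - i) else 0) + (\<Sum>i\<le>n. e i))"
    by (intro small_add small_sum small_unshift small_h small_conv small_e)
  then have "small (Suc s) (\<lambda>n. len (form_part f a L n) (ideal_power R L n))"
  proof (rule small_mono)
    fix n
    have "(\<Sum>i\<le>n. if i < j then h (n - i) else e (n - i))
       \<le> (\<Sum>i\<le>n. (if i < j then h (n - i) else 0) + e (n - i))" by (intro sum_mono) auto
    also have "\<dots> = (\<Sum>i\<le>n. if i < j then h (n - i) else 0) + (\<Sum>i\<le>n. e (n - i))" by (rule sum.distrib)
    also have "(\<Sum>i\<le>n. e (n - i)) = (\<Sum>i\<le>n. e i)"
      by (rule sum.reindex_bij_witness[where i = "\<lambda>i. n - i" and j = "\<lambda>i. n - i"]) auto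
    also have "(\<Sum>i\<le>n. if i < j then h (n - i) else 0) = (\<Sum>i<j. if i \<le> n then h (n - i) else 0)"
      by (simp add: sum.inter_filter[symmetric] sum.If_cases Int_def conj_commute)
    finally show "len (form_part f a L n) (ideal_power R L n) \<le> (\<Sum>i<j. if i \<le> n then h (n - i) else 0) + (\<Sum>i\<le>n. e i)"
      using bound[of n] by simp
  qed
  then show ?case unfolding L_def .
qed

end

section \<open>Dimension and growth\<close>

text \<open>The assumption \<open>step\<close> is Pascal's rule with the argument advanced by
  \<open>c\<close> instead of 1. In the applications \<open>i\<close> is the position in a chain of
  primes and \<open>h i\<close> a length function modulo the i-th prime; the last prime contributes
  at least 1.\<close>

lemma chain_growth:
  fixes h :: "nat \<Rightarrow> nat \<Rightarrow> enat"
  assumes step: "\<And>i n. i < s \<Longrightarrow> h i n + h (Suc i) n \<le> h i (n + c)"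
    and top: "\<And>n. n \<ge> n0 \<Longrightarrow> 1 \<le> h s n"
  shows "enat (n choose s) \<le> h 0 (c * n + n0)"
proof -
  have "enat (n choose k) \<le> h (s - k) (c * n + n0)" if "k \<le> s" for k using that
  proof (induction k arbitrary: n)
    case 0 then show ?case using top by (simp add: one_enat_def)
  next
    case (Suc k)
    show ?case
    proof (induction n)
      case 0 then show ?case by (simp add: zero_enat_def[symmetric])
    next
      case (Suc n)
      have e: "Suc (s - Suc k) = s - k" using \<open>Suc k \<le> s\<close> by simp
      have "enat (Suc n choose Suc k) = enat (n choose Suc k) + enat (n choose k)" by simp
      also have "\<dots> \<le> h (s - Suc k) (c * n + n0) + h (s - k) (c * n + n0)"
        using Suc.IH Suc.prems \<open>\<And>n. k \<le> s \<Longrightarrow> enat (n choose k) \<le> h (s - k) (c * n + n0)\<close>[of n] \<open>Suc k \<le> s\<close>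
        by (intro add_mono) auto
      also have "\<dots> \<le> h (s - Suc k) (c * n + n0 + c)"
        using step[of "s - Suc k" "c * n + n0"] e \<open>Suc k \<le> s\<close> by simp
      also have "c * n + n0 + c = c * Suc n + n0" by simp
      finally show ?case .
    qed
  qed
  from this[of s] show ?thesis by simp
qed

lemma binomial_not_bounded:
  assumes "\<And>n. (n choose d) \<le> C * (c * n + n0 + 1) ^ e" "e < d"
  shows False
proof -
  define D where "D = C * (c * d + n0 + 1) ^ e"
  \<comment> \<open>At \<open>n = d * m\<close> the binomial coefficient is at least
    \<open>m ^ d\<close>, whereas the bound is at most \<open>D * m ^ e\<close>; any
    \<open>m\<close> above \<open>D\<close> gives a contradiction.\<close>
  define m where "m = Suc D"
  have d: "d > 0" using assms(2) by simp
  have "real m ^ d = (real (d * m) / real d) ^ d" using d by simp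
  also have "\<dots> \<le> real (d * m choose d)" by (rule binomial_ge_n_over_k_pow_k) (simp add: m_def)
  finally have "m ^ d \<le> (d * m) choose d" by (metis of_nat_le_iff of_nat_power)
  also have "\<dots> \<le> C * (c * (d * m) + n0 + 1) ^ e" by (rule assms)
  also have "\<dots> \<le> C * ((c * d + n0 + 1) * m) ^ e"
    by (intro mult_left_mono power_mono) (auto simp: m_def algebra_simps)
  also have "\<dots> = D * m ^ e" by (simp only: D_def power_mult_distrib mult.assoc)
  finally have le: "m ^ d \<le> D * m ^ e" .
  have "m ^ d = m ^ (d - e) * m ^ e" using assms(2) by (simp add: power_add[symmetric])
  then have "m ^ (d - e) \<le> D" using le by (simp add: m_def)
  moreover have "m \<le> m ^ (d - e)" using assms(2) by (intro self_le_power) (auto simp: m_def)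
  ultimately show False by (simp add: m_def)
qed

section \<open>Artin-Rees and the growth forced by a chain of primes\<close>

context local_noetherian_ring
begin

text \<open>The locale gives uniqueness of the maximal ideal; that a proper ideal lies below some
  maximal ideal comes from Zorn's lemma, where the union of a chain is already a member of it by
  noetherianity.\<close>

lemma proper_ideal_subset:
  assumes I: "ideal I R" and "I \<noteq> carrier R"
  shows "I \<subseteq> \<mm>"
proof -
  let ?A = "{K. ideal K R \<and> I \<subseteq> K \<and> K \<noteq> carrier R}"
  have "\<exists>M\<in>?A. \<forall>X\<in>?A. M \<subseteq> X \<longrightarrow> X = M"
  proof (rule subset_Zorn_nonempty)
    show "?A \<noteq> {}" using assms by auto
    fix C assume C: "C \<noteq> {}" "subset.chain ?A C"
    have "subset.chain {I. ideal I R} C" using C(2) by (auto simp: pred_on.chain_def)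
    then have "\<Union>C \<in> C" by (rule ideal_chain_is_trivial[OF C(1)])
    then show "\<Union>C \<in> ?A" using C(2) by (auto simp: pred_on.chain_def)
  qed
  then obtain M where MA: "M \<in> ?A" and mA: "\<forall>X\<in>?A. M \<subseteq> X \<longrightarrow> X = M" by blast
  from MA have M: "ideal M R" "I \<subseteq> M" "M \<noteq> carrier R" by auto
  from mA have mx: "X = M" if "ideal X R" "I \<subseteq> X" "X \<noteq> carrier R" "M \<subseteq> X" for X using that by blast
  have "maximalideal M R"
  proof (rule maximalidealI[OF M(1)])
    show "carrier R \<noteq> M" using M(3) by simp
    fix X assume "ideal X R" "M \<subseteq> X" "X \<subseteq> carrier R"
    then show "X = M \<or> X = carrier R" using mx[of X] M(2) by blast
  qed
  then show ?thesis using maximal_unique M(2) by blast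
qed

text \<open>The intersections \<open>C n\<close> of the \<open>J\<close>-adic filtration modulo
  \<open>P\<close> with the ideal of \<open>z\<close> form a graded submodule over the generators of
  \<open>J\<close>, so \<open>graded_noetherian\<close> gives a degree \<open>N\<close> beyond which
  each \<open>C\<close> is generated by the preceding one. The shift \<open>c\<close> is this
  \<open>N\<close>; primality of \<open>P\<close> then cancels \<open>z\<close>.\<close>

lemma artin_rees:
  fixes t :: nat
  assumes x: "\<And>i. i < t \<Longrightarrow> x i \<in> carrier R" and J: "J = Idl (x ` {..<t})"
    and P: "primeideal P R" and z: "z \<in> carrier R" "z \<notin> P"
  shows "\<exists>c. \<forall>n a. a \<in> carrier R \<longrightarrow> z \<otimes> a \<in> P \<boxplus> ideal_power R J (n + c) \<longrightarrow> a \<in> P \<boxplus> ideal_power R J n"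
proof -
  have Pi: "ideal P R" using P by (rule primeideal.axioms)
  have Ji: "ideal J R" unfolding J by (rule gen_ideal[OF x])
  have Jp: "ideal (ideal_power R J n) R" for n by (rule ideal_power_ideal[OF Ji])
  have xJ: "x i \<in> J" if "i < t" for i unfolding J by (rule gen_mem[OF x that])
  have xJn: "x i \<otimes> a \<in> ideal_power R J (Suc n)" if "i < t" "a \<in> ideal_power R J n" for i a n
    using prodI[OF xJ[OF that(1)] that(2)] ideal_power_Suc2[OF Ji, of n] by simp
  define Z where "Z = mult_set R z (carrier R) \<boxplus> P"
  have zi: "ideal (mult_set R z (ideal_power R J n)) R" for n using mult_set_ideal[OF Jp z(1)] .
  have zc: "ideal (mult_set R z (carrier R)) R" using mult_set_ideal[OF oneideal z(1)] .
  have Z: "ideal Z R" unfolding Z_def by (rule add_ideals[OF zc Pi])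
  define A where "A = (\<lambda>n. ideal_power R J n \<boxplus> P)"
  define C where "C = (\<lambda>n. A n \<inter> Z)"
  have A: "ideal (A n) R" for n unfolding A_def by (rule add_ideals[OF Jp Pi])
  have C: "ideal (C n) R" for n unfolding C_def by (rule Int_ideal[OF A Z])
  have PA: "P \<subseteq> A n" and JA: "ideal_power R J n \<subseteq> A n" for n
    unfolding A_def using plus_upper2[OF Jp Pi] plus_upper1[OF Jp Pi] by - assumption+
  have PC: "P \<subseteq> C n" for n using PA plus_upper2[OF zc Pi] unfolding C_def Z_def by simp
  have xA: "x i \<otimes> a \<in> A (Suc n)" if i: "i < t" and a: "a \<in> A n" for i a n
  proof -
    obtain u p where up: "u \<in> ideal_power R J n" "p \<in> P" "a = u \<oplus> p" using a by (auto simp: A_def mem_set_add)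
    have "x i \<otimes> a = x i \<otimes> u \<oplus> x i \<otimes> p"
      using up idealD(8)[OF Jp] idealD(8)[OF Pi] x[OF i] by (simp add: r_distr)
    then show ?thesis unfolding A_def mem_set_add
      using xJn[OF i up(1)] idealD(6)[OF Pi x[OF i] up(2)] by blast
  qed
  have gpA: "graded_pair t x A (\<lambda>_. P)"
    unfolding graded_pair_def using A Pi PA xA idealD(6)[OF Pi x] by auto
  have gpC: "graded_pair t x C (\<lambda>_. P)"
    unfolding graded_pair_def using C Pi PC xA idealD(6)[OF Pi x] idealD(6)[OF Z x] by (auto simp: C_def)
  have fgA: "graded_fg t x A (\<lambda>_. P)"
    unfolding graded_fg_def
  proof (intro exI[of _ 0] allI impI)
    fix n :: nat
    have S: "ideal (lin_span R x t (A n) P) R" by (rule lin_span_ideal[OF A Pi x])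
    have "ideal_power R J (Suc n) \<subseteq> lin_span R x t (ideal_power R J n) P"
      unfolding ideal_power_Suc2[OF Ji] unfolding J by (rule prod_lin_span[OF x Jp[unfolded J] Pi])
    also have "\<dots> \<subseteq> lin_span R x t (A n) P"
    proof (rule lin_span_least[OF S lin_span_base[OF A Pi x]])
      fix i e assume "i < t" "e \<in> ideal_power R J n"
      then show "x i \<otimes> e \<in> lin_span R x t (A n) P" using lin_span_gen[of "A n" P t x i e] A Pi x JA by blast
    qed
    finally have "ideal_power R J (Suc n) \<boxplus> P \<subseteq> lin_span R x t (A n) P"
      using lin_span_base[OF A Pi x] by (rule plus_least[OF S])
    then show "A (Suc n) \<subseteq> lin_span R x t (A n) P" by (simp add: A_def)
  qed
  have "graded_fg t x C (\<lambda>_. P)"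
    by (rule graded_noetherian[OF noetherian x gpA fgA gpC]) (auto simp: C_def)
  then obtain N where N: "\<And>n. n \<ge> N \<Longrightarrow> C (Suc n) \<subseteq> lin_span R x t (C n) P"
    unfolding graded_fg_def by blast
  have zP: "ideal (mult_set R z (ideal_power R J n) \<boxplus> P) R" for n by (rule add_ideals[OF zi Pi])
  have key: "C (n + N) \<subseteq> mult_set R z (ideal_power R J n) \<boxplus> P" for n
  proof (induction n)
    case 0 then show ?case by (simp add: C_def Z_def ideal_power_0)
  next
    case (Suc n)
    let ?S = "mult_set R z (ideal_power R J (Suc n)) \<boxplus> P"
    have "lin_span R x t (C (n + N)) P \<subseteq> ?S"
    proof (rule lin_span_least[OF zP plus_upper2[OF zi Pi]])
      fix i e assume i: "i < t" and e: "e \<in> C (n + N)"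
      then obtain u p where up: "u \<in> ideal_power R J n" "p \<in> P" "e = z \<otimes> u \<oplus> p"
        using Suc unfolding subset_iff mem_set_add mult_set_def by blast
      have "x i \<otimes> e = z \<otimes> (x i \<otimes> u) \<oplus> x i \<otimes> p"
        using up idealD(8)[OF Jp] idealD(8)[OF Pi] x[OF i] z(1) by (simp add: r_distr m_lcomm)
      then show "x i \<otimes> e \<in> ?S" unfolding mem_set_add mult_set_def
        using xJn[OF i up(1)] idealD(6)[OF Pi x[OF i] up(2)] by blast
    qed
    then show ?case using N[of "n + N"] by auto
  qed
  show ?thesis
  proof (intro exI allI impI)
    fix n a assume a: "a \<in> carrier R" "z \<otimes> a \<in> P \<boxplus> ideal_power R J (n + N)"
    have "z \<otimes> a \<in> Z" using a(1) plus_upper1[OF zc Pi] by (auto simp: Z_def mult_set_def)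
    then have "z \<otimes> a \<in> C (n + N)" using a(2) plus_ideal_commute[OF Pi Jp] by (simp add: C_def A_def)
    then obtain u p where up: "u \<in> ideal_power R J n" "p \<in> P" "z \<otimes> a = z \<otimes> u \<oplus> p"
      using key[of n] unfolding subset_iff mem_set_add mult_set_def by blast
    have c: "u \<in> carrier R" "p \<in> carrier R" using up idealD(8)[OF Jp] idealD(8)[OF Pi] by auto
    have "z \<otimes> (a \<ominus> u) = z \<otimes> a \<ominus> z \<otimes> u" using z a c by (simp add: a_minus_def r_distr r_minus)
    also have "\<dots> = p" unfolding up(3) using z c by (simp add: add_cancel_left)
    finally have "z \<otimes> (a \<ominus> u) \<in> P" using up(2) by simp
    then have "a \<ominus> u \<in> P" using primeideal.I_prime[OF P z(1)] a(1) c(1) z(2) by (metis minus_closed)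
    moreover have "a = (a \<ominus> u) \<oplus> u" using a c by (simp add: a_minus_def a_assoc l_neg)
    ultimately show "a \<in> P \<boxplus> ideal_power R J n" using up(1) unfolding mem_set_add by blast
  qed
qed

text \<open>\<open>A\<close> is filtered modulo \<open>T\<close> by its multiples by powers of
  \<open>\<mm>\<close>, up to the exponent \<open>w\<close>. In the i-th quotient the products with
  \<open>D\<close> vanish, so its length is at most a fixed multiple of that of \<open>A/D\<close>;
  \<open>k\<close> adds up numbers of generators of the powers and depends on \<open>w\<close>
  alone.\<close>

lemma len_m_filter:
  "\<exists>k::nat. \<forall>A D T. ideal A R \<longrightarrow> ideal D R \<longrightarrow> ideal T R \<longrightarrow> D \<subseteq> A \<longrightarrow> T \<subseteq> A \<longrightarrow>
     ideal_power R \<mm> w \<cdot> A \<subseteq> T \<longrightarrow> (\<forall>i<w. ideal_power R \<mm> i \<cdot> D \<subseteq> T \<boxplus> ideal_power R \<mm> (Suc i) \<cdot> A)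
     \<longrightarrow> len T A \<le> enat k * len D A"
proof -
  have i: "ideal (ideal_power R \<mm> k) R" for k by (rule ideal_power_ideal[OF m_ideal])
  obtain \<mu> :: "nat \<Rightarrow> nat" where \<mu>: "\<And>k A B T. ideal A R \<and> ideal B R \<and> ideal T R \<and> B \<subseteq> A \<and> ideal_power R \<mm> k \<cdot> B \<subseteq> T
     \<Longrightarrow> len T (T \<boxplus> ideal_power R \<mm> k \<cdot> A) \<le> enat (\<mu> k) * len B A"
    using noetherian_len_prod_le[OF noetherian i] by metis
  have "len T A \<le> enat (\<Sum>i<w. \<mu> i) * len D A"
    if A: "ideal A R" and D: "ideal D R" and T: "ideal T R" and DA: "D \<subseteq> A" and TA: "T \<subseteq> A"
      and w: "ideal_power R \<mm> w \<cdot> A \<subseteq> T"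
      and f: "\<And>i. i < w \<Longrightarrow> ideal_power R \<mm> i \<cdot> D \<subseteq> T \<boxplus> ideal_power R \<mm> (Suc i) \<cdot> A" for A D T
  proof -
    define X where "X = (\<lambda>i. T \<boxplus> ideal_power R \<mm> i \<cdot> A)"
    have mA: "ideal (ideal_power R \<mm> i \<cdot> A) R" for i by (rule ideal_prod_is_ideal[OF \<open>\<And>k. ideal (ideal_power R \<mm> k) R\<close> A])
    have X: "ideal (X i) R" for i unfolding X_def by (rule add_ideals[OF T mA])
    have TX: "T \<subseteq> X i" and mX: "ideal_power R \<mm> i \<cdot> A \<subseteq> X i" for i
      unfolding X_def using plus_upper1[OF T mA] plus_upper2[OF T mA] by - assumption+
    have XX: "X (Suc i) \<subseteq> X i" for i
      unfolding X_def by (intro plus_mono order_refl prod_mono ideal_power_antimono[OF m_ideal]) auto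
    have "len (X j) A \<le> enat (\<Sum>i<j. \<mu> i) * len D A" if "j \<le> w" for j using that
    proof (induction j)
      case 0
      have "X 0 = A" unfolding X_def using plus_absorb[OF T A TA] prod_one[OF A] by (simp add: ideal_power_0)
      then show ?case by simp
    next
      case (Suc j)
      have XA: "X i \<subseteq> A" for i unfolding X_def by (rule plus_least[OF A TA prod_subset2[OF i A]])
      have "len (X (Suc j)) (X j) \<le> len (X (Suc j)) (X (Suc j) \<boxplus> ideal_power R \<mm> j \<cdot> A)"
      proof (rule chain_length_mono[OF order_refl])
        have "T \<boxplus> ideal_power R \<mm> j \<cdot> A \<subseteq> X (Suc j) \<boxplus> ideal_power R \<mm> j \<cdot> A"
          by (rule plus_mono[OF TX order_refl])
        then show "X j \<subseteq> X (Suc j) \<boxplus> ideal_power R \<mm> j \<cdot> A" by (simp add: X_def)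
      qed
      also have "\<dots> \<le> enat (\<mu> j) * len D A"
      proof -
        have "ideal_power R \<mm> j \<cdot> D \<subseteq> X (Suc j)" unfolding X_def by (rule f) (use Suc.prems in simp)
        then show ?thesis using A D X[of "Suc j"] DA by (intro \<mu> conjI)
      qed
      finally have "len (X (Suc j)) (X j) \<le> enat (\<mu> j) * len D A" .
      moreover have "len (X (Suc j)) A = len (X (Suc j)) (X j) + len (X j) A" by (rule len_add[OF X X A XX XA])
      moreover have "len (X j) A \<le> enat (\<Sum>i<j. \<mu> i) * len D A" using Suc by simp
      ultimately have "len (X (Suc j)) A \<le> enat (\<mu> j) * len D A + enat (\<Sum>i<j. \<mu> i) * len D A"
        by (simp add: add_mono)
      also have "\<dots> = enat (\<Sum>i<Suc j. \<mu> i) * len D A"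
        by (simp only: distrib_right[symmetric] plus_enat_simps(1) sum.lessThan_Suc add.commute)
      finally show ?case .
    qed
    from this[of w] have "len (X w) A \<le> enat (\<Sum>i<w. \<mu> i) * len D A" by simp
    moreover have "X w = T" unfolding X_def using plus_ideal_commute[OF T mA] plus_absorb[OF mA T w] by simp
    ultimately show ?thesis by simp
  qed
  then show ?thesis by blast
qed

text \<open>For \<open>z\<close> in \<open>P (i + 1)\<close> but not in \<open>P i\<close>, multiplication by \<open>z\<close> embeds \<open>R/P i\<close> into itself with
  cokernel mapping onto \<open>R/P (i + 1)\<close>; by the Artin--Rees lemma it shifts the \<open>J\<close>-adic filtration
  by a bounded amount only. This gives the recursion of the binomial coefficients.\<close>

lemma dim_growth:
  fixes t :: nat
  assumes x: "\<And>i. i < t \<Longrightarrow> x i \<in> carrier R" and J: "J = Idl (x ` {..<t})" "J \<subseteq> \<mm>"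
    and P: "\<And>i. i \<le> s \<Longrightarrow> primeideal (P i) R" "\<And>i. i < s \<Longrightarrow> P i \<subset> P (Suc i)"
  shows "\<exists>c. \<forall>n. enat (n choose s) \<le> len (ideal_power R J (c * n + 1)) (carrier R)"
proof -
  have Ji: "ideal J R" unfolding J by (rule gen_ideal[OF x])
  have Jp: "ideal (ideal_power R J n) R" for n by (rule ideal_power_ideal[OF Ji])
  have Pi: "ideal (P i) R" if "i \<le> s" for i using P(1)[OF that] by (rule primeideal.axioms)
  have "\<exists>z. z \<in> P (Suc i) \<and> z \<notin> P i" if "i < s" for i using P(2)[OF that] by blast
  then obtain z where z: "\<And>i. i < s \<Longrightarrow> z i \<in> P (Suc i) \<and> z i \<notin> P i" by metis
  have zc: "z i \<in> carrier R" if "i < s" for i using z[OF that] idealD(8)[OF Pi[of "Suc i"]] that by auto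
  have "\<exists>c. \<forall>n a. a \<in> carrier R \<longrightarrow> z i \<otimes> a \<in> P i \<boxplus> ideal_power R J (n + c) \<longrightarrow> a \<in> P i \<boxplus> ideal_power R J n"
    if i: "i < s" for i
    by (rule artin_rees[OF x J(1) P(1)]) (use i zc z in auto)
  then obtain c where c: "\<And>i n a. i < s \<Longrightarrow> a \<in> carrier R \<Longrightarrow> z i \<otimes> a \<in> P i \<boxplus> ideal_power R J (n + c i) \<Longrightarrow> a \<in> P i \<boxplus> ideal_power R J n"
    by metis
  \<comment> \<open>One shift for all primes of the chain, as \<open>chain_growth\<close>
    demands.\<close>
  define C where "C = (\<Sum>i<s. c i)"
  have cC: "c i \<le> C" if "i < s" for i unfolding C_def using that by (intro member_le_sum) auto
  define h where "h = (\<lambda>i n. len (P i \<boxplus> ideal_power R J n) (carrier R))"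
  have PJ: "ideal (P i \<boxplus> ideal_power R J n) R" if "i \<le> s" for i n by (rule add_ideals[OF Pi[OF that] Jp])
  have "enat (n choose s) \<le> h 0 (C * n + 1)" for n
  proof (rule chain_growth)
    fix i n assume i: "i < s"
    let ?I = "P i \<boxplus> ideal_power R J (n + C)"
    have I: "ideal ?I R" using PJ i by simp
    let ?Z = "mult_set R (z i) (carrier R)"
    have Z: "ideal ?Z R" by (rule mult_set_ideal[OF oneideal zc[OF i]])
    have ZI: "ideal (?Z \<boxplus> ?I) R" by (rule add_ideals[OF Z I])
    have 1: "h i n \<le> len ?I (?Z \<boxplus> ?I)"
      unfolding h_def
    proof (rule len_mult_ge[OF oneideal I zc[OF i]])
      fix d assume d: "d \<in> carrier R" "z i \<otimes> d \<in> ?I"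
      have "ideal_power R J (n + C) \<subseteq> ideal_power R J (n + c i)"
        using cC[OF i] by (intro ideal_power_antimono[OF Ji]) simp
      then have "z i \<otimes> d \<in> P i \<boxplus> ideal_power R J (n + c i)" using d(2) plus_mono[OF order_refl] by blast
      then show "d \<in> P i \<boxplus> ideal_power R J n" by (rule c[OF i d(1)])
    qed
    have i': "Suc i \<le> s" using i by simp
    have "?Z \<boxplus> ?I \<subseteq> P (Suc i) \<boxplus> ideal_power R J n"
    proof (rule plus_least[OF PJ[OF i']])
      have up: "P (Suc i) \<subseteq> P (Suc i) \<boxplus> ideal_power R J n" by (rule plus_upper1[OF Pi[OF i'] Jp])
      have "?Z \<subseteq> P (Suc i)" using z[OF i] idealD(7)[OF Pi[OF i']] by (auto simp: mult_set_subset)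
      then show "?Z \<subseteq> P (Suc i) \<boxplus> ideal_power R J n" using up by blast
      show "?I \<subseteq> P (Suc i) \<boxplus> ideal_power R J n"
        using P(2)[OF i] ideal_power_antimono[OF Ji, of n "n + C"] by (intro plus_mono) auto
    qed
    then have 2: "h (Suc i) n \<le> len (?Z \<boxplus> ?I) (carrier R)" unfolding h_def by (intro chain_length_mono) auto
    have "h i (n + C) = len ?I (?Z \<boxplus> ?I) + len (?Z \<boxplus> ?I) (carrier R)"
      unfolding h_def by (rule len_add[OF I ZI oneideal plus_upper2[OF Z I] idealD(1)[OF ZI]])
    then show "h i n + h (Suc i) n \<le> h i (n + C)" using add_mono[OF 1 2] by simp
  next
    fix n :: nat assume n: "1 \<le> n"
    have "P s \<subseteq> \<mm>" using proper_ideal_subset[OF Pi[of s]] primeideal.I_notcarr[OF P(1)[of s]] by auto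
    moreover have "ideal_power R J n \<subseteq> J" using ideal_power_antimono[OF Ji n] ideal_power_1[OF Ji] by simp
    ultimately have "P s \<boxplus> ideal_power R J n \<subseteq> \<mm>" using J(2) by (intro plus_least[OF m_ideal]) auto
    then have "len \<mm> (carrier R) \<le> h s n" unfolding h_def by (intro chain_length_mono) auto
    then show "1 \<le> h s n" by (simp add: len_residue)
  qed
  moreover have "h 0 n \<le> len (ideal_power R J n) (carrier R)" for n
    unfolding h_def using plus_upper2[OF Pi[of 0] Jp] by (intro chain_length_mono) auto
  ultimately show ?thesis by (meson order_trans)
qed

text \<open>Here the chain of primes meets the fibre ring. Since a power of \<open>\<mm>\<close>
  lies in \<open>J\<close>, each quotient of successive powers of \<open>J\<close> has length at
  most a constant times that of the fibre ring in the same degree. Small growth of the fibre ring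
  would keep the lengths modulo powers of \<open>J\<close> below a power with exponent
  \<open>d - 1\<close>, against \<open>dim_growth\<close>.\<close>

lemma fibre_not_small:
  fixes t :: nat
  assumes x: "\<And>i. i < t \<Longrightarrow> x i \<in> carrier R" and J: "J = Idl (x ` {..<t})" "J \<subseteq> \<mm>"
    and w: "ideal_power R \<mm> w \<subseteq> J"
    and P: "\<And>i. i \<le> d \<Longrightarrow> primeideal (P i) R" "\<And>i. i < d \<Longrightarrow> P i \<subset> P (Suc i)" and d: "d > 0"
  shows "\<not> small d (\<lambda>n. len (\<mm> \<cdot> ideal_power R J n) (ideal_power R J n))"
proof
  assume sm: "small d (\<lambda>n. len (\<mm> \<cdot> ideal_power R J n) (ideal_power R J n))"
  have Ji: "ideal J R" unfolding J by (rule gen_ideal[OF x])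
  have Jp: "ideal (ideal_power R J n) R" for n by (rule ideal_power_ideal[OF Ji])
  have mp: "ideal (ideal_power R \<mm> n) R" for n by (rule ideal_power_ideal[OF m_ideal])
  obtain k :: nat where k: "\<forall>A D T. ideal A R \<longrightarrow> ideal D R \<longrightarrow> ideal T R \<longrightarrow> D \<subseteq> A \<longrightarrow> T \<subseteq> A \<longrightarrow>
     ideal_power R \<mm> w \<cdot> A \<subseteq> T \<longrightarrow> (\<forall>i<w. ideal_power R \<mm> i \<cdot> D \<subseteq> T \<boxplus> ideal_power R \<mm> (Suc i) \<cdot> A)
     \<longrightarrow> len T A \<le> enat k * len D A" using len_m_filter[of w] by blast
  obtain f C where f: "\<And>n. enat k * len (\<mm> \<cdot> ideal_power R J n) (ideal_power R J n) \<le> enat (f n)"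
    "\<And>n. (n + 1) * (\<Sum>i\<le>n. f i) \<le> C * (n + 1) ^ d"
    using smallE[OF small_cmult[OF sm, of k]] by metis
  have step: "len (ideal_power R J (Suc n)) (ideal_power R J n) \<le> enat (f n)" for n
  proof -
    have mJ: "ideal (\<mm> \<cdot> ideal_power R J n) R" by (rule ideal_prod_is_ideal[OF m_ideal Jp])
    have "ideal_power R \<mm> w \<cdot> ideal_power R J n \<subseteq> ideal_power R J (Suc n)"
      unfolding ideal_power_Suc2[OF Ji] by (rule prod_mono[OF w order_refl])
    moreover have "ideal_power R \<mm> i \<cdot> (\<mm> \<cdot> ideal_power R J n) \<subseteq> ideal_power R J (Suc n) \<boxplus> ideal_power R \<mm> (Suc i) \<cdot> ideal_power R J n" for i
      unfolding ideal_prod_assoc[OF mp m_ideal Jp, symmetric] ideal_power_Suc[of \<mm>]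
      by (rule plus_upper2[OF Jp ideal_prod_is_ideal[OF ideal_prod_is_ideal[OF mp m_ideal] Jp]])
    ultimately have "len (ideal_power R J (Suc n)) (ideal_power R J n) \<le> enat k * len (\<mm> \<cdot> ideal_power R J n) (ideal_power R J n)"
      by (rule k[rule_format, OF Jp mJ Jp prod_subset2[OF m_ideal Jp] ideal_power_antimono[OF Ji le_SucI[OF order_refl]]])
    then show ?thesis using f(1)[of n] by (rule order_trans)
  qed
  have sum: "len (ideal_power R J n) (carrier R) \<le> enat (\<Sum>i<n. f i)" for n
  proof (induction n)
    case 0 then show ?case by (simp add: ideal_power_0)
  next
    case (Suc n)
    have "len (ideal_power R J (Suc n)) (carrier R) = len (ideal_power R J (Suc n)) (ideal_power R J n) + len (ideal_power R J n) (carrier R)"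
      by (rule len_add[OF Jp Jp oneideal ideal_power_antimono[OF Ji] idealD(1)[OF Jp]]) simp
    also have "\<dots> \<le> enat (f n) + enat (\<Sum>i<n. f i)" by (rule add_mono[OF step Suc])
    finally show ?case by (simp add: add.commute)
  qed
  obtain c where c: "\<And>n. enat (n choose d) \<le> len (ideal_power R J (c * n + 1)) (carrier R)"
    using dim_growth[of t x J d P] x J P by blast
  have "n choose d \<le> C * (c * n + 1 + 1) ^ (d - 1)" for n
  proof -
    have "enat (n choose d) \<le> enat (\<Sum>i<c * n + 1. f i)" using c[of n] sum by (rule order_trans)
    then have "n choose d \<le> (\<Sum>i<c * n + 1. f i)" by simp
    also have "\<dots> \<le> (\<Sum>i\<le>c * n + 1. f i)" by (intro sum_mono2) auto
    finally have "(c * n + 1 + 1) * (n choose d) \<le> C * (c * n + 1 + 1) ^ d"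
      by (rule order_trans[OF mult_le_mono2 f(2)])
    also have "\<dots> = (c * n + 1 + 1) * (C * (c * n + 1 + 1) ^ (d - 1))"
      using power_minus_mult[OF d, of "c * n + 1 + 1"] by (simp only: ac_simps)
    finally show ?thesis using mult_le_cancel1[of "c * n + 1 + 1"] by simp
  qed
  then show False by (rule binomial_not_bounded) (use d in simp)
qed

end

section \<open>Quotients of the fibre ring of full growth\<close>

context local_noetherian_ring
begin

text \<open>The graded ring with components \<open>J^n / Q n\<close> is generated by the
  \<open>s\<close> elements \<open>y i\<close>, so a nonzero form \<open>a\<close> has a
  representative \<open>a'\<close> built from these generators alone. The ring modulo
  \<open>a\<close> is then a quotient of the one treated in \<open>form_small\<close>.\<close>

lemma small_form_quotient:
  fixes s :: nat
  assumes y: "\<And>i. i < s \<Longrightarrow> y i \<in> carrier R" and K: "K = Idl (y ` {..<s})" and J: "ideal J R" and KJ: "K \<subseteq> J"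
    and Q: "\<And>n. ideal (Q n) R" "\<And>n. \<mm> \<cdot> ideal_power R J n \<subseteq> Q n"
    and Qmult: "\<And>q z n k. q \<in> Q n \<Longrightarrow> z \<in> ideal_power R J k \<Longrightarrow> z \<otimes> q \<in> Q (n + k)"
    and gen: "\<And>n. ideal_power R J n \<subseteq> ideal_power R K n \<boxplus> Q n"
    and a: "a \<in> ideal_power R J u" "a \<notin> Q u"
  shows "small s (\<lambda>n. len ((if u \<le> n then mult_set R a (ideal_power R J (n - u)) else {\<zero>}) \<boxplus> Q n) (ideal_power R J n))"
proof -
  have Ki: "ideal K R" unfolding K by (rule gen_ideal[OF y])
  have Jp: "ideal (ideal_power R J n) R" and Kp: "ideal (ideal_power R K n) R" for n
    using J Ki by (auto intro: ideal_power_ideal)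
  have KJp: "ideal_power R K n \<subseteq> ideal_power R J n" for n by (rule ideal_power_mono[OF KJ])
  have mK: "\<mm> \<cdot> ideal_power R K n \<subseteq> Q n" for n
    using prod_mono[OF order_refl KJp] Q(2) by (rule order_trans)
  have ac: "a \<in> carrier R" using a idealD(8)[OF Jp] by blast
  obtain a' q where aq: "a' \<in> ideal_power R K u" "q \<in> Q u" "a = a' \<oplus> q"
    using gen a(1) unfolding subset_iff mem_set_add by blast
  have c: "a' \<in> carrier R" "q \<in> carrier R" using aq idealD(8)[OF Kp] idealD(8)[OF Q(1)] by auto
  have "a' \<notin> Q u" using a(2) aq idealD(3)[OF Q(1)] by blast
  then have a'm: "a' \<notin> \<mm> \<cdot> ideal_power R K u" using mK by blast
  define T where "T = (\<lambda>n. (if u \<le> n then mult_set R a (ideal_power R J (n - u)) else {\<zero>}) \<boxplus> Q n)"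
  have t: "ideal (if u \<le> n then mult_set R a (ideal_power R J (n - u)) else {\<zero>}) R" for n
    using mult_set_ideal[OF Jp ac] zeroideal by simp
  have T: "ideal (T n) R" for n unfolding T_def by (rule add_ideals[OF t Q(1)])
  have QT: "Q n \<subseteq> T n" for n unfolding T_def by (rule plus_upper2[OF t Q(1)])
  have aT: "a \<otimes> k \<in> T n" if "u \<le> n" "k \<in> ideal_power R J (n - u)" for k n
    using plus_upper1[OF t Q(1), of n] that unfolding T_def mult_set_def by auto
  have fT: "form_part a' u K n \<subseteq> T n" for n
  proof
    fix e assume "e \<in> form_part a' u K n"
    then show "e \<in> T n"
    proof (cases rule: form_part_cases)
      case (1 k w)
      have k: "k \<in> ideal_power R J (n - u)" using 1(2) KJp by blast
      have kc: "k \<in> carrier R" "w \<in> carrier R"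
        using k 1(3) idealD(8)[OF Jp] idealD(8)[OF ideal_prod_is_ideal[OF m_ideal Kp]] by auto
      have e: "a' = a \<ominus> q" unfolding aq(3) using c by (simp add: add_cancel_right)
      have "(a \<ominus> q) \<otimes> k = a \<otimes> k \<ominus> q \<otimes> k"
        using ac c kc by (simp add: a_minus_def l_distr l_minus)
      then have "a' \<otimes> k = a \<otimes> k \<ominus> k \<otimes> q" using m_comm[OF c(2) kc(1)] e by metis
      moreover have "k \<otimes> q \<in> T n" using Qmult[OF aq(2) k] 1(1) QT by auto
      ultimately have "a' \<otimes> k \<in> T n" using aT[OF 1(1) k] idealD(5)[OF T] by simp
      moreover have "w \<in> T n" using 1(3) mK QT by blast
      ultimately show ?thesis unfolding 1(4) by (rule idealD(3)[OF T])
    next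
      case (2 w)
      have "w \<in> carrier R" using 2 idealD(8)[OF ideal_prod_is_ideal[OF m_ideal Kp]] by auto
      then show ?thesis using 2 mK QT by auto
    qed
  qed
  have "small s (\<lambda>n. len (form_part a' u K n) (ideal_power R K n))"
    unfolding K by (rule form_small[OF y]) (use aq a'm in \<open>simp_all add: K\<close>)
  then have "small s (\<lambda>n. len (T n) (ideal_power R J n))"
  proof (rule small_mono)
    fix n
    have "ideal_power R K n \<boxplus> Q n \<subseteq> ideal_power R K n \<boxplus> T n" by (rule plus_mono[OF order_refl QT])
    then have "len (T n) (ideal_power R J n) \<le> len (T n) (ideal_power R K n \<boxplus> T n)"
      using gen[of n] by (intro chain_length_mono) auto
    also have "\<dots> \<le> len (form_part a' u K n) (ideal_power R K n)"
      by (rule len_plus_le[OF Kp T form_part_subset[OF Ki aq(1)] fT])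
    finally show "len (T n) (ideal_power R J n) \<le> len (form_part a' u K n) (ideal_power R K n)" .
  qed
  then show ?thesis unfolding T_def .
qed

text \<open>A quotient of the fibre ring generated by \<open>s\<close> elements and of full dimension \<open>s\<close> is a
  polynomial ring, hence a domain.\<close>

lemma fibre_domain:
  fixes s :: nat
  assumes y: "\<And>i. i < s \<Longrightarrow> y i \<in> carrier R" and K: "K = Idl (y ` {..<s})" and J: "ideal J R" and KJ: "K \<subseteq> J"
    and Q: "\<And>n. ideal (Q n) R" "\<And>n. \<mm> \<cdot> ideal_power R J n \<subseteq> Q n" "\<And>n. Q n \<subseteq> ideal_power R J n"
    and Qmult: "\<And>q z n k. q \<in> Q n \<Longrightarrow> z \<in> ideal_power R J k \<Longrightarrow> z \<otimes> q \<in> Q (n + k)"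
    and gen: "\<And>n. ideal_power R J n \<subseteq> ideal_power R K n \<boxplus> Q n"
    and nsmall: "\<not> small s (\<lambda>n. len (Q n) (ideal_power R J n))"
    and a: "a \<in> ideal_power R J u" "a \<notin> Q u" and b: "b \<in> ideal_power R J v" "b \<notin> Q v"
  shows "a \<otimes> b \<notin> Q (u + v)"
proof
  assume ab: "a \<otimes> b \<in> Q (u + v)"
  have Jp: "ideal (ideal_power R J n) R" for n using J by (rule ideal_power_ideal)
  have c: "a \<in> carrier R" "b \<in> carrier R" using a b idealD(8)[OF Jp] by auto
  define T where "T = (\<lambda>c w n. (if w \<le> n then mult_set R c (ideal_power R J (n - w)) else {\<zero>}) \<boxplus> Q n)"
  have sm: "small s (\<lambda>n. len (T a u n) (ideal_power R J n))" "small s (\<lambda>n. len (T b v n) (ideal_power R J n))"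
    unfolding T_def using small_form_quotient[of s y K J Q, OF y K J KJ Q(1,2) Qmult gen] a b by auto
  have t: "ideal (if w \<le> n then mult_set R c (ideal_power R J (n - w)) else {\<zero>}) R" if "c \<in> carrier R" for c w n
    using mult_set_ideal[OF Jp that] zeroideal by simp
  have T: "ideal (T c w n) R" if "c \<in> carrier R" for c w n unfolding T_def by (rule add_ideals[OF t[OF that] Q(1)])
  have QT: "Q n \<subseteq> T c w n" if "c \<in> carrier R" for c w n unfolding T_def by (rule plus_upper2[OF t[OF that] Q(1)])
  have TJ: "T c w n \<subseteq> ideal_power R J n" if "c \<in> ideal_power R J w" for c w n
  proof -
    have "c \<otimes> k \<in> ideal_power R J n" if "w \<le> n" "k \<in> ideal_power R J (n - w)" for k
      using ideal_power_multI[OF J \<open>c \<in> ideal_power R J w\<close> that(2)] that(1) by simp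
    then show ?thesis unfolding T_def using idealD(2)[OF Jp] Q(3)
      by (intro plus_least[OF Jp]) (auto simp: mult_set_subset)
  qed
  \<comment> \<open>Since \<open>a \<otimes> b\<close> vanishes, the ideal of \<open>a\<close> is a
    shifted quotient of the ring modulo \<open>b\<close>. The ring is thus composed of the ideal of
    \<open>a\<close> and the ring modulo \<open>a\<close>, both of small growth.\<close>
  have le: "len (Q n) (T a u n) \<le> (if u \<le> n then len (T b v (n - u)) (ideal_power R J (n - u)) else 0)" for n
  proof (cases "u \<le> n")
    case True
    have "len (Q n) (mult_set R a (ideal_power R J (n - u)) \<boxplus> Q n) \<le> len (T b v (n - u)) (ideal_power R J (n - u))"
    proof (rule len_mult_le[OF Jp Q(1) c(1) TJ[OF b(1)]])
      fix e assume "e \<in> T b v (n - u)"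
      then obtain f q where fq: "f \<in> (if v \<le> n - u then mult_set R b (ideal_power R J (n - u - v)) else {\<zero>})"
          "q \<in> Q (n - u)" "e = f \<oplus> q" by (auto simp: T_def mem_set_add)
      have fc: "f \<in> carrier R" "q \<in> carrier R" using fq idealD(8)[OF t[OF c(2)]] idealD(8)[OF Q(1)] by blast+
      have 1: "a \<otimes> q \<in> Q n" using Qmult[OF fq(2) a(1)] True by simp
      have 2: "a \<otimes> f \<in> Q n"
      proof (cases "v \<le> n - u")
        case True
        then obtain k where k: "k \<in> ideal_power R J (n - u - v)" "f = b \<otimes> k" using fq(1) by (auto simp: mult_set_def)
        have kc: "k \<in> carrier R" using k idealD(8)[OF Jp] by blast
        have "k \<otimes> (a \<otimes> b) \<in> Q (u + v + (n - u - v))" by (rule Qmult[OF ab k(1)])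
        moreover have "k \<otimes> (a \<otimes> b) = a \<otimes> f" unfolding k(2) using kc c by (simp add: m_ac)
        moreover have "u + v + (n - u - v) = n" using True \<open>u \<le> n\<close> by simp
        ultimately show ?thesis by simp
      next
        case False
        then show ?thesis using fq(1) c idealD(2)[OF Q(1)] by simp
      qed
      show "a \<otimes> e \<in> Q n" unfolding fq(3) using idealD(3)[OF Q(1) 2 1] c fc by (simp add: r_distr)
    qed
    then show ?thesis using True by (simp add: T_def)
  next
    case False
    have "T a u n = Q n" unfolding T_def using False plus_absorb[OF zeroideal Q(1)] idealD(2)[OF Q(1)] by simp
    then show ?thesis using False by simp
  qed
  have "small s (\<lambda>n. (if u \<le> n then len (T b v (n - u)) (ideal_power R J (n - u)) else 0) + len (T a u n) (ideal_power R J n))"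
    by (rule small_add[OF small_unshift[OF sm(2)] sm(1)])
  then have "small s (\<lambda>n. len (Q n) (ideal_power R J n))"
  proof (rule small_mono)
    fix n
    have "len (Q n) (ideal_power R J n) = len (Q n) (T a u n) + len (T a u n) (ideal_power R J n)"
      by (rule len_add[OF Q(1) T[OF c(1)] Jp QT[OF c(1)] TJ[OF a(1)]])
    then show "len (Q n) (ideal_power R J n)
        \<le> (if u \<le> n then len (T b v (n - u)) (ideal_power R J (n - u)) else 0) + len (T a u n) (ideal_power R J n)"
      using le[of n] by (simp add: add_right_mono)
  qed
  then show False using nsmall by simp
qed

end

section \<open>Reductions of the maximal ideal\<close>

text \<open>The data extracted from the hypotheses of the theorem: generators \<open>x\<close> of
  \<open>J\<close>, the exponent \<open>r\<close> of the reduction equation, and a chain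
  \<open>P\<close> of \<open>d + 1\<close> primes as a witness for the dimension.\<close>

locale m_reduction = local_noetherian_ring R \<mm> for R (structure) and \<mm> +
  fixes d r :: nat and x :: "nat \<Rightarrow> 'a" and J :: "'a set" and P :: "nat \<Rightarrow> 'a set"
  assumes d_pos: "d > 0"
    and x_carrier: "i < d \<Longrightarrow> x i \<in> carrier R"
    and J_def: "J = Idl (x ` {..<d})"
    and J_subset: "J \<subseteq> \<mm>"
    and reduction: "ideal_power R \<mm> (Suc r) = J \<cdot> ideal_power R \<mm> r"
    and P_prime: "i \<le> d \<Longrightarrow> primeideal (P i) R"
    and P_chain: "i < d \<Longrightarrow> P i \<subset> P (Suc i)"
begin

lemma J_ideal: "ideal J R"
  unfolding J_def by (rule gen_ideal[OF x_carrier])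

lemma Jp: "ideal (ideal_power R J n) R"
  by (rule ideal_power_ideal[OF J_ideal])

lemma mp: "ideal (ideal_power R \<mm> n) R"
  by (rule ideal_power_ideal[OF m_ideal])

lemma mJ: "ideal (\<mm> \<cdot> ideal_power R J n) R"
  by (rule ideal_prod_is_ideal[OF m_ideal Jp])

lemma x_J: "i < d \<Longrightarrow> x i \<in> J"
  unfolding J_def by (rule gen_mem[OF x_carrier])

lemma m_power_J: "ideal_power R \<mm> (Suc r) \<subseteq> J"
  unfolding reduction by (rule prod_subset1[OF J_ideal mp])

lemma reduction_power: "ideal_power R \<mm> (n + r) = ideal_power R J n \<cdot> ideal_power R \<mm> r"
proof (induction n)
  case 0 then show ?case using prod_one[OF mp] by (simp add: ideal_power_0)
next
  case (Suc n)
  have "ideal_power R \<mm> (Suc n + r) = \<mm> \<cdot> ideal_power R \<mm> (n + r)"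
    using ideal_power_Suc2[OF m_ideal, of "n + r"] by (simp only: add_Suc)
  also have "\<dots> = \<mm> \<cdot> (ideal_power R J n \<cdot> ideal_power R \<mm> r)" by (simp only: Suc)
  also have "\<dots> = (ideal_power R J n \<cdot> \<mm>) \<cdot> ideal_power R \<mm> r"
    using ideal_prod_assoc[OF m_ideal Jp mp] ideal_prod_commute[OF m_ideal Jp] by metis
  also have "\<dots> = ideal_power R J n \<cdot> (J \<cdot> ideal_power R \<mm> r)"
    unfolding reduction[symmetric] ideal_power_Suc2[OF m_ideal] by (rule ideal_prod_assoc[OF Jp m_ideal mp])
  also have "\<dots> = ideal_power R J (Suc n) \<cdot> ideal_power R \<mm> r"
    unfolding ideal_power_Suc by (rule ideal_prod_assoc[OF Jp J_ideal mp, symmetric])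
  finally show ?case .
qed

text \<open>Together with \<open>J_power_m\<close> this shows that the two adic filtrations differ
  by the bounded shift \<open>r\<close>; finiteness of lengths and equality of the multiplicities
  rest on it.\<close>

lemma m_power_Jn: "ideal_power R \<mm> (n + r) \<subseteq> ideal_power R J n"
  unfolding reduction_power by (rule prod_subset1[OF Jp mp])

lemma m_power_mJn: "ideal_power R \<mm> (n + r + 1) \<subseteq> \<mm> \<cdot> ideal_power R J n"
  using ideal_power_Suc2[OF m_ideal, of "n + r"] prod_mono[OF order_refl m_power_Jn, of \<mm> n] by (simp only: Suc_eq_plus1)

lemma J_power_m: "ideal_power R J n \<subseteq> ideal_power R \<mm> n"
  by (rule ideal_power_mono[OF J_subset])

abbreviation head_ideal :: "nat \<Rightarrow> 'a set" where "head_ideal i \<equiv> Idl (x ` {..<i})"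

text \<open>The degree \<open>n\<close> part of the ideal generated by \<open>\<mm>\<close> and \<open>x\<^sub>0t, \<dots>, x\<^sub>i\<^sub>-\<^sub>1t\<close> in the Rees algebra.\<close>

definition fibre_ideal :: "nat \<Rightarrow> nat \<Rightarrow> 'a set" where
  "fibre_ideal i n = \<mm> \<cdot> ideal_power R J n \<boxplus> (case n of 0 \<Rightarrow> {\<zero>} | Suc k \<Rightarrow> head_ideal i \<cdot> ideal_power R J k)"

lemma head_ideal: "i \<le> d \<Longrightarrow> ideal (head_ideal i) R"
  by (rule gen_ideal) (use x_carrier in auto)

lemma head_part_ideal:
  "i \<le> d \<Longrightarrow> ideal (case n of 0 \<Rightarrow> {\<zero>} | Suc k \<Rightarrow> head_ideal i \<cdot> ideal_power R J k) R"
  by (cases n) (simp_all add: zeroideal ideal_prod_is_ideal head_ideal Jp)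

lemma fibre_ideal_ideal: "i \<le> d \<Longrightarrow> ideal (fibre_ideal i n) R"
  unfolding fibre_ideal_def by (intro add_ideals mJ head_part_ideal)

lemma fibre_ideal_m: "i \<le> d \<Longrightarrow> \<mm> \<cdot> ideal_power R J n \<subseteq> fibre_ideal i n"
  unfolding fibre_ideal_def by (intro plus_upper1 mJ head_part_ideal)

lemma fibre_ideal_head: "i \<le> d \<Longrightarrow> head_ideal i \<cdot> ideal_power R J k \<subseteq> fibre_ideal i (Suc k)"
  using plus_upper2[OF mJ head_part_ideal[of i "Suc k"], of "Suc k"] by (simp add: fibre_ideal_def)

lemma fibre_ideal_least:
  assumes "ideal T R" "\<mm> \<cdot> ideal_power R J n \<subseteq> T" "\<And>k. n = Suc k \<Longrightarrow> head_ideal i \<cdot> ideal_power R J k \<subseteq> T"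
  shows "fibre_ideal i n \<subseteq> T"
  unfolding fibre_ideal_def
  by (rule plus_least[OF assms(1,2)]) (use assms(3) idealD(2)[OF assms(1)] in \<open>auto split: nat.splits\<close>)

lemma head_subset_J: "i \<le> d \<Longrightarrow> head_ideal i \<subseteq> J"
  unfolding J_def by (rule gen_mono[OF x_carrier])

lemma fibre_ideal_subset: assumes "i \<le> d" shows "fibre_ideal i n \<subseteq> ideal_power R J n"
proof (rule fibre_ideal_least[OF Jp prod_subset2[OF m_ideal Jp]])
  fix k assume "n = Suc k"
  then show "head_ideal i \<cdot> ideal_power R J k \<subseteq> ideal_power R J n"
    using prod_mono[OF head_subset_J[OF assms] order_refl] ideal_power_Suc2[OF J_ideal, of k] by metis
qed

lemma fibre_ideal_mult:
  assumes i: "i \<le> d" and z: "z \<in> ideal_power R J k" and q: "q \<in> fibre_ideal i n"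
  shows "z \<otimes> q \<in> fibre_ideal i (n + k)"
proof -
  have F: "ideal (fibre_ideal i m) R" for m by (rule fibre_ideal_ideal[OF i])
  have zc: "z \<in> carrier R" using z idealD(8)[OF Jp] by blast
  have Z: "ideal {e \<in> carrier R. z \<otimes> e \<in> fibre_ideal i (n + k)} R" by (rule colon_ideal[OF oneideal F zc])
  have "fibre_ideal i n \<subseteq> {e \<in> carrier R. z \<otimes> e \<in> fibre_ideal i (n + k)}"
  proof (rule fibre_ideal_least[OF Z])
    show "\<mm> \<cdot> ideal_power R J n \<subseteq> {e \<in> carrier R. z \<otimes> e \<in> fibre_ideal i (n + k)}"
    proof
      fix e assume e: "e \<in> \<mm> \<cdot> ideal_power R J n"
      have "z \<otimes> e \<in> fibre_ideal i (k + n)" using m_power_mult[OF J_ideal z e] fibre_ideal_m[OF i] by blast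
      then show "e \<in> {e \<in> carrier R. z \<otimes> e \<in> fibre_ideal i (n + k)}"
        using idealD(8)[OF mJ e] by (simp add: add.commute)
    qed
    fix l assume l: "n = Suc l"
    show "head_ideal i \<cdot> ideal_power R J l \<subseteq> {e \<in> carrier R. z \<otimes> e \<in> fibre_ideal i (n + k)}"
    proof (rule prod_least[OF Z])
      fix u v assume uv: "u \<in> head_ideal i" "v \<in> ideal_power R J l"
      have c: "u \<in> carrier R" "v \<in> carrier R" using uv idealD(8)[OF head_ideal[OF i]] idealD(8)[OF Jp] by auto
      have "u \<otimes> (z \<otimes> v) \<in> head_ideal i \<cdot> ideal_power R J (k + l)"
        by (rule prodI[OF uv(1) ideal_power_multI[OF J_ideal z uv(2)]])
      moreover have "u \<otimes> (z \<otimes> v) = z \<otimes> (u \<otimes> v)" using c zc by (simp add: m_lcomm)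
      ultimately have "z \<otimes> (u \<otimes> v) \<in> fibre_ideal i (Suc (k + l))"
        using fibre_ideal_head[OF i, of "k + l"] by auto
      moreover have "n + k = Suc (k + l)" using l by simp
      ultimately show "u \<otimes> v \<in> {e \<in> carrier R. z \<otimes> e \<in> fibre_ideal i (n + k)}"
        using c by (simp only: mem_Collect_eq m_closed simp_thms)
    qed
  qed
  then show ?thesis using q by blast
qed

lemma fibre_ideal_0: "fibre_ideal 0 n = \<mm> \<cdot> ideal_power R J n"
proof
  have "head_ideal 0 \<cdot> ideal_power R J k = {\<zero>}" for k
    unfolding gen_zero using ideal_prod_zero[OF Jp] ideal_prod_commute[OF Jp zeroideal] by simp
  then show "fibre_ideal 0 n \<subseteq> \<mm> \<cdot> ideal_power R J n"
    by (intro fibre_ideal_least[OF mJ order_refl]) (simp only: empty_subsetI insert_subset idealD(2)[OF mJ])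
qed (rule fibre_ideal_m, simp)

lemma fibre_ideal_mono: "i \<le> j \<Longrightarrow> j \<le> d \<Longrightarrow> fibre_ideal i n \<subseteq> fibre_ideal j n"
proof (rule fibre_ideal_least)
  assume ij: "i \<le> j" "j \<le> d"
  show "ideal (fibre_ideal j n) R" by (rule fibre_ideal_ideal[OF ij(2)])
  show "\<mm> \<cdot> ideal_power R J n \<subseteq> fibre_ideal j n" by (rule fibre_ideal_m[OF ij(2)])
  fix k assume "n = Suc k"
  moreover have "head_ideal i \<cdot> ideal_power R J k \<subseteq> head_ideal j \<cdot> ideal_power R J k"
    by (intro prod_mono gen_mono order_refl) (use x_carrier ij in auto)
  ultimately show "head_ideal i \<cdot> ideal_power R J k \<subseteq> fibre_ideal j n" using fibre_ideal_head[OF ij(2)] by blast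
qed

lemma fibre_ideal_Suc:
  assumes "i < d" shows "fibre_ideal (Suc i) (Suc k) \<subseteq> mult_set R (x i) (ideal_power R J k) \<boxplus> fibre_ideal i (Suc k)"
proof (rule fibre_ideal_least)
  have i: "i \<le> d" using assms by simp
  have X: "ideal (mult_set R (x i) (ideal_power R J k)) R" by (rule mult_set_ideal[OF Jp x_carrier[OF assms]])
  show T: "ideal (mult_set R (x i) (ideal_power R J k) \<boxplus> fibre_ideal i (Suc k)) R"
    by (rule add_ideals[OF X fibre_ideal_ideal[OF i]])
  have up: "fibre_ideal i (Suc k) \<subseteq> mult_set R (x i) (ideal_power R J k) \<boxplus> fibre_ideal i (Suc k)"
    by (rule plus_upper2[OF X fibre_ideal_ideal[OF i]])
  show "\<mm> \<cdot> ideal_power R J (Suc k) \<subseteq> mult_set R (x i) (ideal_power R J k) \<boxplus> fibre_ideal i (Suc k)"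
    using fibre_ideal_m[OF i] up by (rule order_trans)
  fix l assume "Suc k = Suc l"
  then have l: "l = k" by simp
  have "head_ideal (Suc i) \<cdot> ideal_power R J k \<subseteq> mult_set R (x i) (ideal_power R J k) \<boxplus> head_ideal i \<cdot> ideal_power R J k"
    by (rule gen_span) (use x_carrier assms Jp in auto)
  also have "\<dots> \<subseteq> mult_set R (x i) (ideal_power R J k) \<boxplus> fibre_ideal i (Suc k)"
    by (rule plus_mono[OF order_refl fibre_ideal_head[OF i]])
  finally show "head_ideal (Suc i) \<cdot> ideal_power R J l \<subseteq> mult_set R (x i) (ideal_power R J k) \<boxplus> fibre_ideal i (Suc k)"
    unfolding l .
qed

text \<open>Multiplication by \<open>x i\<close> maps the ring modulo the first \<open>i\<close>
  variables onto the ideal of \<open>x i\<close>, with cokernel the ring modulo one more variable.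
  Unrolling this over the degrees gives a partial sum.\<close>

lemma fibre_len_le:
  assumes i: "i < d"
  shows "len (fibre_ideal i n) (ideal_power R J n) \<le> (\<Sum>k\<le>n. len (fibre_ideal (Suc i) k) (ideal_power R J k))"
proof (induction n)
  case 0
  have "fibre_ideal i 0 = fibre_ideal (Suc i) 0" by (simp add: fibre_ideal_def)
  then show ?case by simp
next
  case (Suc n)
  have i': "i \<le> d" "Suc i \<le> d" using i by auto
  have "len (fibre_ideal i (Suc n)) (ideal_power R J (Suc n))
     = len (fibre_ideal i (Suc n)) (fibre_ideal (Suc i) (Suc n)) + len (fibre_ideal (Suc i) (Suc n)) (ideal_power R J (Suc n))"
    by (rule len_add[OF fibre_ideal_ideal[OF i'(1)] fibre_ideal_ideal[OF i'(2)] Jp fibre_ideal_mono[OF le_SucI[OF order_refl] i'(2)] fibre_ideal_subset[OF i'(2)]])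
  also have "len (fibre_ideal i (Suc n)) (fibre_ideal (Suc i) (Suc n))
      \<le> len (fibre_ideal i (Suc n)) (mult_set R (x i) (ideal_power R J n) \<boxplus> fibre_ideal i (Suc n))"
    by (rule chain_length_mono[OF order_refl fibre_ideal_Suc[OF i]])
  also have "\<dots> \<le> len (fibre_ideal i n) (ideal_power R J n)"
  proof (rule len_mult_le[OF Jp fibre_ideal_ideal[OF i'(1)] x_carrier[OF i] fibre_ideal_subset[OF i'(1)]])
    fix e assume "e \<in> fibre_ideal i n"
    moreover have "x i \<in> ideal_power R J 1" using x_J[OF i] ideal_power_1[OF J_ideal] by simp
    ultimately show "x i \<otimes> e \<in> fibre_ideal i (Suc n)" using fibre_ideal_mult[OF i'(1), of "x i" 1 e n] by simp
  qed
  also note Suc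
  finally show ?case by (simp add: add_right_mono)
qed

text \<open>By \<open>fibre_len_le\<close>, killing one variable lowers the growth exponent by at
  most one; the induction starts from \<open>fibre_not_small\<close>.\<close>

lemma fibre_ideal_not_small:
  assumes "i \<le> d" shows "\<not> small (d - i) (\<lambda>n. len (fibre_ideal i n) (ideal_power R J n))"
  using assms
proof (induction i)
  case 0
  show ?case unfolding fibre_ideal_0
    using fibre_not_small[of d x J "Suc r" d P] x_carrier J_def J_subset m_power_J P_prime P_chain d_pos by simp
next
  case (Suc i)
  have i: "i < d" and e: "d - i = Suc (d - Suc i)" using Suc.prems by auto
  show ?case
  proof
    assume "small (d - Suc i) (\<lambda>n. len (fibre_ideal (Suc i) n) (ideal_power R J n))"
    then have "small (d - i) (\<lambda>n. \<Sum>k\<le>n. len (fibre_ideal (Suc i) k) (ideal_power R J k))"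
      unfolding e by (rule small_conv)
    then have "small (d - i) (\<lambda>n. len (fibre_ideal i n) (ideal_power R J n))"
      by (rule small_mono) (rule fibre_len_le[OF i])
    then show False using Suc by simp
  qed
qed

abbreviation tail_ideal :: "nat \<Rightarrow> 'a set" where "tail_ideal i \<equiv> Idl ((\<lambda>j. x (i + j)) ` {..<d - i})"

lemma tail_subset_J: "tail_ideal i \<subseteq> J"
  by (rule genideal_minimal[OF J_ideal]) (use x_J in auto)

lemma tail_carrier: "j < d - i \<Longrightarrow> x (i + j) \<in> carrier R"
  using x_carrier by simp

lemma tail_ideal: "ideal (tail_ideal i) R"
  by (rule gen_ideal[OF tail_carrier])

lemma J_split: assumes "i \<le> d" shows "J \<subseteq> head_ideal i \<boxplus> tail_ideal i"
  unfolding J_def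
proof (rule genideal_minimal)
  show S: "ideal (head_ideal i \<boxplus> tail_ideal i) R" by (rule add_ideals[OF head_ideal[OF assms] tail_ideal])
  show "x ` {..<d} \<subseteq> head_ideal i \<boxplus> tail_ideal i"
  proof
    fix z assume "z \<in> x ` {..<d}"
    then obtain j where j: "j < d" "z = x j" by auto
    show "z \<in> head_ideal i \<boxplus> tail_ideal i"
    proof (cases "j < i")
      case True
      then have "z \<in> head_ideal i" using gen_mem[of i x j] x_carrier assms j by auto
      then show ?thesis using plus_upper1[OF head_ideal[OF assms] tail_ideal] by blast
    next
      case False
      then have "z \<in> tail_ideal i" using gen_mem[of "d - i" "\<lambda>j. x (i + j)" "j - i"] tail_carrier j by auto
      then show ?thesis using plus_upper2[OF head_ideal[OF assms] tail_ideal] by blast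
    qed
  qed
qed

text \<open>Modulo the first \<open>i\<close> variables the remaining \<open>d - i\<close> generate.
  This number equals the exponent in \<open>fibre_ideal_not_small\<close>, which is the match that
  \<open>fibre_domain\<close> asks for.\<close>

lemma J_power_split:
  assumes i: "i \<le> d" shows "ideal_power R J n \<subseteq> ideal_power R (tail_ideal i) n \<boxplus> fibre_ideal i n"
proof (induction n)
  case 0
  show ?case using plus_upper1[OF oneideal fibre_ideal_ideal[OF i]] by (simp add: ideal_power_0)
next
  case (Suc n)
  let ?K = "tail_ideal i"
  have Kp: "ideal (ideal_power R ?K k) R" for k by (rule ideal_power_ideal[OF tail_ideal])
  let ?S = "ideal_power R ?K (Suc n) \<boxplus> fibre_ideal i (Suc n)"
  have F: "ideal (fibre_ideal i k) R" for k by (rule fibre_ideal_ideal[OF i])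
  have S: "ideal ?S R" by (rule add_ideals[OF Kp F])
  have up1: "ideal_power R ?K (Suc n) \<subseteq> ?S" by (rule plus_upper1[OF Kp F])
  have up2: "fibre_ideal i (Suc n) \<subseteq> ?S" by (rule plus_upper2[OF Kp F])
  show ?case
    unfolding ideal_power_Suc2[OF J_ideal]
  proof (rule prod_least[OF S])
    fix u v assume u: "u \<in> J" and v: "v \<in> ideal_power R J n"
    obtain h k where hk: "h \<in> head_ideal i" "k \<in> ?K" "u = h \<oplus> k"
      using J_split[OF i] u unfolding subset_iff mem_set_add by blast
    obtain l f where lf: "l \<in> ideal_power R ?K n" "f \<in> fibre_ideal i n" "v = l \<oplus> f"
      using Suc v unfolding subset_iff mem_set_add by blast
    have c: "h \<in> carrier R" "k \<in> carrier R" "l \<in> carrier R" "f \<in> carrier R" "v \<in> carrier R"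
      using hk lf v idealD(8)[OF head_ideal[OF i]] idealD(8)[OF tail_ideal] idealD(8)[OF Kp] idealD(8)[OF F] idealD(8)[OF Jp] by blast+
    have 1: "h \<otimes> v \<in> ?S" using prodI[OF hk(1) v] fibre_ideal_head[OF i] up2 by blast
    have 2: "k \<otimes> l \<in> ?S" using prodI[OF hk(2) lf(1)] ideal_power_Suc2[OF tail_ideal, of i n] up1 by blast
    have "k \<in> ideal_power R J 1" using hk(2) tail_subset_J ideal_power_1[OF J_ideal] by auto
    then have 3: "k \<otimes> f \<in> ?S" using fibre_ideal_mult[OF i _ lf(2), of k 1] up2 by auto
    have "k \<otimes> v = k \<otimes> l \<oplus> k \<otimes> f" unfolding lf(3) using c by (simp add: r_distr)
    then have "k \<otimes> v \<in> ?S" using idealD(3)[OF S 2 3] by simp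
    moreover have "u \<otimes> v = h \<otimes> v \<oplus> k \<otimes> v" unfolding hk(3) using c by (simp add: l_distr)
    ultimately show "u \<otimes> v \<in> ?S" using idealD(3)[OF S 1] by simp
  qed
qed

lemma fibre_ideal_prime:
  assumes "i \<le> d" "a \<in> ideal_power R J u" "a \<notin> fibre_ideal i u" "b \<in> ideal_power R J v" "b \<notin> fibre_ideal i v"
  shows "a \<otimes> b \<notin> fibre_ideal i (u + v)"
  by (rule fibre_domain[OF tail_carrier refl J_ideal tail_subset_J, of i])
    (use assms fibre_ideal_ideal fibre_ideal_m fibre_ideal_subset fibre_ideal_mult J_power_split fibre_ideal_not_small in auto)

text \<open>If \<open>x i\<close> already belonged to the ideal of the earlier variables, the
  quotient would be generated by \<open>d - i - 1\<close> elements, too few for its growth. This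
  makes the chain of primes in the Rees algebra strict.\<close>

lemma x_notin_fibre_ideal:
  assumes i: "i < d" shows "x i \<notin> fibre_ideal i 1"
proof
  assume x: "x i \<in> fibre_ideal i 1"
  have i': "i \<le> d" "Suc i \<le> d" using i by auto
  let ?K = "tail_ideal (Suc i)"
  have Kp: "ideal (ideal_power R ?K k) R" for k by (rule ideal_power_ideal[OF tail_ideal])
  have sub: "fibre_ideal (Suc i) n \<subseteq> fibre_ideal i n" for n
  proof (cases n)
    case 0 then show ?thesis by (simp add: fibre_ideal_def)
  next
    case (Suc k)
    have "mult_set R (x i) (ideal_power R J k) \<subseteq> fibre_ideal i (Suc k)"
      unfolding mult_set_subset
    proof
      fix a assume a: "a \<in> ideal_power R J k"
      have "a \<otimes> x i \<in> fibre_ideal i (1 + k)" by (rule fibre_ideal_mult[OF i'(1) a x])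
      then show "x i \<otimes> a \<in> fibre_ideal i (Suc k)" using m_comm[OF x_carrier[OF i] idealD(8)[OF Jp a]] by simp
    qed
    then have "mult_set R (x i) (ideal_power R J k) \<boxplus> fibre_ideal i (Suc k) \<subseteq> fibre_ideal i (Suc k)"
      by (intro plus_least[OF fibre_ideal_ideal[OF i'(1)]]) auto
    then show ?thesis using fibre_ideal_Suc[OF i] Suc by blast
  qed
  have "small (Suc (d - Suc i)) (\<lambda>n. len (\<mm> \<cdot> ideal_power R ?K n) (ideal_power R ?K n))"
    by (rule len_fibre_small[OF tail_carrier])
  then have "small (d - i) (\<lambda>n. len (fibre_ideal i n) (ideal_power R J n))"
    unfolding Suc_diff_Suc[OF i]
  proof (rule small_mono)
    fix n
    have F: "ideal (fibre_ideal i n) R" by (rule fibre_ideal_ideal[OF i'(1)])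
    have "ideal_power R J n \<subseteq> ideal_power R ?K n \<boxplus> fibre_ideal i n"
      using J_power_split[OF i'(2), of n] plus_mono[OF order_refl sub] by (rule order_trans)
    then have "len (fibre_ideal i n) (ideal_power R J n) \<le> len (fibre_ideal i n) (ideal_power R ?K n \<boxplus> fibre_ideal i n)"
      by (rule chain_length_mono[OF order_refl])
    also have "\<dots> \<le> len (\<mm> \<cdot> ideal_power R ?K n) (ideal_power R ?K n)"
    proof (rule len_plus_le[OF Kp F prod_subset2[OF m_ideal Kp]])
      have "\<mm> \<cdot> ideal_power R ?K n \<subseteq> \<mm> \<cdot> ideal_power R J n"
        by (intro prod_mono order_refl ideal_power_mono tail_subset_J)
      then show "\<mm> \<cdot> ideal_power R ?K n \<subseteq> fibre_ideal i n" using fibre_ideal_m[OF i'(1)] by blast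
    qed
    finally show "len (fibre_ideal i n) (ideal_power R J n) \<le> len (\<mm> \<cdot> ideal_power R ?K n) (ideal_power R ?K n)" .
  qed
  then show False using fibre_ideal_not_small[OF i'(1)] by simp
qed

end

section \<open>Hilbert polynomials of the fibre ring, of the two filtrations and of the Sally
  module\<close>

lemma has_num_poly_shift_iter:
  assumes "has_num_poly (Suc s) c f"
  shows "\<exists>c'. has_num_poly (Suc s) c' (\<lambda>n. f (n - k)) \<and> c' s = c s"
proof (induction k)
  case 0 then show ?case using assms by auto
next
  case (Suc k)
  then obtain c' where c': "has_num_poly (Suc s) c' (\<lambda>n. f (n - k))" "c' s = c s" by blast
  have "has_num_poly (Suc s) (\<lambda>i. c' i - c' (Suc i)) (\<lambda>n. f (n - 1 - k))" by (rule has_num_poly_shift[OF c'(1)])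
  moreover have "c' (Suc s) = 0" using c'(1) by (simp add: has_num_poly_def)
  ultimately show ?case using c'(2) by (intro exI[of _ "\<lambda>i. c' i - c' (Suc i)"]) simp
qed

text \<open>With \<open>s\<close> coefficients the degree is below \<open>s\<close>, so the partial
  sums are bounded by a power with exponent \<open>s\<close>; the extra factor in
  \<open>small\<close> turns this into \<open>Suc s\<close>.\<close>

lemma has_num_poly_small:
  assumes "has_num_poly s c (\<lambda>n. int (f n))"
  shows "small (Suc s) (\<lambda>n. enat (f n))"
proof -
  have "\<exists>c'. has_num_poly (Suc s) c' (\<lambda>n. int (\<Sum>i\<le>n. f i))"
    by (rule has_num_poly_sum[OF assms]) simp
  then obtain C where C: "C \<ge> 0" "\<And>n. int (\<Sum>i\<le>n. f i) \<le> C * (int n + 1) ^ s"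
    using has_num_poly_bound by blast
  show ?thesis
  proof (rule smallI[where f = f and C = "nat C"])
    fix n
    have "int (\<Sum>i\<le>n. f i) \<le> int (nat C * (n + 1) ^ s)" using C by (simp add: add.commute)
    then have "(\<Sum>i\<le>n. f i) \<le> nat C * (n + 1) ^ s" by linarith
    then have "(n + 1) * (\<Sum>i\<le>n. f i) \<le> (n + 1) * (nat C * (n + 1) ^ s)" by (rule mult_le_mono2)
    then show "(n + 1) * (\<Sum>i\<le>n. f i) \<le> nat C * (n + 1) ^ Suc s" by (simp only: power_Suc ac_simps)
  qed simp
qed

text \<open>By the hockey-stick identity, all coefficients of the Hilbert function of the polynomial
  ring in \<open>d\<close> variables are 1 in the chosen basis.\<close>

lemma has_num_poly_binomial:
  assumes "d > 0"
  shows "has_num_poly d (\<lambda>k. if k < d then 1 else 0) (\<lambda>n. int ((n + d - 1) choose n))"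
  unfolding has_num_poly_def
proof (intro conjI allI impI)
  obtain e where e: "d = Suc e" using assms by (cases d) auto
  have "int ((n + d - 1) choose n) = (\<Sum>k<d. (if k < d then 1 else 0) * int ((n + k - 1) choose k))" if n1: "n \<ge> 1" for n
  proof -
    obtain m where m: "n = Suc m" using n1 by (cases n) auto
    have "(\<Sum>k<d. (if k < d then 1 else 0) * int ((n + k - 1) choose k)) = int (\<Sum>k\<le>e. (m + k) choose k)"
      unfolding e m by (simp only: lessThan_Suc_atMost of_nat_sum) (intro sum.cong, auto)
    also have "(\<Sum>k\<le>e. (m + k) choose k) = Suc (m + e) choose e" by (rule sum_choose_lower)
    also have "\<dots> = (n + d - 1) choose n" unfolding e m using binomial_symmetric[of e "Suc (m + e)"] by (simp add: Suc_diff_le)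
    finally show ?thesis by simp
  qed
  then show "\<forall>\<^sub>F n in sequentially. int ((n + d - 1) choose n) = (\<Sum>k<d. (if k < d then 1 else 0) * int ((n + k - 1) choose k))"
    unfolding eventually_sequentially by blast
qed simp

lemma the_enat_mono: "\<lbrakk>a \<le> b; b \<noteq> \<infinity>\<rbrakk> \<Longrightarrow> the_enat a \<le> the_enat b"
  by (cases a; cases b) auto

context m_reduction
begin

lemma len_fin_m: assumes "ideal_power R \<mm> k \<subseteq> I" "A \<subseteq> carrier R" shows "enat (fin_len I A) = len I A"
  using len_finite[OF assms] by (cases "len I A") auto

lemma fin_J: "A \<subseteq> carrier R \<Longrightarrow> enat (fin_len (ideal_power R J n) A) = len (ideal_power R J n) A"
  by (rule len_fin_m[OF m_power_Jn])

lemma fin_m: "A \<subseteq> carrier R \<Longrightarrow> enat (fin_len (ideal_power R \<mm> n) A) = len (ideal_power R \<mm> n) A"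
  by (rule len_fin_m[OF order_refl])

lemma fin_mJ: "A \<subseteq> carrier R \<Longrightarrow> enat (fin_len (\<mm> \<cdot> ideal_power R J n) A) = len (\<mm> \<cdot> ideal_power R J n) A"
  by (rule len_fin_m[OF m_power_mJn])

lemma x_power: "i < d \<Longrightarrow> a \<in> ideal_power R J n \<Longrightarrow> x i \<otimes> a \<in> ideal_power R J (Suc n)"
  using prodI[OF x_J, of i a "ideal_power R J n"] ideal_power_Suc2[OF J_ideal, of n] by simp

lemma x_m_power: "i < d \<Longrightarrow> a \<in> ideal_power R \<mm> n \<Longrightarrow> x i \<otimes> a \<in> ideal_power R \<mm> (Suc n)"
  using prodI[of "x i" \<mm> a "ideal_power R \<mm> n"] x_J[of i] J_subset ideal_power_Suc2[OF m_ideal, of n] by auto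

lemma J_prod_span: "ideal A R \<Longrightarrow> ideal T R \<Longrightarrow> J \<cdot> A \<subseteq> lin_span R x d A T"
  unfolding J_def by (rule prod_lin_span[OF x_carrier])

lemma fibre_poly: "\<exists>c. has_num_poly d c (\<lambda>n. int (fin_len (\<mm> \<cdot> ideal_power R J n) (ideal_power R J n)))"
proof (rule hilbert_serre[OF noetherian x_carrier])
  show "graded_pair d x (ideal_power R J) (\<lambda>n. \<mm> \<cdot> ideal_power R J n)"
    unfolding graded_pair_def
  proof (intro conjI allI impI ballI)
    fix n show "ideal (ideal_power R J n) R" "ideal (\<mm> \<cdot> ideal_power R J n) R" by (rule Jp mJ)+
    show "\<mm> \<cdot> ideal_power R J n \<subseteq> ideal_power R J n" by (rule prod_subset2[OF m_ideal Jp])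
    fix i assume i: "i < d"
    show "a \<in> ideal_power R J n \<Longrightarrow> x i \<otimes> a \<in> ideal_power R J (Suc n)" for a by (rule x_power[OF i])
    have xi: "x i \<in> ideal_power R J 1" using x_J[OF i] ideal_power_1[OF J_ideal] by simp
    show "b \<in> \<mm> \<cdot> ideal_power R J n \<Longrightarrow> x i \<otimes> b \<in> \<mm> \<cdot> ideal_power R J (Suc n)" for b
      using m_power_mult[OF J_ideal xi, of b n] by simp
  qed
  show "graded_fg d x (ideal_power R J) (\<lambda>n. \<mm> \<cdot> ideal_power R J n)"
    unfolding graded_fg_def ideal_power_Suc2[OF J_ideal] using J_prod_span[OF Jp ideal_prod_is_ideal[OF m_ideal ideal_prod_is_ideal[OF J_ideal Jp]]] by blast
  show "len (\<mm> \<cdot> ideal_power R J n) (ideal_power R J n) \<noteq> \<infinity>" for n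
    using fin_mJ[OF idealD(1)[OF Jp], of n n] by (metis enat.distinct(2))
qed

text \<open>The coefficient is an integer: at least 0 because lengths are, not 0 because the growth
  is not small, and at most 1 by comparison with the polynomial ring.\<close>

lemma fibre_poly_lead:
  assumes c: "has_num_poly d c (\<lambda>n. int (fin_len (\<mm> \<cdot> ideal_power R J n) (ideal_power R J n)))"
  shows "c (d - 1) = 1"
proof -
  obtain e where e: "d = Suc e" using d_pos by (cases d) auto
  have fin: "enat (fin_len (\<mm> \<cdot> ideal_power R J n) (ideal_power R J n)) = len (\<mm> \<cdot> ideal_power R J n) (ideal_power R J n)" for n
    by (rule fin_mJ[OF idealD(1)[OF Jp]])
  have "c e \<ge> 0" by (rule has_num_poly_lead_nonneg[OF c[unfolded e]]) simp
  moreover have "c e \<noteq> 0"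
  proof
    assume "c e = 0"
    then have "has_num_poly e c (\<lambda>n. int (fin_len (\<mm> \<cdot> ideal_power R J n) (ideal_power R J n)))"
      by (rule has_num_poly_drop[OF c[unfolded e]])
    from has_num_poly_small[OF this] have "small d (\<lambda>n. len (\<mm> \<cdot> ideal_power R J n) (ideal_power R J n))"
      by (simp add: fin e)
    then show False using fibre_ideal_not_small[of 0] by (simp add: fibre_ideal_0)
  qed
  moreover have "1 - c e \<ge> 0"
  proof -
    have "has_num_poly (Suc e) (\<lambda>k. (if k < d then 1 else 0) - c k) (\<lambda>n. int ((n + d - 1) choose n) - int (fin_len (\<mm> \<cdot> ideal_power R J n) (ideal_power R J n)))"
      using has_num_poly_diff[OF has_num_poly_binomial[OF d_pos] c] e by simp
    moreover have "fin_len (\<mm> \<cdot> ideal_power R J n) (ideal_power R J n) \<le> (n + d - 1) choose n" for n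
    proof -
      have "len (\<mm> \<cdot> ideal_power R J n) (ideal_power R J n) \<le> enat ((n + d - 1) choose n)"
        unfolding J_def by (rule len_fibre_binomial[OF x_carrier])
      then show ?thesis using fin[of n] by (metis enat_ord_simps(1))
    qed
    ultimately have "(if e < d then 1 else 0) - c e \<ge> 0" by (intro has_num_poly_lead_nonneg) auto
    then show ?thesis using e by simp
  qed
  ultimately show ?thesis using e by simp
qed

lemma hilbert_poly_exists:
  assumes I: "ideal I R" and xI: "\<And>i n a. i < d \<Longrightarrow> a \<in> ideal_power R I n \<Longrightarrow> x i \<otimes> a \<in> ideal_power R I (Suc n)"
    and fg: "\<And>n. n \<ge> N \<Longrightarrow> ideal_power R I (Suc n) = J \<cdot> ideal_power R I n"
    and k: "\<And>n. ideal_power R \<mm> (n + r) \<subseteq> ideal_power R I n"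
  shows "\<exists>c. has_num_poly (Suc d) c (\<lambda>n. int (fin_len (ideal_power R I n) (carrier R)))"
proof -
  have Ip: "ideal (ideal_power R I n) R" for n by (rule ideal_power_ideal[OF I])
  have sub: "ideal_power R I (Suc n) \<subseteq> ideal_power R I n" for n by (rule ideal_power_antimono[OF I]) simp
  have fin: "enat (fin_len (ideal_power R I n) A) = len (ideal_power R I n) A" if "A \<subseteq> carrier R" for n A
    by (rule len_fin_m[OF k that])
  have "\<exists>c. has_num_poly d c (\<lambda>n. int (fin_len (ideal_power R I (Suc n)) (ideal_power R I n)))"
  proof (rule hilbert_serre[OF noetherian x_carrier])
    show "graded_pair d x (ideal_power R I) (\<lambda>n. ideal_power R I (Suc n))"
      unfolding graded_pair_def using Ip sub xI by blast
    show "graded_fg d x (ideal_power R I) (\<lambda>n. ideal_power R I (Suc n))"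
      unfolding graded_fg_def using fg J_prod_span[OF Ip Ip] by metis
    show "len (ideal_power R I (Suc n)) (ideal_power R I n) \<noteq> \<infinity>" for n
      using fin[OF idealD(1)[OF Ip], of "Suc n" n] by (metis enat.distinct(2))
  qed
  then obtain c where c: "has_num_poly d c (\<lambda>n. int (fin_len (ideal_power R I (Suc n)) (ideal_power R I n)))" by blast
  show ?thesis
  \<comment> \<open>The step from \<open>n\<close> to \<open>n + 1\<close> adds the component of
    degree \<open>n\<close>, whereas summation expects a function evaluated at \<open>n + 1\<close>;
    hence the shift.\<close>
  proof (rule has_num_poly_sum[OF has_num_poly_shift[OF c]])
    have "int (fin_len (ideal_power R I (Suc n)) (carrier R)) - int (fin_len (ideal_power R I n) (carrier R))
      = int (fin_len (ideal_power R I (Suc (Suc n - 1))) (ideal_power R I (Suc n - 1)))" for n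
    proof -
      have "len (ideal_power R I (Suc n)) (carrier R) = len (ideal_power R I (Suc n)) (ideal_power R I n) + len (ideal_power R I n) (carrier R)"
        by (rule len_add[OF Ip Ip oneideal sub idealD(1)[OF Ip]])
      then have "fin_len (ideal_power R I (Suc n)) (carrier R) = fin_len (ideal_power R I (Suc n)) (ideal_power R I n) + fin_len (ideal_power R I n) (carrier R)"
        using fin[OF order_refl, of "Suc n"] fin[OF order_refl, of n] fin[OF idealD(1)[OF Ip], of "Suc n" n]
        by (metis plus_enat_simps(1) enat.inject)
      then show ?thesis by simp
    qed
    then show "\<forall>\<^sub>F n in sequentially. int (fin_len (ideal_power R I (Suc n)) (carrier R)) - int (fin_len (ideal_power R I n) (carrier R))
      = int (fin_len (ideal_power R I (Suc (Suc n - 1))) (ideal_power R I (Suc n - 1)))" by simp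
  qed
qed

lemma hilbert_poly_J: "\<exists>c. has_num_poly (Suc d) c (\<lambda>n. int (fin_len (ideal_power R J n) (carrier R)))"
  by (rule hilbert_poly_exists[OF J_ideal x_power ideal_power_Suc2[OF J_ideal] m_power_Jn])

lemma reduction_Suc: assumes "n \<ge> r" shows "ideal_power R \<mm> (Suc n) = J \<cdot> ideal_power R \<mm> n"
proof -
  obtain k where k: "n = k + r" using assms by (metis add.commute le_Suc_ex)
  have "ideal_power R \<mm> (Suc k + r) = (J \<cdot> ideal_power R J k) \<cdot> ideal_power R \<mm> r"
    unfolding reduction_power ideal_power_Suc2[OF J_ideal] ..
  also have "\<dots> = J \<cdot> ideal_power R \<mm> (k + r)" unfolding reduction_power by (rule ideal_prod_assoc[OF J_ideal Jp mp])
  finally show ?thesis unfolding k by (simp only: add_Suc)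
qed

lemma hilbert_poly_m: "\<exists>c. has_num_poly (Suc d) c (\<lambda>n. int (fin_len (ideal_power R \<mm> n) (carrier R)))"
  by (rule hilbert_poly_exists[OF m_ideal x_m_power reduction_Suc]) (simp_all add: ideal_power_antimono[OF m_ideal])

text \<open>The powers of \<open>\<mm>\<close> lie between those of \<open>J\<close> with the same
  exponent and those with the exponent smaller by \<open>r\<close>, and a bounded shift does not
  change the top coefficient.\<close>

lemma same_multiplicity:
  assumes cJ: "has_num_poly (Suc d) cJ (\<lambda>n. int (fin_len (ideal_power R J n) (carrier R)))"
    and cm: "has_num_poly (Suc d) cm (\<lambda>n. int (fin_len (ideal_power R \<mm> n) (carrier R)))"
  shows "cJ d = cm d"
proof (rule antisym)
  have le: "fin_len (ideal_power R \<mm> n) (carrier R) \<le> fin_len (ideal_power R J n) (carrier R)" for n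
  proof -
    have "len (ideal_power R \<mm> n) (carrier R) \<le> len (ideal_power R J n) (carrier R)"
      by (rule chain_length_mono[OF J_power_m order_refl])
    then show ?thesis by (rule the_enat_mono) (rule len_finite[OF m_power_Jn order_refl])
  qed
  have "cJ d - cm d \<ge> 0" by (rule has_num_poly_lead_nonneg[OF has_num_poly_diff[OF cJ cm]]) (use le in simp)
  then show "cm d \<le> cJ d" by simp
  obtain c' where c': "has_num_poly (Suc d) c' (\<lambda>n. int (fin_len (ideal_power R J (n - r)) (carrier R)))" "c' d = cJ d"
    using has_num_poly_shift_iter[OF cJ] by blast
  have "fin_len (ideal_power R J (n - r)) (carrier R) \<le> fin_len (ideal_power R \<mm> n) (carrier R)" if "n \<ge> r" for n
  proof -
    have "len (ideal_power R J (n - r)) (carrier R) \<le> len (ideal_power R \<mm> n) (carrier R)"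
      using m_power_Jn[of "n - r"] that by (intro chain_length_mono) auto
    then show ?thesis by (rule the_enat_mono) (rule len_m_power)
  qed
  then have "\<forall>\<^sub>F n in sequentially. 0 \<le> int (fin_len (ideal_power R \<mm> n) (carrier R)) - int (fin_len (ideal_power R J (n - r)) (carrier R))"
    unfolding eventually_sequentially by (intro exI[of _ r]) auto
  then have "cm d - c' d \<ge> 0" by (rule has_num_poly_lead_nonneg[OF has_num_poly_diff[OF cm c'(1)]])
  then show "cJ d \<le> cm d" using c'(2) by simp
qed

lemma mJ_subset_m: "\<mm> \<cdot> ideal_power R J n \<subseteq> ideal_power R \<mm> (Suc n)"
  unfolding ideal_power_Suc2[OF m_ideal] by (rule prod_mono[OF order_refl J_power_m])

lemma sally_poly:
  assumes cJ: "has_num_poly (Suc d) cJ (\<lambda>n. int (fin_len (ideal_power R J n) (carrier R)))"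
    and cm: "has_num_poly (Suc d) cm (\<lambda>n. int (fin_len (ideal_power R \<mm> n) (carrier R)))"
  shows "\<exists>c. has_num_poly d c (\<lambda>n. int (fin_len (\<mm> \<cdot> ideal_power R J (n - 1)) (ideal_power R \<mm> n)))
           \<and> c (d - 1) = 1 + cJ (d - 1) - cJ d - cm (d - 1)"
proof -
  obtain cH where cH: "has_num_poly d cH (\<lambda>n. int (fin_len (\<mm> \<cdot> ideal_power R J n) (ideal_power R J n)))"
    using fibre_poly by blast
  have zero: "cH d = 0" "cH (Suc d) = 0" "cJ (Suc d) = 0" using cH cJ by (auto simp: has_num_poly_def)
  \<comment> \<open>The three terms are the fibre ring and the quotient by the power of
    \<open>J\<close>, both at \<open>n - 1\<close> and hence with shifted coefficients, and the
    quotient by the power of \<open>\<mm>\<close> at \<open>n\<close>. At index \<open>d\<close>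
    only \<open>cJ d - cm d\<close> survives, which is 0; at \<open>d - 1\<close> the shift of the
    second term produces \<open>- cJ d\<close>, that is, minus the multiplicity.\<close>
  define c where "c = (\<lambda>k. (cH k - cH (Suc k)) + (cJ k - cJ (Suc k)) - cm k)"
  define f where "f = (\<lambda>n. int (fin_len (\<mm> \<cdot> ideal_power R J (n - 1)) (ideal_power R J (n - 1))) + int (fin_len (ideal_power R J (n - 1)) (carrier R)) - int (fin_len (ideal_power R \<mm> n) (carrier R)))"
  have "has_num_poly (Suc d) c f"
    unfolding c_def f_def
    by (intro has_num_poly_diff has_num_poly_add has_num_poly_shift has_num_poly_mono[OF has_num_poly_shift[OF cH]] cJ cm) simp
  moreover have "f n = int (fin_len (\<mm> \<cdot> ideal_power R J (n - 1)) (ideal_power R \<mm> n))" if n1: "n \<ge> 1" for n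
  proof -
    obtain k where k: "n = Suc k" using n1 by (cases n) auto
    have 1: "len (\<mm> \<cdot> ideal_power R J k) (carrier R) = len (\<mm> \<cdot> ideal_power R J k) (ideal_power R J k) + len (ideal_power R J k) (carrier R)"
      by (rule len_add[OF mJ Jp oneideal prod_subset2[OF m_ideal Jp] idealD(1)[OF Jp]])
    have 2: "len (\<mm> \<cdot> ideal_power R J k) (carrier R) = len (\<mm> \<cdot> ideal_power R J k) (ideal_power R \<mm> n) + len (ideal_power R \<mm> n) (carrier R)"
      unfolding k by (rule len_add[OF mJ mp oneideal mJ_subset_m idealD(1)[OF mp]])
    have "enat (fin_len (\<mm> \<cdot> ideal_power R J k) (ideal_power R J k) + fin_len (ideal_power R J k) (carrier R))
       = enat (fin_len (\<mm> \<cdot> ideal_power R J k) (ideal_power R \<mm> n) + fin_len (ideal_power R \<mm> n) (carrier R))"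
      unfolding plus_enat_simps(1)[symmetric] fin_mJ[OF idealD(1)[OF Jp]] fin_mJ[OF idealD(1)[OF mp]] fin_J[OF order_refl] fin_m[OF order_refl]
      using 1 2 by simp
    then show ?thesis by (simp add: f_def k)
  qed
  then have "\<forall>\<^sub>F n in sequentially. f n = int (fin_len (\<mm> \<cdot> ideal_power R J (n - 1)) (ideal_power R \<mm> n))"
    unfolding eventually_sequentially by blast
  ultimately have "has_num_poly (Suc d) c (\<lambda>n. int (fin_len (\<mm> \<cdot> ideal_power R J (n - 1)) (ideal_power R \<mm> n)))"
    by (rule has_num_poly_cong)
  moreover have "c d = 0" using same_multiplicity[OF cJ cm] zero by (simp add: c_def)
  ultimately have "has_num_poly d c (\<lambda>n. int (fin_len (\<mm> \<cdot> ideal_power R J (n - 1)) (ideal_power R \<mm> n)))"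
    by (rule has_num_poly_drop)
  moreover have "c (d - 1) = 1 + cJ (d - 1) - cJ d - cm (d - 1)"
    using fibre_poly_lead[OF cH] zero d_pos by (simp add: c_def)
  ultimately show ?thesis by blast
qed

end

section \<open>Annihilating forms and the growth of the Sally module\<close>

lemma power_le_fact_binomial: "(n + 1) ^ k \<le> fact k * ((n + k) choose k)"
proof (induction k)
  case (Suc k)
  have "(n + 1) ^ Suc k \<le> (n + k + 1) * (fact k * ((n + k) choose k))"
    using mult_mono[OF _ Suc, of "n + 1" "n + k + 1"] by simp
  also have "\<dots> = fact k * (Suc (n + k) * ((n + k) choose k))" by (simp only: Suc_eq_plus1 ac_simps)
  also have "\<dots> = fact k * ((Suc (n + k) choose Suc k) * Suc k)" by (simp only: Suc_times_binomial_eq)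
  also have "\<dots> = fact (Suc k) * ((n + Suc k) choose Suc k)" by (simp only: fact_Suc add_Suc_right of_nat_id ac_simps)
  finally show ?case .
qed simp

lemma has_num_poly_cmult:
  assumes "has_num_poly s c f" shows "has_num_poly s (\<lambda>k. a * c k) (\<lambda>n. a * f n)"
  using assms unfolding has_num_poly_def
  by (auto elim: eventually_mono simp: sum_distrib_left mult.assoc)

text \<open>A positive top coefficient would let the partial sums grow with exponent
  \<open>e + 1\<close>, while smallness bounds them by a multiple of a function of degree
  \<open>e\<close>.\<close>

lemma small_has_num_poly:
  assumes c: "has_num_poly (Suc e) c (\<lambda>n. int (f n))" and small: "small (Suc e) (\<lambda>n. enat (f n))"
  shows "c e \<le> 0"
proof -
  obtain c' where c': "has_num_poly (Suc (Suc e)) c' (\<lambda>n. int (\<Sum>i\<le>n. f i))" "\<And>k. c' (Suc k) = c k"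
    using has_num_poly_sum_coeff[OF c, of "\<lambda>n. int (\<Sum>i\<le>n. f i)"] by auto
  obtain g C where g: "\<And>n. enat (f n) \<le> enat (g n)" "\<And>n. (n + 1) * (\<Sum>i\<le>n. g i) \<le> C * (n + 1) ^ Suc e"
    using smallE[OF small] by metis
  let ?b = "\<lambda>k::nat. if k < Suc e then 1 else (0::int)"
  have le: "(\<Sum>i\<le>n. f i) \<le> C * fact e * ((n + Suc e - 1) choose n)" for n
  proof -
    have "(n + 1) * (\<Sum>i\<le>n. f i) \<le> (n + 1) * (\<Sum>i\<le>n. g i)" using g(1) by (intro mult_le_mono2 sum_mono) simp
    also have "\<dots> \<le> C * (n + 1) ^ Suc e" by (rule g(2))
    also have "\<dots> = (n + 1) * (C * (n + 1) ^ e)" by (simp only: power_Suc ac_simps)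
    finally have "(\<Sum>i\<le>n. f i) \<le> C * (n + 1) ^ e" by (subst (asm) mult_le_cancel1) simp
    also have "\<dots> \<le> C * (fact e * ((n + e) choose e))" by (rule mult_le_mono2[OF power_le_fact_binomial])
    also have "(n + e) choose e = (n + Suc e - 1) choose n" using binomial_symmetric[of e "n + e"] by simp
    finally show ?thesis by (simp only: mult.assoc)
  qed
  \<comment> \<open>The majorant has coefficients up to index \<open>e\<close> only, so the
    coefficient of the difference at \<open>Suc e\<close> is \<open>- c e\<close>.\<close>
  have "has_num_poly (Suc (Suc e)) (\<lambda>k. int (C * fact e) * ?b k - c' k)
      (\<lambda>n. int (C * fact e) * int ((n + Suc e - 1) choose n) - int (\<Sum>i\<le>n. f i))"
    by (intro has_num_poly_diff c'(1) has_num_poly_cmult has_num_poly_mono[OF has_num_poly_binomial]) simp_all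
  then have "int (C * fact e) * ?b (Suc e) - c' (Suc e) \<ge> 0"
  proof (rule has_num_poly_lead_nonneg)
    have "int (\<Sum>i\<le>n. f i) \<le> int (C * fact e) * int ((n + Suc e - 1) choose n)" for n
      using le[of n] by (simp only: of_nat_mult[symmetric] of_nat_le_iff)
    then show "\<forall>\<^sub>F n in sequentially. 0 \<le> int (C * fact e) * int ((n + Suc e - 1) choose n) - int (\<Sum>i\<le>n. f i)"
      by simp
  qed
  then show ?thesis using c'(2)[of e] by simp
qed

context m_reduction
begin

lemma reduction_power': "ideal_power R \<mm> (n + (r + 1)) = ideal_power R J n \<cdot> ideal_power R \<mm> (r + 1)"
proof -
  have "ideal_power R \<mm> (Suc n + r) = (ideal_power R J n \<cdot> J) \<cdot> ideal_power R \<mm> r"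
    unfolding reduction_power ideal_power_Suc ..
  also have "\<dots> = ideal_power R J n \<cdot> ideal_power R \<mm> (Suc r)"
    unfolding reduction by (rule ideal_prod_assoc[OF Jp J_ideal mp])
  finally show ?thesis by (simp only: Suc_eq_plus1 ac_simps)
qed

text \<open>In high degrees a component of the Sally module is the product of the fixed ideal
  \<open>?V\<close> with a power of \<open>J\<close>, modulo the denominator. Since \<open>f\<close>
  annihilates, this product only sees the Rees algebra modulo \<open>f\<close> and a power of
  \<open>\<mm>\<close>, so its length is at most a constant times that of the fibre ring modulo
  \<open>f\<close>, which is small.\<close>

lemma small_if_annihilated:
  assumes f: "f \<in> ideal_power R J K" "f \<notin> \<mm> \<cdot> ideal_power R J K"
    and ann: "\<And>n y. y \<in> ideal_power R \<mm> (n + 1) \<Longrightarrow> f \<otimes> y \<in> \<mm> \<cdot> ideal_power R J (K + n)"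
  shows "small d (\<lambda>n. len (\<mm> \<cdot> ideal_power R J (n - 1)) (ideal_power R \<mm> n))"
proof -
  have fc: "f \<in> carrier R" using f idealD(8)[OF Jp] by blast
  let ?V = "ideal_power R \<mm> (r + 1)"
  obtain \<mu> :: nat where \<mu>: "\<forall>A B T. ideal A R \<and> ideal B R \<and> ideal T R \<and> B \<subseteq> A \<and> ?V \<cdot> B \<subseteq> T
     \<longrightarrow> len T (T \<boxplus> ?V \<cdot> A) \<le> enat \<mu> * len B A" using noetherian_len_prod_le[OF noetherian mp] by blast
  obtain m :: nat where m: "\<forall>A D T. ideal A R \<longrightarrow> ideal D R \<longrightarrow> ideal T R \<longrightarrow> D \<subseteq> A \<longrightarrow> T \<subseteq> A \<longrightarrow>
     ideal_power R \<mm> r \<cdot> A \<subseteq> T \<longrightarrow> (\<forall>i<r. ideal_power R \<mm> i \<cdot> D \<subseteq> T \<boxplus> ideal_power R \<mm> (Suc i) \<cdot> A)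
     \<longrightarrow> len T A \<le> enat m * len D A" using len_m_filter[of r] by blast
  have bound: "len (\<mm> \<cdot> ideal_power R J (r + k)) (ideal_power R \<mm> (k + (r + 1)))
      \<le> enat (\<mu> * m) * len (form_part f K J k) (ideal_power R J k)" for k
  proof -
    define F where "F = (if K \<le> k then mult_set R f (ideal_power R J (k - K)) else {\<zero>})"
    have F: "ideal F R" using mult_set_ideal[OF Jp fc] zeroideal by (simp add: F_def)
    define D where "D = form_part f K J k"
    have D: "ideal D R" unfolding D_def by (rule form_part_ideal[OF J_ideal fc])
    have DA: "D \<subseteq> ideal_power R J k" unfolding D_def by (rule form_part_subset[OF J_ideal f(1)])
    have mA: "ideal (ideal_power R \<mm> i \<cdot> ideal_power R J k) R" for i by (rule ideal_prod_is_ideal[OF mp Jp])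
    \<comment> \<open>\<open>?V\<close> carries \<open>T\<close> into the denominator: on
      \<open>F\<close> because \<open>f\<close> annihilates, on the rest because products of
      \<open>2 * r + 1\<close> factors from \<open>\<mm>\<close> lie in \<open>\<mm>\<close> times
      the r-th power of \<open>J\<close>. Then \<open>len_m_filter\<close> replaces \<open>T\<close>
      by \<open>D\<close>, where \<open>\<mm>\<close> itself is killed.\<close>
    define T where "T = F \<boxplus> ideal_power R \<mm> r \<cdot> ideal_power R J k"
    have T: "ideal T R" unfolding T_def by (rule add_ideals[OF F mA])
    have FT: "F \<subseteq> T" unfolding T_def by (rule plus_upper1[OF F mA])
    have mT: "ideal_power R \<mm> r \<cdot> ideal_power R J k \<subseteq> T" unfolding T_def by (rule plus_upper2[OF F mA])
    have FA: "F \<subseteq> ideal_power R J k"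
    proof -
      have "f \<otimes> z \<in> ideal_power R J k" if "K \<le> k" "z \<in> ideal_power R J (k - K)" for z
        using ideal_power_multI[OF J_ideal f(1) that(2)] that(1) by simp
      then show ?thesis using idealD(2)[OF Jp] by (auto simp: F_def mult_set_def)
    qed
    have TA: "T \<subseteq> ideal_power R J k" unfolding T_def by (rule plus_least[OF Jp FA prod_subset2[OF mp Jp]])
    have filt: "ideal_power R \<mm> i \<cdot> D \<subseteq> T \<boxplus> ideal_power R \<mm> (Suc i) \<cdot> ideal_power R J k" for i
    proof -
      have De: "D = F \<boxplus> \<mm> \<cdot> ideal_power R J k" by (simp add: D_def form_part_def F_def)
      have "ideal_power R \<mm> i \<cdot> D = ideal_power R \<mm> i \<cdot> F \<boxplus> ideal_power R \<mm> i \<cdot> (\<mm> \<cdot> ideal_power R J k)"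
        unfolding De by (rule ideal_prod_r_distr[OF mp F mJ])
      also have "ideal_power R \<mm> i \<cdot> (\<mm> \<cdot> ideal_power R J k) = ideal_power R \<mm> (Suc i) \<cdot> ideal_power R J k"
        unfolding ideal_power_Suc by (rule ideal_prod_assoc[OF mp m_ideal Jp, symmetric])
      also have "ideal_power R \<mm> i \<cdot> F \<boxplus> ideal_power R \<mm> (Suc i) \<cdot> ideal_power R J k \<subseteq> T \<boxplus> ideal_power R \<mm> (Suc i) \<cdot> ideal_power R J k"
        using prod_subset2[OF mp F] FT by (intro plus_mono order_refl) blast
      finally show ?thesis .
    qed
    have lenT: "len T (ideal_power R J k) \<le> enat m * len D (ideal_power R J k)"
      using m[rule_format, OF Jp D T DA TA mT] filt by blast
    have VT: "?V \<cdot> T \<subseteq> \<mm> \<cdot> ideal_power R J (r + k)"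
    proof -
      have E: "ideal (\<mm> \<cdot> ideal_power R J (r + k)) R" by (rule mJ)
      have "?V \<cdot> F \<subseteq> \<mm> \<cdot> ideal_power R J (r + k)"
      proof (rule prod_least[OF E])
        fix v e assume v: "v \<in> ?V" and e: "e \<in> F"
        have vc: "v \<in> carrier R" using v idealD(8)[OF mp] by blast
        show "v \<otimes> e \<in> \<mm> \<cdot> ideal_power R J (r + k)"
        proof (cases "K \<le> k")
          case True
          then obtain z where z: "z \<in> ideal_power R J (k - K)" "e = f \<otimes> z" using e by (auto simp: F_def mult_set_def)
          have zc: "z \<in> carrier R" using z idealD(8)[OF Jp] by blast
          have "z \<otimes> (f \<otimes> v) \<in> \<mm> \<cdot> ideal_power R J (k - K + (K + r))" by (rule m_power_mult[OF J_ideal z(1) ann[OF v]])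
          moreover have "z \<otimes> (f \<otimes> v) = v \<otimes> e" unfolding z(2) using zc vc fc by (simp add: m_ac)
          moreover have "k - K + (K + r) = r + k" using True by simp
          ultimately show ?thesis by simp
        next
          case False
          then show ?thesis using e vc idealD(2)[OF E] by (simp add: F_def)
        qed
      qed
      moreover have "?V \<cdot> (ideal_power R \<mm> r \<cdot> ideal_power R J k) \<subseteq> \<mm> \<cdot> ideal_power R J (r + k)"
      proof -
        have "?V \<cdot> (ideal_power R \<mm> r \<cdot> ideal_power R J k) = ideal_power R \<mm> (r + 1 + r) \<cdot> ideal_power R J k"
          unfolding ideal_power_add[OF m_ideal, of "r + 1" r] by (rule ideal_prod_assoc[OF mp mp Jp, symmetric])
        also have "\<dots> \<subseteq> (\<mm> \<cdot> ideal_power R J r) \<cdot> ideal_power R J k"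
          using m_power_mJn[of r] by (intro prod_mono order_refl) (simp add: ac_simps del: nat_pow_Suc)
        also have "\<dots> = \<mm> \<cdot> ideal_power R J (r + k)"
          unfolding ideal_power_add[OF J_ideal] by (rule ideal_prod_assoc[OF m_ideal Jp Jp])
        finally show ?thesis .
      qed
      ultimately show ?thesis unfolding T_def ideal_prod_r_distr[OF mp F mA] by (intro plus_least[OF E])
    qed
    have "ideal_power R \<mm> (k + (r + 1)) = ?V \<cdot> ideal_power R J k"
      unfolding reduction_power' by (rule ideal_prod_commute[OF Jp mp])
    also have "\<dots> \<subseteq> \<mm> \<cdot> ideal_power R J (r + k) \<boxplus> ?V \<cdot> ideal_power R J k"
      by (rule plus_upper2[OF mJ ideal_prod_is_ideal[OF mp Jp]])
    finally have "len (\<mm> \<cdot> ideal_power R J (r + k)) (ideal_power R \<mm> (k + (r + 1)))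
      \<le> len (\<mm> \<cdot> ideal_power R J (r + k)) (\<mm> \<cdot> ideal_power R J (r + k) \<boxplus> ?V \<cdot> ideal_power R J k)"
      by (rule chain_length_mono[OF order_refl])
    also have "\<dots> \<le> enat \<mu> * len T (ideal_power R J k)"
      using \<mu> Jp T mJ TA VT by blast
    also have "\<dots> \<le> enat \<mu> * (enat m * len D (ideal_power R J k))" by (rule mult_left_mono[OF lenT]) simp
    also have "\<dots> = enat (\<mu> * m) * len (form_part f K J k) (ideal_power R J k)"
      unfolding D_def times_enat_simps(1)[symmetric] by (rule mult.assoc[symmetric])
    finally show ?thesis .
  qed
  have "small d (\<lambda>k. enat (\<mu> * m) * len (form_part f K J k) (ideal_power R J k))"
    using f unfolding J_def by (intro small_cmult form_small[OF x_carrier])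
  then have "small d (\<lambda>k. len (\<mm> \<cdot> ideal_power R J (k + (r + 1) - 1)) (ideal_power R \<mm> (k + (r + 1))))"
    by (rule small_mono) (use bound in \<open>simp add: add.commute del: nat_pow_Suc\<close>)
  then show ?thesis
    by (rule small_unshift_iff[OF _ d_pos]) (rule len_finite[OF m_power_mJn idealD(1)[OF mp]])
qed

lemma fibre_prime:
  assumes "a \<in> ideal_power R J u" "a \<notin> \<mm> \<cdot> ideal_power R J u" "b \<in> ideal_power R J v" "b \<notin> \<mm> \<cdot> ideal_power R J v"
  shows "a \<otimes> b \<in> ideal_power R J (u + v)" "a \<otimes> b \<notin> \<mm> \<cdot> ideal_power R J (u + v)"
  using fibre_ideal_prime[of 0 a u b v] assms ideal_power_multI[OF J_ideal assms(1,3)] by (simp_all add: fibre_ideal_0)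

text \<open>If no form outside \<open>\<mm>\<R>(J)\<close> kills the class of \<open>y\<close>, multiplication by \<open>y\<close> embeds the fibre ring
  into the Sally module up to a shift, and the latter grows as fast. Otherwise multiply such forms
  for finitely many \<open>y\<close> generating the Sally module.\<close>

lemma annihilator_if_small:
  assumes small: "small d (\<lambda>n. len (\<mm> \<cdot> ideal_power R J (n - 1)) (ideal_power R \<mm> n))"
  shows "\<exists>K f. f \<in> ideal_power R J K \<and> f \<notin> \<mm> \<cdot> ideal_power R J K \<and>
    (\<forall>n. \<forall>y\<in>ideal_power R \<mm> (n + 1). f \<otimes> y \<in> \<mm> \<cdot> ideal_power R J (K + n))"
proof -
  define good where "good = (\<lambda>n S. \<exists>K f. f \<in> ideal_power R J K \<and> f \<notin> \<mm> \<cdot> ideal_power R J K \<and>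
    (\<forall>y\<in>S. f \<otimes> y \<in> \<mm> \<cdot> ideal_power R J (K + n)))"
  have one: "\<one> \<in> ideal_power R J 0" "\<one> \<notin> \<mm> \<cdot> ideal_power R J 0"
    using ideal_prod_one[OF m_ideal] m_proper ideal.one_imp_carrier[OF m_ideal] by (auto simp: ideal_power_0)
  have single: "good n {y}" if y: "y \<in> ideal_power R \<mm> (n + 1)" for n y
  proof (rule ccontr)
    assume "\<not> good n {y}"
    then have ng: "f \<in> \<mm> \<cdot> ideal_power R J k" if "f \<in> ideal_power R J k" "f \<otimes> y \<in> \<mm> \<cdot> ideal_power R J (k + n)" for f k
      using that unfolding good_def by blast
    have yc: "y \<in> carrier R" using y idealD(8)[OF mp] by blast
    have "len (\<mm> \<cdot> ideal_power R J k) (ideal_power R J k) \<le> len (\<mm> \<cdot> ideal_power R J (k + (n + 1) - 1)) (ideal_power R \<mm> (k + (n + 1)))" for k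
    proof -
      have "len (\<mm> \<cdot> ideal_power R J k) (ideal_power R J k) \<le> len (\<mm> \<cdot> ideal_power R J (k + n)) (mult_set R y (ideal_power R J k) \<boxplus> \<mm> \<cdot> ideal_power R J (k + n))"
      proof (rule len_mult_ge[OF Jp mJ yc])
        fix z assume z: "z \<in> ideal_power R J k" "y \<otimes> z \<in> \<mm> \<cdot> ideal_power R J (k + n)"
        then have "z \<otimes> y \<in> \<mm> \<cdot> ideal_power R J (k + n)" using m_comm[OF yc idealD(8)[OF Jp z(1)]] by simp
        then show "z \<in> \<mm> \<cdot> ideal_power R J k" by (rule ng[OF z(1)])
      qed
      also have "\<dots> \<le> len (\<mm> \<cdot> ideal_power R J (k + n)) (ideal_power R \<mm> (k + (n + 1)))"
      proof (rule chain_length_mono[OF order_refl plus_least[OF mp]])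
        show "mult_set R y (ideal_power R J k) \<subseteq> ideal_power R \<mm> (k + (n + 1))"
          unfolding mult_set_subset
        proof
          fix z assume z: "z \<in> ideal_power R J k"
          have "z \<otimes> y \<in> ideal_power R \<mm> (k + (n + 1))"
            using ideal_power_multI[OF m_ideal _ y, of z k] J_power_m z by blast
          then show "y \<otimes> z \<in> ideal_power R \<mm> (k + (n + 1))" using m_comm[OF yc idealD(8)[OF Jp z]] by simp
        qed
        show "\<mm> \<cdot> ideal_power R J (k + n) \<subseteq> ideal_power R \<mm> (k + (n + 1))"
          using mJ_subset_m[of "k + n"] by (simp only: Suc_eq_plus1 add.assoc)
      qed
      finally show ?thesis by simp
    qed
    then have "small d (\<lambda>k. len (\<mm> \<cdot> ideal_power R J k) (ideal_power R J k))"
      by (rule small_mono[OF small_shift[OF small, of "n + 1"]])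
    then show False using fibre_ideal_not_small[of 0] by (simp add: fibre_ideal_0)
  qed
  have fin: "good n S" if "finite S" "S \<subseteq> ideal_power R \<mm> (n + 1)" for n S
    using that
  proof (induction S)
    case empty
    show ?case unfolding good_def using one by blast
  next
    case (insert y S)
    obtain k f where f: "f \<in> ideal_power R J k" "f \<notin> \<mm> \<cdot> ideal_power R J k" "\<And>y. y \<in> S \<Longrightarrow> f \<otimes> y \<in> \<mm> \<cdot> ideal_power R J (k + n)"
      using insert unfolding good_def by auto
    obtain l g where g: "g \<in> ideal_power R J l" "g \<notin> \<mm> \<cdot> ideal_power R J l" "g \<otimes> y \<in> \<mm> \<cdot> ideal_power R J (l + n)"
      using single[of y n] insert unfolding good_def by auto
    have c: "f \<in> carrier R" "g \<in> carrier R" using f g idealD(8)[OF Jp] by auto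
    have "(f \<otimes> g) \<otimes> z \<in> \<mm> \<cdot> ideal_power R J (k + l + n)" if z: "z \<in> insert y S" for z
    proof -
      have zc: "z \<in> carrier R" using z insert.prems idealD(8)[OF mp] by blast
      show ?thesis
      proof (cases "z = y")
        case True
        have "f \<otimes> (g \<otimes> z) \<in> \<mm> \<cdot> ideal_power R J (k + (l + n))" using m_power_mult[OF J_ideal f(1) g(3)] True by simp
        then show ?thesis using c zc by (simp add: m_assoc add.assoc)
      next
        case False
        then have "g \<otimes> (f \<otimes> z) \<in> \<mm> \<cdot> ideal_power R J (l + (k + n))" using m_power_mult[OF J_ideal g(1) f(3)] z by simp
        moreover have "g \<otimes> (f \<otimes> z) = (f \<otimes> g) \<otimes> z" using c zc by (simp add: m_ac)
        moreover have "l + (k + n) = k + l + n" by simp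
        ultimately show ?thesis by simp
      qed
    qed
    \<comment> \<open>The product of the two forms stays outside the multiples of
      \<open>\<mm>\<close> because the fibre ring is a domain.\<close>
    then show ?case using fibre_prime[OF f(1,2) g(1,2)] unfolding good_def by blast
  qed
  have all: "good n (ideal_power R \<mm> (n + 1))" for n
  proof -
    obtain S where S: "S \<subseteq> carrier R" "finite S" "ideal_power R \<mm> (n + 1) = Idl S"
      using noetherian_ring.finetely_gen[OF noetherian mp] by blast
    obtain k f where f: "f \<in> ideal_power R J k" "f \<notin> \<mm> \<cdot> ideal_power R J k" "\<And>y. y \<in> S \<Longrightarrow> f \<otimes> y \<in> \<mm> \<cdot> ideal_power R J (k + n)"
      using fin[OF S(2), of n] genideal_self[OF S(1)] S(3) unfolding good_def by auto
    have fc: "f \<in> carrier R" using f idealD(8)[OF Jp] by blast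
    have "Idl S \<subseteq> {y \<in> carrier R. f \<otimes> y \<in> \<mm> \<cdot> ideal_power R J (k + n)}"
      by (rule genideal_minimal[OF colon_ideal[OF oneideal mJ fc]]) (use S(1) f(3) in auto)
    then show ?thesis unfolding good_def S(3) using f by blast
  qed
  have upto: "\<exists>K f. f \<in> ideal_power R J K \<and> f \<notin> \<mm> \<cdot> ideal_power R J K \<and>
    (\<forall>n<N. \<forall>y\<in>ideal_power R \<mm> (n + 1). f \<otimes> y \<in> \<mm> \<cdot> ideal_power R J (K + n))" for N
  proof (induction N)
    case 0 then show ?case using one by blast
  next
    case (Suc N)
    then obtain k f where f: "f \<in> ideal_power R J k" "f \<notin> \<mm> \<cdot> ideal_power R J k"
      "\<And>n y. n < N \<Longrightarrow> y \<in> ideal_power R \<mm> (n + 1) \<Longrightarrow> f \<otimes> y \<in> \<mm> \<cdot> ideal_power R J (k + n)" by blast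
    obtain l g where g: "g \<in> ideal_power R J l" "g \<notin> \<mm> \<cdot> ideal_power R J l"
      "\<And>y. y \<in> ideal_power R \<mm> (N + 1) \<Longrightarrow> g \<otimes> y \<in> \<mm> \<cdot> ideal_power R J (l + N)"
      using all[of N] unfolding good_def by blast
    have c: "f \<in> carrier R" "g \<in> carrier R" using f g idealD(8)[OF Jp] by auto
    have "(f \<otimes> g) \<otimes> z \<in> \<mm> \<cdot> ideal_power R J (k + l + n)" if n: "n < Suc N" and z: "z \<in> ideal_power R \<mm> (n + 1)" for n z
    proof -
      have zc: "z \<in> carrier R" using z idealD(8)[OF mp] by blast
      show ?thesis
      proof (cases "n = N")
        case True
        have "f \<otimes> (g \<otimes> z) \<in> \<mm> \<cdot> ideal_power R J (k + (l + n))" using m_power_mult[OF J_ideal f(1) g(3)] True z by simp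
        then show ?thesis using c zc by (simp add: m_assoc add.assoc)
      next
        case False
        then have "n < N" using n by simp
        then have "g \<otimes> (f \<otimes> z) \<in> \<mm> \<cdot> ideal_power R J (l + (k + n))" by (rule m_power_mult[OF J_ideal g(1) f(3)]) (rule z)
        moreover have "g \<otimes> (f \<otimes> z) = (f \<otimes> g) \<otimes> z" using c zc by (simp add: m_ac)
        moreover have "l + (k + n) = k + l + n" by simp
        ultimately show ?thesis by simp
      qed
    qed
    then show ?case using fibre_prime[OF f(1,2) g(1,2)] by blast
  qed
  \<comment> \<open>The degrees \<open>n \<le> r\<close> suffice: above them, the power of
    \<open>\<mm>\<close> with exponent \<open>n + 1\<close> is the one with exponent
    \<open>r + 1\<close> times a power of \<open>J\<close>.\<close>
  obtain k f where f: "f \<in> ideal_power R J k" "f \<notin> \<mm> \<cdot> ideal_power R J k"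
    "\<And>n y. n < r + 1 \<Longrightarrow> y \<in> ideal_power R \<mm> (n + 1) \<Longrightarrow> f \<otimes> y \<in> \<mm> \<cdot> ideal_power R J (k + n)"
    using upto[of "r + 1"] by blast
  have fc: "f \<in> carrier R" using f idealD(8)[OF Jp] by blast
  have "f \<otimes> y \<in> \<mm> \<cdot> ideal_power R J (k + n)" if y: "y \<in> ideal_power R \<mm> (n + 1)" for n y
  proof (cases "n < r + 1")
    case True
    then show ?thesis using f(3) y by blast
  next
    case False
    define j where "j = n - r"
    have nj: "n = j + r" "n + 1 = j + (r + 1)" using False by (auto simp: j_def)
    have "ideal_power R \<mm> (n + 1) \<subseteq> {y \<in> carrier R. f \<otimes> y \<in> \<mm> \<cdot> ideal_power R J (k + n)}"
      unfolding nj(2) reduction_power'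
    proof (rule prod_least[OF colon_ideal[OF oneideal mJ fc]])
      fix z w assume z: "z \<in> ideal_power R J j" and w: "w \<in> ideal_power R \<mm> (r + 1)"
      have c: "z \<in> carrier R" "w \<in> carrier R" using idealD(8)[OF Jp z] idealD(8)[OF mp w] by auto
      have "z \<otimes> (f \<otimes> w) \<in> \<mm> \<cdot> ideal_power R J (j + (k + r))"
        by (rule m_power_mult[OF J_ideal z f(3)[OF _ w]]) simp
      moreover have "z \<otimes> (f \<otimes> w) = f \<otimes> (z \<otimes> w)" using c fc by (simp add: m_lcomm)
      moreover have "j + (k + r) = k + n" using nj by simp
      ultimately show "z \<otimes> w \<in> {y \<in> carrier R. f \<otimes> y \<in> \<mm> \<cdot> ideal_power R J (k + n)}" using c by simp
    qed
    then show ?thesis using y by blast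
  qed
  then show ?thesis using f by blast
qed

end

section \<open>The Rees algebra\<close>

lemma UP_carrier: "carrier (UP R) = up R"
  by (simp add: UP_def)

context cring
begin

lemma finsum_ideal:
  assumes I: "ideal I R" and "finite A" "\<And>i. i \<in> A \<Longrightarrow> f i \<in> I"
  shows "(\<Oplus>i\<in>A. f i) \<in> I"
  using assms(2,3)
proof (induction A)
  case empty then show ?case using idealD(2)[OF I] by simp
next
  case (insert a A)
  have "f \<in> A \<rightarrow> carrier R" "f a \<in> carrier R" using insert.prems idealD(8)[OF I] by auto
  then have "(\<Oplus>i\<in>insert a A. f i) = f a \<oplus> (\<Oplus>i\<in>A. f i)" using insert.hyps by simp
  then show ?case using insert idealD(3)[OF I] by simp
qed

text \<open>Isolates one term of a coefficient of a product when all the others already lie in the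
  ideal.\<close>

lemma finsum_ideal_single:
  assumes I: "ideal I R" and A: "finite A" "a \<in> A" and f: "\<And>i. i \<in> A \<Longrightarrow> f i \<in> carrier R"
    and o: "\<And>i. i \<in> A \<Longrightarrow> i \<noteq> a \<Longrightarrow> f i \<in> I"
  shows "(\<Oplus>i\<in>A. f i) \<in> I \<longleftrightarrow> f a \<in> I"
proof -
  have A': "A = insert a (A - {a})" using A by auto
  have "(\<Oplus>i\<in>insert a (A - {a}). f i) = f a \<oplus> (\<Oplus>i\<in>A - {a}. f i)"
    using A f by (intro finsum_insert) auto
  then have e: "(\<Oplus>i\<in>A. f i) = f a \<oplus> (\<Oplus>i\<in>A - {a}. f i)" using A' by simp
  have r: "(\<Oplus>i\<in>A - {a}. f i) \<in> I" by (rule finsum_ideal[OF I]) (use A o in auto)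
  have fa: "f a \<in> carrier R" using f A by auto
  show ?thesis
  proof
    assume "(\<Oplus>i\<in>A. f i) \<in> I"
    then have "(f a \<oplus> (\<Oplus>i\<in>A - {a}. f i)) \<ominus> (\<Oplus>i\<in>A - {a}. f i) \<in> I" using e r idealD(5)[OF I] by simp
    then show "f a \<in> I" using add_cancel_right[OF fa] idealD(8)[OF I r] by simp
  next
    assume "f a \<in> I" then show "(\<Oplus>i\<in>A. f i) \<in> I" using e r idealD(3)[OF I] by simp
  qed
qed

definition single :: "'a \<Rightarrow> nat \<Rightarrow> nat \<Rightarrow> 'a" where
  "single a n = (\<lambda>i. if i = n then a else \<zero>)"

definition graded_part :: "'a set \<Rightarrow> (nat \<Rightarrow> 'a set) \<Rightarrow> (nat \<Rightarrow> 'a) set" where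
  "graded_part K Q = {p \<in> carrier (rees_algebra R K). \<forall>n. p n \<in> Q n}"

context
  fixes K :: "'a set"
  assumes K: "ideal K R"
begin

lemma rees_mem: "p \<in> carrier (rees_algebra R K) \<longleftrightarrow> p \<in> up R \<and> (\<forall>n. p n \<in> ideal_power R K n)"
  by (simp add: rees_algebra_def UP_carrier)

text \<open>The operations of \<open>UP R\<close> are restricted to its carrier, so the pointwise
  formulas need membership; ring laws are transferred through the unconditional equations
  \<open>rees_UP\<close> instead.\<close>

lemma rees_ops:
  assumes "p \<in> carrier (rees_algebra R K)" "q \<in> carrier (rees_algebra R K)"
  shows "p \<oplus>\<^bsub>rees_algebra R K\<^esub> q = (\<lambda>i. p i \<oplus> q i)"
    "p \<otimes>\<^bsub>rees_algebra R K\<^esub> q = (\<lambda>n. \<Oplus>i\<in>{..n}. p i \<otimes> q (n - i))"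
  using assms by (simp_all add: rees_mem) (simp_all add: rees_algebra_def UP_def)

lemma rees_consts:
  "\<zero>\<^bsub>rees_algebra R K\<^esub> = (\<lambda>i. \<zero>)" "\<one>\<^bsub>rees_algebra R K\<^esub> = (\<lambda>i. if i = 0 then \<one> else \<zero>)"
  by (simp_all add: rees_algebra_def UP_def)

lemma rees_UP:
  "p \<oplus>\<^bsub>rees_algebra R K\<^esub> q = p \<oplus>\<^bsub>UP R\<^esub> q" "p \<otimes>\<^bsub>rees_algebra R K\<^esub> q = p \<otimes>\<^bsub>UP R\<^esub> q"
  "\<zero>\<^bsub>rees_algebra R K\<^esub> = \<zero>\<^bsub>UP R\<^esub>" "\<one>\<^bsub>rees_algebra R K\<^esub> = \<one>\<^bsub>UP R\<^esub>"
  by (simp_all add: rees_algebra_def)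

lemma rees_cring: "cring (rees_algebra R K)"
proof -
  interpret U: UP_cring R "UP R" by (unfold_locales)
  let ?A = "rees_algebra R K"
  have Kp: "ideal (ideal_power R K n) R" for n by (rule ideal_power_ideal[OF K])
  have sub: "p \<in> carrier ?A \<Longrightarrow> p \<in> carrier (UP R)" for p by (simp add: rees_algebra_def)
  have add: "p \<oplus>\<^bsub>?A\<^esub> q \<in> carrier ?A" if "p \<in> carrier ?A" "q \<in> carrier ?A" for p q
    unfolding rees_ops[OF that] using that idealD(3)[OF Kp] up_add_closed by (auto simp: rees_mem)
  have mul: "p \<otimes>\<^bsub>?A\<^esub> q \<in> carrier ?A" if "p \<in> carrier ?A" "q \<in> carrier ?A" for p q
  proof -
    have "(\<Oplus>i\<in>{..n}. p i \<otimes> q (n - i)) \<in> ideal_power R K n" for n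
    proof (rule finsum_ideal[OF Kp])
      fix i assume "i \<in> {..n}"
      then show "p i \<otimes> q (n - i) \<in> ideal_power R K n"
        using that ideal_power_multI[OF K, of "p i" i "q (n - i)" "n - i"] by (simp add: rees_mem)
    qed simp
    then show ?thesis unfolding rees_ops[OF that] using that up_mult_closed by (auto simp: rees_mem)
  qed
  have zero: "\<zero>\<^bsub>?A\<^esub> \<in> carrier ?A"
    using U.UP_zero_closed idealD(2)[OF Kp] by (simp add: rees_mem rees_UP UP_carrier) (simp add: UP_def)
  have one: "\<one>\<^bsub>?A\<^esub> \<in> carrier ?A"
    using U.UP_one_closed idealD(2)[OF Kp] by (simp add: rees_mem rees_UP UP_carrier) (simp add: UP_def ideal_power_0)
  show ?thesis
  proof (rule cringI)
    show "abelian_group ?A"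
    proof (rule abelian_groupI)
      fix p q s assume p: "p \<in> carrier ?A" and q: "q \<in> carrier ?A" and s: "s \<in> carrier ?A"
      show "p \<oplus>\<^bsub>?A\<^esub> q \<in> carrier ?A" by (rule add[OF p q])
      show "(p \<oplus>\<^bsub>?A\<^esub> q) \<oplus>\<^bsub>?A\<^esub> s = p \<oplus>\<^bsub>?A\<^esub> (q \<oplus>\<^bsub>?A\<^esub> s)"
        unfolding rees_UP using sub p q s U.P.a_assoc by simp
      show "p \<oplus>\<^bsub>?A\<^esub> q = q \<oplus>\<^bsub>?A\<^esub> p" unfolding rees_UP using sub p q U.P.a_comm by simp
      show "\<zero>\<^bsub>?A\<^esub> \<oplus>\<^bsub>?A\<^esub> p = p" unfolding rees_UP using sub p by simp
      let ?n = "\<lambda>i. \<ominus> (p i)"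
      have n: "?n \<in> carrier ?A" using p up_a_inv_closed idealD(4)[OF Kp] by (simp add: rees_mem)
      have "?n \<oplus>\<^bsub>?A\<^esub> p = \<zero>\<^bsub>?A\<^esub>"
        unfolding rees_ops[OF n p] rees_consts using p by (auto simp: rees_mem l_neg mem_upD)
      then show "\<exists>q\<in>carrier ?A. q \<oplus>\<^bsub>?A\<^esub> p = \<zero>\<^bsub>?A\<^esub>" using n by blast
    qed (rule zero)
    show "comm_monoid ?A"
    proof (rule comm_monoidI)
      fix p q s assume p: "p \<in> carrier ?A" and q: "q \<in> carrier ?A" and s: "s \<in> carrier ?A"
      show "p \<otimes>\<^bsub>?A\<^esub> q \<in> carrier ?A" by (rule mul[OF p q])
      show "(p \<otimes>\<^bsub>?A\<^esub> q) \<otimes>\<^bsub>?A\<^esub> s = p \<otimes>\<^bsub>?A\<^esub> (q \<otimes>\<^bsub>?A\<^esub> s)"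
        unfolding rees_UP using sub p q s U.P.m_assoc by simp
      show "p \<otimes>\<^bsub>?A\<^esub> q = q \<otimes>\<^bsub>?A\<^esub> p" unfolding rees_UP using sub p q U.P.m_comm by simp
      show "\<one>\<^bsub>?A\<^esub> \<otimes>\<^bsub>?A\<^esub> p = p" unfolding rees_UP using sub p by simp
    qed (rule one)
    fix p q s assume p: "p \<in> carrier ?A" and q: "q \<in> carrier ?A" and s: "s \<in> carrier ?A"
    show "(p \<oplus>\<^bsub>?A\<^esub> q) \<otimes>\<^bsub>?A\<^esub> s = p \<otimes>\<^bsub>?A\<^esub> s \<oplus>\<^bsub>?A\<^esub> q \<otimes>\<^bsub>?A\<^esub> s"
      unfolding rees_UP using sub p q s U.P.l_distr by simp
  qed
qed

lemma single_mem: "a \<in> ideal_power R K n \<Longrightarrow> single a n \<in> carrier (rees_algebra R K)"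
proof -
  assume a: "a \<in> ideal_power R K n"
  have Kp: "ideal (ideal_power R K i) R" for i by (rule ideal_power_ideal[OF K])
  have "a \<in> carrier R" using a idealD(8)[OF Kp] by blast
  then have "single a n \<in> up R" by (auto simp: single_def intro!: exI[of _ n])
  then show ?thesis using a idealD(2)[OF Kp] by (auto simp: rees_mem single_def)
qed

lemma rees_mult_single:
  assumes a: "a \<in> ideal_power R K n" and p: "p \<in> carrier (rees_algebra R K)"
  shows "single a n \<otimes>\<^bsub>rees_algebra R K\<^esub> p = (\<lambda>i. if n \<le> i then a \<otimes> p (i - n) else \<zero>)"
  unfolding rees_ops[OF single_mem[OF a] p]
proof
  fix i
  have ac: "a \<in> carrier R" using a idealD(8)[OF ideal_power_ideal[OF K]] by blast
  have pc: "p j \<in> carrier R" for j using p by (auto simp: rees_mem)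
  have "(\<Oplus>j\<in>{..i}. single a n j \<otimes> p (i - j)) = (\<Oplus>j\<in>{..i}. if n = j then a \<otimes> p (i - j) else \<zero>)"
    using ac pc by (intro finsum_cong') (auto simp: single_def)
  also have "\<dots> = (if n \<le> i then a \<otimes> p (i - n) else \<zero>)"
  proof (cases "n \<le> i")
    case True
    then show ?thesis using finsum_singleton[of n "{..i}" "\<lambda>j. a \<otimes> p (i - j)"] ac pc by simp
  next
    case False
    then have "(\<Oplus>j\<in>{..i}. if n = j then a \<otimes> p (i - j) else \<zero>) = (\<Oplus>j\<in>{..i}. \<zero>)"
      by (intro finsum_cong') auto
    then show ?thesis using False by simp
  qed
  finally show "(\<Oplus>j\<in>{..i}. single a n j \<otimes> p (i - j)) = (if n \<le> i then a \<otimes> p (i - n) else \<zero>)" .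
qed

text \<open>A polynomial is the sum of its finitely many monomials, added here one at a time to its
  truncations.\<close>

lemma rees_sum_components:
  assumes p: "p \<in> carrier (rees_algebra R K)" and G: "\<zero>\<^bsub>rees_algebra R K\<^esub> \<in> G"
    "\<And>u v. u \<in> G \<Longrightarrow> v \<in> G \<Longrightarrow> u \<in> carrier (rees_algebra R K) \<Longrightarrow> v \<in> carrier (rees_algebra R K) \<Longrightarrow> u \<oplus>\<^bsub>rees_algebra R K\<^esub> v \<in> G"
    and c: "\<And>n. single (p n) n \<in> G"
  shows "p \<in> G"
proof -
  let ?A = "rees_algebra R K"
  have Kp: "ideal (ideal_power R K i) R" for i by (rule ideal_power_ideal[OF K])
  have pn: "p n \<in> ideal_power R K n" "p n \<in> carrier R" for n using p by (auto simp: rees_mem)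
  define t where "t = (\<lambda>N i. if i < N then p i else \<zero>)"
  have tA: "t N \<in> carrier ?A" for N
  proof -
    have "t N \<in> up R" using pn by (auto simp: t_def intro!: exI[of _ N])
    then show ?thesis using pn idealD(2)[OF Kp] by (auto simp: rees_mem t_def)
  qed
  have "t N \<in> G" for N
  proof (induction N)
    case 0 then show ?case using G(1) by (simp add: t_def rees_consts)
  next
    case (Suc N)
    have s: "single (p N) N \<in> carrier ?A" by (rule single_mem[OF pn(1)])
    have "t N \<oplus>\<^bsub>?A\<^esub> single (p N) N = t (Suc N)"
      unfolding rees_ops[OF tA s] using pn(2) by (auto simp: t_def single_def fun_eq_iff less_Suc_eq)
    then show ?case using G(2)[OF Suc c tA s] by simp
  qed
  moreover obtain N where "bound \<zero> N p" using p by (auto simp: rees_mem)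
  then have "p i = \<zero>" if "i > N" for i using that by (simp add: bound_def)
  then have "p = t (Suc N)" by (auto simp: t_def fun_eq_iff)
  ultimately show ?thesis by metis
qed

lemma graded_part_ideal:
  assumes Q: "\<And>n. ideal (Q n) R"
    and mult: "\<And>q z n k. q \<in> Q n \<Longrightarrow> z \<in> ideal_power R K k \<Longrightarrow> z \<otimes> q \<in> Q (n + k)"
  shows "ideal (graded_part K Q) (rees_algebra R K)"
proof -
  let ?A = "rees_algebra R K"
  interpret A: cring ?A by (rule rees_cring)
  have pc: "p \<in> carrier ?A \<Longrightarrow> p n \<in> carrier R" for p n by (auto simp: rees_mem)
  show ?thesis
    unfolding A.ideal_iff_submods
  proof (rule A.submodsI)
    show "graded_part K Q \<subseteq> carrier ?A" by (auto simp: graded_part_def)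
    have "\<zero>\<^bsub>?A\<^esub> n \<in> Q n" for n using idealD(2)[OF Q] by (simp add: rees_consts)
    then show "\<zero>\<^bsub>?A\<^esub> \<in> graded_part K Q" by (simp add: graded_part_def)
    fix p q assume pq: "p \<in> graded_part K Q" "q \<in> graded_part K Q"
    then have c: "p \<in> carrier ?A" "q \<in> carrier ?A" by (auto simp: graded_part_def)
    have "(p \<oplus>\<^bsub>?A\<^esub> q) n \<in> Q n" for n
      unfolding rees_ops[OF c] using pq idealD(3)[OF Q] by (simp add: graded_part_def)
    then show "p \<oplus>\<^bsub>?A\<^esub> q \<in> graded_part K Q" using c by (simp add: graded_part_def)
  next
    fix p assume p: "p \<in> graded_part K Q"
    have mul: "c \<otimes>\<^bsub>?A\<^esub> p \<in> graded_part K Q" if c: "c \<in> carrier ?A" for c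
    proof -
      have pA: "p \<in> carrier ?A" using p by (simp add: graded_part_def)
      have "(c \<otimes>\<^bsub>?A\<^esub> p) n \<in> Q n" for n
        unfolding rees_ops[OF c pA]
      proof (rule finsum_ideal[OF Q])
        fix i assume "i \<in> {..n}"
        then show "c i \<otimes> p (n - i) \<in> Q n" using mult[of "p (n - i)" "n - i" "c i" i] p c by (simp add: graded_part_def rees_mem)
      qed simp
      then show ?thesis using c pA by (simp add: graded_part_def)
    qed
    then show "c \<in> carrier ?A \<Longrightarrow> c \<otimes>\<^bsub>?A\<^esub> p \<in> graded_part K Q" for c .
    have pA: "p \<in> carrier ?A" using p by (simp add: graded_part_def)
    have "\<ominus>\<^bsub>?A\<^esub> p = (\<ominus>\<^bsub>?A\<^esub> \<one>\<^bsub>?A\<^esub>) \<otimes>\<^bsub>?A\<^esub> p" using pA by (simp add: A.l_minus)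
    then show "\<ominus>\<^bsub>?A\<^esub> p \<in> graded_part K Q" using mul[of "\<ominus>\<^bsub>?A\<^esub> \<one>\<^bsub>?A\<^esub>"] by simp
  qed
qed

text \<open>A homogeneous ideal is prime once it is prime on homogeneous elements. For two
  polynomials outside it, the lowest components that lie outside multiply to the one summand in
  degree \<open>u + v\<close> that is not in the ideal.\<close>

lemma graded_part_prime:
  assumes Q: "\<And>n. ideal (Q n) R"
    and mult: "\<And>q z n k. q \<in> Q n \<Longrightarrow> z \<in> ideal_power R K k \<Longrightarrow> z \<otimes> q \<in> Q (n + k)"
    and prime: "\<And>a b u v. a \<in> ideal_power R K u \<Longrightarrow> a \<notin> Q u \<Longrightarrow> b \<in> ideal_power R K v \<Longrightarrow> b \<notin> Q v \<Longrightarrow> a \<otimes> b \<notin> Q (u + v)"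
    and proper: "\<one> \<notin> Q 0"
  shows "primeideal (graded_part K Q) (rees_algebra R K)"
proof -
  let ?A = "rees_algebra R K"
  interpret A: cring ?A by (rule rees_cring)
  show ?thesis
  proof (rule primeidealI[OF graded_part_ideal[of Q, OF Q mult] rees_cring])
    have "\<one>\<^bsub>?A\<^esub> \<notin> graded_part K Q"
    proof
      assume "\<one>\<^bsub>?A\<^esub> \<in> graded_part K Q"
      then have "\<one>\<^bsub>?A\<^esub> 0 \<in> Q 0" unfolding graded_part_def by blast
      then show False using proper by (simp add: rees_consts)
    qed
    then show "carrier ?A \<noteq> graded_part K Q" using A.one_closed by metis
    fix p q assume p: "p \<in> carrier ?A" and q: "q \<in> carrier ?A" and pq: "p \<otimes>\<^bsub>?A\<^esub> q \<in> graded_part K Q"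
    show "p \<in> graded_part K Q \<or> q \<in> graded_part K Q"
    proof (rule ccontr)
      assume "\<not> ?thesis"
      then have ex: "\<exists>n. p n \<notin> Q n" "\<exists>n. q n \<notin> Q n" using p q by (auto simp: graded_part_def)
      define u where "u = (LEAST n. p n \<notin> Q n)"
      define v where "v = (LEAST n. q n \<notin> Q n)"
      have u: "p u \<notin> Q u" "\<And>i. i < u \<Longrightarrow> p i \<in> Q i"
        unfolding u_def using LeastI_ex[OF ex(1)] not_less_Least by blast+
      have v: "q v \<notin> Q v" "\<And>i. i < v \<Longrightarrow> q i \<in> Q i"
        unfolding v_def using LeastI_ex[OF ex(2)] not_less_Least by blast+
      have c: "p i \<in> ideal_power R K i" "q i \<in> ideal_power R K i" "p i \<in> carrier R" "q i \<in> carrier R" for i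
        using p q by (auto simp: rees_mem)
      have "(p \<otimes>\<^bsub>?A\<^esub> q) (u + v) \<in> Q (u + v)" using pq by (simp add: graded_part_def)
      then have "(\<Oplus>i\<in>{..u + v}. p i \<otimes> q (u + v - i)) \<in> Q (u + v)" unfolding rees_ops[OF p q] .
      moreover have "(\<Oplus>i\<in>{..u + v}. p i \<otimes> q (u + v - i)) \<in> Q (u + v) \<longleftrightarrow> p u \<otimes> q (u + v - u) \<in> Q (u + v)"
      proof (rule finsum_ideal_single[OF Q])
        fix i assume i: "i \<in> {..u + v}" "i \<noteq> u"
        show "p i \<otimes> q (u + v - i) \<in> Q (u + v)"
        proof (cases "i < u")
          case True
          then have "q (u + v - i) \<otimes> p i \<in> Q (i + (u + v - i))" by (intro mult u(2) c)
          then show ?thesis using i m_comm[OF c(3,4)] by simp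
        next
          case False
          then have "u + v - i < v" using i by auto
          then have "p i \<otimes> q (u + v - i) \<in> Q (u + v - i + i)" by (intro mult v(2) c)
          then show ?thesis using i by simp
        qed
      qed (use c in auto)
      ultimately have "p u \<otimes> q v \<in> Q (u + v)" by simp
      then show False using prime[OF c(1) u(1) c(2) v(1)] by blast
    qed
  qed
qed

text \<open>Makes the generated ideal accessible degree by degree: a sum of products, placed in
  degree \<open>n\<close>, is reached from the constants in \<open>I\<close> by multiplying with
  monomials.\<close>

lemma rees_extension_eq:
  assumes I: "ideal I R"
  shows "rees_extension R I K = graded_part K (\<lambda>n. I \<cdot> ideal_power R K n)"
proof -
  let ?A = "rees_algebra R K"
  interpret A: cring ?A by (rule rees_cring)
  have Kp: "ideal (ideal_power R K i) R" for i by (rule ideal_power_ideal[OF K])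
  have IK: "ideal (I \<cdot> ideal_power R K n) R" for n by (rule ideal_prod_is_ideal[OF I Kp])
  have mult: "z \<otimes> q \<in> I \<cdot> ideal_power R K (n + k)" if "q \<in> I \<cdot> ideal_power R K n" "z \<in> ideal_power R K k" for q z n k
  proof -
    have zc: "z \<in> carrier R" using that idealD(8)[OF Kp] by blast
    have "I \<cdot> ideal_power R K n \<subseteq> {e \<in> carrier R. z \<otimes> e \<in> I \<cdot> ideal_power R K (n + k)}"
    proof (rule prod_least[OF colon_ideal[OF oneideal IK zc]])
      fix i j assume ij: "i \<in> I" "j \<in> ideal_power R K n"
      have c: "i \<in> carrier R" "j \<in> carrier R" using ij idealD(8)[OF I] idealD(8)[OF Kp] by auto
      have "i \<otimes> (j \<otimes> z) \<in> I \<cdot> ideal_power R K (n + k)" by (rule prodI[OF ij(1) ideal_power_multI[OF K ij(2) that(2)]])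
      moreover have "i \<otimes> (j \<otimes> z) = z \<otimes> (i \<otimes> j)" using c zc by (simp add: m_ac)
      ultimately show "i \<otimes> j \<in> {e \<in> carrier R. z \<otimes> e \<in> I \<cdot> ideal_power R K (n + k)}" using c by simp
    qed
    then show ?thesis using that(1) by blast
  qed
  have mon: "monom (UP R) a 0 = single a 0" if "a \<in> I" for a
    using idealD(8)[OF I that] by (simp add: UP_def single_def)
  have im: "(\<lambda>a. monom (UP R) a 0) ` I = (\<lambda>a. single a 0) ` I" using mon by (intro image_cong) auto
  have s0: "single a 0 \<in> carrier ?A" if "a \<in> I" for a
    using that idealD(8)[OF I] by (intro single_mem) (simp add: ideal_power_0)
  define G where "G = genideal ?A ((\<lambda>a. single a 0) ` I)"
  have Gid: "ideal G ?A" unfolding G_def by (rule A.genideal_ideal) (use s0 in auto)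
  have "G \<subseteq> graded_part K (\<lambda>n. I \<cdot> ideal_power R K n)"
    unfolding G_def
  proof (rule A.genideal_minimal[OF graded_part_ideal[of "\<lambda>n. I \<cdot> ideal_power R K n", OF IK mult]])
    have "single a 0 n \<in> I \<cdot> ideal_power R K n" if "a \<in> I" for a n
      using that idealD(2)[OF IK] ideal_prod_one[OF I] by (auto simp: single_def ideal_power_0)
    then show "(\<lambda>a. single a 0) ` I \<subseteq> graded_part K (\<lambda>n. I \<cdot> ideal_power R K n)"
      using s0 by (auto simp: graded_part_def)
  qed
  moreover have "graded_part K (\<lambda>n. I \<cdot> ideal_power R K n) \<subseteq> G"
  proof
    have gen: "single a 0 \<in> G" if "a \<in> I" for a
      unfolding G_def using A.genideal_self[of "(\<lambda>a. single a 0) ` I"] s0 that by auto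
    have sG: "single z n \<in> G" if "z \<in> I \<cdot> ideal_power R K n" for z n
      using that
    proof induction
      case (prod i j)
      have i0: "i \<in> ideal_power R K 0" using prod idealD(8)[OF I] by (simp add: ideal_power_0)
      have jA: "single j n \<in> carrier ?A" by (rule single_mem[OF prod(2)])
      have "single i 0 \<otimes>\<^bsub>?A\<^esub> single j n = single (i \<otimes> j) n"
        unfolding rees_mult_single[OF i0 jA] using prod idealD(8)[OF I] by (auto simp: single_def fun_eq_iff)
      then show ?case using A.idealD(7)[OF Gid jA gen[OF prod(1)]] by simp
    next
      case (sum s1 s2)
      have c: "s1 \<in> ideal_power R K n" "s2 \<in> ideal_power R K n" using sum prod_subset2[OF I Kp] by blast+
      have "single s1 n \<oplus>\<^bsub>?A\<^esub> single s2 n = single (s1 \<oplus> s2) n"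
        unfolding rees_ops[OF single_mem[OF c(1)] single_mem[OF c(2)]] by (auto simp: single_def fun_eq_iff)
      then show ?case using A.idealD(3)[OF Gid sum(3,4)] by simp
    qed
    fix p assume p: "p \<in> graded_part K (\<lambda>n. I \<cdot> ideal_power R K n)"
    show "p \<in> G"
    proof (rule rees_sum_components)
      show "p \<in> carrier ?A" using p by (simp add: graded_part_def)
      show "\<zero>\<^bsub>?A\<^esub> \<in> G" by (rule A.idealD(2)[OF Gid])
      show "single (p n) n \<in> G" for n by (rule sG) (use p in \<open>simp add: graded_part_def\<close>)
    qed (rule A.idealD(3)[OF Gid])
  qed
  ultimately have "G = graded_part K (\<lambda>n. I \<cdot> ideal_power R K n)" by blast
  then show ?thesis unfolding rees_extension_def im G_def .
qed

end

end

section \<open>Chains of primes, Krull dimension and quotient rings\<close>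

definition prime_chain :: "('a, 'b) ring_scheme \<Rightarrow> 'a set \<Rightarrow> nat \<Rightarrow> bool" where
  "prime_chain S I n \<longleftrightarrow> (\<exists>P :: nat \<Rightarrow> 'a set. (\<forall>i\<le>n. primeideal (P i) S \<and> I \<subseteq> P i) \<and> (\<forall>i<n. P i \<subset> P (Suc i)))"

lemma prime_chain_shorter: "prime_chain S I n \<Longrightarrow> m \<le> n \<Longrightarrow> prime_chain S I m"
  unfolding prime_chain_def by (meson le_trans less_le_trans)

text \<open>Initial segments of a chain are chains, so the lengths that occur form an initial
  segment of the naturals, and a finite supremum is attained.\<close>

lemma krull_dim_eq_iff:
  "krull_dim S = ereal (real d) \<longleftrightarrow> prime_chain S {} d \<and> \<not> prime_chain S {} (Suc d)"
proof -
  let ?C = "{ereal (real n) | n. prime_chain S {} n}"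
  have kd: "krull_dim S = Sup ?C" by (simp add: krull_dim_def prime_chain_def)
  have up: "Sup ?C \<le> ereal (real m)" if "\<not> prime_chain S {} (Suc m)" for m
  proof (rule Sup_least)
    fix z assume "z \<in> ?C"
    then obtain n where n: "z = ereal (real n)" "prime_chain S {} n" by blast
    have "n \<le> m"
    proof (rule ccontr)
      assume "\<not> n \<le> m"
      then have "Suc m \<le> n" by simp
      then show False using prime_chain_shorter[OF n(2)] that by blast
    qed
    then show "z \<le> ereal (real m)" using n by simp
  qed
  have low: "ereal (real m) \<le> Sup ?C" if "prime_chain S {} m" for m using that by (intro Sup_upper) blast
  show ?thesis
  proof
    assume d: "krull_dim S = ereal (real d)"
    have 1: "\<not> prime_chain S {} (Suc d)"
    proof
      assume "prime_chain S {} (Suc d)"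
      then have "ereal (real (Suc d)) \<le> ereal (real d)" using low kd d by metis
      then show False by simp
    qed
    have "prime_chain S {} d"
    proof (rule ccontr)
      assume n: "\<not> prime_chain S {} d"
      show False
      proof (cases d)
        case 0
        \<comment> \<open>Without any prime the supremum is minus infinity, which separates this
          case from dimension 0.\<close>
        then have "?C = {}" using n prime_chain_shorter[of S "{}" _ 0] by auto
        then show False using kd d by (simp add: bot_ereal_def)
      next
        case (Suc e)
        then have "Sup ?C \<le> ereal (real e)" using up n by simp
        then have "ereal (real (Suc e)) \<le> ereal (real e)" using kd d Suc by metis
        then show False by simp
      qed
    qed
    then show "prime_chain S {} d \<and> \<not> prime_chain S {} (Suc d)" using 1 by blast
  next
    assume "prime_chain S {} d \<and> \<not> prime_chain S {} (Suc d)"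
    then show "krull_dim S = ereal (real d)" unfolding kd using up low by (intro antisym) auto
  qed
qed

context cring
begin

text \<open>Elements of the quotient ring are cosets, hence subsets of \<open>R\<close>, so the
  union of a set of cosets is its preimage under the projection. The third claim makes the
  correspondence injective, which keeps chains strict.\<close>

lemma quot_prime_vimage:
  assumes I: "ideal I R" and P: "primeideal P (R Quot I)"
  shows "primeideal (\<Union>P) R" "I \<subseteq> \<Union>P" "((+>) I) ` (\<Union>P) = P"
proof -
  have Pi: "ideal P (R Quot I)" using P by (rule primeideal.axioms)
  have e: "\<Union>P = {r \<in> carrier R. I +> r \<in> P}"
    using canonical_proj_vimage_in_carrier[OF I, of P] canonical_proj_vimage_mem_iff[OF I, of P]
      additive_subgroup.a_subset[OF ideal.axioms(1)[OF Pi]] by blast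
  show "primeideal (\<Union>P) R" unfolding e by (rule ring_hom_ring.primeideal_vimage[OF ideal.rcos_ring_hom_ring[OF I] is_cring P])
  have "I \<in> P" using additive_subgroup.zero_closed[OF ideal.axioms(1)[OF Pi]] by (simp add: FactRing_def)
  then show "I \<subseteq> \<Union>P" by blast
  show "((+>) I) ` (\<Union>P) = P"
  proof
    show "((+>) I) ` (\<Union>P) \<subseteq> P" using e by blast
    show "P \<subseteq> ((+>) I) ` (\<Union>P)"
    proof
      fix X assume X: "X \<in> P"
      then have "X \<in> carrier (R Quot I)" using additive_subgroup.a_subset[OF ideal.axioms(1)[OF Pi]] by blast
      then obtain r where "r \<in> carrier R" "X = I +> r" by (auto simp: FactRing_def A_RCOSETS_def')
      then show "X \<in> ((+>) I) ` (\<Union>P)" using X e by blast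
    qed
  qed
qed

lemma quot_prime_image:
  assumes I: "ideal I R" and P: "primeideal P R" and IP: "I \<subseteq> P"
  shows "primeideal (((+>) I) ` P) (R Quot I)" "\<Union>(((+>) I) ` P) = P"
proof -
  have Pi: "ideal P R" using P by (rule primeideal.axioms)
  show U: "\<Union>(((+>) I) ` P) = P" using ideal_incl_iff[OF I Pi] IP by simp
  have mem: "r \<in> P" if "r \<in> carrier R" "I +> r \<in> ((+>) I) ` P" for r
  proof -
    have "r = \<zero> \<oplus> r" using that(1) by simp
    then have "r \<in> I +> r" using idealD(2)[OF I] unfolding a_r_coset_def' by blast
    then show ?thesis using that(2) U by blast
  qed
  have rep: "\<exists>r\<in>carrier R. X = I +> r" if "X \<in> carrier (R Quot I)" for X
    using that by (auto simp: FactRing_def A_RCOSETS_def')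
  show "primeideal (((+>) I) ` P) (R Quot I)"
  proof (rule primeidealI[OF ring_ideal_imp_quot_ideal[OF I Pi] ideal.quotient_is_cring[OF I is_cring]])
    show "carrier (R Quot I) \<noteq> ((+>) I) ` P"
    proof
      assume a: "carrier (R Quot I) = ((+>) I) ` P"
      have "r \<in> P" if "r \<in> carrier R" for r
      proof (rule mem[OF that])
        have "I +> r \<in> carrier (R Quot I)" using that by (auto simp: FactRing_def A_RCOSETS_def')
        then show "I +> r \<in> ((+>) I) ` P" using a by simp
      qed
      then have "carrier R \<subseteq> P" by blast
      then show False using primeideal.I_notcarr[OF P] idealD(1)[OF Pi] by blast
    qed
    fix X Y assume X: "X \<in> carrier (R Quot I)" and Y: "Y \<in> carrier (R Quot I)" and XY: "X \<otimes>\<^bsub>R Quot I\<^esub> Y \<in> ((+>) I) ` P"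
    obtain a b where ab: "a \<in> carrier R" "X = I +> a" "b \<in> carrier R" "Y = I +> b" using rep[OF X] rep[OF Y] by blast
    have "X \<otimes>\<^bsub>R Quot I\<^esub> Y = I +> (a \<otimes> b)" using ab ideal.rcoset_mult_add[OF I] by (simp add: FactRing_def)
    then have "a \<otimes> b \<in> P" using mem XY ab by auto
    then show "X \<in> ((+>) I) ` P \<or> Y \<in> ((+>) I) ` P" using primeideal.I_prime[OF P ab(1,3)] ab by blast
  qed
qed

lemma prime_chain_quot:
  assumes I: "ideal I R" shows "prime_chain (R Quot I) {} n \<longleftrightarrow> prime_chain R I n"
proof
  assume "prime_chain (R Quot I) {} n"
  then obtain P where P: "\<And>i. i \<le> n \<Longrightarrow> primeideal (P i) (R Quot I)" "\<And>i. i < n \<Longrightarrow> P i \<subset> P (Suc i)"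
    unfolding prime_chain_def by blast
  have "\<Union>(P i) \<subset> \<Union>(P (Suc i))" if i: "i < n" for i
  proof -
    have "\<Union>(P i) \<subseteq> \<Union>(P (Suc i))" using P(2)[OF i] by blast
    moreover have "\<Union>(P i) \<noteq> \<Union>(P (Suc i))"
      using quot_prime_vimage(3)[OF I P(1)[of i]] quot_prime_vimage(3)[OF I P(1)[of "Suc i"]] i P(2)[OF i] by (metis Suc_leI less_imp_le psubsetE subset_refl)
    ultimately show ?thesis by blast
  qed
  then show "prime_chain R I n" unfolding prime_chain_def
    using quot_prime_vimage(1,2)[OF I P(1)] by (intro exI[of _ "\<lambda>i. \<Union>(P i)"]) auto
next
  assume "prime_chain R I n"
  then obtain P where P: "\<And>i. i \<le> n \<Longrightarrow> primeideal (P i) R" "\<And>i. i \<le> n \<Longrightarrow> I \<subseteq> P i" "\<And>i. i < n \<Longrightarrow> P i \<subset> P (Suc i)"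
    unfolding prime_chain_def by blast
  have "((+>) I) ` P i \<subset> ((+>) I) ` P (Suc i)" if i: "i < n" for i
  proof -
    have "((+>) I) ` P i \<subseteq> ((+>) I) ` P (Suc i)" using P(3)[OF i] by blast
    moreover have "((+>) I) ` P i \<noteq> ((+>) I) ` P (Suc i)"
      using quot_prime_image(2)[OF I P(1,2), of i] quot_prime_image(2)[OF I P(1,2), of "Suc i"] i P(3)[OF i] by (metis Suc_leI less_imp_le psubsetE subset_refl)
    ultimately show ?thesis by blast
  qed
  then show "prime_chain (R Quot I) {} n" unfolding prime_chain_def
    using quot_prime_image(1)[OF I P(1,2)] by (intro exI[of _ "\<lambda>i. ((+>) I) ` P i"]) auto
qed

end

section \<open>Primes of the Rees algebra above the extension of the maximal ideal\<close>

context m_reduction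
begin

abbreviation Rees :: "(nat \<Rightarrow> 'a) ring" where "Rees \<equiv> rees_algebra R J"

lemmas rees_mem_J = rees_mem[OF J_ideal] and rees_ops_J = rees_ops[OF J_ideal]
  and rees_consts_J = rees_consts[OF J_ideal]

lemma Rees_cring: "cring Rees"
  by (rule rees_cring[OF J_ideal])

definition fibre_prime_ideal :: "nat \<Rightarrow> (nat \<Rightarrow> 'a) set" where
  "fibre_prime_ideal i = graded_part J (fibre_ideal i)"

lemma mem_fibre_prime_ideal:
  "p \<in> fibre_prime_ideal i \<longleftrightarrow> p \<in> carrier Rees \<and> (\<forall>n. p n \<in> fibre_ideal i n)"
  by (simp add: fibre_prime_ideal_def graded_part_def)

lemma primeideal_fibre: "i \<le> d \<Longrightarrow> primeideal (fibre_prime_ideal i) Rees"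
  unfolding fibre_prime_ideal_def
proof (rule graded_part_prime[OF J_ideal])
  assume i: "i \<le> d"
  show "ideal (fibre_ideal i n) R" for n by (rule fibre_ideal_ideal[OF i])
  show "q \<in> fibre_ideal i n \<Longrightarrow> z \<in> ideal_power R J k \<Longrightarrow> z \<otimes> q \<in> fibre_ideal i (n + k)" for q z n k
    by (rule fibre_ideal_mult[OF i])
  show "a \<in> ideal_power R J u \<Longrightarrow> a \<notin> fibre_ideal i u \<Longrightarrow> b \<in> ideal_power R J v \<Longrightarrow> b \<notin> fibre_ideal i v \<Longrightarrow> a \<otimes> b \<notin> fibre_ideal i (u + v)" for a b u v
    by (rule fibre_ideal_prime[OF i])
  have "fibre_ideal i 0 \<subseteq> \<mm>"
    by (rule fibre_ideal_least[OF m_ideal prod_subset1[OF m_ideal Jp]]) simp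
  then show "\<one> \<notin> fibre_ideal i 0" using m_proper ideal.one_imp_carrier[OF m_ideal] by blast
qed

lemma fibre_prime_strict: assumes i: "i < d" shows "fibre_prime_ideal i \<subset> fibre_prime_ideal (Suc i)"
proof -
  have i': "i \<le> d" "Suc i \<le> d" using i by auto
  have "fibre_prime_ideal i \<subseteq> fibre_prime_ideal (Suc i)"
    using fibre_ideal_mono[OF le_SucI[OF order_refl] i'(2)] unfolding subset_iff mem_fibre_prime_ideal by blast
  moreover have x1: "x i \<in> ideal_power R J 1" using x_J[OF i] ideal_power_1[OF J_ideal] by simp
  have "x i \<in> head_ideal (Suc i)" by (rule gen_mem) (use x_carrier i' in auto)
  then have "x i \<otimes> \<one> \<in> fibre_ideal (Suc i) (Suc 0)"
    using prodI[of "x i" "head_ideal (Suc i)" \<one> "ideal_power R J 0"] fibre_ideal_head[OF i'(2), of 0] by (auto simp: ideal_power_0)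
  then have "x i \<in> fibre_ideal (Suc i) 1" using x_carrier[OF i] by simp
  then have "single (x i) 1 \<in> fibre_prime_ideal (Suc i)"
    using single_mem[OF J_ideal x1] idealD(2)[OF fibre_ideal_ideal[OF i'(2)]] by (auto simp: mem_fibre_prime_ideal single_def)
  moreover have "single (x i) 1 \<notin> fibre_prime_ideal i"
  proof
    assume "single (x i) 1 \<in> fibre_prime_ideal i"
    then have "single (x i) 1 1 \<in> fibre_ideal i 1" unfolding mem_fibre_prime_ideal by blast
    then show False using x_notin_fibre_ideal[OF i] by (simp add: single_def)
  qed
  ultimately show ?thesis by blast
qed

text \<open>Polynomials of bounded degree are stable under these scalars but in general not under
  the whole Rees algebra; lengths in the Rees algebra are therefore counted over the
  constants.\<close>

definition constants :: "(nat \<Rightarrow> 'a) set" where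
  "constants = (\<lambda>a. single a 0) ` carrier R"

lemma single_const_mem: "a \<in> carrier R \<Longrightarrow> single a 0 \<in> carrier Rees"
  by (rule single_mem[OF J_ideal]) (simp add: ideal_power_0)

lemma constants_subset: "constants \<subseteq> carrier Rees"
  using single_const_mem by (auto simp: constants_def)

lemma const_mult: "\<lbrakk>a \<in> carrier R; p \<in> carrier Rees\<rbrakk> \<Longrightarrow> single a 0 \<otimes>\<^bsub>Rees\<^esub> p = (\<lambda>i. a \<otimes> p i)"
  using rees_mult_single[OF J_ideal, of a 0 p] by (simp add: ideal_power_0)

definition truncation :: "nat \<Rightarrow> (nat \<Rightarrow> 'a) set" where
  "truncation n = {p \<in> carrier Rees. \<forall>i>n. p i = \<zero>}"

abbreviation rlen :: "(nat \<Rightarrow> 'a) set \<Rightarrow> (nat \<Rightarrow> 'a) set \<Rightarrow> enat" where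
  "rlen \<equiv> chain_length (submods Rees constants)"

lemma rees_coeff: "p \<in> carrier Rees \<Longrightarrow> p n \<in> carrier R"
  by (auto simp: rees_mem_J)

lemma rees_uminus: assumes "p \<in> carrier Rees" shows "(\<ominus>\<^bsub>Rees\<^esub> p) = (\<lambda>i. \<ominus> (p i))"
proof -
  interpret A: cring Rees by (rule Rees_cring)
  have c: "\<ominus>\<^bsub>Rees\<^esub> p \<in> carrier Rees" using assms by simp
  have "\<ominus>\<^bsub>Rees\<^esub> p \<oplus>\<^bsub>Rees\<^esub> p = \<zero>\<^bsub>Rees\<^esub>" using assms by (rule A.l_neg)
  then have "(\<ominus>\<^bsub>Rees\<^esub> p) i \<oplus> p i = \<zero>" for i
    unfolding rees_ops_J[OF c assms] rees_consts_J by (rule fun_cong)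
  then have "\<ominus> (p i) = (\<ominus>\<^bsub>Rees\<^esub> p) i" for i
    by (rule minus_equality[OF _ rees_coeff[OF assms] rees_coeff[OF c]])
  then show ?thesis by (simp add: fun_eq_iff)
qed

lemma truncation_submods: "truncation n \<in> submods Rees constants"
proof -
  interpret A: cring Rees by (rule Rees_cring)
  show ?thesis
  proof (rule A.submodsI)
    show "truncation n \<subseteq> carrier Rees" by (auto simp: truncation_def)
    show "\<zero>\<^bsub>Rees\<^esub> \<in> truncation n" using A.zero_closed by (simp add: truncation_def) (simp add: rees_consts_J)
    show "p \<oplus>\<^bsub>Rees\<^esub> q \<in> truncation n" if "p \<in> truncation n" "q \<in> truncation n" for p q
      using that A.a_closed[of p q] by (simp add: truncation_def rees_ops_J)
    show "\<ominus>\<^bsub>Rees\<^esub> p \<in> truncation n" if "p \<in> truncation n" for p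
      using that A.a_inv_closed[of p] by (simp add: truncation_def rees_uminus)
    show "c \<otimes>\<^bsub>Rees\<^esub> p \<in> truncation n" if "c \<in> constants" "p \<in> truncation n" for c p
      using that A.m_closed[of c p] constants_subset by (auto simp: truncation_def constants_def const_mult)
  qed
qed

lemma prime_submods: "ideal P' Rees \<Longrightarrow> P' \<in> submods Rees constants"
  using constants_subset cring.ideal_iff_submods[OF Rees_cring, of P'] by (auto simp: submods_def)

lemma truncation_mult:
  assumes p: "p \<in> truncation n" and q: "q \<in> truncation m" shows "p \<otimes>\<^bsub>Rees\<^esub> q \<in> truncation (n + m)"
proof -
  interpret A: cring Rees by (rule Rees_cring)
  have c: "p \<in> carrier Rees" "q \<in> carrier Rees" using p q by (auto simp: truncation_def)
  have "(\<Oplus>i\<in>{..k}. p i \<otimes> q (k - i)) = \<zero>" if k: "k > n + m" for k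
  proof -
    have "p i \<otimes> q (k - i) = \<zero>" for i
    proof (cases "i > n")
      case True then show ?thesis using p rees_coeff[OF c(2)] by (simp add: truncation_def)
    next
      case False
      then have "k - i > m" using k by simp
      then show ?thesis using q rees_coeff[OF c(1)] by (simp add: truncation_def)
    qed
    then show ?thesis by simp
  qed
  then show ?thesis using A.m_closed[OF c] by (simp add: truncation_def rees_ops_J[OF c])
qed

lemma truncation_mono: "n \<le> m \<Longrightarrow> truncation n \<subseteq> truncation m"
  by (auto simp: truncation_def)

text \<open>Reading off the coefficient of degree \<open>n\<close> is strictly monotone on
  submodules above \<open>B\<close>, because two elements of \<open>truncation n\<close> with the
  same top coefficient differ by an element of \<open>B\<close>.\<close>

lemma rlen_top_le:
  assumes B: "B \<in> submods Rees constants" and 0: "fibre_prime_ideal 0 \<inter> truncation n \<subseteq> B" and Bn: "B \<subseteq> truncation n"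
    and low: "\<And>p. p \<in> truncation n \<Longrightarrow> p n = \<zero> \<Longrightarrow> p \<in> B"
  shows "rlen B (truncation n) \<le> len (\<mm> \<cdot> ideal_power R J n) (ideal_power R J n)"
proof (rule chain_length_transport[where g = "\<lambda>N. (\<lambda>p. p n) ` N"])
  interpret A: cring Rees by (rule Rees_cring)
  fix N assume N: "N \<in> submods Rees constants" "B \<subseteq> N" "N \<subseteq> truncation n"
  note nd = A.submodsD[OF N(1)]
  have NA: "p \<in> carrier Rees" if "p \<in> N" for p using nd(7)[OF that] .
  have "(\<lambda>p. p n) ` N \<in> submods R (carrier R)"
  proof (rule submodsI)
    show "(\<lambda>p. p n) ` N \<subseteq> carrier R" using rees_coeff NA by blast
    have "\<zero>\<^bsub>Rees\<^esub> n = \<zero>" by (simp add: rees_consts_J)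
    then show "\<zero> \<in> (\<lambda>p. p n) ` N" using nd(2) by (metis imageI)
    fix u v assume "u \<in> (\<lambda>p. p n) ` N" "v \<in> (\<lambda>p. p n) ` N"
    then obtain p q where pq: "p \<in> N" "q \<in> N" "u = p n" "v = q n" by blast
    have "(p \<oplus>\<^bsub>Rees\<^esub> q) n = u \<oplus> v" using rees_ops_J[OF NA[OF pq(1)] NA[OF pq(2)]] pq by simp
    then show "u \<oplus> v \<in> (\<lambda>p. p n) ` N" using nd(3)[OF pq(1,2)] by (metis imageI)
  next
    fix u assume "u \<in> (\<lambda>p. p n) ` N"
    then obtain p where p: "p \<in> N" "u = p n" by blast
    have "(\<ominus>\<^bsub>Rees\<^esub> p) n = \<ominus> u" using rees_uminus[OF NA[OF p(1)]] p by simp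
    then show "\<ominus> u \<in> (\<lambda>p. p n) ` N" using nd(4)[OF p(1)] by (metis imageI)
    fix c assume c: "c \<in> carrier R"
    have "(single c 0 \<otimes>\<^bsub>Rees\<^esub> p) n = c \<otimes> u" using const_mult[OF c NA[OF p(1)]] p by simp
    moreover have "single c 0 \<in> constants" using c by (simp add: constants_def)
    ultimately show "c \<otimes> u \<in> (\<lambda>p. p n) ` N" using nd(6)[OF _ p(1)] by (metis imageI)
  qed
  moreover have "\<mm> \<cdot> ideal_power R J n \<subseteq> (\<lambda>p. p n) ` N"
  proof
    fix a assume a: "a \<in> \<mm> \<cdot> ideal_power R J n"
    then have aJ: "a \<in> ideal_power R J n" using prod_subset2[OF m_ideal Jp] by blast
    have "single a n \<in> fibre_prime_ideal 0 \<inter> truncation n"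
      using single_mem[OF J_ideal aJ] a idealD(2)[OF mJ] by (auto simp: mem_fibre_prime_ideal fibre_ideal_0 truncation_def single_def)
    then have "single a n \<in> N" using 0 N by blast
    moreover have "single a n n = a" by (simp add: single_def)
    ultimately show "a \<in> (\<lambda>p. p n) ` N" by (metis imageI)
  qed
  moreover have "(\<lambda>p. p n) ` N \<subseteq> ideal_power R J n" using NA by (auto simp: rees_mem_J)
  ultimately show "(\<lambda>p. p n) ` N \<in> submods R (carrier R) \<and> \<mm> \<cdot> ideal_power R J n \<subseteq> (\<lambda>p. p n) ` N \<and> (\<lambda>p. p n) ` N \<subseteq> ideal_power R J n"
    by blast
next
  interpret A: cring Rees by (rule Rees_cring)
  fix N N' assume N: "N \<in> submods Rees constants" "N' \<in> submods Rees constants" "B \<subseteq> N" "N \<subset> N'" "N' \<subseteq> truncation n"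
  obtain z where z: "z \<in> N'" "z \<notin> N" using N(4) by blast
  have "z n \<notin> (\<lambda>p. p n) ` N"
  proof
    assume "z n \<in> (\<lambda>p. p n) ` N"
    then obtain p where p: "p \<in> N" "z n = p n" by blast
    have c: "z \<in> carrier Rees" "p \<in> carrier Rees" using A.submodsD(7)[OF N(2) z(1)] A.submodsD(7)[OF N(1) p(1)] by auto
    have mc: "\<ominus>\<^bsub>Rees\<^esub> p \<in> carrier Rees" using c by simp
    have "z \<ominus>\<^bsub>Rees\<^esub> p \<in> truncation n" using A.submodsD(5)[OF N(2) z(1)] p(1) N(4,5) by blast
    moreover have "(z \<ominus>\<^bsub>Rees\<^esub> p) n = z n \<oplus> (\<ominus>\<^bsub>Rees\<^esub> p) n"
      using fun_cong[OF rees_ops_J(1)[OF c(1) mc], of n] by (simp add: a_minus_def)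
    then have "(z \<ominus>\<^bsub>Rees\<^esub> p) n = \<zero>"
      using fun_cong[OF rees_uminus[OF c(2)], of n] p(2) rees_coeff[OF c(2), of n] by (simp add: r_neg)
    ultimately have "z \<ominus>\<^bsub>Rees\<^esub> p \<in> N" using low N(3) by blast
    then have "(z \<ominus>\<^bsub>Rees\<^esub> p) \<oplus>\<^bsub>Rees\<^esub> p \<in> N" using A.submodsD(3)[OF N(1)] p(1) by blast
    moreover have "(z \<ominus>\<^bsub>Rees\<^esub> p) \<oplus>\<^bsub>Rees\<^esub> p = z" using c by (simp add: a_minus_def A.a_assoc A.l_neg)
    ultimately show False using z(2) by simp
  qed
  then show "(\<lambda>p. p n) ` N \<subset> (\<lambda>p. p n) ` N'" using z(1) N(4) by blast
qed

lemma rlen_le: "rlen (fibre_prime_ideal 0 \<inter> truncation n) (truncation n)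
    \<le> (\<Sum>i\<le>n. len (\<mm> \<cdot> ideal_power R J i) (ideal_power R J i))"
proof -
  interpret A: cring Rees by (rule Rees_cring)
  interpret M: modular_family "submods Rees constants" "set_add Rees" by (rule A.modular_submods[OF constants_subset])
  have P0: "fibre_prime_ideal 0 \<in> submods Rees constants"
    using primeideal_fibre[of 0] by (intro prime_submods primeideal.axioms) simp
  have PT: "fibre_prime_ideal 0 \<inter> truncation n \<in> submods Rees constants" for n
    by (rule A.submods_Int[OF P0 truncation_submods])
  show ?thesis
  proof (induction n)
    case 0
    have "rlen (fibre_prime_ideal 0 \<inter> truncation 0) (truncation 0) \<le> len (\<mm> \<cdot> ideal_power R J 0) (ideal_power R J 0)"
    proof (rule rlen_top_le[OF PT])
      fix p assume p: "p \<in> truncation 0" "p 0 = \<zero>"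
      then have "p i = \<zero>" for i by (cases i) (auto simp: truncation_def)
      then have "p = \<zero>\<^bsub>Rees\<^esub>" by (auto simp: rees_consts_J)
      then show "p \<in> fibre_prime_ideal 0 \<inter> truncation 0" using A.submodsD(2)[OF PT] by simp
    qed auto
    then show ?case by simp
  next
    case (Suc n)
    let ?P = "fibre_prime_ideal 0 \<inter> truncation (Suc n)"
    \<comment> \<open>Multiplication by one turns \<open>chain_length_mult_le\<close> into the
      second isomorphism theorem for \<open>truncation n\<close>.\<close>
    let ?B = "mult_set Rees \<one>\<^bsub>Rees\<^esub> (truncation n) <+>\<^bsub>Rees\<^esub> ?P"
    have T1: "mult_set Rees \<one>\<^bsub>Rees\<^esub> (truncation n) = truncation n"
      by (rule A.mult_set_one) (auto simp: truncation_def)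
    have B: "?B \<in> submods Rees constants" unfolding T1 by (rule A.submods_add[OF constants_subset truncation_submods PT])
    have up: "truncation n \<subseteq> ?B" "?P \<subseteq> ?B" unfolding T1 by (rule A.submods_add_upper[OF truncation_submods PT])+
    have BT: "?B \<subseteq> truncation (Suc n)"
      unfolding T1 by (rule A.submods_add_least[OF truncation_submods]) (use truncation_mono[of n "Suc n"] in auto)
    have "rlen ?P (truncation (Suc n)) = rlen ?P ?B + rlen ?B (truncation (Suc n))"
      by (rule M.chain_length_add[OF PT B truncation_submods up(2) BT])
    also have "rlen ?B (truncation (Suc n)) \<le> len (\<mm> \<cdot> ideal_power R J (Suc n)) (ideal_power R J (Suc n))"
    proof (rule rlen_top_le[OF B up(2) BT])
      fix p assume p: "p \<in> truncation (Suc n)" "p (Suc n) = \<zero>"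
      then have "p i = \<zero>" if "i > n" for i using that by (cases "i = Suc n") (auto simp: truncation_def)
      then have "p \<in> truncation n" using p by (auto simp: truncation_def)
      then show "p \<in> ?B" using up(1) by blast
    qed
    also have "rlen ?P ?B \<le> rlen (fibre_prime_ideal 0 \<inter> truncation n) (truncation n)"
    proof (rule A.chain_length_mult_le[OF constants_subset truncation_submods PT A.one_closed])
      fix q assume q: "q \<in> fibre_prime_ideal 0 \<inter> truncation n"
      then have "q \<in> carrier Rees" by (simp add: truncation_def)
      then show "\<one>\<^bsub>Rees\<^esub> \<otimes>\<^bsub>Rees\<^esub> q \<in> ?P" using q truncation_mono[of n "Suc n"] by auto
    qed simp
    also note Suc
    finally show ?case by (simp add: add_right_mono)
  qed
qed

text \<open>The recursion of \<open>dim_growth\<close> with truncations by degree: multiplying by a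
  polynomial of degree at most \<open>C\<close> shifts them by \<open>C\<close>, without any
  homogeneity of the primes. A chain of \<open>d + 2\<close> primes would force growth of degree
  \<open>d + 1\<close>, while modulo \<open>fibre_prime_ideal 0\<close> the lengths are at most
  partial sums of the fibre ring, of degree at most \<open>d\<close>.\<close>

lemma no_long_prime_chain: "\<not> prime_chain Rees (fibre_prime_ideal 0) (Suc d)"
proof
  assume "prime_chain Rees (fibre_prime_ideal 0) (Suc d)"
  then obtain Q where Q: "\<And>i. i \<le> Suc d \<Longrightarrow> primeideal (Q i) Rees" "\<And>i. i \<le> Suc d \<Longrightarrow> fibre_prime_ideal 0 \<subseteq> Q i"
    "\<And>i. i < Suc d \<Longrightarrow> Q i \<subset> Q (Suc i)" unfolding prime_chain_def by blast
  interpret A: cring Rees by (rule Rees_cring)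
  interpret M: modular_family "submods Rees constants" "set_add Rees" by (rule A.modular_submods[OF constants_subset])
  have Qi: "ideal (Q i) Rees" if "i \<le> Suc d" for i using Q(1)[OF that] by (rule primeideal.axioms)
  have QT: "Q i \<inter> truncation n \<in> submods Rees constants" if "i \<le> Suc d" for i n
    by (rule A.submods_Int[OF prime_submods[OF Qi[OF that]] truncation_submods])
  have "\<exists>z. z \<in> Q (Suc i) \<and> z \<notin> Q i" if "i < Suc d" for i using Q(3)[OF that] by blast
  then obtain z where z: "\<And>i. i < Suc d \<Longrightarrow> z i \<in> Q (Suc i) \<and> z i \<notin> Q i" by metis
  have zA: "z i \<in> carrier Rees" if "i < Suc d" for i using z[OF that] A.idealD(8)[OF Qi[of "Suc i"]] that by auto
  have "\<exists>c. z i \<in> truncation c" if i: "i < Suc d" for i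
  proof -
    obtain c where "bound \<zero> c (z i)" using zA[OF i] by (auto simp: rees_mem_J)
    then show ?thesis using zA[OF i] by (auto simp: truncation_def bound_def)
  qed
  then obtain c where c: "\<And>i. i < Suc d \<Longrightarrow> z i \<in> truncation (c i)" by metis
  define C where "C = (\<Sum>i<Suc d. c i)"
  have cC: "c i \<le> C" if "i < Suc d" for i unfolding C_def using that by (intro member_le_sum) auto
  have zC: "z i \<in> truncation C" if "i < Suc d" for i using c[OF that] truncation_mono[OF cC[OF that]] by blast
  define h where "h = (\<lambda>i n. rlen (Q i \<inter> truncation n) (truncation n))"
  \<comment> \<open>The summand for the next prime is found in the larger truncation; the recursion
    wants it at \<open>n\<close>.\<close>
  have hmono: "h i n \<le> h i (n + C)" if i: "i \<le> Suc d" for i n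
  proof -
    let ?B = "Q i \<inter> truncation (n + C)"
    have T1: "mult_set Rees \<one>\<^bsub>Rees\<^esub> (truncation n) = truncation n"
      by (rule A.mult_set_one) (auto simp: truncation_def)
    have "h i n \<le> rlen ?B (mult_set Rees \<one>\<^bsub>Rees\<^esub> (truncation n) <+>\<^bsub>Rees\<^esub> ?B)"
      unfolding h_def
    proof (rule A.chain_length_mult_ge[OF constants_subset truncation_submods QT[OF i] A.one_closed])
      fix q assume "q \<in> truncation n" "\<one>\<^bsub>Rees\<^esub> \<otimes>\<^bsub>Rees\<^esub> q \<in> ?B"
      moreover from this(1) have "q \<in> carrier Rees" by (simp add: truncation_def)
      ultimately show "q \<in> Q i \<inter> truncation n" by simp
    qed
    also have "\<dots> \<le> h i (n + C)"
      unfolding h_def T1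
      by (rule chain_length_mono[OF order_refl A.submods_add_least[OF truncation_submods]]) (use truncation_mono[of n "n + C"] in auto)
    finally show ?thesis .
  qed
  have "enat (n choose Suc d) \<le> h 0 (C * n + 0)" for n
  proof (rule chain_growth)
    fix i n assume i: "i < Suc d"
    then have i': "i \<le> Suc d" "Suc i \<le> Suc d" by auto
    let ?B = "Q i \<inter> truncation (n + C)"
    let ?T = "mult_set Rees (z i) (truncation n) <+>\<^bsub>Rees\<^esub> ?B"
    have zT: "mult_set Rees (z i) (truncation n) \<in> submods Rees constants"
      by (rule A.mult_set_submods[OF constants_subset truncation_submods zA[OF i]])
    have T: "?T \<in> submods Rees constants" by (rule A.submods_add[OF constants_subset zT QT[OF i'(1)]])
    have 1: "h i n \<le> rlen ?B ?T"
      unfolding h_def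
    proof (rule A.chain_length_mult_ge[OF constants_subset truncation_submods QT[OF i'(1)] zA[OF i]])
      fix q assume q: "q \<in> truncation n" "z i \<otimes>\<^bsub>Rees\<^esub> q \<in> ?B"
      then have "q \<in> carrier Rees" by (simp add: truncation_def)
      then have "q \<in> Q i" using primeideal.I_prime[OF Q(1)[OF i'(1)] zA[OF i], of q] q(2) z[OF i] by blast
      then show "q \<in> Q i \<inter> truncation n" using q(1) by blast
    qed
    have TQ: "?T \<subseteq> Q (Suc i) \<inter> truncation (n + C)"
    proof (rule A.submods_add_least[OF QT[OF i'(2)]])
      show "?B \<subseteq> Q (Suc i) \<inter> truncation (n + C)" using Q(3)[OF i] by blast
      have "z i \<otimes>\<^bsub>Rees\<^esub> q \<in> Q (Suc i) \<inter> truncation (n + C)" if q: "q \<in> truncation n" for q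
      proof -
        have "q \<in> carrier Rees" using q by (simp add: truncation_def)
        then have "z i \<otimes>\<^bsub>Rees\<^esub> q \<in> Q (Suc i)" using A.idealD(7)[OF Qi[OF i'(2)]] z[OF i] by blast
        moreover have "z i \<otimes>\<^bsub>Rees\<^esub> q \<in> truncation (C + n)" by (rule truncation_mult[OF zC[OF i] q])
        ultimately show ?thesis by (simp add: add.commute)
      qed
      then show "mult_set Rees (z i) (truncation n) \<subseteq> Q (Suc i) \<inter> truncation (n + C)" by (auto simp: mult_set_def)
    qed
    have "h (Suc i) n \<le> h (Suc i) (n + C)" by (rule hmono[OF i'(2)])
    also have "\<dots> \<le> rlen ?T (truncation (n + C))" unfolding h_def by (rule chain_length_mono[OF TQ order_refl])
    finally have 2: "h (Suc i) n \<le> rlen ?T (truncation (n + C))" .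
    have "h i (n + C) = rlen ?B ?T + rlen ?T (truncation (n + C))"
      unfolding h_def using TQ
      by (intro M.chain_length_add[OF QT[OF i'(1)] T truncation_submods A.submods_add_upper(2)[OF zT QT[OF i'(1)]]]) blast
    then show "h i n + h (Suc i) n \<le> h i (n + C)" using add_mono[OF 1 2] by simp
  next
    fix n :: nat
    have "\<one>\<^bsub>Rees\<^esub> \<in> truncation n" using A.one_closed by (simp add: truncation_def) (simp add: rees_consts_J)
    moreover have "\<one>\<^bsub>Rees\<^esub> \<notin> Q (Suc d)"
      using ideal.one_imp_carrier[OF Qi[of "Suc d"]] primeideal.I_notcarr[OF Q(1)[of "Suc d"]] by auto
    ultimately have "Q (Suc d) \<inter> truncation n \<subset> truncation n" by blast
    then show "1 \<le> h (Suc d) n" unfolding h_def using QT truncation_submods by (intro chain_length_pos) auto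
  qed
  moreover have "h 0 n \<le> (\<Sum>i\<le>n. len (\<mm> \<cdot> ideal_power R J i) (ideal_power R J i))" for n
  proof -
    have "h 0 n \<le> rlen (fibre_prime_ideal 0 \<inter> truncation n) (truncation n)"
      unfolding h_def using Q(2)[of 0] by (intro chain_length_mono) auto
    then show ?thesis using rlen_le by (rule order_trans)
  qed
  ultimately have b: "enat (n choose Suc d) \<le> (\<Sum>i\<le>C * n + 0. len (\<mm> \<cdot> ideal_power R J i) (ideal_power R J i))" for n
    by (rule order_trans)
  have "small (Suc d) (\<lambda>n. len (\<mm> \<cdot> ideal_power R J n) (ideal_power R J n))"
    unfolding J_def by (rule len_fibre_small[OF x_carrier])
  then obtain f D where f: "\<And>n. len (\<mm> \<cdot> ideal_power R J n) (ideal_power R J n) \<le> enat (f n)"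
    "\<And>n. (n + 1) * (\<Sum>i\<le>n. f i) \<le> D * (n + 1) ^ Suc d" unfolding small_def by blast
  have "n choose Suc d \<le> D * (C * n + 0 + 1) ^ d" for n
  proof -
    have "(\<Sum>i\<le>C * n + 0. len (\<mm> \<cdot> ideal_power R J i) (ideal_power R J i)) \<le> (\<Sum>i\<le>C * n + 0. enat (f i))"
      by (intro sum_mono f(1))
    with b[of n] have "enat (n choose Suc d) \<le> enat (\<Sum>i\<le>C * n + 0. f i)" unfolding sum_enat by (rule order_trans)
    then have "(C * n + 0 + 1) * (n choose Suc d) \<le> (C * n + 0 + 1) * (\<Sum>i\<le>C * n + 0. f i)" by (intro mult_le_mono2) simp
    also have "\<dots> \<le> D * (C * n + 0 + 1) ^ Suc d" by (rule f(2))
    also have "\<dots> = (C * n + 0 + 1) * (D * (C * n + 0 + 1) ^ d)" by (simp only: power_Suc ac_simps)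
    finally show ?thesis by (subst (asm) mult_le_cancel1) simp
  qed
  then show False by (rule binomial_not_bounded) simp
qed

end

section \<open>The Sally module\<close>

text \<open>Submodules of a quotient are sets of cosets; the trivial bounds \<open>{}\<close> and
  \<open>UNIV\<close> bring them into the framework of chains.\<close>

lemma module_length_eq: "module_length S M = chain_length {N. submodule N S M} {} UNIV"
  by (simp add: module_length_def chain_length_def)

context cring
begin

lemma mem_coset: "z \<in> I +> x \<longleftrightarrow> (\<exists>b\<in>I. z = b \<oplus> x)"
  by (auto simp: a_r_coset_def')

lemma coset_self: "ideal I R \<Longrightarrow> x \<in> carrier R \<Longrightarrow> x \<in> I +> x"
  unfolding mem_coset using idealD(2) by (metis l_zero)

lemma coset_eq:
  assumes I: "ideal I R" and "x \<in> carrier R" "z \<in> I +> x" shows "I +> z = I +> x" "z \<in> carrier R"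
proof -
  interpret abelian_subgroup I R
    by (rule abelian_subgroupI3[OF ideal.axioms(1)[OF I] is_abelian_group])
  show "I +> z = I +> x" using a_repr_independence'[OF assms(3,2)] by simp
  show "z \<in> carrier R" using assms(2,3) idealD(8)[OF I] unfolding mem_coset by auto
qed

lemma coset_sum: "\<lbrakk>ideal I R; x \<in> carrier R; y \<in> carrier R\<rbrakk> \<Longrightarrow> set_add R (I +> x) (I +> y) = I +> (x \<oplus> y)"
  by (rule ideal.a_rcos_sum)

lemma coset_in_super: "\<lbrakk>ideal N R; I \<subseteq> N; x \<in> N\<rbrakk> \<Longrightarrow> I +> x \<subseteq> N"
  using idealD(3) unfolding mem_coset subset_iff by blast

context
  fixes E B :: "'a set"
  assumes E: "ideal E R" and B: "ideal B R" and BE: "B \<subseteq> E"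
begin

abbreviation quotient :: "('a, 'a set) module" where
  "quotient \<equiv> quot_module (ideal_module R E) B"

lemma quotient_simps:
  "carrier quotient = (\<lambda>x. B +> x) ` E" "zero quotient = B" "add quotient = set_add R"
  "smult quotient = (\<lambda>a X. \<Union>x\<in>X. B +> (a \<otimes> x))"
  by (auto simp: quot_module_def ideal_module_def A_RCOSETS_def' a_r_coset_def' set_add_def' fun_eq_iff)

lemma quotient_smult: "\<lbrakk>a \<in> carrier R; x \<in> carrier R\<rbrakk> \<Longrightarrow> smult quotient a (B +> x) = B +> (a \<otimes> x)"
proof -
  assume a: "a \<in> carrier R" and x: "x \<in> carrier R"
  have "B +> (a \<otimes> z) = B +> (a \<otimes> x)" if z: "z \<in> B +> x" for z
  proof (rule coset_eq(1)[OF B])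
    obtain b where b: "b \<in> B" "z = b \<oplus> x" using z unfolding mem_coset by blast
    have "a \<otimes> z = a \<otimes> b \<oplus> a \<otimes> x" unfolding b(2) using a x idealD(8)[OF B b(1)] by (simp add: r_distr)
    then show "a \<otimes> z \<in> B +> (a \<otimes> x)" unfolding mem_coset using idealD(6)[OF B a b(1)] by blast
  qed (use a x in simp)
  then show ?thesis unfolding quotient_simps using coset_self[OF B x] by blast
qed

lemma submodule_quotientD:
  assumes N: "submodule N R quotient"
  shows "ideal (\<Union>N) R" "B \<subseteq> \<Union>N" "\<Union>N \<subseteq> E" "X \<in> N \<Longrightarrow> \<exists>x\<in>E. X = B +> x"
proof -
  have sg: "subgroup N (add_monoid quotient)" using N by (rule submodule.axioms)
  have sub: "N \<subseteq> (\<lambda>x. B +> x) ` E" using subgroup.subset[OF sg] by (simp add: quotient_simps)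
  have zero: "B \<in> N" using subgroup.one_closed[OF sg] by (simp add: quotient_simps)
  have add: "set_add R X Y \<in> N" if "X \<in> N" "Y \<in> N" for X Y
    using subgroup.m_closed[OF sg that] by (simp add: quotient_simps)
  have smul: "smult quotient a X \<in> N" if "a \<in> carrier R" "X \<in> N" for a X
    using submodule.smult_closed[OF N that] .
  show rep: "\<exists>x\<in>E. X = B +> x" if "X \<in> N" for X using sub that by blast
  show BU: "B \<subseteq> \<Union>N" using zero by blast
  show UE: "\<Union>N \<subseteq> E"
  proof
    fix z assume "z \<in> \<Union>N"
    then obtain x where "x \<in> E" "z \<in> B +> x" using rep by blast
    then show "z \<in> E" using coset_in_super[OF E BE] by blast
  qed
  have smulU: "c \<otimes> x \<in> \<Union>N" if c: "c \<in> carrier R" and x: "x \<in> \<Union>N" for c x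
  proof -
    obtain X where X: "X \<in> N" "x \<in> X" using x by blast
    have xc: "x \<in> carrier R" using x UE idealD(8)[OF E] by blast
    have "c \<otimes> x \<in> smult quotient c X" unfolding quotient_simps using coset_self[OF B m_closed[OF c xc]] X(2) by blast
    then show ?thesis using smul[OF c X(1)] by blast
  qed
  show "ideal (\<Union>N) R"
    unfolding ideal_iff_submods
  proof (rule submodsI)
    show "\<Union>N \<subseteq> carrier R" using UE idealD(1)[OF E] by blast
    show "\<zero> \<in> \<Union>N" using BU idealD(2)[OF B] by blast
    show "x \<oplus> y \<in> \<Union>N" if xy: "x \<in> \<Union>N" "y \<in> \<Union>N" for x y
    proof -
      obtain X Y where "X \<in> N" "x \<in> X" "Y \<in> N" "y \<in> Y" using xy by blast
      then show ?thesis using add[of X Y] unfolding set_add_def' by blast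
    qed
    show "c \<otimes> x \<in> \<Union>N" if "c \<in> carrier R" "x \<in> \<Union>N" for c x by (rule smulU[OF that])
    show "\<ominus> x \<in> \<Union>N" if x: "x \<in> \<Union>N" for x
    proof -
      have "x \<in> carrier R" using x UE idealD(8)[OF E] by blast
      then have "\<ominus> x = (\<ominus> \<one>) \<otimes> x" by (simp add: l_minus)
      then show ?thesis using smulU[OF _ x, of "\<ominus> \<one>"] by simp
    qed
  qed
qed

lemma submodule_quotientI:
  assumes N: "ideal N R" and BN: "B \<subseteq> N" and NE: "N \<subseteq> E"
  shows "submodule ((\<lambda>x. B +> x) ` N) R quotient"
proof -
  have c: "x \<in> carrier R" if "x \<in> N" for x using idealD(8)[OF N that] .
  have B0: "B +> \<zero> = B" using idealD(1)[OF B] by (rule a_coset_add_zero)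
  have "subgroup ((\<lambda>x. B +> x) ` N) (add_monoid quotient)"
  proof (rule subgroup.intro)
    show "(\<lambda>x. B +> x) ` N \<subseteq> carrier (add_monoid quotient)" using NE by (auto simp: quotient_simps)
    show "\<one>\<^bsub>add_monoid quotient\<^esub> \<in> (\<lambda>x. B +> x) ` N"
      using B0 idealD(2)[OF N] by (simp add: quotient_simps) (metis imageI)
    show "X \<otimes>\<^bsub>add_monoid quotient\<^esub> Y \<in> (\<lambda>x. B +> x) ` N" if XY: "X \<in> (\<lambda>x. B +> x) ` N" "Y \<in> (\<lambda>x. B +> x) ` N" for X Y
    proof -
      obtain x y where xy: "x \<in> N" "y \<in> N" "X = B +> x" "Y = B +> y" using XY by blast
      have "set_add R X Y = B +> (x \<oplus> y)" unfolding xy(3,4) by (rule coset_sum[OF B c[OF xy(1)] c[OF xy(2)]])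
      then show ?thesis using idealD(3)[OF N xy(1,2)] by (simp add: quotient_simps)
    qed
    fix X assume "X \<in> (\<lambda>x. B +> x) ` N"
    then obtain x where x: "x \<in> N" "X = B +> x" by blast
    have mx: "\<ominus> x \<in> N" by (rule idealD(4)[OF N x(1)])
    have "inv\<^bsub>add_monoid quotient\<^esub> X = B +> (\<ominus> x)"
      unfolding m_inv_def
    proof (rule the_equality)
      have s: "set_add R X (B +> (\<ominus> x)) = B" "set_add R (B +> (\<ominus> x)) X = B"
        unfolding x(2) coset_sum[OF B c[OF x(1)] c[OF mx]] coset_sum[OF B c[OF mx] c[OF x(1)]]
        using c[OF x(1)] B0 by (simp_all add: r_neg l_neg)
      then show "B +> (\<ominus> x) \<in> carrier (add_monoid quotient) \<and> X \<otimes>\<^bsub>add_monoid quotient\<^esub> (B +> (\<ominus> x)) = \<one>\<^bsub>add_monoid quotient\<^esub>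
         \<and> (B +> (\<ominus> x)) \<otimes>\<^bsub>add_monoid quotient\<^esub> X = \<one>\<^bsub>add_monoid quotient\<^esub>"
        using mx NE by (auto simp: quotient_simps)
      fix Y assume Y: "Y \<in> carrier (add_monoid quotient) \<and> X \<otimes>\<^bsub>add_monoid quotient\<^esub> Y = \<one>\<^bsub>add_monoid quotient\<^esub>
         \<and> Y \<otimes>\<^bsub>add_monoid quotient\<^esub> X = \<one>\<^bsub>add_monoid quotient\<^esub>"
      then obtain y where y: "y \<in> E" "Y = B +> y" by (auto simp: quotient_simps)
      have yc: "y \<in> carrier R" using idealD(8)[OF E y(1)] .
      have "set_add R X Y = B" using Y by (simp add: quotient_simps)
      then have e: "B +> (x \<oplus> y) = B" unfolding x(2) y(2) coset_sum[OF B c[OF x(1)] yc] .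
      have "x \<oplus> y \<in> B" using coset_self[OF B, of "x \<oplus> y"] c[OF x(1)] yc unfolding e by simp
      moreover have "y = (x \<oplus> y) \<oplus> (\<ominus> x)" using c[OF x(1)] yc add_cancel_left by (simp add: a_minus_def)
      ultimately have "y \<in> B +> (\<ominus> x)" unfolding mem_coset by blast
      then show "Y = B +> (\<ominus> x)" unfolding y(2) by (rule coset_eq(1)[OF B c[OF mx]])
    qed
    then show "inv\<^bsub>add_monoid quotient\<^esub> X \<in> (\<lambda>x. B +> x) ` N" using mx by simp
  qed
  moreover have "smult quotient a X \<in> (\<lambda>x. B +> x) ` N" if "a \<in> carrier R" "X \<in> (\<lambda>x. B +> x) ` N" for a X
    using that quotient_smult[OF that(1) c] idealD(6)[OF N that(1)] by auto
  ultimately show ?thesis by (intro submodule.intro submodule_axioms.intro)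
qed

text \<open>The correspondence theorem: unions of cosets in one direction, cosets of elements in the
  other, both strictly monotone. Through it the lengths in the definitions become lengths of
  intervals of ideals.\<close>

lemma module_length_quotient: "module_length R quotient = len B E"
proof (rule antisym)
  show "module_length R quotient \<le> len B E"
    unfolding module_length_eq
  proof (rule chain_length_transport[where g = "\<lambda>N. \<Union>N"])
    fix N :: "'a set set" assume "N \<in> {N. submodule N R quotient}"
    then show "\<Union>N \<in> submods R (carrier R) \<and> B \<subseteq> \<Union>N \<and> \<Union>N \<subseteq> E"
      using submodule_quotientD(1-3) by (simp add: ideal_iff_submods)
  next
    fix N N' assume N: "N \<in> {N. submodule N R quotient}" "N' \<in> {N. submodule N R quotient}" "N \<subset> N'"
    obtain X where X: "X \<in> N'" "X \<notin> N" using N(3) by blast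
    obtain x where x: "x \<in> E" "X = B +> x" using submodule_quotientD(4)[OF _ X(1)] N(2) by blast
    have xc: "x \<in> carrier R" by (rule idealD(8)[OF E x(1)])
    have "x \<in> \<Union>N'" using coset_self[OF B xc] x X by blast
    moreover have "x \<notin> \<Union>N"
    proof
      assume "x \<in> \<Union>N"
      then obtain Y where Y: "Y \<in> N" "x \<in> Y" by blast
      obtain y where y: "y \<in> E" "Y = B +> y" using submodule_quotientD(4)[OF _ Y(1)] N(1) by blast
      have "X = Y" using coset_eq(1)[OF B idealD(8)[OF E y(1)], of x] Y(2) x(2) y(2) by simp
      then show False using X Y by simp
    qed
    ultimately show "\<Union>N \<subset> \<Union>N'" using N(3) by blast
  qed
  show "len B E \<le> module_length R quotient"
    unfolding module_length_eq
  proof (rule chain_length_transport[where g = "\<lambda>N. (\<lambda>x. B +> x) ` N"])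
    fix N assume "N \<in> submods R (carrier R)" "B \<subseteq> N" "N \<subseteq> E"
    then show "(\<lambda>x. B +> x) ` N \<in> {N. submodule N R quotient} \<and> {} \<subseteq> (\<lambda>x. B +> x) ` N \<and> (\<lambda>x. B +> x) ` N \<subseteq> UNIV"
      using submodule_quotientI by (simp add: ideal_iff_submods)
  next
    fix N N' assume N: "N \<in> submods R (carrier R)" "N' \<in> submods R (carrier R)" "B \<subseteq> N" "N \<subset> N'" "N' \<subseteq> E"
    obtain x where x: "x \<in> N'" "x \<notin> N" using N(4) by blast
    have xc: "x \<in> carrier R" using x N(5) idealD(8)[OF E] by blast
    have "B +> x \<notin> (\<lambda>x. B +> x) ` N"
    proof
      assume "B +> x \<in> (\<lambda>x. B +> x) ` N"
      then obtain y where y: "y \<in> N" "B +> x = B +> y" by blast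
      then have "x \<in> B +> y" using coset_self[OF B xc] by simp
      then show False using coset_in_super[OF _ N(3) y(1)] N(1) x(2) by (auto simp: ideal_iff_submods)
    qed
    then show "(\<lambda>x. B +> x) ` N \<subset> (\<lambda>x. B +> x) ` N'" using x(1) N(4) by blast
  qed
qed

end

end

section \<open>Hilbert coefficients, annihilator and dimension of the Sally module\<close>

context m_reduction
begin

text \<open>The binomial next to \<open>e i\<close> is the basis function of index
  \<open>d - i\<close>, so the Hilbert coefficients are the coefficients in
  \<open>has_num_poly\<close> read backwards with alternating signs. Uniqueness of the latter
  resolves the definite description.\<close>

lemma hilbert_coeff_eq:
  assumes I: "ideal I R" and fin: "\<And>n. len (ideal_power R I n) (carrier R) \<noteq> \<infinity>"
    and c: "has_num_poly (Suc d) c (\<lambda>n. int (fin_len (ideal_power R I n) (carrier R)))"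
  shows "hilbert_coeff R d I = (\<lambda>i. if i \<le> d then (- 1) ^ i * c (d - i) else 0)"
proof -
  have Ip: "ideal (ideal_power R I n) R" for n by (rule ideal_power_ideal[OF I])
  have ml: "module_length R (quot_module (ideal_module R (carrier R)) (ideal_power R I n)) = enat (fin_len (ideal_power R I n) (carrier R))" for n
    unfolding module_length_quotient[OF oneideal Ip idealD(1)[OF Ip]] using fin[of n] by (cases "len (ideal_power R I n) (carrier R)") auto
  define co where "co = (\<lambda>(e :: nat \<Rightarrow> int) k. if k \<le> d then (- 1) ^ (d - k) * e (d - k) else 0)"
  have sum: "(\<Sum>i\<le>d. (- 1) ^ i * e i * int ((n + d - 1 - i) choose (d - i))) = (\<Sum>k<Suc d. co e k * int ((n + k - 1) choose k))" for e :: "nat \<Rightarrow> int" and n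
    unfolding lessThan_Suc_atMost
  proof (rule sum.reindex_bij_witness[where i = "\<lambda>k. d - k" and j = "\<lambda>i. d - i"])
    fix i assume i: "i \<in> {..d}"
    have "n + d - 1 - i = n + (d - i) - 1" using i by auto
    then show "co e (d - i) * int ((n + (d - i) - 1) choose (d - i)) = (- 1) ^ i * e i * int ((n + d - 1 - i) choose (d - i))"
      using i by (simp add: co_def)
  qed auto
  have iff: "is_hilbert_coeffs R d I e \<longleftrightarrow> (\<forall>i>d. e i = 0) \<and> has_num_poly (Suc d) (co e) (\<lambda>n. int (fin_len (ideal_power R I n) (carrier R)))" for e
    unfolding is_hilbert_coeffs_def has_num_poly_def ml sum by (auto simp: co_def)
  show ?thesis
    unfolding hilbert_coeff_def
  proof (rule the_equality)
    let ?e = "\<lambda>i. if i \<le> d then (- 1) ^ i * c (d - i) else 0"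
    have "co ?e = c"
    proof
      fix k show "co ?e k = c k" using c by (simp add: co_def has_num_poly_def power_add[symmetric] mult.assoc[symmetric])
    qed
    then show "is_hilbert_coeffs R d I ?e" unfolding iff using c by simp
    fix e assume e: "is_hilbert_coeffs R d I e"
    then have "co e = c" using has_num_poly_unique[OF _ c] unfolding iff by blast
    then have "co e (d - i) = c (d - i)" for i by simp
    then have "(- 1) ^ i * c (d - i) = e i" if "i \<le> d" for i
      using that by (simp add: co_def flip: mult.assoc power_add) (metis (no_types, lifting) diff_diff_cancel mult.assoc mult_1 power_mult_distrib minus_one_mult_self)
    then show "e = ?e" using e unfolding iff by (auto simp: fun_eq_iff)
  qed
qed

text \<open>The annihilator of the Sally module, degree by degree: the numerator has the power of
  \<open>\<mm>\<close> with exponent \<open>n + 1\<close> in degree \<open>n\<close>, and its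
  products with the i-th coefficient must land in degree \<open>i + n\<close> of the denominator.
  The identification is \<open>sally_annihilator\<close>.\<close>

definition annihilator :: "(nat \<Rightarrow> 'a) set" where
  "annihilator = {a \<in> carrier Rees. \<forall>i n. \<forall>y\<in>ideal_power R \<mm> (n + 1). a i \<otimes> y \<in> \<mm> \<cdot> ideal_power R J (i + n)}"

lemma annihilator_ideal: "ideal annihilator Rees"
proof -
  interpret A: cring Rees by (rule Rees_cring)
  define Q where "Q = (\<lambda>i. {b \<in> carrier R. \<forall>n. \<forall>y\<in>ideal_power R \<mm> (n + 1). b \<otimes> y \<in> \<mm> \<cdot> ideal_power R J (i + n)})"
  have yc: "y \<in> carrier R" if "y \<in> ideal_power R \<mm> n" for y n using idealD(8)[OF mp that] .
  have Q: "ideal (Q i) R" for i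
    unfolding ideal_iff_submods
  proof (rule submodsI)
    show "Q i \<subseteq> carrier R" by (auto simp: Q_def)
    have "\<zero> \<otimes> y \<in> \<mm> \<cdot> ideal_power R J (i + n)" if y: "y \<in> ideal_power R \<mm> (n + 1)" for y n
      using yc[OF y] idealD(2)[OF mJ] by simp
    then show "\<zero> \<in> Q i" unfolding Q_def by blast
    fix u assume u: "u \<in> Q i"
    then have uc: "u \<in> carrier R" and uQ: "\<And>y n. y \<in> ideal_power R \<mm> (n + 1) \<Longrightarrow> u \<otimes> y \<in> \<mm> \<cdot> ideal_power R J (i + n)"
      unfolding Q_def by blast+
    have "(\<ominus> u) \<otimes> y \<in> \<mm> \<cdot> ideal_power R J (i + n)" if y: "y \<in> ideal_power R \<mm> (n + 1)" for y n
      using l_minus[OF uc yc[OF y]] idealD(4)[OF mJ uQ[OF y]] by simp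
    then show "\<ominus> u \<in> Q i" unfolding Q_def using uc by blast
    fix v assume v: "v \<in> Q i"
    then have vc: "v \<in> carrier R" and vQ: "\<And>y n. y \<in> ideal_power R \<mm> (n + 1) \<Longrightarrow> v \<otimes> y \<in> \<mm> \<cdot> ideal_power R J (i + n)"
      unfolding Q_def by blast+
    have "(u \<oplus> v) \<otimes> y \<in> \<mm> \<cdot> ideal_power R J (i + n)" if y: "y \<in> ideal_power R \<mm> (n + 1)" for y n
      using l_distr[OF uc vc yc[OF y]] idealD(3)[OF mJ uQ[OF y] vQ[OF y]] by simp
    then show "u \<oplus> v \<in> Q i" unfolding Q_def using uc vc by blast
  next
    fix c u assume c: "c \<in> carrier R" and u: "u \<in> Q i"
    then have uc: "u \<in> carrier R" and uQ: "\<And>y n. y \<in> ideal_power R \<mm> (n + 1) \<Longrightarrow> u \<otimes> y \<in> \<mm> \<cdot> ideal_power R J (i + n)"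
      unfolding Q_def by blast+
    have "(c \<otimes> u) \<otimes> y \<in> \<mm> \<cdot> ideal_power R J (i + n)" if y: "y \<in> ideal_power R \<mm> (n + 1)" for y n
      using m_assoc[OF c uc yc[OF y]] idealD(6)[OF mJ c uQ[OF y]] by simp
    then show "c \<otimes> u \<in> Q i" unfolding Q_def using c uc by blast
  qed
  have "z \<otimes> q \<in> Q (n + k)" if q: "q \<in> Q n" and z: "z \<in> ideal_power R J k" for q z n k
  proof -
    have zc: "z \<in> carrier R" using z idealD(8)[OF Jp] by blast
    have qc: "q \<in> carrier R" using q by (simp add: Q_def)
    have "(z \<otimes> q) \<otimes> y \<in> \<mm> \<cdot> ideal_power R J (n + k + l)" if y: "y \<in> ideal_power R \<mm> (l + 1)" for y l
    proof -
      have "q \<otimes> y \<in> \<mm> \<cdot> ideal_power R J (n + l)" using q y unfolding Q_def by blast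
      then have "z \<otimes> (q \<otimes> y) \<in> \<mm> \<cdot> ideal_power R J (k + (n + l))" by (rule m_power_mult[OF J_ideal z])
      moreover have "k + (n + l) = n + k + l" by simp
      ultimately show ?thesis using zc qc yc[OF y] by (simp only: m_assoc)
    qed
    then show ?thesis unfolding Q_def using zc qc by blast
  qed
  then have "ideal (graded_part J Q) Rees" by (intro graded_part_ideal[OF J_ideal] Q)
  moreover have "graded_part J Q = annihilator"
    unfolding graded_part_def annihilator_def Q_def using rees_coeff by blast
  ultimately show ?thesis by simp
qed

lemma sally_annihilator: "module_annihilator Rees (sally_module R J \<mm>) = annihilator"
proof -
  let ?S = "rees_algebra R \<mm>"
  interpret A: cring Rees by (rule Rees_cring)
  interpret S: cring ?S by (rule rees_cring[OF m_ideal])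
  define E where "E = graded_part \<mm> (\<lambda>n. \<mm> \<cdot> ideal_power R \<mm> n)"
  define N where "N = graded_part J (\<lambda>n. \<mm> \<cdot> ideal_power R J n)"
  have extE: "rees_extension R \<mm> \<mm> = E" unfolding E_def by (rule rees_extension_eq[OF m_ideal m_ideal])
  have extN: "rees_extension R \<mm> J = N" unfolding N_def by (rule rees_extension_eq[OF J_ideal m_ideal])
  have AS: "carrier Rees \<subseteq> carrier ?S" using J_power_m unfolding rees_mem[OF m_ideal] rees_mem[OF J_ideal] subset_iff by blast
  have Eid: "ideal E ?S" unfolding extE[symmetric] rees_extension_def
  proof (rule S.genideal_ideal)
    have "monom (UP R) a 0 = single a 0" if "a \<in> \<mm>" for a using idealD(8)[OF m_ideal that] by (simp add: UP_def single_def)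
    moreover have "single a 0 \<in> carrier ?S" if "a \<in> \<mm>" for a
      using idealD(8)[OF m_ideal that] by (intro single_mem[OF m_ideal]) (simp add: ideal_power_0)
    ultimately show "(\<lambda>a. monom (UP R) a 0) ` \<mm> \<subseteq> carrier ?S" by auto
  qed
  have N_eq: "N = fibre_prime_ideal 0" by (auto simp: N_def fibre_prime_ideal_def graded_part_def fibre_ideal_0)
  have Nid: "ideal N Rees" unfolding N_eq using primeideal_fibre[of 0] by (auto intro: primeideal.axioms)
  have NA: "N \<subseteq> carrier Rees" by (rule A.idealD(1)[OF Nid])
  have NE: "N \<subseteq> E"
    using AS prod_mono[OF order_refl J_power_m, of \<mm>] by (fastforce simp: N_def E_def graded_part_def)
  have add_eq: "add ?S = add Rees" by (simp add: rees_algebra_def)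
  let ?M = "ideal_module ?S E"
  \<comment> \<open>Numerator and denominator live in different Rees algebras with the same
    addition; cosets are rewritten with the addition of \<open>Rees\<close>, where the denominator
    is an ideal.\<close>
  define cs where "cs = (\<lambda>z. {b \<oplus>\<^bsub>Rees\<^esub> z | b. b \<in> N})"
  have cs: "N +>\<^bsub>?M\<^esub> z = cs z" for z by (auto simp: a_r_coset_def' cs_def ideal_module_def add_eq)
  have car: "carrier (sally_module R J \<mm>) = cs ` E"
    unfolding sally_module_def extE extN by (auto simp: quot_module_def A_RCOSETS_def' cs[unfolded a_r_coset_def'] a_r_coset_def') (auto simp: ideal_module_def cs_def add_eq a_r_coset_def')
  have zer: "\<zero>\<^bsub>sally_module R J \<mm>\<^esub> = N" unfolding sally_module_def extN by (simp add: quot_module_def)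
  have smu: "a \<odot>\<^bsub>sally_module R J \<mm>\<^esub> X = (\<Union>z\<in>X. cs (a \<otimes>\<^bsub>?S\<^esub> z))" for a X
    unfolding sally_module_def extE extN by (simp add: quot_module_def cs) (simp add: ideal_module_def)
  have cs_self: "z \<in> cs z" if "z \<in> carrier ?S" for z
  proof -
    have "z = \<zero>\<^bsub>Rees\<^esub> \<oplus>\<^bsub>?S\<^esub> z" using S.l_zero[OF that] by (simp add: rees_algebra_def)
    then show ?thesis using A.idealD(2)[OF Nid] unfolding cs_def add_eq by blast
  qed
  have cs_N: "cs z = N" if z: "z \<in> N" for z
  proof
    show "cs z \<subseteq> N" using A.idealD(3)[OF Nid _ z] by (auto simp: cs_def)
    show "N \<subseteq> cs z"
    proof
      fix b assume b: "b \<in> N"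
      have c: "b \<in> carrier Rees" "z \<in> carrier Rees" using b z NA by auto
      have "b = (b \<ominus>\<^bsub>Rees\<^esub> z) \<oplus>\<^bsub>Rees\<^esub> z" using c by (simp add: a_minus_def A.a_assoc A.l_neg)
      then show "b \<in> cs z" using A.idealD(5)[OF Nid b z] unfolding cs_def by blast
    qed
  qed
  have iff: "(\<forall>X\<in>carrier (sally_module R J \<mm>). a \<odot>\<^bsub>sally_module R J \<mm>\<^esub> X = \<zero>\<^bsub>sally_module R J \<mm>\<^esub>)
     \<longleftrightarrow> (\<forall>z\<in>E. a \<otimes>\<^bsub>?S\<^esub> z \<in> N)" if a: "a \<in> carrier Rees" for a
  proof
    assume L: "\<forall>X\<in>carrier (sally_module R J \<mm>). a \<odot>\<^bsub>sally_module R J \<mm>\<^esub> X = \<zero>\<^bsub>sally_module R J \<mm>\<^esub>"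
    show "\<forall>z\<in>E. a \<otimes>\<^bsub>?S\<^esub> z \<in> N"
    proof
      fix z assume z: "z \<in> E"
      have zc: "z \<in> carrier ?S" "a \<otimes>\<^bsub>?S\<^esub> z \<in> carrier ?S" using S.idealD(8)[OF Eid z] a AS by auto
      have "(\<Union>w\<in>cs z. cs (a \<otimes>\<^bsub>?S\<^esub> w)) = N" using L z unfolding car smu zer by blast
      then show "a \<otimes>\<^bsub>?S\<^esub> z \<in> N" using cs_self[OF zc(1)] cs_self[OF zc(2)] by blast
    qed
  next
    assume Rr: "\<forall>z\<in>E. a \<otimes>\<^bsub>?S\<^esub> z \<in> N"
    show "\<forall>X\<in>carrier (sally_module R J \<mm>). a \<odot>\<^bsub>sally_module R J \<mm>\<^esub> X = \<zero>\<^bsub>sally_module R J \<mm>\<^esub>"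
    proof
      fix X assume "X \<in> carrier (sally_module R J \<mm>)"
      then obtain z where z: "z \<in> E" "X = cs z" unfolding car by blast
      have "w \<in> E" if "w \<in> cs z" for w
        using that NE z(1) S.idealD(3)[OF Eid] unfolding cs_def add_eq[symmetric] by blast
      then have "cs (a \<otimes>\<^bsub>?S\<^esub> w) = N" if "w \<in> cs z" for w using Rr cs_N that by blast
      moreover have "z \<in> cs z" using cs_self S.idealD(8)[OF Eid z(1)] by blast
      ultimately show "a \<odot>\<^bsub>sally_module R J \<mm>\<^esub> X = \<zero>\<^bsub>sally_module R J \<mm>\<^esub>" unfolding smu zer z(2) by blast
    qed
  qed
  have E_mem: "z \<in> E \<longleftrightarrow> z \<in> carrier ?S \<and> (\<forall>n. z n \<in> ideal_power R \<mm> (n + 1))" for z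
    unfolding E_def graded_part_def mem_Collect_eq ideal_power_Suc2[OF m_ideal, symmetric] by simp
  have N_mem: "z \<in> N \<longleftrightarrow> z \<in> carrier Rees \<and> (\<forall>n. z n \<in> \<mm> \<cdot> ideal_power R J n)" for z
    by (simp add: N_def graded_part_def)
  have prod: "(a \<otimes>\<^bsub>?S\<^esub> z) k = (\<Oplus>i\<in>{..k}. a i \<otimes> z (k - i))" if "a \<in> carrier Rees" "z \<in> carrier ?S" for a z k
    using rees_ops(2)[OF m_ideal _ that(2)] that(1) AS by auto
  have "(\<forall>z\<in>E. a \<otimes>\<^bsub>?S\<^esub> z \<in> N) \<longleftrightarrow> (\<forall>i n. \<forall>y\<in>ideal_power R \<mm> (n + 1). a i \<otimes> y \<in> \<mm> \<cdot> ideal_power R J (i + n))" if a: "a \<in> carrier Rees" for a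
  proof
    assume L: "\<forall>z\<in>E. a \<otimes>\<^bsub>?S\<^esub> z \<in> N"
    show "\<forall>i n. \<forall>y\<in>ideal_power R \<mm> (n + 1). a i \<otimes> y \<in> \<mm> \<cdot> ideal_power R J (i + n)"
    proof (intro allI ballI)
      \<comment> \<open>Monomials suffice as tests: multiplication by \<open>single y n\<close>
        moves the i-th coefficient to degree \<open>i + n\<close>.\<close>
      fix i n y assume y: "y \<in> ideal_power R \<mm> (n + 1)"
      have yn: "y \<in> ideal_power R \<mm> n" using y ideal_power_antimono[OF m_ideal, of n "n + 1"] by auto
      have yc: "y \<in> carrier R" by (rule idealD(8)[OF mp y])
      have sS: "single y n \<in> carrier ?S" by (rule single_mem[OF m_ideal yn])
      have "single y n k \<in> ideal_power R \<mm> (k + 1)" for k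
      proof (cases "k = n")
        case True then show ?thesis using y by (simp only: single_def if_True refl)
      next
        case False then show ?thesis using idealD(2)[OF mp, of "k + 1"] by (simp only: single_def if_False)
      qed
      then have "single y n \<in> E" unfolding E_mem using sS by blast
      then have "(a \<otimes>\<^bsub>?S\<^esub> single y n) (i + n) \<in> \<mm> \<cdot> ideal_power R J (i + n)" using L N_mem by blast
      moreover have "a \<otimes>\<^bsub>?S\<^esub> single y n = single y n \<otimes>\<^bsub>?S\<^esub> a" using a AS sS by (intro S.m_comm) auto
      moreover have "(single y n \<otimes>\<^bsub>?S\<^esub> a) (i + n) = y \<otimes> a i"
        using rees_mult_single[OF m_ideal yn, of a] a AS by auto
      ultimately show "a i \<otimes> y \<in> \<mm> \<cdot> ideal_power R J (i + n)" using m_comm[OF yc rees_coeff[OF a]] by simp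
    qed
  next
    assume Rr: "\<forall>i n. \<forall>y\<in>ideal_power R \<mm> (n + 1). a i \<otimes> y \<in> \<mm> \<cdot> ideal_power R J (i + n)"
    show "\<forall>z\<in>E. a \<otimes>\<^bsub>?S\<^esub> z \<in> N"
    proof
      fix z assume z: "z \<in> E"
      have zS: "z \<in> carrier ?S" and zn: "\<And>n. z n \<in> ideal_power R \<mm> (n + 1)" using z unfolding E_mem by auto
      have m: "(a \<otimes>\<^bsub>?S\<^esub> z) k \<in> \<mm> \<cdot> ideal_power R J k" for k
        unfolding prod[OF a zS]
      proof (rule finsum_ideal[OF mJ])
        fix i assume i: "i \<in> {..k}"
        have "a i \<otimes> z (k - i) \<in> \<mm> \<cdot> ideal_power R J (i + (k - i))" using Rr zn by blast
        then show "a i \<otimes> z (k - i) \<in> \<mm> \<cdot> ideal_power R J k" using i by simp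
      qed simp
      have "a \<otimes>\<^bsub>?S\<^esub> z \<in> carrier ?S" using a AS zS by blast
      then have "a \<otimes>\<^bsub>?S\<^esub> z \<in> carrier Rees"
        using m prod_subset2[OF m_ideal Jp] unfolding rees_mem[OF m_ideal] rees_mem[OF J_ideal] by blast
      then show "a \<otimes>\<^bsub>?S\<^esub> z \<in> N" unfolding N_mem using m by blast
    qed
  qed
  then have "(\<forall>X\<in>carrier (sally_module R J \<mm>). a \<odot>\<^bsub>sally_module R J \<mm>\<^esub> X = \<zero>\<^bsub>sally_module R J \<mm>\<^esub>)
     \<longleftrightarrow> (\<forall>i n. \<forall>y\<in>ideal_power R \<mm> (n + 1). a i \<otimes> y \<in> \<mm> \<cdot> ideal_power R J (i + n))" if "a \<in> carrier Rees" for a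
    using iff[OF that] that by simp
  then show ?thesis unfolding module_annihilator_def annihilator_def by (intro Collect_cong conj_cong refl)
qed

text \<open>The annihilating power of \<open>\<mm>\<close> is the r-th: it sends the power with
  exponent \<open>n + 1\<close> into the one with exponent \<open>n + r + 1\<close>, which
  \<open>m_power_mJn\<close> places in the denominator. A prime containing these constants contains
  those from \<open>\<mm>\<close>, and hence the ideal they generate.\<close>

lemma annihilator_prime:
  assumes Q: "primeideal Q Rees" and AQ: "annihilator \<subseteq> Q" shows "fibre_prime_ideal 0 \<subseteq> Q"
proof -
  interpret A: cring Rees by (rule Rees_cring)
  have Qi: "ideal Q Rees" using Q by (rule primeideal.axioms)
  have ann: "single u 0 \<in> annihilator" if u: "u \<in> ideal_power R \<mm> r" for u
  proof -
    have uc: "u \<in> carrier R" using u idealD(8)[OF mp] by blast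
    have "single u 0 i \<otimes> y \<in> \<mm> \<cdot> ideal_power R J (i + n)" if y: "y \<in> ideal_power R \<mm> (n + 1)" for i n y
    proof (cases "i = 0")
      case True
      have e: "n + r + 1 = r + (n + 1)" by simp
      have "u \<otimes> y \<in> ideal_power R \<mm> (n + r + 1)" unfolding e by (rule ideal_power_multI[OF m_ideal u y])
      then have "u \<otimes> y \<in> \<mm> \<cdot> ideal_power R J n" using m_power_mJn by blast
      then show ?thesis using True by (simp add: single_def)
    next
      case False
      then show ?thesis using idealD(8)[OF mp y] idealD(2)[OF mJ] by (simp add: single_def)
    qed
    then show ?thesis using single_const_mem[OF uc] unfolding annihilator_def by blast
  qed
  have const: "single y 0 \<in> Q" if y: "y \<in> \<mm>" for y
  proof -
    have yc: "y \<in> carrier R" by (rule idealD(8)[OF m_ideal y])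
    have yp: "y [^] (k::nat) \<in> ideal_power R \<mm> k" for k
    proof (induction k)
      case (Suc k) then show ?case using prodI[OF Suc y] by simp
    qed (simp add: ideal_power_0)
    have "single (y [^] (k::nat)) 0 \<in> Q \<Longrightarrow> single y 0 \<in> Q" for k
    proof (induction k)
      case 0
      have "single \<one> 0 = \<one>\<^bsub>Rees\<^esub>" by (auto simp: single_def rees_consts_J)
      then show ?case using 0 ideal.one_imp_carrier[OF Qi] primeideal.I_notcarr[OF Q] by simp
    next
      case (Suc k)
      have ykc: "y [^] k \<in> carrier R" using yc by simp
      have "single (y [^] k) 0 \<otimes>\<^bsub>Rees\<^esub> single y 0 = single (y [^] Suc k) 0"
        unfolding const_mult[OF ykc single_const_mem[OF yc]] using ykc yc by (auto simp: single_def)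
      then have "single (y [^] k) 0 \<in> Q \<or> single y 0 \<in> Q"
        using primeideal.I_prime[OF Q single_const_mem[OF ykc] single_const_mem[OF yc]] Suc.prems by simp
      then show ?case using Suc.IH by blast
    qed
    then show ?thesis using ann[OF yp[of r]] AQ by blast
  qed
  have mon: "monom (UP R) a 0 = single a 0" if "a \<in> \<mm>" for a using idealD(8)[OF m_ideal that] by (simp add: UP_def single_def)
  have "fibre_prime_ideal 0 = rees_extension R \<mm> J"
    unfolding rees_extension_eq[OF J_ideal m_ideal] by (simp add: fibre_prime_ideal_def graded_part_def fibre_ideal_0)
  also have "\<dots> \<subseteq> Q" unfolding rees_extension_def
    by (rule A.genideal_minimal[OF Qi]) (use const mon in auto)
  finally show ?thesis .
qed

lemma sally_dim_iff: "module_dim Rees (sally_module R J \<mm>) = ereal (real d) \<longleftrightarrow> annihilator \<subseteq> fibre_prime_ideal 0"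
proof -
  interpret A: cring Rees by (rule Rees_cring)
  have dim: "module_dim Rees (sally_module R J \<mm>) = ereal (real d) \<longleftrightarrow> prime_chain Rees annihilator d \<and> \<not> prime_chain Rees annihilator (Suc d)"
    unfolding module_dim_def sally_annihilator krull_dim_eq_iff A.prime_chain_quot[OF annihilator_ideal] ..
  show ?thesis
  proof
    assume "module_dim Rees (sally_module R J \<mm>) = ereal (real d)"
    then obtain Q where Q: "\<And>i. i \<le> d \<Longrightarrow> primeideal (Q i) Rees" "\<And>i. i \<le> d \<Longrightarrow> annihilator \<subseteq> Q i" "\<And>i. i < d \<Longrightarrow> Q i \<subset> Q (Suc i)"
      unfolding dim prime_chain_def by blast
    have F: "fibre_prime_ideal 0 \<subseteq> Q i" if "i \<le> d" for i by (rule annihilator_prime[OF Q(1,2)[OF that]])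
    show "annihilator \<subseteq> fibre_prime_ideal 0"
    proof (rule ccontr)
      assume "\<not> annihilator \<subseteq> fibre_prime_ideal 0"
      then have ne: "fibre_prime_ideal 0 \<subset> Q 0" using F[of 0] Q(2)[of 0] by auto
      \<comment> \<open>An annihilator outside \<open>fibre_prime_ideal 0\<close> makes
        \<open>Q 0\<close> strictly larger than it, so prepending it yields a chain of
        \<open>d + 2\<close> primes.\<close>
      define P' where "P' = (\<lambda>i. case i of 0 \<Rightarrow> fibre_prime_ideal 0 | Suc j \<Rightarrow> Q j)"
      have "primeideal (P' i) Rees \<and> fibre_prime_ideal 0 \<subseteq> P' i" if "i \<le> Suc d" for i
        using that Q(1) F primeideal_fibre[of 0] by (cases i) (auto simp: P'_def)
      moreover have "P' i \<subset> P' (Suc i)" if "i < Suc d" for i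
        using that Q(3) ne by (cases i) (auto simp: P'_def)
      ultimately have "prime_chain Rees (fibre_prime_ideal 0) (Suc d)" unfolding prime_chain_def by blast
      then show False using no_long_prime_chain by blast
    qed
  next
    assume sub: "annihilator \<subseteq> fibre_prime_ideal 0"
    have "fibre_prime_ideal 0 \<subseteq> fibre_prime_ideal i" if "i \<le> d" for i
      using that
    proof (induction i)
      case (Suc i)
      then show ?case using fibre_prime_strict[of i] by force
    qed simp
    then have "prime_chain Rees annihilator d"
      unfolding prime_chain_def using primeideal_fibre fibre_prime_strict sub by (intro exI[of _ fibre_prime_ideal]) blast
    moreover have "\<not> prime_chain Rees annihilator (Suc d)"
    proof
      assume "prime_chain Rees annihilator (Suc d)"
      then obtain Q where "\<forall>i\<le>Suc d. primeideal (Q i) Rees \<and> annihilator \<subseteq> Q i" "\<forall>i<Suc d. Q i \<subset> Q (Suc i)"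
        unfolding prime_chain_def by blast
      then have "prime_chain Rees (fibre_prime_ideal 0) (Suc d)"
        unfolding prime_chain_def using annihilator_prime by blast
      then show False using no_long_prime_chain by blast
    qed
    ultimately show "module_dim Rees (sally_module R J \<mm>) = ereal (real d)" unfolding dim by blast
  qed
qed

text \<open>Passage between polynomials and forms: every coefficient of an annihilating polynomial
  annihilates by itself, and conversely a form \<open>f\<close> of degree \<open>K\<close> gives the
  monomial \<open>single f K\<close>. The two growth results for annihilating forms then decide the
  sign of the top coefficient.\<close>

lemma annihilator_iff:
  assumes c: "has_num_poly d c (\<lambda>n. int (fin_len (\<mm> \<cdot> ideal_power R J (n - 1)) (ideal_power R \<mm> n)))"
  shows "annihilator \<subseteq> fibre_prime_ideal 0 \<longleftrightarrow> c (d - 1) > 0"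
proof -
  obtain e where e: "d = Suc e" using d_pos by (cases d) auto
  let ?s = "\<lambda>n. len (\<mm> \<cdot> ideal_power R J (n - 1)) (ideal_power R \<mm> n)"
  have fin: "enat (fin_len (\<mm> \<cdot> ideal_power R J (n - 1)) (ideal_power R \<mm> n)) = ?s n" for n
    by (rule fin_mJ[OF idealD(1)[OF mp]])
  show ?thesis
  proof
    assume sub: "annihilator \<subseteq> fibre_prime_ideal 0"
    have "c e \<ge> 0" by (rule has_num_poly_lead_nonneg[OF c[unfolded e]]) simp
    moreover have "c e \<noteq> 0"
    proof
      assume "c e = 0"
      then have "has_num_poly e c (\<lambda>n. int (fin_len (\<mm> \<cdot> ideal_power R J (n - 1)) (ideal_power R \<mm> n)))"
        by (rule has_num_poly_drop[OF c[unfolded e]])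
      from has_num_poly_small[OF this] have "small d ?s" unfolding fin e .
      then obtain K f where f: "f \<in> ideal_power R J K" "f \<notin> \<mm> \<cdot> ideal_power R J K"
        "\<And>n y. y \<in> ideal_power R \<mm> (n + 1) \<Longrightarrow> f \<otimes> y \<in> \<mm> \<cdot> ideal_power R J (K + n)"
        using annihilator_if_small by blast
      have "single f K i \<otimes> y \<in> \<mm> \<cdot> ideal_power R J (i + n)" if y: "y \<in> ideal_power R \<mm> (n + 1)" for i n y
        using f(3)[OF y] idealD(8)[OF mp y] idealD(2)[OF mJ] by (cases "i = K") (simp_all add: single_def)
      then have "single f K \<in> annihilator" unfolding annihilator_def using single_mem[OF J_ideal f(1)] by blast
      then have "single f K \<in> fibre_prime_ideal 0" using sub by blast
      then have "single f K K \<in> \<mm> \<cdot> ideal_power R J K" unfolding mem_fibre_prime_ideal fibre_ideal_0 by blast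
      then show False using f(2) by (simp add: single_def)
    qed
    ultimately show "c (d - 1) > 0" using e by simp
  next
    assume pos: "c (d - 1) > 0"
    show "annihilator \<subseteq> fibre_prime_ideal 0"
    proof (rule ccontr)
      assume "\<not> annihilator \<subseteq> fibre_prime_ideal 0"
      then obtain a where a: "a \<in> annihilator" "a \<notin> fibre_prime_ideal 0" by blast
      have aA: "a \<in> carrier Rees" using a by (simp add: annihilator_def)
      then obtain K where K: "a K \<notin> \<mm> \<cdot> ideal_power R J K" using a(2) unfolding mem_fibre_prime_ideal fibre_ideal_0 by blast
      have "a K \<in> ideal_power R J K" using aA by (simp add: rees_mem_J)
      moreover have "a K \<otimes> y \<in> \<mm> \<cdot> ideal_power R J (K + n)" if "y \<in> ideal_power R \<mm> (n + 1)" for n y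
        using a(1) that unfolding annihilator_def by blast
      ultimately have "small d ?s" using K by (intro small_if_annihilated)
      then have "small (Suc e) (\<lambda>n. enat (fin_len (\<mm> \<cdot> ideal_power R J (n - 1)) (ideal_power R \<mm> n)))"
        unfolding fin e .
      then have "c e \<le> 0" by (rule small_has_num_poly[OF c[unfolded e]])
      then show False using pos e by simp
    qed
  qed
qed

lemma sally_hilbert_poly_eq:
  assumes c: "has_num_poly d c (\<lambda>n. int (fin_len (\<mm> \<cdot> ideal_power R J (n - 1)) (ideal_power R \<mm> n)))"
  shows "sally_hilbert_poly R J \<mm> = num_poly d c"
proof -
  let ?f = "\<lambda>n. fin_len (\<mm> \<cdot> ideal_power R J (n - 1)) (ideal_power R \<mm> n)"
  have ml: "module_length R (sally_component R J \<mm> n) = enat (?f n)" if n: "n \<ge> 1" for n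
  proof -
    obtain k where k: "n = Suc k" using n by (cases n) auto
    have sub: "\<mm> \<cdot> ideal_power R J (n - 1) \<subseteq> ideal_power R \<mm> n" unfolding k using mJ_subset_m[of k] by simp
    show ?thesis unfolding sally_component_def module_length_quotient[OF mp mJ sub] fin_mJ[OF idealD(1)[OF mp]] ..
  qed
  have ev: "(\<forall>\<^sub>F n in sequentially. \<exists>l. module_length R (sally_component R J \<mm> n) = enat l \<and> of_nat l = poly p (of_nat n))
      \<longleftrightarrow> (\<forall>\<^sub>F n in sequentially. of_nat (?f n) = poly p (of_nat n))" for p :: "rat poly"
  \<comment> \<open>At \<open>n = 0\<close> the truncated \<open>n - 1\<close> spoils the component,
    so only \<open>n \<ge> 1\<close> is compared.\<close>
  proof (rule eventually_cong[OF eventually_ge_at_top[of 1]])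
    fix n :: nat assume "1 \<le> n"
    then show "(\<exists>l. module_length R (sally_component R J \<mm> n) = enat l \<and> of_nat l = poly p (of_nat n)) \<longleftrightarrow> of_nat (?f n) = poly p (of_nat n)"
      using ml by auto
  qed
  have np: "\<forall>\<^sub>F n in sequentially. of_nat (?f n) = poly (num_poly d c :: rat poly) (of_nat n)"
    using has_num_poly_poly[OF c, where 'a=rat] by simp
  show ?thesis
    unfolding sally_hilbert_poly_def ev
  proof (rule the_equality)
    show "\<forall>\<^sub>F n in sequentially. of_nat (?f n) = poly (num_poly d c :: rat poly) (of_nat n)" by (rule np)
    fix p :: "rat poly" assume "\<forall>\<^sub>F n in sequentially. of_nat (?f n) = poly p (of_nat n)"
    then have "\<forall>\<^sub>F n in sequentially. poly p (of_nat n) = poly (num_poly d c) (of_nat n)"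
      using np by eventually_elim simp
    then show "p = num_poly d c" by (rule poly_eq_if_eventually)
  qed
qed

lemma sally_dim_and_multiplicity:
  "(module_dim Rees (sally_module R J \<mm>) = ereal (real d) \<longleftrightarrow>
      hilbert_coeff R d \<mm> 1 - hilbert_coeff R d \<mm> 0 - hilbert_coeff R d J 1 + 1 > 0) \<and>
   (module_dim Rees (sally_module R J \<mm>) = ereal (real d) \<longrightarrow>
      sally_multiplicity R d J \<mm> =
        of_int (hilbert_coeff R d \<mm> 1 - hilbert_coeff R d \<mm> 0 - hilbert_coeff R d J 1 + 1))"
proof -
  obtain e where e: "d = Suc e" using d_pos by (cases d) auto
  obtain cJ where cJ: "has_num_poly (Suc d) cJ (\<lambda>n. int (fin_len (ideal_power R J n) (carrier R)))" using hilbert_poly_J by blast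
  obtain cm where cm: "has_num_poly (Suc d) cm (\<lambda>n. int (fin_len (ideal_power R \<mm> n) (carrier R)))" using hilbert_poly_m by blast
  obtain c where c: "has_num_poly d c (\<lambda>n. int (fin_len (\<mm> \<cdot> ideal_power R J (n - 1)) (ideal_power R \<mm> n)))"
    "c (d - 1) = 1 + cJ (d - 1) - cJ d - cm (d - 1)" using sally_poly[OF cJ cm] by blast
  have hJ: "hilbert_coeff R d J = (\<lambda>i. if i \<le> d then (- 1) ^ i * cJ (d - i) else 0)"
    by (rule hilbert_coeff_eq[OF J_ideal len_finite[OF m_power_Jn order_refl] cJ])
  have hm: "hilbert_coeff R d \<mm> = (\<lambda>i. if i \<le> d then (- 1) ^ i * cm (d - i) else 0)"
    by (rule hilbert_coeff_eq[OF m_ideal len_m_power cm])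
  \<comment> \<open>With the alternating signs, \<open>e_0\<close> is the coefficient at
    \<open>d\<close> and \<open>e_1\<close> is minus the one at \<open>d - 1\<close>; by
    \<open>same_multiplicity\<close> the term \<open>cJ d\<close> becomes \<open>e_0\<close> of
    \<open>\<mm>\<close>.\<close>
  have eps: "hilbert_coeff R d \<mm> 1 - hilbert_coeff R d \<mm> 0 - hilbert_coeff R d J 1 + 1 = c (d - 1)"
    unfolding hJ hm c(2) using e same_multiplicity[OF cJ cm] by simp
  \<comment> \<open>Positivity guarantees that the polynomial has degree exactly
    \<open>d - 1\<close>, so that its leading coefficient is the one at \<open>d - 1\<close>; the
    factorial in the definition cancels its denominator.\<close>
  have "sally_multiplicity R d J \<mm> = of_int (c (d - 1))" if pos: "c (d - 1) > 0"
  proof -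
    have co: "Polynomial.coeff (num_poly d c :: rat poly) e = of_int (c e) / fact e" unfolding e by (rule coeff_num_poly_top)
    have "degree (num_poly d c :: rat poly) \<le> e" using degree_num_poly_less[OF d_pos, of c, where 'a=rat] e by simp
    moreover have "e \<le> degree (num_poly d c :: rat poly)" using co pos e by (intro le_degree) simp
    ultimately have "lead_coeff (num_poly d c :: rat poly) = of_int (c e) / fact e" using co by simp
    then show ?thesis unfolding sally_multiplicity_def sally_hilbert_poly_eq[OF c(1)] using e by simp
  qed
  then show ?thesis unfolding eps sally_dim_iff annihilator_iff[OF c(1)] by blast
qed

end

theorem proposition2p1:
  fixes R :: "('a, 'c) ring_scheme" and \<mm> J :: "'a set" and d :: nat
  assumes "local_noetherian_ring R \<mm>"
    and "krull_dim R = ereal (real d)" and "d > 0"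
    and "infinite (carrier (R Quot \<mm>))"
    and "minimal_reduction R d \<mm> J"
  shows "(module_dim (rees_algebra R J) (sally_module R J \<mm>) = ereal (real d) \<longleftrightarrow>
           hilbert_coeff R d \<mm> 1 - hilbert_coeff R d \<mm> 0 - hilbert_coeff R d J 1 + 1 > 0) \<and>
         (module_dim (rees_algebra R J) (sally_module R J \<mm>) = ereal (real d) \<longrightarrow>
           sally_multiplicity R d J \<mm> =
             of_int (hilbert_coeff R d \<mm> 1 - hilbert_coeff R d \<mm> 0 - hilbert_coeff R d J 1 + 1))"
proof -
  \<comment> \<open>A finite Krull dimension is attained, so there is an actual chain of
    \<open>d + 1\<close> primes.\<close>
  obtain P where P: "\<And>i. i \<le> d \<Longrightarrow> primeideal (P i) R" "\<And>i. i < d \<Longrightarrow> P i \<subset> P (Suc i)"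
    using assms(2) unfolding krull_dim_eq_iff prime_chain_def by blast
  obtain x r where x: "x ` {..<d} \<subseteq> carrier R" "J = genideal R (x ` {..<d})"
    and J: "J \<subseteq> \<mm>" "ideal_power R \<mm> (Suc r) = J \<cdot>\<^bsub>R\<^esub> ideal_power R \<mm> r"
    using assms(5) unfolding minimal_reduction_def by blast
  have "m_reduction R \<mm> d r x J P"
    by (intro m_reduction.intro[OF assms(1)] m_reduction_axioms.intro) (use assms(3) x J P in auto)
  then show ?thesis by (rule m_reduction.sally_dim_and_multiplicity)
qed

end
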